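(* Let $A$ be a closed, densely defined $G$-symmetric operator in $\mathcal H$ and let $(a,b)$ be a (possibly unbounded) open interval in $\mathbb R$ with $(a,b)\cap\sigma_{ap}(A)\subset\sigma_{\pi_+}(A)$ such that there exists an open neighborhood $\mathcal U$ of $(a,b)$ in $\mathbb C$ with $\mathcal U\setminus\mathbb R\subset\rho(A)$. Then $A$ has a local spectral function $E$ on $(a,b)$ with $S:=(a,b)\cap(\sigma_{\pi_+}(A)\setminus\sigma_+(A))$. For $\Delta\in\mathscr M_S(a,b)$ the projection $E(\Delta)$ is $G$-selfadjoint, and its range is an Almost Pontryagin space with finite rank of non-positivity.
   Context: $(\mathcal H,(\cdot,\cdot))$ is a Hilbert space, $G$ is a bounded selfadjoint operator in $\mathcal H$ (not assumed boundedly invertible or injective), and $[x,y]:=(Gx,y)$. A linear operator $T$ in $\mathcal H$ is $G$-symmetric if $[Tx,y]=[x,Ty]$ for all $x,y\in\operatorname{dom}T$, and $G$-selfadjoint if $GT=(GT)^*$ (Hilbert space adjoint). For a closed, densely defined operator $A$, $\sigma_{ap}(A)$ is the set of all $\lambda\in\mathbb C$ for which there is a sequence $(x_n)$ in $\operatorname{dom}A$ with $\|x_n\|=1$ and $(A-\lambda)x_n\to0$. A point $\lambda\in\sigma_{ap}(A)$ belongs to $\sigma_{\pi_+}(A)$ if there is a linear manifold $\mathcal H_\lambda\subset\mathcal H$ with $\dim(\mathcal H/\mathcal H_\lambda)<\infty$ such that for every sequence $(x_n)$ in $\mathcal H_\lambda\cap\operatorname{dom}A$ with $\|x_n\|=1$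 and $(A-\lambda)x_n\to0$ one has $\liminf_n[x_n,x_n]>0$; it belongs to $\sigma_+(A)$ if $\mathcal H_\lambda$ can be chosen as $\mathcal H$. A closed linear manifold $\mathcal L\subset\mathcal H$ is an Almost Pontryagin space with finite rank of non-positivity if there is a closed linear manifold $\widetilde{\mathcal L}\subset\mathcal L$ with $\dim(\mathcal L/\widetilde{\mathcal L})<\infty$ and $\delta>0$ with $[x,x]\ge\delta\|x\|^2$ for all $x\in\widetilde{\mathcal L}$. $\mathscr M(a,b)$ is the set of all bounded intervals $\Delta$ whose closure is contained in $(a,b)$ and finite unions of such intervals. If $S$ is a discrete subset of $(a,b)$ (it may accumulate only at $a$ or $b$), then $\mathscr M_S(a,b):=\{\Delta\in\mathscr M(a,b):\partial\Delta\cap S=\varnothing\}$. A bounded operator $B$ commutes with $A$ if $BA\subset AB$, i.e. $x\in\operatorname{dom}A$ implies $Bx\in\operatorname{dom}A$ and $ABx=BAx$. For a discrete subset $S$ of $(a,b)$, a mapping $E$ from $\mathscr M_S(a,b)$ into the set of bounded projections on $\mathcal H$ is a local spectral function for $A$ on $(a,b)$ (with $S$) if $E(\varnothing)=0$ and: (S1) $E(\Delta_1\cap\Delta_2)=E(\Delta_1)E(\Delta_2)$ for all $\Delta_1,\Delta_2\in\mathscr M_S(a,b)$. (S2) If $\Delta_1,\Delta_2,\dots\in\mathscr M_S(a,b)$ are mutually disjoint and $\Delta:=\bigcup_{i=1}^\infty\Delta_i\in\mathscr M_S(a,b)$, then $E(\Delta)=\sum_{i=1}^\infty E(\Delta_i)$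 with convergence in the strong operator topology. (S3) If a bounded operator $B$ commutes with $A$, then it commutes with every $E(\Delta)$, $\Delta\in\mathscr M_S(a,b)$. (S4) $\sigma(A|E(\Delta)\mathcal H)\subset\overline\Delta$ for every $\Delta\in\mathscr M_S(a,b)$. (S5) $\sigma(A|(I-E(\Delta))\mathcal H)\subset\overline{\sigma(A)\setminus\Delta}$ for every $\Delta\in\mathscr M_S(a,b)$. The assertion that $A$ has such a function with the given $S$ includes that $S$ is discrete in this sense. *)

theory Defs
  imports "HOL-Analysis.Analysis"
begin

section \<open>Complex Hilbert spaces\<close>

class complex_vector = real_vector +
  fixes scaleC :: "complex \<Rightarrow> 'a \<Rightarrow> 'a"  (infixr "*\<^sub>C" 75)
  assumes scaleC_add_right: "c *\<^sub>C (x + y) = c *\<^sub>C x + c *\<^sub>C y"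
    and scaleC_add_left: "(c + d) *\<^sub>C x = c *\<^sub>C x + d *\<^sub>C x"
    and scaleC_scaleC: "c *\<^sub>C (d *\<^sub>C x) = (c * d) *\<^sub>C x"
    and scaleC_of_real: "complex_of_real r *\<^sub>C x = r *\<^sub>R x"

global_interpretation complex_vector:
  vector_space "scaleC :: complex \<Rightarrow> 'a \<Rightarrow> 'a::complex_vector"
  defines csubspace = complex_vector.subspace
    and cspan = complex_vector.span
proof unfold_locales
  show "1 *\<^sub>C x = x" for x :: 'a
    using scaleC_of_real[of 1 x] by simp
qed (simp_all add: scaleC_add_right scaleC_add_left scaleC_scaleC)

text \<open>The inner product is linear in its first argument. The axiom \<open>cinner_self\<close> contains
  positive definiteness and says that the norm is the one induced by the inner product.\<close>

class complex_inner = complex_vector + real_normed_vector +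
  fixes cinner :: "'a \<Rightarrow> 'a \<Rightarrow> complex"
  assumes cinner_commute: "cinner x y = cnj (cinner y x)"
    and cinner_add_left: "cinner (x + y) z = cinner x z + cinner y z"
    and cinner_scaleC_left: "cinner (c *\<^sub>C x) y = c * cinner x y"
    and cinner_self: "cinner x x = complex_of_real ((norm x)\<^sup>2)"

class chilbert_space = complex_inner + complete_space

instantiation complex :: chilbert_space
begin

definition scaleC_complex :: "complex \<Rightarrow> complex \<Rightarrow> complex"
  where "scaleC_complex c x = c * x"

definition cinner_complex :: "complex \<Rightarrow> complex \<Rightarrow> complex"
  where "cinner_complex x y = x * cnj y"

instance
proof
  show "cinner x x = complex_of_real ((norm x)\<^sup>2)" for x :: complex
    unfolding cinner_complex_def complex_norm_square ..
qed (simp_all add: scaleC_complex_def cinner_complex_def algebra_simps scaleR_conv_of_real)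

end

text \<open>\<open>dim (L / M) < \<infinity>\<close>: the cosets of finitely many vectors of \<open>L\<close> span \<open>L / M\<close>.\<close>

definition finite_codim :: "'a::complex_vector set \<Rightarrow> 'a set \<Rightarrow> bool"
  where "finite_codim L M \<longleftrightarrow>
    (\<exists>F. finite F \<and> F \<subseteq> L \<and> (\<forall>x\<in>L. \<exists>v\<in>cspan F. x - v \<in> M))"

section \<open>Operators\<close>

text \<open>A possibly unbounded operator is represented by its graph, so its domain is
  \<^term>\<open>Domain T\<close>, equality and inclusion of operators are equality and inclusion of sets, and
  closedness is \<^const>\<open>closed\<close> in the product topology. Everywhere defined bounded operators are
  functions; \<open>op_graph\<close> turns them into graphs.\<close>

type_synonym 'a operator = "('a \<times> 'a) set"

definition linear_operator :: "'a::complex_vector operator \<Rightarrow> bool"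
  where "linear_operator T \<longleftrightarrow>
    single_valued T \<and> (0, 0) \<in> T \<and>
    (\<forall>x u y v. (x, u) \<in> T \<longrightarrow> (y, v) \<in> T \<longrightarrow> (x + y, u + v) \<in> T) \<and>
    (\<forall>c x u. (x, u) \<in> T \<longrightarrow> (c *\<^sub>C x, c *\<^sub>C u) \<in> T)"

definition bounded_clinear :: "('a::complex_inner \<Rightarrow> 'a) \<Rightarrow> bool"
  where "bounded_clinear B \<longleftrightarrow> bounded_linear B \<and> (\<forall>c x. B (c *\<^sub>C x) = c *\<^sub>C B x)"

definition op_graph :: "('a \<Rightarrow> 'a) \<Rightarrow> 'a operator"
  where "op_graph B = {(x, B x) | x. True}"

definition densely_defined :: "'a::topological_space operator \<Rightarrow> bool"
  where "densely_defined T \<longleftrightarrow> closure (Domain T) = UNIV"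

text \<open>This is the usual adjoint when \<open>T\<close> is densely defined; otherwise it is not single-valued.\<close>

definition adjoint_op :: "'a::complex_inner operator \<Rightarrow> 'a operator"
  where "adjoint_op T = {(y, z). \<forall>(x, u)\<in>T. cinner u y = cinner x z}"

definition selfadjoint :: "'a::complex_inner operator \<Rightarrow> bool"
  where "selfadjoint T \<longleftrightarrow> T = adjoint_op T"

definition restrict_op :: "'a operator \<Rightarrow> 'a set \<Rightarrow> 'a operator"
  where "restrict_op T M = {(x, u) \<in> T. x \<in> M}"

text \<open>Resolvent set and spectrum of an operator \<open>T\<close> acting in the closed subspace \<open>M\<close>. If \<open>T\<close> does
  not map into \<open>M\<close>, the resolvent set is empty; a bound on the spectrum of
  \<^term>\<open>restrict_op T M\<close> by a proper subset of the plane thus includes invariance of \<open>M\<close>.\<close>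

definition resolvent_set_in :: "'a::complex_inner set \<Rightarrow> 'a operator \<Rightarrow> complex set"
  where "resolvent_set_in M T = {l. T \<subseteq> M \<times> M \<and>
    (\<forall>y\<in>M. \<exists>!x. \<exists>u. (x, u) \<in> T \<and> u - l *\<^sub>C x = y) \<and>
    (\<exists>C. \<forall>(x, u)\<in>T. norm x \<le> C * norm (u - l *\<^sub>C x))}"

definition spectrum_in :: "'a::complex_inner set \<Rightarrow> 'a operator \<Rightarrow> complex set"
  where "spectrum_in M T = - resolvent_set_in M T"

abbreviation resolvent_set :: "'a::complex_inner operator \<Rightarrow> complex set"
  where "resolvent_set T \<equiv> resolvent_set_in UNIV T"

abbreviation spectrum :: "'a::complex_inner operator \<Rightarrow> complex set"
  where "spectrum T \<equiv> spectrum_in UNIV T"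

definition commutes_with :: "('a \<Rightarrow> 'a) \<Rightarrow> 'a operator \<Rightarrow> bool"
  where "commutes_with B T \<longleftrightarrow> (\<forall>(x, u)\<in>T. (B x, B u) \<in> T)"

section \<open>The indefinite inner product induced by \<open>G\<close>\<close>

definition G_inner :: "('a::complex_inner \<Rightarrow> 'a) \<Rightarrow> 'a \<Rightarrow> 'a \<Rightarrow> complex"
  where "G_inner G x y = cinner (G x) y"

definition G_symmetric :: "('a::complex_inner \<Rightarrow> 'a) \<Rightarrow> 'a operator \<Rightarrow> bool"
  where "G_symmetric G T \<longleftrightarrow>
    linear_operator T \<and> (\<forall>(x, u)\<in>T. \<forall>(y, v)\<in>T. G_inner G u y = G_inner G x v)"

text \<open>\<^term>\<open>T O op_graph G\<close> is the product \<open>GT\<close>: relational composition applies \<open>T\<close> first.\<close>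

definition G_selfadjoint :: "('a::complex_inner \<Rightarrow> 'a) \<Rightarrow> 'a operator \<Rightarrow> bool"
  where "G_selfadjoint G T \<longleftrightarrow> linear_operator T \<and> selfadjoint (T O op_graph G)"

definition approx_eigenseq ::
    "'a::complex_inner operator \<Rightarrow> complex \<Rightarrow> (nat \<Rightarrow> 'a) \<Rightarrow> bool"
  where "approx_eigenseq A l x \<longleftrightarrow> (\<forall>n. norm (x n) = 1) \<and>
    (\<exists>u. (\<forall>n. (x n, u n) \<in> A) \<and> (\<lambda>n. u n - l *\<^sub>C x n) \<longlonglongrightarrow> 0)"

definition sigma_ap :: "'a::complex_inner operator \<Rightarrow> complex set"
  where "sigma_ap A = {l. \<exists>x. approx_eigenseq A l x}"

text \<open>\<open>[x, x]\<close> is real for selfadjoint \<open>G\<close>, hence the real part below.\<close>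

definition positive_type_on ::
    "('a::complex_inner \<Rightarrow> 'a) \<Rightarrow> 'a operator \<Rightarrow> complex \<Rightarrow> 'a set \<Rightarrow> bool"
  where "positive_type_on G A l M \<longleftrightarrow>
    (\<forall>x. approx_eigenseq A l x \<longrightarrow> (\<forall>n. x n \<in> M) \<longrightarrow>
      0 < liminf (\<lambda>n. ereal (Re (G_inner G (x n) (x n)))))"

definition sigma_pi_plus :: "('a::complex_inner \<Rightarrow> 'a) \<Rightarrow> 'a operator \<Rightarrow> complex set"
  where "sigma_pi_plus G A =
    {l \<in> sigma_ap A. \<exists>M. csubspace M \<and> finite_codim UNIV M \<and> positive_type_on G A l M}"

definition sigma_plus :: "('a::complex_inner \<Rightarrow> 'a) \<Rightarrow> 'a operator \<Rightarrow> complex set"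
  where "sigma_plus G A = {l \<in> sigma_ap A. positive_type_on G A l UNIV}"

text \<open>Finite rank of non-positivity is part of this notion.\<close>

definition almost_pontryagin :: "('a::complex_inner \<Rightarrow> 'a) \<Rightarrow> 'a set \<Rightarrow> bool"
  where "almost_pontryagin G L \<longleftrightarrow> csubspace L \<and> closed L \<and>
    (\<exists>M d. csubspace M \<and> closed M \<and> M \<subseteq> L \<and> finite_codim L M \<and> d > 0 \<and>
      (\<forall>x\<in>M. d * (norm x)\<^sup>2 \<le> Re (G_inner G x x)))"

section \<open>Local spectral functions\<close>

definition real_interval :: "ereal \<Rightarrow> ereal \<Rightarrow> real set"
  where "real_interval a b = {t. a < ereal t \<and> ereal t < b}"

text \<open>Intervals may be open, closed, half-open, degenerate to a point, or empty; degenerate ones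
  arise as intersections of closed intervals.\<close>

definition interval_unions :: "ereal \<Rightarrow> ereal \<Rightarrow> real set set"
  where "interval_unions a b = {\<Union>F | F. finite F \<and>
    (\<forall>I\<in>F. is_interval I \<and> bounded I \<and> closure I \<subseteq> real_interval a b)}"

definition interval_unions_off :: "real set \<Rightarrow> ereal \<Rightarrow> ereal \<Rightarrow> real set set"
  where "interval_unions_off S a b = {D \<in> interval_unions a b. frontier D \<inter> S = {}}"

definition discrete_in :: "real set \<Rightarrow> ereal \<Rightarrow> ereal \<Rightarrow> bool"
  where "discrete_in S a b \<longleftrightarrow>
    S \<subseteq> real_interval a b \<and> (\<forall>t\<in>real_interval a b. \<not> t islimpt S)"

definition bounded_projection :: "('a::complex_inner \<Rightarrow> 'a) \<Rightarrow> bool"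
  where "bounded_projection P \<longleftrightarrow> bounded_clinear P \<and> P \<circ> P = P"

text \<open>Only the values of \<open>E\<close> on \<^term>\<open>interval_unions_off S a b\<close> matter.\<close>

definition local_spectral_function ::
    "'a::complex_inner operator \<Rightarrow> ereal \<Rightarrow> ereal \<Rightarrow> real set \<Rightarrow> (real set \<Rightarrow> 'a \<Rightarrow> 'a) \<Rightarrow> bool"
  where "local_spectral_function A a b S E \<longleftrightarrow>
    discrete_in S a b \<and>
    (\<forall>D\<in>interval_unions_off S a b. bounded_projection (E D)) \<and>
    E {} = (\<lambda>x. 0) \<and>
    (\<forall>D1\<in>interval_unions_off S a b. \<forall>D2\<in>interval_unions_off S a b.
      E (D1 \<inter> D2) = E D1 \<circ> E D2) \<and>
    (\<forall>D :: nat \<Rightarrow> real set. (\<forall>i. D i \<in> interval_unions_off S a b) \<longrightarrow> disjoint_family D \<longrightarrow>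
      (\<Union>i. D i) \<in> interval_unions_off S a b \<longrightarrow>
      (\<forall>x. (\<lambda>i. E (D i) x) sums E (\<Union>i. D i) x)) \<and>
    (\<forall>B. bounded_clinear B \<longrightarrow> commutes_with B A \<longrightarrow>
      (\<forall>D\<in>interval_unions_off S a b. commutes_with B (op_graph (E D)))) \<and>
    (\<forall>D\<in>interval_unions_off S a b.
      spectrum_in (range (E D)) (restrict_op A (range (E D)))
        \<subseteq> complex_of_real ` closure D) \<and>
    (\<forall>D\<in>interval_unions_off S a b.
      spectrum_in (range (\<lambda>x. x - E D x)) (restrict_op A (range (\<lambda>x. x - E D x)))
        \<subseteq> closure (spectrum A - complex_of_real ` D))"

end

theory Submission
  imports Defs "HOL-Complex_Analysis.Complex_Analysis"
begin

text \<open>At a point \<open>t\<close> of positive type, \<open>[x, x] \<ge> d |x|\<^sup>2 - C |(A - l) x|\<^sup>2\<close> for all \<open>l\<close> near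
  \<open>t\<close>, so the resolvent grows at most like \<open>1 / |Im l|\<close> there; at a point of type \<open>\<pi>\<^sub>+\<close>
  the inequality holds on a subspace of finite codimension. If \<open>A\<close> is bounded on an invariant
  subspace, testing these inequalities on weighted Fourier sums over the orbits of the Cayley
  transform shows that the form is uniformly positive on the subspace, up to finite codimension.

  For a short interval \<open>(p, q)\<close> of points of positive type, the integral of
  \<open>(l - p)\<^sup>2 (l - q)\<^sup>2 (A - l)\<^sup>-\<^sup>1\<close> over the circle with diameter \<open>[p, q]\<close> converges. The closure
  of its range is uniformly positive, hence the range of a \<open>G\<close>-orthogonal projection, whose kernel
  is the kernel of the integral; this is \<open>E (p, q)\<close>. Around an exceptional point a Riesz
  projection is available once the spectrum on both sides has been cut by such intervals, and
  Boolean combinations give \<open>E D\<close> in general.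

  Frontier points are controlled by two facts: an isolated spectral point of positive type is an
  eigenvalue, and by Liouville's theorem a bounded part of \<open>A\<close> with empty spectrum lives on the zero
  space. They yield uniqueness of \<open>E D\<close>, hence multiplicativity, and together with Baire's theorem
  also countable additivity. Exceptional points are eigenvalues with eigenvectors \<open>x\<close> such that
  \<open>[x, x] \<le> 0\<close>, and these cannot accumulate.\<close>

section \<open>Complex inner product spaces\<close>

text \<open>\<open>G\<close> may have a kernel, so a closed subspace need not be complemented by the
  vectors orthogonal to it in the form. A complement is available where the form is uniformly
  positive, so positivity has to be proved before there is any projection. For this the closed range
  of the circle integral is embedded into a larger invariant subspace on which \<open>A\<close> is
  bounded and has real spectrum close to the interval. That space is cut out by the kernels of two
  further integrals and by a Riesz integral.

  The Cayley transform preserves the form, so the form is constant along an orbit, and the norms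
  along an orbit grow subexponentially because the spectrum of the transform lies on the unit
  circle. Parseval's identity for roots of unity merges the inequalities at finitely many points of
  the circle into one inequality for the orbit. Finitely many frequencies mean finitely many
  conditions of finite codimension, and no condition at all if every real spectral point of the
  subspace is of positive type.\<close>

instance chilbert_space \<subseteq> banach ..

lemma cinner_add_right: "cinner x (y + z) = cinner x y + cinner x z"
  by (metis cinner_commute cinner_add_left complex_cnj_add)

lemma cinner_scaleC_right: "cinner x (c *\<^sub>C y) = cnj c * cinner x y"
  by (metis cinner_commute cinner_scaleC_left complex_cnj_mult)

lemma scaleC_zero_left [simp]: "0 *\<^sub>C x = (0::'a::complex_vector)"
  by (rule complex_vector.scale_zero_left)

lemma scaleC_zero_right [simp]: "c *\<^sub>C (0::'a::complex_vector) = 0"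
  by (rule complex_vector.scale_zero_right)

lemma scaleC_one [simp]: "1 *\<^sub>C x = (x::'a::complex_vector)"
  by (rule complex_vector.scale_one)

lemma scaleC_minus_left [simp]: "(- c) *\<^sub>C x = - (c *\<^sub>C (x::'a::complex_vector))"
  by (rule complex_vector.scale_minus_left)

lemma scaleC_diff_left: "(c - d) *\<^sub>C x = c *\<^sub>C x - d *\<^sub>C (x::'a::complex_vector)"
  by (rule complex_vector.scale_left_diff_distrib)

lemma scaleC_diff_right: "c *\<^sub>C (x - y) = c *\<^sub>C x - c *\<^sub>C (y::'a::complex_vector)"
  by (rule complex_vector.scale_right_diff_distrib)

lemmas scaleC_algebra = scaleC_add_left scaleC_add_right scaleC_diff_left scaleC_diff_right
  scaleC_scaleC

lemma cinner_zero_left [simp]: "cinner 0 y = 0"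
  using cinner_scaleC_left[of 0 0 y] by simp

lemma cinner_zero_right [simp]: "cinner y 0 = 0"
  using cinner_scaleC_right[of y 0 0] by simp

lemma cinner_minus_left [simp]: "cinner (- x) y = - cinner x y"
  using cinner_scaleC_left[of "-1" x y] by simp

lemma cinner_minus_right [simp]: "cinner x (- y) = - cinner x y"
  using cinner_scaleC_right[of x "-1" y] by simp

lemma cinner_diff_left: "cinner (x - y) z = cinner x z - cinner y z"
  using cinner_add_left[of x "- y" z] by simp

lemma cinner_diff_right: "cinner x (y - z) = cinner x y - cinner x z"
  using cinner_add_right[of x y "- z"] by simp

lemma cinner_scaleR_left: "cinner (r *\<^sub>R x) y = complex_of_real r * cinner x y"
  by (metis cinner_scaleC_left scaleC_of_real)

lemma cinner_scaleR_right: "cinner x (r *\<^sub>R y) = complex_of_real r * cinner x y"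
  by (metis cinner_scaleC_right scaleC_of_real complex_cnj_complex_of_real)

lemma norm_scaleC: "norm (c *\<^sub>C x) = cmod c * norm (x::'a::complex_inner)"
proof -
  have "complex_of_real ((norm (c *\<^sub>C x))\<^sup>2) = c * cnj c * complex_of_real ((norm x)\<^sup>2)"
    unfolding cinner_self[symmetric] by (simp add: cinner_scaleC_left cinner_scaleC_right)
  also have "\<dots> = complex_of_real ((cmod c * norm x)\<^sup>2)"
    by (simp add: complex_norm_square[symmetric] power_mult_distrib)
  finally have "(norm (c *\<^sub>C x))\<^sup>2 = (cmod c * norm x)\<^sup>2"
    using of_real_eq_iff by blast
  then show ?thesis
    by (metis norm_ge_zero mult_nonneg_nonneg power2_eq_iff_nonneg)
qed

lemma cauchy_schwarz: "cmod (cinner x y) \<le> norm x * norm y"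
proof (cases "y = 0")
  case False
  define c where "c = cinner x y / complex_of_real ((norm y)\<^sup>2)"
  have ny: "norm y > 0" using False by simp
  have "cinner (x - c *\<^sub>C y) (x - c *\<^sub>C y)
      = cinner x x - cnj c * cinner x y - c * cnj (cinner x y) + c * cnj c * cinner y y"
    by (simp add: cinner_diff_left cinner_diff_right cinner_scaleC_left cinner_scaleC_right
        cinner_commute[of y x] algebra_simps)
  also have "\<dots> = complex_of_real ((norm x)\<^sup>2) - cinner x y * cnj (cinner x y) / complex_of_real ((norm y)\<^sup>2)"
    using ny by (simp add: c_def cinner_self field_simps power2_eq_square)
  also have "\<dots> = complex_of_real ((norm x)\<^sup>2 - (cmod (cinner x y))\<^sup>2 / (norm y)\<^sup>2)"
    by (simp add: complex_norm_square[symmetric])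
  finally have "(norm (x - c *\<^sub>C y))\<^sup>2 = (norm x)\<^sup>2 - (cmod (cinner x y))\<^sup>2 / (norm y)\<^sup>2"
    unfolding cinner_self of_real_eq_iff .
  then have "(cmod (cinner x y))\<^sup>2 / (norm y)\<^sup>2 \<le> (norm x)\<^sup>2"
    by (metis diff_ge_0_iff_ge zero_le_power2)
  then have "(cmod (cinner x y))\<^sup>2 \<le> (norm x * norm y)\<^sup>2"
    using ny by (simp add: divide_le_eq power_mult_distrib)
  then show ?thesis
    by (rule power2_le_imp_le) simp
qed simp

lemma bounded_bilinear_scaleC:
  "bounded_bilinear ((*\<^sub>C) :: complex \<Rightarrow> 'a \<Rightarrow> 'a::complex_inner)"
proof
  show "\<exists>K. \<forall>a (b::'a). norm (a *\<^sub>C b) \<le> norm a * norm b * K"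
    by (intro exI[of _ 1]) (simp add: norm_scaleC)
  show "(r *\<^sub>R a) *\<^sub>C b = r *\<^sub>R a *\<^sub>C (b::'a)" for r a b
    by (simp only: scaleR_conv_of_real scaleC_scaleC[symmetric] scaleC_of_real)
  show "a *\<^sub>C r *\<^sub>R b = r *\<^sub>R a *\<^sub>C (b::'a)" for r a b
    by (simp only: scaleC_of_real[symmetric] scaleC_scaleC mult.commute)
qed (simp_all add: scaleC_add_left scaleC_add_right)

lemma bounded_bilinear_cinner: "bounded_bilinear (cinner :: 'a \<Rightarrow> 'a \<Rightarrow> complex)"
  for dummy :: "'a::complex_inner"
proof
  show "\<exists>K. \<forall>(a::'a) b. norm (cinner a b) \<le> norm a * norm b * K"
    by (intro exI[of _ 1]) (simp add: cauchy_schwarz)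
qed (simp_all add: cinner_add_left cinner_add_right cinner_scaleR_left cinner_scaleR_right
      scaleR_conv_of_real)

lemmas continuous_on_scaleC [continuous_intros] =
  bounded_bilinear.continuous_on[OF bounded_bilinear_scaleC]
lemmas continuous_on_cinner [continuous_intros] =
  bounded_bilinear.continuous_on[OF bounded_bilinear_cinner]
lemmas tendsto_scaleC [tendsto_intros] = bounded_bilinear.tendsto[OF bounded_bilinear_scaleC]
lemma cinner_eq_zero_imp: "(\<And>y. cinner x y = 0) \<Longrightarrow> x = 0"
  using cinner_self[of x] by (metis norm_eq_zero of_real_eq_0_iff zero_eq_power2)

lemma csubspace_imp_subspace: "csubspace M \<Longrightarrow> subspace M"
  unfolding complex_vector.subspace_def subspace_def by (metis scaleC_of_real)

lemma scaleC_sum_right: "c *\<^sub>C (\<Sum>i\<in>I. f i) = (\<Sum>i\<in>I. c *\<^sub>C (f i::'a::complex_vector))"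
  by (rule complex_vector.scale_sum_right)

lemma cinner_sum_left: "cinner (\<Sum>i\<in>I. f i) y = (\<Sum>i\<in>I. cinner (f i) y)"
  by (induction I rule: infinite_finite_induct) (simp_all add: cinner_add_left)

lemma cinner_sum_right: "cinner y (\<Sum>i\<in>I. f i) = (\<Sum>i\<in>I. cinner y (f i))"
  by (induction I rule: infinite_finite_induct) (simp_all add: cinner_add_right)

text \<open>Graphs of operators are subspaces of the Hilbert space \<open>'a \<times> 'a\<close>, so the graph norm is the
  ambient norm.\<close>

instantiation prod :: (complex_vector, complex_vector) complex_vector
begin
definition scaleC_prod :: "complex \<Rightarrow> 'a \<times> 'b \<Rightarrow> 'a \<times> 'b"
  where "scaleC_prod c p = (c *\<^sub>C fst p, c *\<^sub>C snd p)"
instance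
  by standard (simp_all add: scaleC_prod_def scaleC_add_right scaleC_add_left scaleC_scaleC
      scaleC_of_real prod_eq_iff)
end

lemma scaleC_Pair [simp]: "c *\<^sub>C (x, y) = (c *\<^sub>C x, c *\<^sub>C y)"
  by (simp add: scaleC_prod_def)

lemma fst_scaleC [simp]: "fst (c *\<^sub>C p) = c *\<^sub>C fst p"
  and snd_scaleC [simp]: "snd (c *\<^sub>C p) = c *\<^sub>C snd p"
  by (simp_all add: scaleC_prod_def)

instantiation prod :: (complex_inner, complex_inner) complex_inner
begin
definition cinner_prod :: "'a \<times> 'b \<Rightarrow> 'a \<times> 'b \<Rightarrow> complex"
  where "cinner_prod p q = cinner (fst p) (fst q) + cinner (snd p) (snd q)"
instance
proof
  show "cinner p q = cnj (cinner q p)" for p q :: "'a \<times> 'b"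
    by (simp add: cinner_prod_def cinner_commute[of "fst p"] cinner_commute[of "snd p"])
  show "cinner p p = complex_of_real ((norm p)\<^sup>2)" for p :: "'a \<times> 'b"
    by (simp add: cinner_prod_def cinner_self norm_prod_def)
qed (simp_all add: cinner_prod_def cinner_add_left cinner_scaleC_left algebra_simps)
end

instance prod :: (chilbert_space, chilbert_space) chilbert_space ..

lemma linear_operator_imp_csubspace: "linear_operator T \<Longrightarrow> csubspace T"
  unfolding linear_operator_def complex_vector.subspace_def
  by (auto simp: zero_prod_def)

lemma bounded_clinearD:
  assumes "bounded_clinear B"
  shows "bounded_linear B" "B (c *\<^sub>C x) = c *\<^sub>C B x" "B (x + y) = B x + B y" "B (x - y) = B x - B y"
    "B 0 = 0" "B (- x) = - B x"
proof -
  show "bounded_linear B" "B (c *\<^sub>C x) = c *\<^sub>C B x"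
    using assms by (auto simp: bounded_clinear_def)
  then show "B (x + y) = B x + B y" "B (x - y) = B x - B y" "B 0 = 0" "B (- x) = - B x"
    by (simp_all add: linear_simps)
qed

lemma bounded_clinearI:
  assumes "\<And>x y. B (x + y) = B x + B y" "\<And>c x. B (c *\<^sub>C x) = c *\<^sub>C B x"
    and "\<And>x. norm (B x) \<le> K * norm x"
  shows "bounded_clinear (B :: 'a::complex_inner \<Rightarrow> 'a)"
proof -
  have "bounded_linear B"
    by (rule bounded_linear_intro[of _ K])
      (use assms in \<open>auto simp: mult.commute scaleC_of_real[symmetric]\<close>)
  then show ?thesis
    using assms by (auto simp: bounded_clinear_def)
qed

section \<open>Subspaces of finite codimension\<close>

lemma finite_codim_mono: "finite_codim L M \<Longrightarrow> M \<subseteq> M' \<Longrightarrow> finite_codim L M'"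
  unfolding finite_codim_def by (meson subsetD)

lemma finite_codim_refl: "csubspace L \<Longrightarrow> finite_codim L L"
  unfolding finite_codim_def
  by (intro exI[of _ "{}"]) auto

lemma finite_codim_trans:
  assumes "finite_codim L M" "finite_codim M K" "M \<subseteq> L"
  shows "finite_codim L K"
proof -
  obtain F1 where F1: "finite F1" "F1 \<subseteq> L" "\<And>x. x \<in> L \<Longrightarrow> \<exists>v\<in>cspan F1. x - v \<in> M"
    using assms(1) unfolding finite_codim_def by blast
  obtain F2 where F2: "finite F2" "F2 \<subseteq> M" "\<And>x. x \<in> M \<Longrightarrow> \<exists>v\<in>cspan F2. x - v \<in> K"
    using assms(2) unfolding finite_codim_def by blast
  have "\<exists>v\<in>cspan (F1 \<union> F2). x - v \<in> K" if x: "x \<in> L" for x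
  proof -
    obtain v1 where v1: "v1 \<in> cspan F1" "x - v1 \<in> M" using F1(3)[OF x] by blast
    obtain v2 where v2: "v2 \<in> cspan F2" "x - v1 - v2 \<in> K" using F2(3)[OF v1(2)] by blast
    have "v1 + v2 \<in> cspan (F1 \<union> F2)"
      using v1 v2 by (auto simp: complex_vector.span_Un)
    moreover have "x - (v1 + v2) \<in> K" using v2 by (simp add: algebra_simps)
    ultimately show ?thesis by blast
  qed
  then show ?thesis
    unfolding finite_codim_def using F1(1,2) F2(1,2) assms(3) by (intro exI[of _ "F1 \<union> F2"]) blast
qed

text \<open>The induced map of the quotients is injective, so the codimension cannot grow.
  \<open>W\<close> is the part of \<open>cspan F\<close> reached by \<open>f\<close> modulo
  \<open>M\<close>; preimages of a basis of \<open>W\<close> serve as the finite set in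
  \<open>L\<close>. Linearity of \<open>f\<close> is assumed on \<open>L\<close> alone, as suits
  maps that behave well only on an invariant subspace.\<close>

lemma finite_codim_preimage:
  fixes f :: "'a::complex_vector \<Rightarrow> 'b::complex_vector"
  assumes L: "csubspace L" and K: "csubspace K" and M: "csubspace M"
    and f: "\<And>x y. x \<in> L \<Longrightarrow> y \<in> L \<Longrightarrow> f (x + y) = f x + f y"
      "\<And>c x. x \<in> L \<Longrightarrow> f (c *\<^sub>C x) = c *\<^sub>C f x" "\<And>x. x \<in> L \<Longrightarrow> f x \<in> K"
    and codim: "finite_codim K M"
  shows "finite_codim L {x \<in> L. f x \<in> M}"
proof -
  obtain F where F: "finite F" "\<And>x. x \<in> K \<Longrightarrow> \<exists>v\<in>cspan F. x - v \<in> M"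
    using codim unfolding finite_codim_def by blast
  define W where "W = {v \<in> cspan F. \<exists>x\<in>L. f x - v \<in> M}"
  have f0: "f 0 = 0"
    using f(2)[of 0 0] complex_vector.subspace_0[OF L] by simp
  have sW: "csubspace W"
    unfolding complex_vector.subspace_def
  proof (intro conjI allI ballI)
    show "0 \<in> W"
      using complex_vector.subspace_0[OF L] complex_vector.subspace_0[OF M] f0
      by (force simp: W_def complex_vector.span_zero)
  next
    fix v w assume "v \<in> W" "w \<in> W"
    then obtain x y where *: "v \<in> cspan F" "w \<in> cspan F" "x \<in> L" "y \<in> L" "f x - v \<in> M" "f y - w \<in> M"
      by (auto simp: W_def)
    have "f (x + y) - (v + w) = (f x - v) + (f y - w)" using * f(1) by simp
    then have "f (x + y) - (v + w) \<in> M"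
      using * complex_vector.subspace_add[OF M] by metis
    then show "v + w \<in> W"
      using * complex_vector.subspace_add[OF L] complex_vector.span_add by (auto simp: W_def)
  next
    fix c v assume "v \<in> W"
    then obtain x where *: "v \<in> cspan F" "x \<in> L" "f x - v \<in> M"
      by (auto simp: W_def)
    have "f (c *\<^sub>C x) - c *\<^sub>C v = c *\<^sub>C (f x - v)" using * f(2) by (simp add: scaleC_diff_right)
    then have "f (c *\<^sub>C x) - c *\<^sub>C v \<in> M"
      using * complex_vector.subspace_scale[OF M] by metis
    then show "c *\<^sub>C v \<in> W"
      using * complex_vector.subspace_scale[OF L] complex_vector.span_scale by (auto simp: W_def)
  qed
  obtain B where B: "B \<subseteq> W" "complex_vector.independent B" "W \<subseteq> cspan B"
    using complex_vector.maximal_independent_subset[of W] by metis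
  have "finite B"
    using complex_vector.independent_span_bound[OF F(1) B(2)] B(1) by (auto simp: W_def)
  have "\<forall>b\<in>B. \<exists>x\<in>L. f x - b \<in> M" using B(1) by (auto simp: W_def)
  then obtain g where g: "\<And>b. b \<in> B \<Longrightarrow> g b \<in> L \<and> f (g b) - b \<in> M" by metis
  have "\<exists>v\<in>cspan (g ` B). x - v \<in> {x \<in> L. f x \<in> M}" if x: "x \<in> L" for x
  proof -
    obtain v where v: "v \<in> cspan F" "f x - v \<in> M" using F(2) f(3)[OF x] by blast
    then have "v \<in> cspan B" using B(3) x by (auto simp: W_def)
    then have "\<exists>w\<in>cspan (g ` B). w \<in> L \<and> f w - v \<in> M"
    proof (induction rule: complex_vector.span_induct_alt)
      case base
      show ?case
        by (rule bexI[of _ 0])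
          (simp_all add: f0 complex_vector.span_zero complex_vector.subspace_0[OF L] complex_vector.subspace_0[OF M])
    next
      case (step c b v)
      then obtain w where w: "w \<in> cspan (g ` B)" "w \<in> L" "f w - v \<in> M" by blast
      have 1: "c *\<^sub>C g b + w \<in> cspan (g ` B)"
        using w(1) step(1) by (intro complex_vector.span_add complex_vector.span_scale)
          (auto intro: complex_vector.span_base)
      have gL: "c *\<^sub>C g b \<in> L" using g[OF step(1)] complex_vector.subspace_scale[OF L] by blast
      have 2: "c *\<^sub>C g b + w \<in> L"
        using gL w(2) complex_vector.subspace_add[OF L] by blast
      have "f (c *\<^sub>C g b + w) - (c *\<^sub>C b + v) = c *\<^sub>C (f (g b) - b) + (f w - v)"
        using gL w(2) g[OF step(1)] by (simp add: f(1) f(2) scaleC_diff_right)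
      also have "\<dots> \<in> M"
        using g[OF step(1)] w(3)
        by (intro complex_vector.subspace_add[OF M] complex_vector.subspace_scale[OF M]) auto
      finally show ?case using 1 2 by blast
    qed
    then obtain w where w: "w \<in> cspan (g ` B)" "w \<in> L" "f w - v \<in> M" by blast
    have xw: "x - w \<in> L" using x w(2) complex_vector.subspace_diff[OF L] by blast
    have "f (x - w) = f x - f w"
      using f(1)[OF xw w(2)] by simp
    also have "\<dots> = (f x - v) - (f w - v)" by simp
    also have "\<dots> \<in> M" using v w complex_vector.subspace_diff[OF M] by blast
    finally show ?thesis using w xw by blast
  qed
  then show ?thesis
    unfolding finite_codim_def using g \<open>finite B\<close> by (intro exI[of _ "g ` B"]) auto
qed

lemma finite_codim_Int:
  assumes "csubspace L" "csubspace M1" "csubspace M2" "M1 \<subseteq> L" "M2 \<subseteq> L"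
    and "finite_codim L M1" "finite_codim L M2"
  shows "finite_codim L (M1 \<inter> M2)"
proof -
  have "finite_codim M1 {x \<in> M1. id x \<in> M2}"
    by (rule finite_codim_preimage[of _ L]) (use assms in auto)
  then have "finite_codim M1 (M1 \<inter> M2)"
    by (simp add: Int_def)
  then show ?thesis
    using finite_codim_trans assms by blast
qed

lemma closure_seqI:
  fixes f :: "nat \<Rightarrow> 'a::metric_space"
  shows "(\<And>n. f n \<in> M) \<Longrightarrow> f \<longlonglongrightarrow> x \<Longrightarrow> x \<in> closure M"
  unfolding closure_sequential by blast

lemma csubspace_closure:
  fixes M :: "'a::complex_inner set"
  assumes M: "csubspace M" shows "csubspace (closure M)"
  unfolding complex_vector.subspace_def
proof (intro conjI allI ballI)
  show "0 \<in> closure M"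
    using complex_vector.subspace_0[OF M] closure_subset by blast
next
  fix x y assume "x \<in> closure M" "y \<in> closure M"
  then obtain f g where f: "\<And>n. f n \<in> M" "f \<longlonglongrightarrow> x" and g: "\<And>n. g n \<in> M" "g \<longlonglongrightarrow> y"
    unfolding closure_sequential by blast
  have "(\<lambda>n. f n + g n) \<longlonglongrightarrow> x + y" using f(2) g(2) by (intro tendsto_intros)
  moreover have "f n + g n \<in> M" for n using f(1) g(1) complex_vector.subspace_add[OF M] by blast
  ultimately show "x + y \<in> closure M" by (rule closure_seqI[rotated])
next
  fix c x assume "x \<in> closure M"
  then obtain f where f: "\<And>n. f n \<in> M" "f \<longlonglongrightarrow> x"
    unfolding closure_sequential by blast
  have "(\<lambda>n. c *\<^sub>C f n) \<longlonglongrightarrow> c *\<^sub>C x" using f(2) by (intro tendsto_intros)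
  moreover have "c *\<^sub>C f n \<in> M" for n using f(1) complex_vector.subspace_scale[OF M] by blast
  ultimately show "c *\<^sub>C x \<in> closure M" by (rule closure_seqI[rotated])
qed

text \<open>The coefficient of \<open>f\<close> is a bounded functional because \<open>f\<close> has
  a positive distance \<open>d\<close> from \<open>M\<close>; dividing by \<open>c\<close> reduces
  the estimate to \<open>c = 1\<close>.\<close>

lemma coordinate_bound:
  fixes M :: "'a::complex_inner set"
  assumes M: "csubspace M" "closed M" and f: "f \<notin> M"
  obtains d where "d > 0" "\<And>m c. m \<in> M \<Longrightarrow> d * cmod c \<le> norm (m + c *\<^sub>C f)"
proof -
  obtain d where "d > 0" "ball f d \<subseteq> - M"
    using M(2) f open_contains_ball[of "- M"] by (auto simp: closed_def)
  then have d: "d > 0" "\<And>y. y \<in> M \<Longrightarrow> d \<le> dist f y"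
    by (auto simp: subset_iff not_less[symmetric])
  have "d * cmod c \<le> norm (m + c *\<^sub>C f)" if "m \<in> M" for m c
  proof (cases "c = 0")
    case False
    have "- ((1 / c) *\<^sub>C m) \<in> M"
      using that M(1) complex_vector.subspace_neg complex_vector.subspace_scale by metis
    then have "d \<le> norm (f + (1 / c) *\<^sub>C m)" using d(2) by (force simp: dist_norm)
    then have "d * cmod c \<le> norm (c *\<^sub>C (f + (1 / c) *\<^sub>C m))"
      by (simp add: norm_scaleC mult.commute[of d] mult_left_mono)
    also have "c *\<^sub>C (f + (1 / c) *\<^sub>C m) = m + c *\<^sub>C f"
      using False by (simp add: scaleC_algebra)
    finally show ?thesis .
  qed simp
  then show ?thesis using that d(1) by blast
qed

text \<open>By \<open>coordinate_bound\<close> the coefficients of a convergent sequence form a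
  Cauchy sequence, so both summands converge.\<close>

lemma closed_add_line:
  fixes M :: "'a::complex_inner set"
  assumes M: "csubspace M" "closed M"
  shows "closed {m + c *\<^sub>C f | m c. m \<in> M}"
proof (cases "f \<in> M")
  case True
  then have "{m + c *\<^sub>C f | m c. m \<in> M} = M"
    by (auto intro!: exI[of _ "0::complex"] complex_vector.subspace_add[OF M(1)]
        complex_vector.subspace_scale[OF M(1)])
  then show ?thesis using M by simp
next
  case False
  then obtain d where d: "d > 0" "\<And>m c. m \<in> M \<Longrightarrow> d * cmod c \<le> norm (m + c *\<^sub>C f)"
    using coordinate_bound[OF M] by metis
  show ?thesis
    unfolding closed_sequential_limits
  proof (intro allI impI)
    fix x l assume "(\<forall>n. x n \<in> {m + c *\<^sub>C f |m c. m \<in> M}) \<and> x \<longlonglongrightarrow> l"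
    then have x: "\<forall>n. \<exists>m c. x n = m + c *\<^sub>C f \<and> m \<in> M" and l: "x \<longlonglongrightarrow> l" by auto
    then obtain m c where mc: "\<And>n. x n = m n + c n *\<^sub>C f" "\<And>n. m n \<in> M" by metis
    have le: "d * cmod (c i - c j) \<le> norm (x i - x j)" for i j
    proof -
      have "m i - m j \<in> M" using mc(2) M(1) complex_vector.subspace_diff by blast
      moreover have "x i - x j = (m i - m j) + (c i - c j) *\<^sub>C f"
        by (simp add: mc(1) scaleC_diff_left)
      ultimately show ?thesis using d(2) by metis
    qed
    have "Cauchy c"
    proof (rule metric_CauchyI)
      fix e :: real assume "e > 0"
      have "Cauchy x" using l by (simp add: LIMSEQ_imp_Cauchy)
      then obtain N where N: "\<And>i j. i \<ge> N \<Longrightarrow> j \<ge> N \<Longrightarrow> dist (x i) (x j) < d * e"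
        using d(1) \<open>e > 0\<close> by (meson metric_CauchyD mult_pos_pos)
      have "dist (c i) (c j) < e" if "i \<ge> N" "j \<ge> N" for i j
        using N[OF that] le[of i j] d(1) by (simp add: dist_norm) (smt (verit) mult_less_cancel_left_pos)
      then show "\<exists>M. \<forall>m\<ge>M. \<forall>n\<ge>M. dist (c m) (c n) < e" by blast
    qed
    then obtain c0 where c0: "c \<longlonglongrightarrow> c0" using Cauchy_convergent convergent_def by blast
    have "(\<lambda>n. x n - c n *\<^sub>C f) \<longlonglongrightarrow> l - c0 *\<^sub>C f" using l c0 by (intro tendsto_intros)
    then have "m \<longlonglongrightarrow> l - c0 *\<^sub>C f" by (simp add: mc(1))
    then have "l - c0 *\<^sub>C f \<in> M" using M(2) mc(2) closed_sequentially by blast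
    then show "l \<in> {m + c *\<^sub>C f |m c. m \<in> M}"
      by (intro CollectI exI[of _ "l - c0 *\<^sub>C f"] exI[of _ c0]) simp
  qed
qed

lemma csubspace_add_line:
  assumes M: "csubspace M"
  shows "csubspace {m + c *\<^sub>C f | m c. m \<in> M}"
proof -
  have "{m + c *\<^sub>C f | m c. m \<in> M} = {x + y |x y. x \<in> M \<and> y \<in> range (\<lambda>c. c *\<^sub>C f)}"
    by auto
  moreover have "csubspace (range (\<lambda>c. c *\<^sub>C f))"
    using complex_vector.span_singleton[of f] complex_vector.subspace_span by metis
  ultimately show ?thesis
    using complex_vector.subspace_sums[OF M, of "range (\<lambda>c. c *\<^sub>C f)"] by simp
qed

text \<open>A substitute for compactness of the unit ball of the finite-dimensional quotient.\<close>

lemma finite_codim_subseq: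
  fixes M :: "'a::complex_inner set"
  assumes codim: "finite_codim X M" and M: "csubspace M" "closed M" "M \<subseteq> X" and X: "csubspace X"
    and x: "\<And>n. x n \<in> X" "\<And>n. norm (x n) \<le> K"
  obtains r u l where "strict_mono (r::nat \<Rightarrow> nat)" "\<And>n. u n \<in> X" "u \<longlonglongrightarrow> l"
    "\<And>n. x (r n) - u n \<in> M"
proof -
  obtain F where "finite F" "F \<subseteq> X" "\<And>y. y \<in> X \<Longrightarrow> \<exists>v\<in>cspan F. y - v \<in> M"
    using codim unfolding finite_codim_def by blast
  then have "\<exists>r u l. strict_mono (r::nat \<Rightarrow> nat) \<and> (\<forall>n. u n \<in> X) \<and> u \<longlonglongrightarrow> l \<and> (\<forall>n. x (r n) - u n \<in> M)"
    using M
  \<comment> \<open>One generator at a time: adding the line through \<open>f\<close> to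
    \<open>M\<close> leaves fewer generators. The coefficients of \<open>f\<close> stay bounded, so
    Bolzano-Weierstrass in the complex plane yields a further subsequence.\<close>
  proof (induction F arbitrary: M rule: finite_induct)
    case empty
    then have "\<And>y. y \<in> X \<Longrightarrow> y \<in> M" by (auto simp: complex_vector.span_empty)
    then show ?case
      using x complex_vector.subspace_0[OF X]
      by (intro exI[of _ id] exI[of _ "\<lambda>n. 0"] exI[of _ 0]) (auto simp: strict_mono_def)
  next
    case (insert f F)
    define M' where "M' = {m + c *\<^sub>C f | m c. m \<in> M}"
    have fX: "f \<in> X" using insert.prems by auto
    have M': "csubspace M'" "closed M'"
      unfolding M'_def using insert.prems csubspace_add_line closed_add_line by blast+
    have M'X: "M' \<subseteq> X"
      using insert.prems(5) fX complex_vector.subspace_add[OF X] complex_vector.subspace_scale[OF X]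
      by (auto simp: M'_def)
    have "\<exists>v\<in>cspan F. y - v \<in> M'" if y: "y \<in> X" for y
    proof -
      obtain v where v: "v \<in> cspan (insert f F)" "y - v \<in> M" using insert.prems(2)[OF y] by blast
      obtain k where k: "v - k *\<^sub>C f \<in> cspan F" using v(1) complex_vector.span_insert[of f F] by blast
      have "y - (v - k *\<^sub>C f) = (y - v) + k *\<^sub>C f" by simp
      then have "y - (v - k *\<^sub>C f) \<in> M'" using v(2) M'_def by blast
      then show ?thesis using k by blast
    qed
    then obtain r u l where ru: "strict_mono (r::nat \<Rightarrow> nat)" "\<And>n. u n \<in> X" "u \<longlonglongrightarrow> l"
        "\<And>n. x (r n) - u n \<in> M'"
      using insert.IH[of M'] insert.prems(1) M' M'X by auto
    show ?case
    proof (cases "f \<in> M")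
      case True
      then have "M' \<subseteq> M"
        using complex_vector.subspace_add[OF insert.prems(3)]
          complex_vector.subspace_scale[OF insert.prems(3)]
        by (auto simp: M'_def)
      then show ?thesis using ru by blast
    next
      case False
      then obtain d where d: "d > 0" "\<And>m c. m \<in> M \<Longrightarrow> d * cmod c \<le> norm (m + c *\<^sub>C f)"
        using coordinate_bound insert.prems by metis
      have "\<forall>n. \<exists>m c. x (r n) - u n = m + c *\<^sub>C f \<and> m \<in> M" using ru(4) by (auto simp: M'_def)
      then obtain m c where mc: "\<And>n. x (r n) - u n = m n + c n *\<^sub>C f" "\<And>n. m n \<in> M" by metis
      obtain K' where K': "\<And>n. norm (u n) \<le> K'"
        using convergent_imp_Bseq[OF convergentI[OF ru(3)]] Bseq_def by auto
      have "cmod (c n) \<le> (K + K') / d" for n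
      proof -
        have "d * cmod (c n) \<le> norm (x (r n) - u n)" using d(2)[OF mc(2)] mc(1) by metis
        also have "\<dots> \<le> K + K'"
          using norm_triangle_ineq4[of "x (r n)" "u n"] x(2)[of "r n"] K'[of n] by linarith
        finally show ?thesis using d(1) by (simp add: field_simps)
      qed
      then have "bounded (range c)" unfolding bounded_iff by blast
      then obtain c0 s where s: "strict_mono (s::nat \<Rightarrow> nat)" "(c \<circ> s) \<longlonglongrightarrow> c0"
        using bounded_imp_convergent_subsequence by blast
      have "(\<lambda>n. u (s n) + c (s n) *\<^sub>C f) \<longlonglongrightarrow> l + c0 *\<^sub>C f"
        using s ru(3) LIMSEQ_subseq_LIMSEQ[OF ru(3) s(1)] by (auto simp: o_def intro!: tendsto_intros)
      moreover have "u (s n) + c (s n) *\<^sub>C f \<in> X" for n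
        using ru(2) fX complex_vector.subspace_add[OF X] complex_vector.subspace_scale[OF X] by blast
      moreover have "x (r (s n)) - (u (s n) + c (s n) *\<^sub>C f) \<in> M" for n
        using mc[of "s n"] by (metis add_diff_cancel_right' diff_diff_eq)
      moreover have "strict_mono (r \<circ> s)" using ru(1) s(1) strict_mono_o by blast
      ultimately show ?thesis
        by (intro exI[of _ "r \<circ> s"] exI[of _ "\<lambda>n. u (s n) + c (s n) *\<^sub>C f"]) (auto simp: o_def)
    qed
  qed
  then show ?thesis using that by blast
qed

section \<open>Integrals over circles\<close>

text \<open>This is \<open>1 / (2 \<pi> i)\<close> times the contour integral of \<open>f\<close>.\<close>

definition cint :: "complex \<Rightarrow> real \<Rightarrow> (complex \<Rightarrow> 'a) \<Rightarrow> 'a::chilbert_space"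
  where "cint m r f = integral {0..1} (\<lambda>t. (circlepath m r t - m) *\<^sub>C f (circlepath m r t))"

lemma circlepath_eq: "circlepath m r t = m + of_real r * exp (2 * of_real pi * \<i> * of_real t)"
  by (simp add: circlepath)

lemma circlepath_in_sphere: "r \<ge> 0 \<Longrightarrow> circlepath m r t \<in> sphere m r"
  by (simp add: circlepath dist_norm norm_mult)

lemma norm_circlepath_diff: "r \<ge> 0 \<Longrightarrow> cmod (circlepath m r t - m) = r"
  by (simp add: circlepath norm_mult)

lemma continuous_on_circlepath: "continuous_on S (circlepath m r)"
  unfolding circlepath by (intro continuous_intros)

lemma cint_integrand_continuous:
  assumes "r \<ge> 0" "continuous_on (sphere m r) f"
  shows "continuous_on {0..1} (\<lambda>t. (circlepath m r t - m) *\<^sub>C (f (circlepath m r t) :: 'a::chilbert_space))"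
  by (intro continuous_intros continuous_on_circlepath continuous_on_compose2[OF assms(2)])
    (use circlepath_in_sphere assms in auto)

lemma cint_cong: "r \<ge> 0 \<Longrightarrow> (\<And>l. l \<in> sphere m r \<Longrightarrow> f l = g l) \<Longrightarrow> cint m r f = cint m r g"
  unfolding cint_def using circlepath_in_sphere by (intro integral_cong) metis

lemma cint_add:
  assumes "r \<ge> 0" "continuous_on (sphere m r) f" "continuous_on (sphere m r) g"
  shows "cint m r (\<lambda>l. f l + g l) = cint m r f + cint m r g"
  unfolding cint_def scaleC_add_right
  by (intro integral_add integrable_continuous_real cint_integrand_continuous assms)

lemma cint_linear:
  assumes "r \<ge> 0" "continuous_on (sphere m r) f" "bounded_linear h"
    and "\<And>c x. h (c *\<^sub>C x) = c *\<^sub>C h x"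
  shows "h (cint m r f) = cint m r (\<lambda>l. h (f l))"
proof -
  have "h (cint m r f) = integral {0..1} (h \<circ> (\<lambda>t. (circlepath m r t - m) *\<^sub>C f (circlepath m r t)))"
    unfolding cint_def
    by (intro integral_linear[symmetric] integrable_continuous_real cint_integrand_continuous assms)
  then show ?thesis by (simp add: cint_def o_def assms(4))
qed

lemma cint_norm_le:
  assumes "r \<ge> 0" "continuous_on (sphere m r) f" "\<And>l. l \<in> sphere m r \<Longrightarrow> norm (f l) \<le> B"
  shows "norm (cint m r f) \<le> r * B"
proof -
  have "norm (cint m r f) \<le> (r * B) * (1 - 0)"
    unfolding cint_def
    using assms(1) assms(3)[OF circlepath_in_sphere[OF assms(1)]]
    by (intro integral_bound cint_integrand_continuous assms)
      (simp_all add: norm_scaleC norm_circlepath_diff mult_left_mono)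
  then show ?thesis by simp
qed

lemma bounded_linear_scaleC_left: "bounded_linear (\<lambda>c. c *\<^sub>C (x::'a::complex_inner))"
  by (rule bounded_bilinear.bounded_linear_left[OF bounded_bilinear_scaleC])

lemma bounded_linear_scaleC_right: "bounded_linear (\<lambda>x. c *\<^sub>C (x::'a::complex_inner))"
  by (rule bounded_bilinear.bounded_linear_right[OF bounded_bilinear_scaleC])

lemma bounded_linear_cinner_left: "bounded_linear (\<lambda>x. cinner x y)"
  by (rule bounded_bilinear.bounded_linear_left[OF bounded_bilinear_cinner])

lemma scaleC_complex_eq [simp]: "(c::complex) *\<^sub>C d = c * d"
  by (simp add: scaleC_complex_def)

lemma cint_scaleC_left:
  assumes "r \<ge> 0" "continuous_on (sphere m r) h"
  shows "cint m r (\<lambda>l. h l *\<^sub>C x) = cint m r h *\<^sub>C (x::'a::chilbert_space)"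
  using cint_linear[OF assms bounded_linear_scaleC_left[of x]] by (simp add: scaleC_scaleC)

lemma cint_scaleC_right:
  assumes "r \<ge> 0" "continuous_on (sphere m r) f"
  shows "cint m r (\<lambda>l. c *\<^sub>C f l) = c *\<^sub>C cint m r f"
  using cint_linear[OF assms bounded_linear_scaleC_right[of c]] by (simp add: scaleC_scaleC mult.commute)

lemma cint_minus:
  assumes "r \<ge> 0" "continuous_on (sphere m r) f"
  shows "cint m r (\<lambda>l. - f l) = - cint m r f"
  using cint_scaleC_right[OF assms, of "-1"] by simp

lemma cint_cinner:
  assumes "r \<ge> 0" "continuous_on (sphere m r) f"
  shows "cinner (cint m r f) y = cint m r (\<lambda>l. cinner (f l) y)"
  by (rule cint_linear[OF assms bounded_linear_cinner_left]) (simp add: cinner_scaleC_left)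

section \<open>Cauchy's theorem for circle integrals\<close>

lemma cint_eq_contour_integral:
  "cint m r f = contour_integral (circlepath m r) f / (2 * of_real pi * \<i>)"
proof -
  have "contour_integral (circlepath m r) f
      = integral {0..1} (\<lambda>t. f (circlepath m r t) * vector_derivative (circlepath m r) (at t))"
    by (simp add: contour_integral_integral)
  also have "\<dots> = integral {0..1} (\<lambda>t. (2 * of_real pi * \<i>) * ((circlepath m r t - m) *\<^sub>C f (circlepath m r t)))"
    by (intro integral_cong) (simp add: vector_derivative_circlepath circlepath_eq mult_ac)
  also have "\<dots> = (2 * of_real pi * \<i>) * cint m r f"
    unfolding cint_def by (rule integral_mult_right)
  finally show ?thesis by simp
qed

lemma cint_Cauchy_0:
  fixes f :: "complex \<Rightarrow> complex"
  assumes "r \<ge> 0" "continuous_on (cball m r) f" "f holomorphic_on ball m r"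
  shows "cint m r f = 0"
proof -
  have "(f has_contour_integral 0) (circlepath m r)"
  proof (rule Cauchy_theorem_disc[of "{}" m r])
    show "f field_differentiable at x" if "x \<in> ball m r - {}" for x
      using that assms(3) holomorphic_on_imp_differentiable_at open_ball by blast
  qed (use assms in auto)
  then show ?thesis by (simp add: cint_eq_contour_integral contour_integral_unique)
qed

lemma cint_Cauchy_inside:
  assumes "continuous_on (cball m r) f" "f holomorphic_on ball m r" "l \<in> ball m r"
  shows "cint m r (\<lambda>z. f z / (z - l)) = f l"
  using Cauchy_integral_circlepath[OF assms(1,2), of l] assms(3)
  by (simp add: cint_eq_contour_integral contour_integral_unique dist_norm norm_minus_commute)

lemma cint_Cauchy_outside:
  assumes "r \<ge> 0" "continuous_on (cball m r) f" "f holomorphic_on ball m r" "l \<notin> cball m r"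
  shows "cint m r (\<lambda>z. f z / (z - l)) = 0"
  by (intro cint_Cauchy_0 continuous_intros holomorphic_intros assms) (use assms in auto)

text \<open>The linear homotopy moves every point radially and so stays in the closed
  annulus.\<close>

lemma homotopic_circlepaths:
  assumes "0 \<le> r" "r \<le> s" "cball m s - ball m r \<subseteq> S"
  shows "homotopic_loops S (circlepath m r) (circlepath m s)"
proof (rule homotopic_loops_linear)
  fix t :: real
  have "z \<in> cball m s - ball m r" if z: "z \<in> closed_segment (circlepath m r t) (circlepath m s t)" for z
  proof -
    obtain u where u: "0 \<le> u" "u \<le> 1" "z = (1 - u) *\<^sub>R circlepath m r t + u *\<^sub>R circlepath m s t"
      using z by (auto simp: closed_segment_def)
    have "z - m = of_real ((1 - u) * r + u * s) * exp (2 * of_real pi * \<i> * of_real t)"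
      unfolding u(3) circlepath_eq by (simp add: scaleR_conv_of_real algebra_simps)
    then have "cmod (z - m) = \<bar>(1 - u) * r + u * s\<bar>"
      by (simp add: norm_mult del: of_real_add of_real_mult of_real_diff)
    moreover have "r \<le> (1 - u) * r + u * s" "(1 - u) * r + u * s \<le> s"
      using u assms(1,2) mult_left_mono[of r s u] mult_left_mono[of r s "1 - u"]
      by (auto simp: algebra_simps)
    ultimately show ?thesis using assms(1) by (simp add: dist_norm norm_minus_commute)
  qed
  then show "closed_segment (circlepath m r t) (circlepath m s t) \<subseteq> S" using assms(3) by blast
qed auto

lemma cint_radius_independent_complex:
  fixes f :: "complex \<Rightarrow> complex"
  assumes "0 \<le> r" "r \<le> s" "cball m s - ball m r \<subseteq> S" "open S" "f holomorphic_on S"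
  shows "cint m r f = cint m s f"
  unfolding cint_eq_contour_integral
  using Cauchy_theorem_homotopic_loops[OF homotopic_circlepaths[OF assms(1-3)] assms(4,5)] by simp

text \<open>Pairing with an arbitrary \<open>y\<close> reduces this to scalar Cauchy theory, since
  the inner product separates vectors.\<close>

lemma cint_radius_independent:
  fixes f :: "complex \<Rightarrow> 'a::chilbert_space"
  assumes "0 \<le> r" "r \<le> s" "cball m s - ball m r \<subseteq> S" "open S"
    and "\<And>y. (\<lambda>l. cinner (f l) y) holomorphic_on S" "continuous_on S f"
  shows "cint m r f = cint m s f"
proof -
  have sub: "sphere m r \<subseteq> S" "sphere m s \<subseteq> S" using assms(2,3) by auto
  have "cinner (cint m r f - cint m s f) y = 0" for y
    using cint_radius_independent_complex[OF assms(1-4) assms(5)[of y]] assms(1,2)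
    by (simp add: cinner_diff_left cint_cinner continuous_on_subset[OF assms(6)] sub)
  then show ?thesis using cinner_eq_zero_imp by fastforce
qed

text \<open>Riemann sums lie in \<open>M\<close> because their tags lie in the interval, and
  closedness keeps the limit there. Applied to graphs this gives Hille's theorem: a closed operator
  may be moved under the integral.\<close>

lemma integral_in_closed_subspace:
  fixes f :: "real \<Rightarrow> 'b::real_normed_vector"
  assumes M: "subspace M" "closed M" and f: "\<And>t. t \<in> {a..b} \<Longrightarrow> f t \<in> M" "f integrable_on {a..b}"
  shows "integral {a..b} f \<in> M"
proof -
  let ?I = "integral {a..b} f"
  have "\<exists>y\<in>M. dist y ?I < e" if e: "e > 0" for e
  proof -
    have I: "(f has_integral ?I) (cbox a b)" using f(2) by (simp add: integrable_integral)
    let ?s = "\<lambda>D. (\<Sum>(x,k)\<in>D. Henstock_Kurzweil_Integration.content k *\<^sub>R f x)"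
    have "\<exists>\<gamma>. gauge \<gamma> \<and> (\<forall>D. D tagged_division_of (cbox a b) \<and> \<gamma> fine D \<longrightarrow> norm (?s D - ?I) < e)"
      by (rule has_integral[THEN iffD1, rule_format, OF I e])
    then obtain \<gamma> where \<gamma>: "gauge \<gamma>"
      "\<And>D. D tagged_division_of (cbox a b) \<Longrightarrow> \<gamma> fine D \<Longrightarrow> norm (?s D - ?I) < e"
      by meson
    obtain p where p: "p tagged_division_of (cbox a b)" "\<gamma> fine p"
      using fine_division_exists[OF \<gamma>(1)] by blast
    have "(\<Sum>(x,k)\<in>p. Henstock_Kurzweil_Integration.content k *\<^sub>R f x) \<in> M"
    proof (rule subspace_sum[OF M(1)])
      fix z assume "z \<in> p"
      moreover obtain x k where "z = (x, k)" by fastforce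
      ultimately have "x \<in> {a..b}" using tag_in_interval[OF p(1)] by auto
      then show "(case z of (x, k) \<Rightarrow> Henstock_Kurzweil_Integration.content k *\<^sub>R f x) \<in> M"
        using \<open>z = (x, k)\<close> f(1) subspace_scale[OF M(1)] by auto
    qed
    then show ?thesis using \<gamma>(2)[OF p] by (auto simp: dist_norm)
  qed
  then show ?thesis using closure_approachable[of ?I M] M(2) by (simp add: closure_closed)
qed

lemma cint_in_closed_csubspace:
  assumes "r \<ge> 0" "continuous_on (sphere m r) f" "csubspace M" "closed M"
    and "\<And>l. l \<in> sphere m r \<Longrightarrow> f l \<in> M"
  shows "cint m r f \<in> M"
  unfolding cint_def
  by (intro integral_in_closed_subspace csubspace_imp_subspace assms
      complex_vector.subspace_scale circlepath_in_sphere integrable_continuous_real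
      cint_integrand_continuous)

lemma cint_Pair:
  assumes "r \<ge> 0" "continuous_on (sphere m r) f" "continuous_on (sphere m r) g"
  shows "cint m r (\<lambda>l. (f l, g l)) = (cint m r f, cint m r g)"
proof -
  have c: "continuous_on (sphere m r) (\<lambda>l. (f l, g l))" by (intro continuous_intros assms)
  have "fst (cint m r (\<lambda>l. (f l, g l))) = cint m r f"
    using cint_linear[OF assms(1) c bounded_linear_fst] by simp
  moreover have "snd (cint m r (\<lambda>l. (f l, g l))) = cint m r g"
    using cint_linear[OF assms(1) c bounded_linear_snd] by simp
  ultimately show ?thesis by (metis prod.collapse)
qed

lemma cint_swap:
  assumes r: "r \<ge> 0" "s \<ge> 0"
    and f: "continuous_on (sphere m r \<times> sphere n s) (\<lambda>(l, k). f l k)"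
  shows "cint m r (\<lambda>l. cint n s (f l)) = cint n s (\<lambda>k. cint m r (\<lambda>l. f l k))"
proof -
  let ?F = "\<lambda>t u. (circlepath m r t - m) *\<^sub>C (circlepath n s u - n) *\<^sub>C f (circlepath m r t) (circlepath n s u)"
  have cont: "continuous_on (cbox (0, 0) (1, 1::real)) (\<lambda>(t, u). ?F t u)"
  proof -
    have "continuous_on UNIV (\<lambda>p. (circlepath m r (fst p), circlepath n s (snd p)))"
      unfolding circlepath by (intro continuous_intros)
    then have 1: "continuous_on (cbox (0, 0) (1, 1::real)) (\<lambda>p. (circlepath m r (fst p), circlepath n s (snd p)))"
      using continuous_on_subset by blast
    have "continuous_on (cbox (0, 0) (1, 1::real))
        (\<lambda>p. (\<lambda>(l, k). f l k) (circlepath m r (fst p), circlepath n s (snd p)))"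
      by (rule continuous_on_compose2[OF f 1]) (use r circlepath_in_sphere in auto)
    moreover have "continuous_on (cbox (0, 0) (1, 1::real)) (\<lambda>p. circlepath m r (fst p))"
      "continuous_on (cbox (0, 0) (1, 1::real)) (\<lambda>p. circlepath n s (snd p))"
      unfolding circlepath by (intro continuous_intros)+
    ultimately show ?thesis
      unfolding case_prod_beta by (intro continuous_intros) auto
  qed
  have fc: "continuous_on (sphere n s) (f l)" if "l \<in> sphere m r" for l
  proof -
    have "continuous_on (sphere n s) (\<lambda>k. (\<lambda>(l, k). f l k) (l, k))"
      by (rule continuous_on_compose2[OF f]) (use that in \<open>auto intro!: continuous_intros\<close>)
    then show ?thesis by simp
  qed
  have fc2: "continuous_on (sphere m r) (\<lambda>l. f l k)" if "k \<in> sphere n s" for k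
  proof -
    have "continuous_on (sphere m r) (\<lambda>l. (\<lambda>(l, k). f l k) (l, k))"
      by (rule continuous_on_compose2[OF f]) (use that in \<open>auto intro!: continuous_intros\<close>)
    then show ?thesis by simp
  qed
  have "cint m r (\<lambda>l. cint n s (f l)) = integral (cbox 0 1) (\<lambda>t. integral (cbox 0 1) (?F t))"
    unfolding cint_def[of m] box_real
  proof (rule integral_cong)
    fix t :: real
    have "(circlepath m r t - m) *\<^sub>C cint n s (f (circlepath m r t))
        = cint n s (\<lambda>k. (circlepath m r t - m) *\<^sub>C f (circlepath m r t) k)"
      by (rule cint_scaleC_right[symmetric]) (use r fc circlepath_in_sphere in auto)
    also have "\<dots> = integral {0..1} (?F t)"
      unfolding cint_def by (simp add: scaleC_scaleC mult.commute)
    finally show "(circlepath m r t - m) *\<^sub>C cint n s (f (circlepath m r t)) = integral {0..1} (?F t)" .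
  qed
  also have "\<dots> = integral (cbox 0 1) (\<lambda>u. integral (cbox 0 1) (\<lambda>t. ?F t u))"
    by (rule integral_swap_continuous[OF cont])
  also have "\<dots> = cint n s (\<lambda>k. cint m r (\<lambda>l. f l k))"
    unfolding cint_def[of n] box_real
  proof (rule integral_cong)
    fix u :: real
    have "(circlepath n s u - n) *\<^sub>C cint m r (\<lambda>l. f l (circlepath n s u))
        = cint m r (\<lambda>l. (circlepath n s u - n) *\<^sub>C f l (circlepath n s u))"
      by (rule cint_scaleC_right[symmetric]) (use r fc2 circlepath_in_sphere in auto)
    also have "\<dots> = integral {0..1} (\<lambda>t. ?F t u)"
      unfolding cint_def by simp
    finally show "integral {0..1} (\<lambda>t. ?F t u)
        = (circlepath n s u - n) *\<^sub>C cint m r (\<lambda>l. f l (circlepath n s u))" ..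
  qed
  finally show ?thesis .
qed

section \<open>Resolvents on invariant subspaces\<close>

locale closed_operator =
  fixes A :: "'a::chilbert_space operator"
  assumes A_linear: "linear_operator A"
    and A_closed: "closed A"
begin

lemma A_csubspace: "csubspace A"
  by (rule linear_operator_imp_csubspace[OF A_linear])

lemma A_unique: "(x, u) \<in> A \<Longrightarrow> (x, v) \<in> A \<Longrightarrow> u = v"
  using A_linear by (auto simp: linear_operator_def single_valued_def)

lemma A_zero [simp]: "(0, 0) \<in> A"
  using A_linear by (auto simp: linear_operator_def)

lemma A_add: "(x, u) \<in> A \<Longrightarrow> (y, v) \<in> A \<Longrightarrow> (x + y, u + v) \<in> A"
  using A_linear by (auto simp: linear_operator_def)

lemma A_scale: "(x, u) \<in> A \<Longrightarrow> (c *\<^sub>C x, c *\<^sub>C u) \<in> A"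
  using A_linear by (auto simp: linear_operator_def)

lemma A_minus: "(x, u) \<in> A \<Longrightarrow> (- x, - u) \<in> A"
  using A_scale[of x u "-1"] by simp

lemma A_diff: "(x, u) \<in> A \<Longrightarrow> (y, v) \<in> A \<Longrightarrow> (x - y, u - v) \<in> A"
  using A_add[OF _ A_minus] by fastforce

lemma A_scaleR: "(x, u) \<in> A \<Longrightarrow> (c *\<^sub>R x, c *\<^sub>R u) \<in> A"
  by (metis A_scale scaleC_of_real)

lemma A_limit:
  assumes "\<And>n. (x n, u n) \<in> A" "x \<longlonglongrightarrow> y" "u \<longlonglongrightarrow> v"
  shows "(y, v) \<in> A"
  using closed_sequentially[OF A_closed assms(1) tendsto_Pair[OF assms(2,3)]] .

definition invariant :: "'a set \<Rightarrow> bool"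
  where "invariant N \<longleftrightarrow> csubspace N \<and> closed N \<and> (\<forall>x u. (x, u) \<in> A \<longrightarrow> x \<in> N \<longrightarrow> u \<in> N)"

text \<open>Spectra are attached to invariant subspaces instead of introducing a new operator for
  each of them. That a part of the spectrum has been cut off is expressed by membership in
  \<open>rho N\<close> for a smaller \<open>N\<close>.\<close>

definition rho :: "'a set \<Rightarrow> complex set"
  where "rho N = resolvent_set_in N (restrict_op A N)"

definition R :: "'a set \<Rightarrow> complex \<Rightarrow> 'a \<Rightarrow> 'a"
  where "R N l y = (if l \<in> rho N \<and> y \<in> N then THE x. x \<in> N \<and> (x, y + l *\<^sub>C x) \<in> A else 0)"

lemma invariantD:
  assumes "invariant N"
  shows "csubspace N" "closed N" "(x, u) \<in> A \<Longrightarrow> x \<in> N \<Longrightarrow> u \<in> N"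
  using assms by (auto simp: invariant_def)

lemma invariant_UNIV: "invariant UNIV"
  by (simp add: invariant_def)

lemma invariant_Int: "invariant M \<Longrightarrow> invariant N \<Longrightarrow> invariant (M \<inter> N)"
  by (auto simp: invariant_def complex_vector.subspace_inter)

lemma rhoI:
  assumes N: "invariant N"
    and ex: "\<And>y. y \<in> N \<Longrightarrow> \<exists>x\<in>N. (x, y + l *\<^sub>C x) \<in> A"
    and bound: "\<And>x u. (x, u) \<in> A \<Longrightarrow> x \<in> N \<Longrightarrow> norm x \<le> C * norm (u - l *\<^sub>C x)"
  shows "l \<in> rho N"
proof -
  have "\<exists>!x. \<exists>u. (x, u) \<in> restrict_op A N \<and> u - l *\<^sub>C x = y" if y: "y \<in> N" for y
  proof -
    obtain x where x: "x \<in> N" "(x, y + l *\<^sub>C x) \<in> A" using ex[OF y] by blast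
    show ?thesis
    proof (intro ex1I[of _ x])
      show "\<exists>u. (x, u) \<in> restrict_op A N \<and> u - l *\<^sub>C x = y"
        using x by (intro exI[of _ "y + l *\<^sub>C x"]) (simp add: restrict_op_def)
    next
      fix z assume "\<exists>u. (z, u) \<in> restrict_op A N \<and> u - l *\<^sub>C z = y"
      then obtain u where u: "(z, u) \<in> A" "z \<in> N" "u - l *\<^sub>C z = y" by (auto simp: restrict_op_def)
      have "(z - x, u - (y + l *\<^sub>C x)) \<in> A" using u(1) x(2) by (rule A_diff)
      moreover have "z - x \<in> N" using u(2) x(1) complex_vector.subspace_diff[OF invariantD(1)[OF N]] by blast
      ultimately have "norm (z - x) \<le> C * norm (u - (y + l *\<^sub>C x) - l *\<^sub>C (z - x))" by (rule bound)
      also have "u - (y + l *\<^sub>C x) - l *\<^sub>C (z - x) = 0" using u(3) by (simp add: scaleC_diff_right algebra_simps)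
      finally show "z = x" by simp
    qed
  qed
  then show ?thesis
    using bound invariantD[OF N] unfolding rho_def resolvent_set_in_def
    by (auto simp: restrict_op_def intro!: exI[of _ C])
qed

lemma rho_imp_invariant: "l \<in> rho N \<Longrightarrow> (x, u) \<in> A \<Longrightarrow> x \<in> N \<Longrightarrow> u \<in> N"
  by (auto simp: rho_def resolvent_set_in_def restrict_op_def)

lemma rho_ex1:
  assumes "l \<in> rho N" "y \<in> N"
  shows "\<exists>!x. x \<in> N \<and> (x, y + l *\<^sub>C x) \<in> A"
proof -
  have "\<exists>!x. \<exists>u. (x, u) \<in> restrict_op A N \<and> u - l *\<^sub>C x = y"
    using assms by (auto simp: rho_def resolvent_set_in_def)
  moreover have "(\<exists>u. (x, u) \<in> restrict_op A N \<and> u - l *\<^sub>C x = y) \<longleftrightarrow> x \<in> N \<and> (x, y + l *\<^sub>C x) \<in> A" for x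
    by (auto simp: restrict_op_def intro!: exI[of _ "y + l *\<^sub>C x"])
  ultimately show ?thesis by simp
qed

lemma R_in:
  assumes "l \<in> rho N" "y \<in> N"
  shows "R N l y \<in> N" "(R N l y, y + l *\<^sub>C R N l y) \<in> A"
  using theI'[OF rho_ex1[OF assms]] assms by (auto simp: R_def)

lemma R_eqI: "l \<in> rho N \<Longrightarrow> (x, y + l *\<^sub>C x) \<in> A \<Longrightarrow> x \<in> N \<Longrightarrow> y \<in> N \<Longrightarrow> R N l y = x"
  using ex1E[OF rho_ex1[of l N y]] R_in[of l N y] by metis

lemma R_eq:
  assumes "l \<in> rho N" "(x, u) \<in> A" "x \<in> N" "csubspace N"
  shows "R N l (u - l *\<^sub>C x) = x"
  using assms rho_imp_invariant[OF assms(1-3)]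
  by (intro R_eqI) (auto intro: complex_vector.subspace_diff complex_vector.subspace_scale)

lemma R_bound:
  assumes "l \<in> rho N"
  obtains C where "C > 0" "\<And>y. y \<in> N \<Longrightarrow> norm (R N l y) \<le> C * norm y"
proof -
  obtain C where "\<forall>(x, u)\<in>restrict_op A N. norm x \<le> C * norm (u - l *\<^sub>C x)"
    using assms by (auto simp: rho_def resolvent_set_in_def)
  then have C: "norm x \<le> C * norm (u - l *\<^sub>C x)" if "(x, u) \<in> A" "x \<in> N" for x u
    using that by (auto simp: restrict_op_def)
  have "norm (R N l y) \<le> (\<bar>C\<bar> + 1) * norm y" if "y \<in> N" for y
  proof -
    have "norm (R N l y) \<le> C * norm y"
      using C[OF R_in(2)[OF assms that] R_in(1)[OF assms that]] by simp
    also have "\<dots> \<le> (\<bar>C\<bar> + 1) * norm y" by (intro mult_right_mono) auto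
    finally show ?thesis .
  qed
  then show ?thesis using that[of "\<bar>C\<bar> + 1"] by simp
qed

lemma R_intertwine:
  assumes "l \<in> rho N" "l \<in> rho M" "y \<in> N"
    and "\<And>x. x \<in> N \<Longrightarrow> h x \<in> M" "h (y + l *\<^sub>C R N l y) = h y + l *\<^sub>C h (R N l y)"
    and "\<And>x u. (x, u) \<in> A \<Longrightarrow> x \<in> N \<Longrightarrow> (h x, h u) \<in> A"
  shows "h (R N l y) = R M l (h y)"
  using assms R_in[OF assms(1,3)] R_eqI[OF assms(2), of "h (R N l y)" "h y"] by metis

lemma R_add:
  assumes "l \<in> rho N" "x \<in> N" "y \<in> N" "csubspace N"
  shows "R N l (x + y) = R N l x + R N l y"
proof (rule R_eqI)
  show "(R N l x + R N l y, x + y + l *\<^sub>C (R N l x + R N l y)) \<in> A"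
    using A_add[OF R_in(2)[OF assms(1,2)] R_in(2)[OF assms(1,3)]]
    by (simp add: scaleC_add_right algebra_simps)
qed (use assms R_in complex_vector.subspace_add[OF assms(4)] in auto)

lemma R_scale:
  assumes "l \<in> rho N" "x \<in> N" "csubspace N"
  shows "R N l (c *\<^sub>C x) = c *\<^sub>C R N l x"
proof (rule R_eqI)
  show "(c *\<^sub>C R N l x, c *\<^sub>C x + l *\<^sub>C c *\<^sub>C R N l x) \<in> A"
    using A_scale[OF R_in(2)[OF assms(1,2)], of c] by (simp add: scaleC_algebra mult.commute)
qed (use assms R_in complex_vector.subspace_scale[OF assms(3)] in auto)

lemma R_diff:
  assumes "l \<in> rho N" "x \<in> N" "y \<in> N" "csubspace N"
  shows "R N l (x - y) = R N l x - R N l y"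
  using R_add[OF assms(1) complex_vector.subspace_diff[OF assms(4,2,3)] assms(3,4)] by simp

lemma resolvent_identity:
  assumes "l \<in> rho N" "k \<in> rho N" "y \<in> N" "csubspace N"
  shows "R N l y - R N k y = (l - k) *\<^sub>C R N l (R N k y)"
proof -
  let ?x = "R N k y"
  have x: "?x \<in> N" "(?x, y + k *\<^sub>C ?x) \<in> A" using R_in[OF assms(2,3)] by auto
  have "?x = R N l (y + k *\<^sub>C ?x - l *\<^sub>C ?x)" using R_eq[OF assms(1) x(2,1) assms(4)] by simp
  also have "y + k *\<^sub>C ?x - l *\<^sub>C ?x = y - (l - k) *\<^sub>C ?x" by (simp add: scaleC_diff_left algebra_simps)
  also have "R N l \<dots> = R N l y - (l - k) *\<^sub>C R N l ?x"
    using assms x by (simp add: R_diff R_scale complex_vector.subspace_scale)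
  finally show ?thesis by (simp add: algebra_simps)
qed

text \<open>On the ball of radius \<open>1 / (2 * C)\<close> the perturbation term is at most half
  of \<open>norm (R N k y)\<close> and is absorbed into the left-hand side, which doubles the
  constant.\<close>

lemma R_local_bound:
  assumes "l \<in> rho N" "csubspace N"
  obtains e C where "e > 0" "C > 0"
    "\<And>k y. k \<in> rho N \<Longrightarrow> k \<in> ball l e \<Longrightarrow> y \<in> N \<Longrightarrow> norm (R N k y) \<le> C * norm y"
proof -
  obtain C where C: "C > 0" "\<And>y. y \<in> N \<Longrightarrow> norm (R N l y) \<le> C * norm y" using R_bound[OF assms(1)] by metis
  have "norm (R N k y) \<le> (2 * C) * norm y" if k: "k \<in> rho N" "k \<in> ball l (1 / (2 * C))" and y: "y \<in> N" for k y
  proof -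
    let ?x = "R N k y"
    have x: "?x \<in> N" "(?x, y + k *\<^sub>C ?x) \<in> A" using R_in[OF k(1) y] by auto
    have "?x = R N l (y + k *\<^sub>C ?x - l *\<^sub>C ?x)" using R_eq[OF assms(1) x(2,1) assms(2)] by simp
    then have "norm ?x \<le> C * norm (y + k *\<^sub>C ?x - l *\<^sub>C ?x)"
      using C(2)[of "y + k *\<^sub>C ?x - l *\<^sub>C ?x"] rho_imp_invariant[OF k(1) x(2,1)] x(1) assms(2)
      by (metis complex_vector.subspace_diff complex_vector.subspace_scale)
    also have "C * norm (y + k *\<^sub>C ?x - l *\<^sub>C ?x) \<le> C * (norm y + cmod (k - l) * norm ?x)"
    proof (rule mult_left_mono)
      have eq: "y + k *\<^sub>C ?x - l *\<^sub>C ?x = y + (k - l) *\<^sub>C ?x" by (simp add: scaleC_diff_left)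
      show "norm (y + k *\<^sub>C ?x - l *\<^sub>C ?x) \<le> norm y + cmod (k - l) * norm ?x"
        using norm_triangle_ineq[of y "(k - l) *\<^sub>C ?x"] unfolding eq norm_scaleC .
    qed (use C in simp)
    also have "C * (norm y + cmod (k - l) * norm ?x) \<le> C * (norm y + 1 / (2 * C) * norm ?x)"
      using k(2) C(1) by (intro mult_left_mono add_left_mono mult_right_mono)
        (auto simp: dist_norm norm_minus_commute less_imp_le)
    also have "\<dots> = C * norm y + norm ?x / 2" using C(1) by (simp add: field_simps)
    finally show ?thesis by simp
  qed
  then show ?thesis using that[of "1 / (2 * C)" "2 * C"] C(1) by simp
qed

lemma R_continuous:
  assumes y: "y \<in> N" and N: "csubspace N"
  shows "continuous_on (rho N) (\<lambda>l. R N l y)"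
  unfolding continuous_on_eq_continuous_within continuous_within Lim_within
proof (intro ballI allI impI)
  fix l and \<epsilon> :: real assume l: "l \<in> rho N" and \<epsilon>: "\<epsilon> > 0"
  obtain e C where eC: "e > 0" "C > 0"
    "\<And>k y. k \<in> rho N \<Longrightarrow> k \<in> ball l e \<Longrightarrow> y \<in> N \<Longrightarrow> norm (R N k y) \<le> C * norm y"
    using R_local_bound[OF l N] by metis
  let ?x = "R N l y"
  define d where "d = min e (\<epsilon> / (C * (norm ?x + 1)))"
  have d: "d > 0" using eC \<epsilon> by (simp add: d_def add_nonneg_pos)
  have "dist (R N k y) ?x < \<epsilon>" if k: "k \<in> rho N" "dist k l < d" for k
  proof -
    have "dist (R N k y) ?x = cmod (k - l) * norm (R N k ?x)"
      using resolvent_identity[OF k(1) l y N] by (simp add: dist_norm norm_scaleC)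
    also have "\<dots> \<le> cmod (k - l) * (C * norm ?x)"
      using k eC(3)[OF k(1) _ R_in(1)[OF l y]] by (intro mult_left_mono) (auto simp: d_def dist_commute)
    also have "\<dots> \<le> cmod (k - l) * (C * (norm ?x + 1))"
      using eC(2) by (intro mult_left_mono) auto
    also have "\<dots> < \<epsilon> / (C * (norm ?x + 1)) * (C * (norm ?x + 1))"
      using k(2) eC(2) by (intro mult_strict_right_mono) (auto simp: d_def dist_norm add_nonneg_pos)
    also have "\<dots> = \<epsilon>"
    proof -
      have "norm ?x + 1 > 0" by (simp add: add_nonneg_pos)
      then show ?thesis using eC(2) by simp
    qed
    finally show ?thesis .
  qed
  then show "\<exists>d>0. \<forall>k\<in>rho N. 0 < dist k l \<and> dist k l < d \<longrightarrow> dist (R N k y) ?x < \<epsilon>"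
    using d by blast
qed

lemma R_compact_bound:
  assumes "compact K" "K \<subseteq> rho N" "csubspace N"
  obtains C where "C > 0" "\<And>k y. k \<in> K \<Longrightarrow> y \<in> N \<Longrightarrow> norm (R N k y) \<le> C * norm y"
proof -
  have "\<exists>e C. e > 0 \<and> C > 0 \<and> (\<forall>k y. k \<in> rho N \<longrightarrow> k \<in> ball l e \<longrightarrow> y \<in> N \<longrightarrow> norm (R N k y) \<le> C * norm y)"
    if l: "l \<in> K" for l
    using R_local_bound[of l N] l assms(2,3) by (smt (verit) subsetD)
  then obtain e C where eC: "\<And>l. l \<in> K \<Longrightarrow> e l > 0" "\<And>l. l \<in> K \<Longrightarrow> C l > (0::real)"
    "\<And>l k y. l \<in> K \<Longrightarrow> k \<in> rho N \<Longrightarrow> k \<in> ball l (e l) \<Longrightarrow> y \<in> N \<Longrightarrow> norm (R N k y) \<le> C l * norm y"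
    by metis
  have "K \<subseteq> (\<Union>l\<in>K. ball l (e l))" using eC(1) by auto
  then obtain D where D: "D \<subseteq> K" "finite D" "K \<subseteq> (\<Union>l\<in>D. ball l (e l))"
    using compactE_image[OF assms(1), of K "\<lambda>l. ball l (e l)"] by auto
  define C0 where "C0 = 1 + (\<Sum>l\<in>D. C l)"
  have pos: "0 \<le> C l" if "l \<in> D" for l using that D(1) eC(2) by (meson less_imp_le subsetD)
  have "norm (R N k y) \<le> C0 * norm y" if k: "k \<in> K" and y: "y \<in> N" for k y
  proof -
    obtain l where l: "l \<in> D" "k \<in> ball l (e l)" using D(3) k by blast
    have "norm (R N k y) \<le> C l * norm y" using eC(3)[of l k y] l k y D(1) assms(2) by blast
    also have "C l \<le> (\<Sum>l\<in>D. C l)" using D(2) l(1) pos by (intro member_le_sum) auto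
    then have "C l * norm y \<le> C0 * norm y" unfolding C0_def by (intro mult_right_mono) auto
    finally show ?thesis .
  qed
  moreover have "C0 > 0" unfolding C0_def using sum_nonneg[of D C] pos by (simp add: add_pos_nonneg)
  ultimately show ?thesis using that by blast
qed

text \<open>By the resolvent identity the difference quotient of \<open>R N k x\<close> at
  \<open>l\<close> equals \<open>R N k (R N l x)\<close>, and this converges by continuity of the
  resolvent.\<close>

lemma R_holomorphic:
  assumes "open S" "S \<subseteq> rho N" and x: "x \<in> N" and N: "csubspace N"
  shows "(\<lambda>l. cinner (R N l x) y) holomorphic_on S"
proof -
  have "((\<lambda>k. cinner (R N k x) y) has_field_derivative cinner (R N l (R N l x)) y) (at l)" if l: "l \<in> S" for l
  proof -
    have l': "l \<in> rho N" using l assms by blast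
    have "continuous_on S (\<lambda>k. cinner (R N k (R N l x)) y)"
      by (intro continuous_intros continuous_on_subset[OF R_continuous[OF R_in(1)[OF l' x] N] assms(2)])
    then have "((\<lambda>k. cinner (R N k (R N l x)) y) \<longlongrightarrow> cinner (R N l (R N l x)) y) (at l)"
      using assms(1) l by (simp add: continuous_on_eq_continuous_at isCont_def)
    moreover have "\<forall>\<^sub>F k in at l. cinner (R N k (R N l x)) y = (cinner (R N k x) y - cinner (R N l x) y) / (k - l)"
      unfolding eventually_at_topological
    proof (intro exI[of _ S] conjI assms(1) l ballI impI)
      fix k assume k: "k \<in> S" "k \<noteq> l"
      have "cinner (R N k x) y - cinner (R N l x) y = (k - l) * cinner (R N k (R N l x)) y"
        using resolvent_identity[OF _ l' x N, of k] k assms(2)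
        by (metis cinner_diff_left cinner_scaleC_left subsetD)
      then show "cinner (R N k (R N l x)) y = (cinner (R N k x) y - cinner (R N l x) y) / (k - l)"
        using k(2) by simp
    qed
    ultimately show ?thesis
      unfolding has_field_derivative_iff using Lim_transform_eventually by fast
  qed
  then show ?thesis
    unfolding holomorphic_on_def field_differentiable_def using has_field_derivative_at_within by blast
qed

text \<open>Invariance under \<open>A\<close> would not suffice: restricting to an invariant
  subspace may enlarge the spectrum, as it does for shifts. Invariance under the resolvent itself
  rules this out.\<close>

lemma rho_subspace:
  assumes l: "l \<in> rho N" and M: "invariant M" "M \<subseteq> N"
    and R: "\<And>y. y \<in> M \<Longrightarrow> R N l y \<in> M"
  shows "l \<in> rho M"
proof -
  obtain C where C: "C > 0" "\<And>y. y \<in> N \<Longrightarrow> norm (R N l y) \<le> C * norm y" using R_bound[OF l] by metis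
  show ?thesis
  proof (rule rhoI[OF M(1)])
    show "\<exists>x\<in>M. (x, y + l *\<^sub>C x) \<in> A" if "y \<in> M" for y
      using R[OF that] R_in(2)[OF l] that M(2) by blast
    show "norm x \<le> C * norm (u - l *\<^sub>C x)" if x: "(x, u) \<in> A" "x \<in> M" for x u
    proof -
      have uM: "u - l *\<^sub>C x \<in> M"
        using invariantD[OF M(1)] x complex_vector.subspace_diff complex_vector.subspace_scale by metis
      moreover have "R N l (u - l *\<^sub>C x) = x"
        using uM x M(2) by (intro R_eqI[OF l]) auto
      ultimately show ?thesis using C(2)[of "u - l *\<^sub>C x"] M(2) by auto
    qed
  qed
qed

end

section \<open>Operators that are symmetric with respect to \<open>G\<close>\<close>

locale G_symmetric_operator = closed_operator A for A :: "'a::chilbert_space operator" +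
  fixes G :: "'a \<Rightarrow> 'a"
  assumes G_bounded: "bounded_clinear G"
    and G_selfadj: "selfadjoint (op_graph G)"
    and A_symm: "G_symmetric G A"
begin

abbreviation gi :: "'a \<Rightarrow> 'a \<Rightarrow> complex"
  where "gi \<equiv> G_inner G"

abbreviation gq :: "'a \<Rightarrow> real"
  where "gq x \<equiv> Re (G_inner G x x)"

lemma G_cinner: "cinner (G x) y = cinner x (G y)"
proof -
  have "(y, G y) \<in> adjoint_op (op_graph G)"
    using G_selfadj by (auto simp: selfadjoint_def op_graph_def)
  then show ?thesis by (auto simp: adjoint_op_def op_graph_def)
qed

lemma gi_add_left: "gi (x + y) z = gi x z + gi y z"
  and gi_diff_left: "gi (x - y) z = gi x z - gi y z"
  and gi_minus_left [simp]: "gi (- x) z = - gi x z"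
  and gi_scale_left: "gi (c *\<^sub>C x) z = c * gi x z"
  and gi_zero_left [simp]: "gi 0 z = 0"
  and gi_add_right: "gi z (x + y) = gi z x + gi z y"
  and gi_diff_right: "gi z (x - y) = gi z x - gi z y"
  and gi_minus_right [simp]: "gi z (- x) = - gi z x"
  and gi_scale_right: "gi z (c *\<^sub>C x) = cnj c * gi z x"
  and gi_zero_right [simp]: "gi z 0 = 0"
  by (simp_all add: G_inner_def bounded_clinearD[OF G_bounded] cinner_add_left cinner_diff_left
      cinner_scaleC_left cinner_add_right cinner_diff_right cinner_scaleC_right)

lemmas gi_algebra = gi_add_left gi_diff_left gi_scale_left gi_add_right gi_diff_right gi_scale_right

lemma gi_sum_left: "gi (\<Sum>i\<in>I. f i) y = (\<Sum>i\<in>I. gi (f i) y)"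
  by (induction I rule: infinite_finite_induct) (simp_all add: gi_add_left)

lemma gi_sum_right: "gi y (\<Sum>i\<in>I. f i) = (\<Sum>i\<in>I. gi y (f i))"
  by (induction I rule: infinite_finite_induct) (simp_all add: gi_add_right)

lemma gi_commute: "gi x y = cnj (gi y x)"
  unfolding G_inner_def by (metis G_cinner cinner_commute)

lemma gi_self: "gi x x = complex_of_real (gq x)"
  using gi_commute[of x x] by (metis complex_is_Real_iff Reals_cnj_iff of_real_Re)

lemma gi_bound:
  obtains g where "g > 0" "\<And>x y. cmod (gi x y) \<le> g * norm x * norm y"
proof -
  obtain g where g: "g > 0" "\<And>x. norm (G x) \<le> norm x * g"
    using bounded_linear.pos_bounded[OF bounded_clinearD(1)[OF G_bounded]] by blast
  have "cmod (gi x y) \<le> g * norm x * norm y" for x y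
    unfolding G_inner_def
    using cauchy_schwarz[of "G x" y] mult_right_mono[OF g(2)[of x] norm_ge_zero[of y]]
    by (simp add: mult_ac)
  then show ?thesis using that g(1) by blast
qed

lemma gq_bound:
  obtains g where "g > 0" "\<And>x. \<bar>gq x\<bar> \<le> g * (norm x)\<^sup>2"
proof -
  obtain g where g: "g > 0" "\<And>x y. cmod (gi x y) \<le> g * norm x * norm y" using gi_bound by blast
  have "\<bar>gq x\<bar> \<le> g * (norm x)\<^sup>2" for x
    using abs_Re_le_cmod[of "gi x x"] g(2)[of x x] by (simp add: power2_eq_square mult.assoc)
  then show ?thesis using that[of g] g(1) by blast
qed

lemma gq_add: "gq (x + y) = gq x + gq y + 2 * Re (gi x y)"
  using gi_commute[of y x] by (simp add: gi_algebra)

lemma gq_diff: "gq (x - y) = gq x + gq y - 2 * Re (gi x y)"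
  using gi_commute[of y x] by (simp add: gi_algebra)

lemma gq_scaleC: "gq (c *\<^sub>C x) = (cmod c)\<^sup>2 * gq x"
proof -
  have "gi (c *\<^sub>C x) (c *\<^sub>C x) = (c * cnj c) * gi x x" by (simp add: gi_algebra)
  also have "\<dots> = complex_of_real ((cmod c)\<^sup>2 * gq x)"
    by (subst gi_self) (simp add: complex_norm_square[symmetric])
  finally show ?thesis by (simp only: Re_complex_of_real)
qed

lemma gq_scaleR: "gq (c *\<^sub>R x) = c\<^sup>2 * gq x"
  using gq_scaleC[of "of_real c" x] by (simp add: scaleC_of_real)

lemma bounded_bilinear_gi: "bounded_bilinear gi"
proof -
  have "bounded_bilinear (\<lambda>x y. cinner (G x) y)"
    by (rule bounded_bilinear.comp1[OF bounded_bilinear_cinner bounded_clinearD(1)[OF G_bounded]])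
  then show ?thesis by (simp add: G_inner_def[abs_def])
qed

lemmas tendsto_gi [tendsto_intros] = bounded_bilinear.tendsto[OF bounded_bilinear_gi]

lemma gi_A: "(x, u) \<in> A \<Longrightarrow> (y, v) \<in> A \<Longrightarrow> gi u y = gi x v"
  using A_symm by (auto simp: G_symmetric_def)

lemma R_symmetric:
  assumes "l \<in> rho N" "cnj l \<in> rho N" "x \<in> N" "y \<in> N"
  shows "gi (R N l x) y = gi x (R N (cnj l) y)"
proof -
  let ?u = "R N l x" and ?v = "R N (cnj l) y"
  have "gi (x + l *\<^sub>C ?u) ?v = gi ?u (y + cnj l *\<^sub>C ?v)"
    using gi_A[OF R_in(2)[OF assms(1,3)] R_in(2)[OF assms(2,4)]] .
  then show ?thesis by (simp add: gi_algebra)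
qed

end

text \<open>As \<open>T\<close> is linear and bounded only on \<open>M\<close>, its graph over
  \<open>M\<close> is used: this is a closed subspace containing all pairs
  \<open>(f l, T (f l))\<close>, hence also their integral.\<close>

lemma cint_linear_on:
  fixes f :: "complex \<Rightarrow> 'a::chilbert_space"
  assumes r: "r \<ge> 0" and M: "csubspace M" "closed M"
    and f: "continuous_on (sphere m r) f" "\<And>l. l \<in> sphere m r \<Longrightarrow> f l \<in> M"
    and T: "\<And>x y. x \<in> M \<Longrightarrow> y \<in> M \<Longrightarrow> T (x + y) = T x + T y"
      "\<And>x c. x \<in> M \<Longrightarrow> T (c *\<^sub>C x) = c *\<^sub>C T x" "\<And>x. x \<in> M \<Longrightarrow> norm (T x) \<le> K * norm x"
  shows "T (cint m r f) = cint m r (\<lambda>l. (T (f l) :: 'a))"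
proof -
  define \<Gamma> where "\<Gamma> = {(x, T x) | x. x \<in> M}"
  have T_diff: "T x - T y = T (x - y)" if "x \<in> M" "y \<in> M" for x y
    using T(1)[OF complex_vector.subspace_diff[OF M(1) that] that(2)] by simp
  have T_dist: "dist (T x) (T y) \<le> \<bar>K\<bar> * dist x y" if "x \<in> M" "y \<in> M" for x y
  proof -
    have "dist (T x) (T y) \<le> K * norm (x - y)"
      using T(3) T_diff[OF that] complex_vector.subspace_diff[OF M(1) that] by (simp add: dist_norm)
    also have "\<dots> \<le> \<bar>K\<bar> * norm (x - y)" by (intro mult_right_mono) auto
    finally show ?thesis by (simp add: dist_norm)
  qed
  have T_cont: "continuous_on M T"
    by (rule lipschitz_on_continuous_on[of "\<bar>K\<bar>"]) (auto intro!: lipschitz_onI T_dist)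
  have "csubspace \<Gamma>"
    unfolding complex_vector.subspace_def \<Gamma>_def using M(1) T(1,2) T(2)[of 0 0]
    by (force simp: complex_vector.subspace_def zero_prod_def)
  moreover have "closed \<Gamma>"
    unfolding closed_sequential_limits
  proof (intro allI impI)
    fix p z assume *: "(\<forall>n. p n \<in> \<Gamma>) \<and> p \<longlonglongrightarrow> z"
    then have p: "fst (p n) \<in> M" "snd (p n) = T (fst (p n))" for n by (auto simp: \<Gamma>_def prod_eq_iff)
    have f: "(\<lambda>n. fst (p n)) \<longlonglongrightarrow> fst z" "(\<lambda>n. snd (p n)) \<longlonglongrightarrow> snd z" using * by (auto intro: tendsto_intros)
    have z: "fst z \<in> M" using closed_sequentially[OF M(2) p(1) f(1)] .
    have "(\<lambda>n. T (fst (p n))) \<longlonglongrightarrow> T (fst z)"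
      by (rule continuous_on_tendsto_compose[OF T_cont f(1) z]) (use p in auto)
    then have "snd z = T (fst z)" using f(2) p(2) LIMSEQ_unique by auto
    then show "z \<in> \<Gamma>" using z by (auto simp: \<Gamma>_def prod_eq_iff)
  qed
  moreover have c: "continuous_on (sphere m r) (\<lambda>l. T (f l))"
    by (rule continuous_on_compose2[OF T_cont f(1)]) (use f(2) in auto)
  ultimately have "cint m r (\<lambda>l. (f l, T (f l))) \<in> \<Gamma>"
    by (intro cint_in_closed_csubspace r continuous_intros f(1)) (use f(2) in \<open>auto simp: \<Gamma>_def\<close>)
  then show ?thesis by (auto simp: cint_Pair[OF r f(1) c] \<Gamma>_def)
qed

section \<open>Weighted contour integrals of the resolvent\<close>

text \<open>The weight \<open>w\<close> vanishes where the circle meets the spectrum, to an order that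
  compensates for the growth of the resolvent.\<close>

locale weighted_circle = closed_operator A for A :: "'a::chilbert_space operator" +
  fixes N :: "'a set" and m :: complex and r :: real and w :: "complex \<Rightarrow> complex"
  assumes N: "invariant N"
    and r: "r > 0"
    and w_rho: "l \<in> sphere m r \<Longrightarrow> w l \<noteq> 0 \<Longrightarrow> l \<in> rho N"
    and w_cball: "continuous_on (cball m r) w"
    and w_ball: "w holomorphic_on ball m r"
    and wR_continuous: "x \<in> N \<Longrightarrow> continuous_on (sphere m r) (\<lambda>l. w l *\<^sub>C R N l x)"
    and wR_bounded: "\<exists>K. \<forall>l\<in>sphere m r. \<forall>x\<in>N. norm (w l *\<^sub>C R N l x) \<le> K * norm x"
begin

text \<open>Formally this is minus the function \<open>h * w\<close> applied to the part of
  \<open>A\<close> inside the circle; the sign arises because \<open>R N l\<close> inverts A - l and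
  not l - A. The weight \<open>w\<close> is fixed, while \<open>h\<close> varies so that powers of
  \<open>l\<close> and Cauchy kernels can be inserted.\<close>

definition W :: "(complex \<Rightarrow> complex) \<Rightarrow> 'a \<Rightarrow> 'a"
  where "W h x = cint m r (\<lambda>l. h l *\<^sub>C w l *\<^sub>C R N l x)"

lemma sphere_subset: "sphere m r \<subseteq> cball m r"
  by auto

lemma w_sphere: "continuous_on (sphere m r) w"
  using continuous_on_subset[OF w_cball sphere_subset] .

lemma r_ge: "0 \<le> r"
  using r by simp

lemmas N_csubspace = invariantD(1)[OF N]
lemmas N_closed = invariantD(2)[OF N]

lemma integrand_continuous:
  "continuous_on (sphere m r) h \<Longrightarrow> x \<in> N \<Longrightarrow> continuous_on (sphere m r) (\<lambda>l. h l *\<^sub>C w l *\<^sub>C R N l x)"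
  by (intro continuous_intros wR_continuous)

lemma wR_in: "l \<in> sphere m r \<Longrightarrow> x \<in> N \<Longrightarrow> w l *\<^sub>C R N l x \<in> N"
  using w_rho[of l] R_in(1)[of l N x] complex_vector.subspace_scale[OF N_csubspace]
    complex_vector.subspace_0[OF N_csubspace] by (cases "w l = 0") auto

lemma W_in:
  assumes "continuous_on (sphere m r) h" "x \<in> N"
  shows "W h x \<in> N"
  unfolding W_def
  by (intro cint_in_closed_csubspace integrand_continuous assms r_ge N_csubspace N_closed
      complex_vector.subspace_scale[of _ "w _ *\<^sub>C R N _ x"] wR_in)

lemma W_add:
  assumes "continuous_on (sphere m r) h" "x \<in> N" "y \<in> N"
  shows "W h (x + y) = W h x + W h y"
proof -
  have "h l *\<^sub>C w l *\<^sub>C R N l (x + y) = h l *\<^sub>C w l *\<^sub>C R N l x + h l *\<^sub>C w l *\<^sub>C R N l y"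
    if "l \<in> sphere m r" for l
    using w_rho[OF that] assms R_add[OF _ assms(2,3) N_csubspace, of l]
    by (cases "w l = 0") (auto simp: scaleC_add_right)
  then have "W h (x + y) = cint m r (\<lambda>l. h l *\<^sub>C w l *\<^sub>C R N l x + h l *\<^sub>C w l *\<^sub>C R N l y)"
    unfolding W_def by (intro cint_cong r_ge)
  then show ?thesis
    unfolding W_def
    by (simp only: cint_add[OF r_ge integrand_continuous[OF assms(1,2)] integrand_continuous[OF assms(1,3)]])
qed

lemma W_scale:
  assumes "continuous_on (sphere m r) h" "x \<in> N"
  shows "W h (c *\<^sub>C x) = c *\<^sub>C W h x"
proof -
  have "h l *\<^sub>C w l *\<^sub>C R N l (c *\<^sub>C x) = c *\<^sub>C h l *\<^sub>C w l *\<^sub>C R N l x" if "l \<in> sphere m r" for l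
    using w_rho[OF that] assms R_scale[OF _ assms(2) N_csubspace, of l]
    by (cases "w l = 0") (auto simp: scaleC_scaleC mult_ac)
  then have "W h (c *\<^sub>C x) = cint m r (\<lambda>l. c *\<^sub>C h l *\<^sub>C w l *\<^sub>C R N l x)"
    unfolding W_def by (intro cint_cong r_ge)
  then show ?thesis
    unfolding W_def by (simp only: cint_scaleC_right[OF r_ge integrand_continuous[OF assms]])
qed

lemma W_diff:
  assumes "continuous_on (sphere m r) h" "x \<in> N" "y \<in> N"
  shows "W h (x - y) = W h x - W h y"
  using W_add[OF assms(1) complex_vector.subspace_diff[OF N_csubspace assms(2,3)] assms(3)] by simp

lemma W_bound:
  assumes "continuous_on (sphere m r) h"
  obtains K where "K > 0" "\<And>x. x \<in> N \<Longrightarrow> norm (W h x) \<le> K * norm x"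
proof -
  obtain K where K: "\<And>l x. l \<in> sphere m r \<Longrightarrow> x \<in> N \<Longrightarrow> norm (w l *\<^sub>C R N l x) \<le> K * norm x"
    using wR_bounded by blast
  have "compact (h ` sphere m r)" using compact_continuous_image[OF assms compact_sphere] .
  then obtain H where H: "H > 0" "\<And>l. l \<in> sphere m r \<Longrightarrow> cmod (h l) \<le> H"
    using bounded_pos compact_imp_bounded by (metis image_eqI)
  have "norm (W h x) \<le> (r * (H * (\<bar>K\<bar> + 1))) * norm x" if x: "x \<in> N" for x
  proof -
    have "norm (h l *\<^sub>C w l *\<^sub>C R N l x) \<le> H * ((\<bar>K\<bar> + 1) * norm x)" if l: "l \<in> sphere m r" for l
    proof -
      have "norm (w l *\<^sub>C R N l x) \<le> K * norm x" using K l x by blast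
      also have "\<dots> \<le> (\<bar>K\<bar> + 1) * norm x" by (intro mult_right_mono) auto
      finally show ?thesis
        unfolding norm_scaleC[of "h l"] using H(2)[OF l] H(1) by (intro mult_mono) auto
    qed
    then have "norm (W h x) \<le> r * (H * ((\<bar>K\<bar> + 1) * norm x))"
      unfolding W_def by (intro cint_norm_le r_ge integrand_continuous assms x)
    then show ?thesis by (simp add: mult.assoc)
  qed
  moreover have "r * (H * (\<bar>K\<bar> + 1)) > 0" using r H(1) by simp
  ultimately show ?thesis using that by blast
qed

lemma hw_continuous: "continuous_on (sphere m r) h \<Longrightarrow> continuous_on (sphere m r) (\<lambda>l. h l * w l)"
  by (intro continuous_intros w_sphere)

text \<open>The pairs (R x, x + l R x), multiplied by \<open>h l * w l\<close>, are points of the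
  closed graph of \<open>A\<close>, so their integral is one too. Where \<open>w\<close> vanishes
  the pair is zero.\<close>

lemma W_graph:
  assumes h: "continuous_on (sphere m r) h" and x: "x \<in> N"
  shows "(W h x, W (\<lambda>l. h l * l) x + cint m r (\<lambda>l. h l * w l) *\<^sub>C x) \<in> A"
proof -
  let ?f = "\<lambda>l. h l *\<^sub>C w l *\<^sub>C R N l x"
  let ?g = "\<lambda>l. (h l * l) *\<^sub>C w l *\<^sub>C R N l x"
  have hl: "continuous_on (sphere m r) (\<lambda>l. h l * l)" by (intro continuous_intros h)
  have c: "continuous_on (sphere m r) ?f" "continuous_on (sphere m r) ?g"
    "continuous_on (sphere m r) (\<lambda>l. (h l * w l) *\<^sub>C x)"
    by (intro integrand_continuous h hl x continuous_intros w_sphere)+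
  have "(?f l, ?g l + (h l * w l) *\<^sub>C x) \<in> A" if l: "l \<in> sphere m r" for l
  proof (cases "w l = 0")
    case False
    have "(R N l x, x + l *\<^sub>C R N l x) \<in> A" using w_rho[OF l False] R_in(2) x by blast
    then have "((h l * w l) *\<^sub>C R N l x, (h l * w l) *\<^sub>C (x + l *\<^sub>C R N l x)) \<in> A" by (rule A_scale)
    then show ?thesis by (simp add: scaleC_algebra mult_ac add.commute)
  qed simp
  then have "cint m r (\<lambda>l. (?f l, ?g l + (h l * w l) *\<^sub>C x)) \<in> A"
    by (intro cint_in_closed_csubspace r_ge A_csubspace A_closed continuous_intros c)
  also have "cint m r (\<lambda>l. (?f l, ?g l + (h l * w l) *\<^sub>C x))
      = (cint m r ?f, cint m r ?g + cint m r (\<lambda>l. (h l * w l) *\<^sub>C x))"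
    using c by (simp add: cint_Pair cint_add r_ge continuous_intros)
  also have "cint m r (\<lambda>l. (h l * w l) *\<^sub>C x) = cint m r (\<lambda>l. h l * w l) *\<^sub>C x"
    by (rule cint_scaleC_left[OF r_ge hw_continuous[OF h]])
  finally show ?thesis by (simp add: W_def)
qed

lemma W_intertwine_operator:
  assumes h: "continuous_on (sphere m r) h" and x: "(x, u) \<in> A" "x \<in> N"
  shows "W h u = W (\<lambda>l. h l * l) x + cint m r (\<lambda>l. h l * w l) *\<^sub>C x"
proof -
  have hl: "continuous_on (sphere m r) (\<lambda>l. h l * l)" by (intro continuous_intros h)
  have u: "u \<in> N" using invariantD(3)[OF N] x by blast
  have "h l *\<^sub>C w l *\<^sub>C R N l u = (h l * l) *\<^sub>C w l *\<^sub>C R N l x + (h l * w l) *\<^sub>C x"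
    if l: "l \<in> sphere m r" for l
  proof (cases "w l = 0")
    case False
    have *: "R N l (u - l *\<^sub>C x) = x" using w_rho[OF l False] R_eq x N_csubspace by blast
    have "R N l (u - l *\<^sub>C x) = R N l u - l *\<^sub>C R N l x"
      using w_rho[OF l False] x u N_csubspace by (simp add: R_diff R_scale complex_vector.subspace_scale)
    then have "R N l u = l *\<^sub>C R N l x + x" using * by (simp add: algebra_simps)
    then show ?thesis by (simp add: scaleC_algebra mult_ac)
  qed simp
  then have "W h u = cint m r (\<lambda>l. (h l * l) *\<^sub>C w l *\<^sub>C R N l x + (h l * w l) *\<^sub>C x)"
    unfolding W_def by (intro cint_cong r_ge)
  also have "\<dots> = W (\<lambda>l. h l * l) x + cint m r (\<lambda>l. (h l * w l) *\<^sub>C x)"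
    unfolding W_def
    by (intro cint_add r_ge integrand_continuous hl x continuous_intros h w_sphere)
  also have "cint m r (\<lambda>l. (h l * w l) *\<^sub>C x) = cint m r (\<lambda>l. h l * w l) *\<^sub>C x"
    by (rule cint_scaleC_left[OF r_ge hw_continuous[OF h]])
  finally show ?thesis .
qed

lemma W_commutes_A:
  assumes "continuous_on (sphere m r) h" "(x, u) \<in> A" "x \<in> N"
  shows "(W h x, W h u) \<in> A"
  using W_graph[OF assms(1,3)] W_intertwine_operator[OF assms] by simp

lemma W_commutes:
  assumes h: "continuous_on (sphere m r) h" and x: "x \<in> N"
    and T: "bounded_clinear T" "\<And>x. x \<in> N \<Longrightarrow> T x \<in> N" "commutes_with T A"
  shows "T (W h x) = W h (T x)"
proof -
  have "T (W h x) = cint m r (\<lambda>l. T (h l *\<^sub>C w l *\<^sub>C R N l x))"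
    unfolding W_def
    by (rule cint_linear[OF r_ge integrand_continuous[OF h x]]) (use bounded_clinearD[OF T(1)] in auto)
  also have "\<dots> = W h (T x)"
    unfolding W_def
  proof (intro cint_cong r_ge)
    fix l assume l: "l \<in> sphere m r"
    show "T (h l *\<^sub>C w l *\<^sub>C R N l x) = h l *\<^sub>C w l *\<^sub>C R N l (T x)"
    proof (cases "w l = 0")
      case False
      have "T (R N l x) = R N l (T x)"
        by (rule R_intertwine[OF w_rho[OF l False] w_rho[OF l False] x])
          (use T in \<open>auto simp: bounded_clinearD commutes_with_def\<close>)
      then show ?thesis using T(1) by (simp add: bounded_clinearD)
    qed (use T(1) in \<open>simp add: bounded_clinearD\<close>)
  qed
  finally show ?thesis .
qed

lemma W_R_commute:
  assumes h: "continuous_on (sphere m r) h" and l: "l \<in> rho N" and x: "x \<in> N"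
  shows "W h (R N l x) = R N l (W h x)"
proof -
  have "W h (x + l *\<^sub>C R N l x) = W h x + l *\<^sub>C W h (R N l x)"
    using W_add[OF h x] W_scale[OF h] R_in(1)[OF l x] complex_vector.subspace_scale[OF N_csubspace] by simp
  then show ?thesis
    by (intro R_intertwine[OF l l x]) (use W_in[OF h] W_commutes_A[OF h] in auto)
qed

lemma W_W_commute:
  assumes g: "continuous_on (sphere m r) g" and h: "continuous_on (sphere m r) h" and x: "x \<in> N"
  shows "W g (W h x) = W h (W g x)"
proof -
  obtain K where K: "\<And>x. x \<in> N \<Longrightarrow> norm (W g x) \<le> K * norm x" using W_bound[OF g] by metis
  have "W g (W h x) = cint m r (\<lambda>l. W g (h l *\<^sub>C w l *\<^sub>C R N l x))"
    unfolding W_def[of h]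
    by (rule cint_linear_on[OF r_ge N_csubspace N_closed integrand_continuous[OF h x] _ W_add[OF g] W_scale[OF g] K])
      (use wR_in x complex_vector.subspace_scale[OF N_csubspace] in blast)+
  also have "\<dots> = W h (W g x)"
    unfolding W_def[of h]
  proof (intro cint_cong r_ge)
    fix l assume l: "l \<in> sphere m r"
    show "W g (h l *\<^sub>C w l *\<^sub>C R N l x) = h l *\<^sub>C w l *\<^sub>C R N l (W g x)"
    proof (cases "w l = 0")
      case True
      then show ?thesis using W_scale[OF g, of 0 0] complex_vector.subspace_0[OF N_csubspace] by simp
    next
      case False
      have "W g (h l *\<^sub>C w l *\<^sub>C R N l x) = (h l * w l) *\<^sub>C W g (R N l x)"
        using W_scale[OF g R_in(1)[OF w_rho[OF l False] x], of "h l * w l"] by (simp add: scaleC_scaleC)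
      then show ?thesis using W_R_commute[OF g w_rho[OF l False] x] by (simp add: scaleC_scaleC)
    qed
  qed
  finally show ?thesis .
qed

section \<open>Cauchy kernels and eigenspaces of the weighted integral\<close>

lemma pole_continuous:
  "continuous_on (sphere m r) h \<Longrightarrow> k \<notin> sphere m r \<Longrightarrow> continuous_on (sphere m r) (\<lambda>l. h l / (l - k))"
  by (intro continuous_intros) auto

text \<open>With the kernel \<open>1 / (l - k)\<close> the integral behaves like a resolvent at
  \<open>k\<close>, up to a scalar multiple of \<open>x\<close>. Both parts rest on l / (l - k) = 1
  + k / (l - k).\<close>

lemma W_pole:
  assumes h: "continuous_on (sphere m r) h" and k: "k \<notin> sphere m r" and x: "x \<in> N"
  shows "(W (\<lambda>l. h l / (l - k)) x,
      W h x + cint m r (\<lambda>l. h l * w l / (l - k)) *\<^sub>C x + k *\<^sub>C W (\<lambda>l. h l / (l - k)) x) \<in> A"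
    and "(x, u) \<in> A \<Longrightarrow> W (\<lambda>l. h l / (l - k)) (u - k *\<^sub>C x)
      = W h x + cint m r (\<lambda>l. h l * w l / (l - k)) *\<^sub>C x"
proof -
  let ?h = "\<lambda>l. h l / (l - k)"
  note hk = pole_continuous[OF h k]
  have "(?h l * l) *\<^sub>C w l *\<^sub>C R N l x = h l *\<^sub>C w l *\<^sub>C R N l x + k *\<^sub>C ?h l *\<^sub>C w l *\<^sub>C R N l x"
    if "l \<in> sphere m r" for l
  proof -
    have "l - k \<noteq> 0" using that k by auto
    then have "?h l * l = h l + k * ?h l" by (simp add: field_simps)
    then show ?thesis by (simp only: scaleC_add_left scaleC_scaleC[symmetric])
  qed
  then have "W (\<lambda>l. ?h l * l) x = cint m r (\<lambda>l. h l *\<^sub>C w l *\<^sub>C R N l x + k *\<^sub>C ?h l *\<^sub>C w l *\<^sub>C R N l x)"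
    unfolding W_def by (intro cint_cong r_ge)
  also have "\<dots> = W h x + k *\<^sub>C W ?h x"
    unfolding W_def cint_scaleC_right[OF r_ge integrand_continuous[OF hk x], symmetric]
    by (intro cint_add r_ge integrand_continuous h x continuous_on_scaleC[OF continuous_on_const hk[THEN integrand_continuous]])
  finally have 1: "W (\<lambda>l. ?h l * l) x = W h x + k *\<^sub>C W ?h x" .
  have 2: "cint m r (\<lambda>l. ?h l * w l) = cint m r (\<lambda>l. h l * w l / (l - k))" by simp
  show "(W ?h x, W h x + cint m r (\<lambda>l. h l * w l / (l - k)) *\<^sub>C x + k *\<^sub>C W ?h x) \<in> A"
    using W_graph[OF hk x] unfolding 1 2 by (simp add: algebra_simps)
  assume u: "(x, u) \<in> A"
  have uN: "u \<in> N" using invariantD(3)[OF N] u x by blast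
  have "W ?h (u - k *\<^sub>C x) = W ?h u - k *\<^sub>C W ?h x"
    using W_diff[OF hk uN complex_vector.subspace_scale[OF N_csubspace x]] W_scale[OF hk x] by simp
  then show "W ?h (u - k *\<^sub>C x) = W h x + cint m r (\<lambda>l. h l * w l / (l - k)) *\<^sub>C x"
    using W_intertwine_operator[OF hk u x] unfolding 1 2 by (simp add: algebra_simps)
qed

lemma residue_inside: "k \<in> ball m r \<Longrightarrow> cint m r (\<lambda>l. 1 * w l / (l - k)) = w k"
  using cint_Cauchy_inside[OF w_cball w_ball] by simp

lemma residue_outside:
  assumes "continuous_on (cball m r) h" "h holomorphic_on ball m r" "k \<notin> cball m r"
  shows "cint m r (\<lambda>l. h l * w l / (l - k)) = 0"
  by (rule cint_Cauchy_outside[OF r_ge])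
    (use assms in \<open>auto intro!: continuous_intros holomorphic_intros w_cball w_ball\<close>)

lemma W_outside_graph:
  assumes "continuous_on (cball m r) h" "h holomorphic_on ball m r" "k \<notin> cball m r" "x \<in> N"
  shows "(W (\<lambda>l. h l / (l - k)) x, W h x + k *\<^sub>C W (\<lambda>l. h l / (l - k)) x) \<in> A"
  using W_pole(1)[OF continuous_on_subset[OF assms(1) sphere_subset] _ assms(4), of k]
    residue_outside[OF assms(1-3)] assms(3) by simp

lemma R_W_outside:
  assumes "continuous_on (cball m r) h" "h holomorphic_on ball m r" "k \<notin> cball m r" "x \<in> N"
    and "k \<in> rho N"
  shows "R N k (W h x) = W (\<lambda>l. h l / (l - k)) x"
  using assms(3,4) continuous_on_subset[OF assms(1) sphere_subset]
  by (intro R_eqI[OF assms(5) W_outside_graph[OF assms(1-4)]] W_in pole_continuous) auto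

text \<open>For weight 1 the operator \<open>- W (\<lambda>_. 1)\<close> is the Riesz projection of
  the disc, and this is the set of its fixed vectors.\<close>

definition fix_W :: "'a set"
  where "fix_W = {x \<in> N. W (\<lambda>_. 1) x = - x}"

lemma W_zero_right: "continuous_on (sphere m r) h \<Longrightarrow> W h 0 = 0"
  using W_scale[of h 0 0] complex_vector.subspace_0[OF N_csubspace] by simp

lemma W_sequentially:
  assumes h: "continuous_on (sphere m r) h" and x: "\<And>n. x n \<in> N" "x \<longlonglongrightarrow> y"
  shows "(\<lambda>n. W h (x n)) \<longlonglongrightarrow> W h y"
proof -
  obtain K where K: "K > 0" "\<And>x. x \<in> N \<Longrightarrow> norm (W h x) \<le> K * norm x" using W_bound[OF h] by metis
  have y: "y \<in> N" using closed_sequentially[OF N_closed x(1) x(2)] .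
  have "W h (x n) - W h y = W h (x n - y)" for n
    using W_add[OF h complex_vector.subspace_diff[OF N_csubspace x(1)[of n] y] y] by simp
  then have le: "norm (W h (x n) - W h y) \<le> K * norm (x n - y)" for n
    using K(2) x(1) y complex_vector.subspace_diff[OF N_csubspace] by metis
  moreover have "(\<lambda>n. K * norm (x n - y)) \<longlonglongrightarrow> 0"
    using x(2) by (auto intro!: tendsto_mult_right_zero tendsto_norm_zero simp: LIM_zero)
  ultimately have "(\<lambda>n. W h (x n) - W h y) \<longlonglongrightarrow> 0"
    by (intro Lim_null_comparison[OF always_eventually[OF allI[OF le]]])
  then show ?thesis by (rule LIM_zero_cancel)
qed

lemma eigenspace_W_invariant: "invariant {x \<in> N. W (\<lambda>_. 1) x = c *\<^sub>C x}"
proof -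
  let ?M = "{x \<in> N. W (\<lambda>_. 1) x = c *\<^sub>C x}"
  have h: "continuous_on (sphere m r) (\<lambda>_. 1::complex)" by simp
  have "csubspace ?M"
    unfolding complex_vector.subspace_def
    using W_add[OF h] W_scale[OF h] W_zero_right[OF h] N_csubspace
    by (auto simp: complex_vector.subspace_def scaleC_add_right scaleC_scaleC mult.commute)
  moreover have "closed ?M"
    unfolding closed_sequential_limits
  proof (intro allI impI)
    fix x y assume *: "(\<forall>n. x n \<in> ?M) \<and> x \<longlonglongrightarrow> y"
    then have y: "y \<in> N" using closed_sequentially[OF N_closed, of x y] by blast
    have "(\<lambda>n. W (\<lambda>_. 1) (x n)) \<longlonglongrightarrow> W (\<lambda>_. 1) y"
      by (rule W_sequentially[OF h]) (use * in auto)
    moreover have "(\<lambda>n. c *\<^sub>C x n) \<longlonglongrightarrow> c *\<^sub>C y" using * by (intro tendsto_intros) auto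
    moreover have "W (\<lambda>_. 1) (x n) = c *\<^sub>C x n" for n using * by auto
    ultimately have "W (\<lambda>_. 1) y = c *\<^sub>C y" using LIMSEQ_unique by auto
    then show "y \<in> ?M" using y by simp
  qed
  moreover have "u \<in> ?M" if "(x, u) \<in> A" "x \<in> ?M" for x u
  proof -
    have "(c *\<^sub>C x, W (\<lambda>_. 1) u) \<in> A" using W_commutes_A[OF h that(1)] that(2) by simp
    then have "W (\<lambda>_. 1) u = c *\<^sub>C u" using A_unique A_scale[OF that(1)] by blast
    then show ?thesis using that invariantD(3)[OF N] by simp
  qed
  ultimately show ?thesis by (simp add: invariant_def)
qed

lemma fix_W_invariant: "invariant fix_W"
  using eigenspace_W_invariant[of "-1"] by (simp add: fix_W_def)

lemma rho_eigenspace_W: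
  assumes "k \<in> rho N"
  shows "k \<in> rho {x \<in> N. W (\<lambda>_. 1) x = c *\<^sub>C x}"
  by (rule rho_subspace[OF assms eigenspace_W_invariant])
    (use assms R_in(1)[OF assms] R_scale[OF assms _ N_csubspace] in \<open>auto simp: W_R_commute\<close>)

lemma rho_fix_W: "k \<in> rho N \<Longrightarrow> k \<in> rho fix_W"
  using rho_eigenspace_W[of k "-1"] by (simp add: fix_W_def)

text \<open>On an eigenspace of \<open>W (\<lambda>_. 1)\<close> the two identities of \<open>W_pole\<close> say that
  \<open>W (\<lambda>l. 1 / (l - k))\<close> is a multiple of the resolvent.\<close>

lemma rho_eigenspace_pole:
  assumes k: "k \<notin> sphere m r" and nz: "c + cint m r (\<lambda>l. 1 * w l / (l - k)) \<noteq> 0"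
  shows "k \<in> rho {x \<in> N. W (\<lambda>_. 1) x = c *\<^sub>C x}" (is "k \<in> rho ?M")
proof -
  let ?d = "c + cint m r (\<lambda>l. 1 * w l / (l - k))"
  let ?h = "\<lambda>l. 1 / (l - k)"
  have h1: "continuous_on (sphere m r) (\<lambda>_. 1::complex)" by simp
  note hk = pole_continuous[OF h1 k]
  obtain K where K: "K > 0" "\<And>x. x \<in> N \<Longrightarrow> norm (W ?h x) \<le> K * norm x" using W_bound[OF hk] by metis
  have Mc: "csubspace ?M" using invariantD(1)[OF eigenspace_W_invariant] .
  show ?thesis
  proof (rule rhoI[OF eigenspace_W_invariant])
    fix y assume y: "y \<in> ?M"
    then have yN: "y \<in> N" by simp
    have "W (\<lambda>_. 1) (W ?h y) = c *\<^sub>C W ?h y"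
    proof -
      have "W (\<lambda>_. 1) (W ?h y) = W ?h (W (\<lambda>_. 1) y)" by (rule W_W_commute[OF h1 hk yN])
      then show ?thesis using W_scale[OF hk yN] y by simp
    qed
    then have "W ?h y \<in> ?M" using W_in[OF hk yN] by simp
    moreover have "(W ?h y, ?d *\<^sub>C y + k *\<^sub>C W ?h y) \<in> A"
      using W_pole(1)[OF h1 k yN] y by (simp add: scaleC_add_left)
    ultimately show "\<exists>x\<in>?M. (x, y + k *\<^sub>C x) \<in> A"
      using A_scale[of "W ?h y" "?d *\<^sub>C y + k *\<^sub>C W ?h y" "1 / ?d"] nz complex_vector.subspace_scale[OF Mc]
      by (intro bexI[of _ "(1 / ?d) *\<^sub>C W ?h y"]) (auto simp: scaleC_add_right scaleC_scaleC mult.commute)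
  next
    fix x u assume x: "(x, u) \<in> A" "x \<in> ?M"
    have "W ?h (u - k *\<^sub>C x) = ?d *\<^sub>C x"
      using W_pole(2)[OF h1 k _ x(1)] x(2) by (simp add: scaleC_add_left)
    moreover have "u - k *\<^sub>C x \<in> N"
      using invariantD(3)[OF N x(1)] x(2) N_csubspace complex_vector.subspace_diff complex_vector.subspace_scale
      by blast
    ultimately have "cmod ?d * norm x \<le> K * norm (u - k *\<^sub>C x)" using K(2) by (metis norm_scaleC)
    then show "norm x \<le> (K / cmod ?d) * norm (u - k *\<^sub>C x)" using nz by (simp add: field_simps)
  qed
qed

lemma W_add_weight:
  assumes "continuous_on (sphere m r) g" "continuous_on (sphere m r) h" "x \<in> N"
  shows "W (\<lambda>l. g l + h l) x = W g x + W h x"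
  unfolding W_def scaleC_add_left
  by (intro cint_add r_ge integrand_continuous assms)

lemma W_scale_weight:
  assumes "continuous_on (sphere m r) h" "x \<in> N"
  shows "W (\<lambda>l. c * h l) x = c *\<^sub>C W h x"
  unfolding W_def cint_scaleC_right[OF r_ge integrand_continuous[OF assms], symmetric]
  by (simp add: scaleC_scaleC mult.assoc)

text \<open>On an eigenvector the resolvent is multiplication by \<open>1 / (k - l)\<close>, so the
  integral becomes scalar. The continuity hypothesis admits \<open>k\<close> on the circle: the
  quotient has the value 0 at \<open>l = k\<close>, which fits a zero of \<open>w\<close> of order
  at least two.\<close>

lemma W_eigenvector:
  assumes x: "(x, k *\<^sub>C x) \<in> A" "x \<in> N" and c: "continuous_on (sphere m r) (\<lambda>l. w l / (l - k))"
  shows "W (\<lambda>_. 1) x = - (cint m r (\<lambda>l. w l / (l - k)) *\<^sub>C x)"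
proof -
  have "1 *\<^sub>C w l *\<^sub>C R N l x = - ((w l / (l - k)) *\<^sub>C x)" if l: "l \<in> sphere m r" for l
  proof (cases "w l = 0")
    case False
    have lr: "l \<in> rho N" using w_rho[OF l False] .
    have "R N l ((k - l) *\<^sub>C x) = x"
      using R_eq[OF lr x N_csubspace] by (simp add: scaleC_diff_left)
    then have *: "(k - l) *\<^sub>C R N l x = x" using R_scale[OF lr x(2) N_csubspace] by simp
    show ?thesis
    proof (cases "k = l")
      case True
      then have "x = 0" using * by simp
      then show ?thesis using R_scale[OF lr x(2) N_csubspace, of 0] by simp
    next
      case False
      have "- ((w l / (l - k)) *\<^sub>C x) = (w l / (k - l)) *\<^sub>C (k - l) *\<^sub>C R N l x"
        unfolding * using False by (simp add: minus_divide_right flip: scaleC_minus_left)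
      then show ?thesis using False by (simp add: scaleC_scaleC)
    qed
  qed simp
  then have "W (\<lambda>_. 1) x = cint m r (\<lambda>l. - ((w l / (l - k)) *\<^sub>C x))"
    unfolding W_def by (intro cint_cong r_ge)
  also have "\<dots> = - cint m r (\<lambda>l. (w l / (l - k)) *\<^sub>C x)"
    by (intro cint_minus r_ge continuous_intros c)
  also have "cint m r (\<lambda>l. (w l / (l - k)) *\<^sub>C x) = cint m r (\<lambda>l. w l / (l - k)) *\<^sub>C x"
    by (rule cint_scaleC_left[OF r_ge c])
  finally show ?thesis .
qed

end

section \<open>Circles centred on the real axis and the quartic weight\<close>

context closed_operator
begin

lemma weighted_circle_unit:
  assumes "invariant N" "r > 0" "sphere m r \<subseteq> rho N"
  shows "weighted_circle A N m r (\<lambda>_. 1)"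
proof unfold_locales
  show "continuous_on (sphere m r) (\<lambda>l. 1 *\<^sub>C R N l x)" if "x \<in> N" for x
    using continuous_on_subset[OF R_continuous[OF that invariantD(1)[OF assms(1)]] assms(3)] by simp
  show "\<exists>K. \<forall>l\<in>sphere m r. \<forall>x\<in>N. norm (1 *\<^sub>C R N l x) \<le> K * norm x"
    using R_compact_bound[OF compact_sphere assms(3) invariantD(1)[OF assms(1)]] by (metis scaleC_one)
qed (use assms in auto)

text \<open>Double zeros at the two real points of the circle. Simple zeros would merely bound the
  product with a resolvent of size \<open>K / |Im l|\<close>; double zeros make it tend to 0, so
  that the integrand is continuous. The weight is real on the real axis, which preserves symmetry
  with respect to the form.\<close>

definition q_weight :: "real \<Rightarrow> real \<Rightarrow> complex \<Rightarrow> complex"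
  where "q_weight m r l = ((l - of_real m)\<^sup>2 - of_real (r\<^sup>2))\<^sup>2"

text \<open>On the circle \<open>r\<^sup>2\<close> is l - m times its conjugate, so one factor l - m
  splits off and 2 i Im l remains.\<close>

lemma q_weight_sphere:
  assumes "l \<in> sphere (of_real m) r"
  shows "cmod (q_weight m r l) = 4 * r\<^sup>2 * (Im l)\<^sup>2"
proof -
  have r: "cmod (l - of_real m) = r" using assms by (simp add: dist_norm norm_minus_commute)
  have "of_real (r\<^sup>2) = (l - of_real m) * cnj (l - of_real m)"
    using r complex_norm_square[of "l - of_real m"] by simp
  then have "(l - of_real m)\<^sup>2 - of_real (r\<^sup>2) = (l - of_real m) * (2 * \<i> * of_real (Im l))"
    by (simp add: power2_eq_square algebra_simps complex_eq_iff)
  then have "cmod ((l - of_real m)\<^sup>2 - of_real (r\<^sup>2)) = r * (2 * \<bar>Im l\<bar>)"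
    using r by (simp add: norm_mult)
  then show ?thesis
    by (simp add: q_weight_def norm_power power_mult_distrib)
qed

lemma q_weight_eq: "q_weight m r l = (l - of_real (m - r))\<^sup>2 * (l - of_real (m + r))\<^sup>2"
  by (simp add: q_weight_def power2_eq_square algebra_simps)

lemma q_weight_R_bound:
  assumes "l \<in> sphere (of_real m) r" and "r \<ge> 0" and "K \<ge> 0"
    and "Im l \<noteq> 0 \<Longrightarrow> norm (R N l x) \<le> K / \<bar>Im l\<bar> * norm x"
  shows "norm (q_weight m r l *\<^sub>C R N l x) \<le> 4 * r\<^sup>2 * \<bar>Im l\<bar> * K * norm x"
proof (cases "Im l = 0")
  case False
  have "norm (q_weight m r l *\<^sub>C R N l x) \<le> 4 * r\<^sup>2 * (Im l)\<^sup>2 * (K / \<bar>Im l\<bar> * norm x)"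
    unfolding norm_scaleC q_weight_sphere[OF assms(1)] using assms(4)[OF False] by (intro mult_left_mono) auto
  also have "\<dots> = 4 * r\<^sup>2 * \<bar>Im l\<bar> * K * norm x"
    using False by (simp add: power2_eq_square abs_if)
  finally show ?thesis .
qed (use q_weight_sphere[OF assms(1)] in auto)

lemma weighted_circle_q:
  assumes N: "invariant N" and r: "r > 0" and K: "K \<ge> 0"
    and rho: "\<And>l. l \<in> sphere (of_real m) r \<Longrightarrow> Im l \<noteq> 0 \<Longrightarrow> l \<in> rho N"
    and bound: "\<And>l x. l \<in> sphere (of_real m) r \<Longrightarrow> Im l \<noteq> 0 \<Longrightarrow> x \<in> N \<Longrightarrow>
      norm (R N l x) \<le> K / \<bar>Im l\<bar> * norm x"
  shows "weighted_circle A N (of_real m) r (q_weight m r)"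
proof unfold_locales
  let ?S = "sphere (complex_of_real m) r"
  have le: "norm (q_weight m r l *\<^sub>C R N l x) \<le> 4 * r\<^sup>2 * \<bar>Im l\<bar> * K * norm x"
    if "l \<in> ?S" "x \<in> N" for l x
    using q_weight_R_bound[of l m r K N x] that r K bound by auto
  show "l \<in> rho N" if "l \<in> ?S" "q_weight m r l \<noteq> 0" for l
    using rho[OF that(1)] q_weight_sphere[OF that(1)] that(2) by (cases "Im l = 0") auto
  show "continuous_on (cball (of_real m) r) (q_weight m r)"
    unfolding q_weight_def by (intro continuous_intros)
  show "q_weight m r holomorphic_on ball (of_real m) r"
    unfolding q_weight_def by (intro holomorphic_intros)
  show "\<exists>K. \<forall>l\<in>?S. \<forall>x\<in>N. norm (q_weight m r l *\<^sub>C R N l x) \<le> K * norm x"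
  proof (intro exI ballI)
    fix l x assume *: "l \<in> ?S" "x \<in> N"
    have "\<bar>Im l\<bar> \<le> r" using abs_Im_le_cmod[of "l - of_real m"] *(1) by (simp add: dist_norm norm_minus_commute)
    then have "4 * r\<^sup>2 * \<bar>Im l\<bar> * K * norm x \<le> 4 * r\<^sup>2 * r * K * norm x"
      using r K by (intro mult_right_mono mult_left_mono) auto
    then show "norm (q_weight m r l *\<^sub>C R N l x) \<le> (4 * r\<^sup>2 * r * K) * norm x"
      using le[OF *] by linarith
  qed
  \<comment> \<open>At the two real points of the circle the estimate \<open>le\<close> forces the
    limit 0; at all other points the resolvent itself is continuous.\<close>
  show "continuous_on ?S (\<lambda>l. q_weight m r l *\<^sub>C R N l x)" if x: "x \<in> N" for x
    unfolding continuous_on_eq_continuous_within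
  proof
    fix l assume l: "l \<in> ?S"
    show "continuous (at l within ?S) (\<lambda>l. q_weight m r l *\<^sub>C R N l x)"
    proof (cases "Im l = 0")
      case True
      then have 0: "q_weight m r l = 0" using q_weight_sphere[OF l] by simp
      have "((\<lambda>k. 4 * r\<^sup>2 * \<bar>Im k\<bar> * K * norm x) \<longlongrightarrow> 4 * r\<^sup>2 * \<bar>Im l\<bar> * K * norm x) (at l within ?S)"
        by (intro tendsto_intros)
      then have lim: "((\<lambda>k. 4 * r\<^sup>2 * \<bar>Im k\<bar> * K * norm x) \<longlongrightarrow> 0) (at l within ?S)"
        using True by simp
      have "\<forall>\<^sub>F k in at l within ?S. norm (q_weight m r k *\<^sub>C R N k x) \<le> 4 * r\<^sup>2 * \<bar>Im k\<bar> * K * norm x"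
        unfolding eventually_at_filter by (rule always_eventually) (use le[OF _ x] in blast)
      then have "((\<lambda>k. q_weight m r k *\<^sub>C R N k x) \<longlongrightarrow> 0) (at l within ?S)"
        using lim by (rule Lim_null_comparison)
      then show ?thesis by (simp add: continuous_within 0)
    next
      case False
      let ?T = "?S \<inter> {k. Im k \<noteq> 0}"
      have "open {k. Im k \<noteq> 0}"
        by (rule open_Collect_neq) (intro continuous_intros)+
      have "continuous_on ?T (\<lambda>l. q_weight m r l *\<^sub>C R N l x)"
        unfolding q_weight_def
        by (intro continuous_intros continuous_on_subset[OF R_continuous[OF x invariantD(1)[OF N]]])
          (use rho in blast)
      then have "continuous (at l within ?T) (\<lambda>l. q_weight m r l *\<^sub>C R N l x)"
        using l False by (simp add: continuous_on_eq_continuous_within)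
      moreover have "at l within ?T = at l within ?S"
        by (rule at_within_nhd[of _ "{k. Im k \<noteq> 0}"]) (use False \<open>open {k. Im k \<noteq> 0}\<close> in auto)
      ultimately show ?thesis by simp
    qed
  qed
qed (use N r in auto)

section \<open>Products of circle integrals\<close>

lemma kernel_flip: "a / (l - k) * b * c = a / (k - l) * (- b * c)" for a b c k l :: complex
  by (metis minus_diff_eq minus_divide_right mult_minus_left mult_minus_right mult.assoc)

text \<open>For \<open>k\<close> on the second circle the resolvent turns \<open>W h x\<close> into
  the integral with kernel \<open>1 / (l - k)\<close>. After exchanging the integrals, the inner one
  is that of \<open>w' k / (k - l)\<close> with \<open>l\<close> outside the second disc, which
  vanishes by Cauchy's theorem.\<close>

lemma disjoint_circles:
  assumes "weighted_circle A N m r w" "weighted_circle A N m' r' w'"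
    and disj: "cball m r \<inter> cball m' r' = {}"
    and h: "continuous_on (cball m r) h" "h holomorphic_on ball m r" and x: "x \<in> N"
  shows "weighted_circle.W A N m' r' w' (\<lambda>_. 1) (weighted_circle.W A N m r w h x) = 0"
proof -
  interpret C: weighted_circle A N m r w by fact
  interpret D: weighted_circle A N m' r' w' by fact
  have hs: "continuous_on (sphere m r) h" using continuous_on_subset[OF h(1) C.sphere_subset] .
  let ?F = "\<lambda>k l. (w' k / (l - k) * h l) *\<^sub>C w l *\<^sub>C R N l x"
  have ne: "l \<noteq> k" if "l \<in> sphere m r" "k \<in> sphere m' r'" for l k
    using that disj C.sphere_subset D.sphere_subset by blast
  have pc: "continuous_on (sphere m r) (\<lambda>l. h l / (l - k))" if "k \<in> sphere m' r'" for k
    by (rule C.pole_continuous[OF hs]) (use that ne in blast)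
  have "D.W (\<lambda>_. 1) (C.W h x) = cint m' r' (\<lambda>k. cint m r (?F k))"
    unfolding D.W_def
  proof (intro cint_cong D.r_ge)
    fix k assume k: "k \<in> sphere m' r'"
    have kc: "k \<notin> cball m r" using k disj D.sphere_subset by blast
    have "1 *\<^sub>C w' k *\<^sub>C R N k (C.W h x) = w' k *\<^sub>C C.W (\<lambda>l. h l / (l - k)) x"
    proof (cases "w' k = 0")
      case False
      then show ?thesis using C.R_W_outside[OF h kc x D.w_rho[OF k False]] by simp
    qed simp
    also have "\<dots> = C.W (\<lambda>l. w' k * (h l / (l - k))) x"
      by (rule C.W_scale_weight[OF pc[OF k] x, symmetric])
    also have "\<dots> = cint m r (?F k)" unfolding C.W_def by (simp add: mult_ac)
    finally show "1 *\<^sub>C w' k *\<^sub>C R N k (C.W h x) = cint m r (?F k)" .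
  qed
  also have "\<dots> = cint m r (\<lambda>l. cint m' r' (\<lambda>k. ?F k l))"
  proof (rule cint_swap[OF D.r_ge C.r_ge])
    have 1: "continuous_on (sphere m' r' \<times> sphere m r) (\<lambda>p. w' (fst p))"
      by (rule continuous_on_compose2[OF D.w_sphere]) (auto intro: continuous_intros)
    have 2: "continuous_on (sphere m' r' \<times> sphere m r) (\<lambda>p. h (snd p))"
      by (rule continuous_on_compose2[OF hs]) (auto intro: continuous_intros)
    have 3: "continuous_on (sphere m' r' \<times> sphere m r) (\<lambda>p. w (snd p) *\<^sub>C R N (snd p) x)"
      by (rule continuous_on_compose2[OF C.wR_continuous[OF x]]) (auto intro: continuous_intros)
    show "continuous_on (sphere m' r' \<times> sphere m r) (\<lambda>(k, l). ?F k l)"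
      unfolding case_prod_beta using ne by (intro continuous_intros 1 2 3) auto
  qed
  also have "\<dots> = cint m r (\<lambda>l. 0)"
  proof (intro cint_cong C.r_ge)
    fix l assume l: "l \<in> sphere m r"
    have lc: "l \<notin> cball m' r'" using l disj C.sphere_subset by blast
    have wc: "continuous_on (sphere m' r') (\<lambda>k. w' k / (k - l))"
      by (rule D.pole_continuous[OF D.w_sphere]) (use lc D.sphere_subset in blast)
    have "cint m' r' (\<lambda>k. ?F k l) = cint m' r' (\<lambda>k. (w' k / (k - l)) *\<^sub>C (- h l) *\<^sub>C w l *\<^sub>C R N l x)"
      by (intro cint_cong D.r_ge) (simp only: scaleC_scaleC kernel_flip)
    also have "\<dots> = cint m' r' (\<lambda>k. w' k / (k - l)) *\<^sub>C (- h l) *\<^sub>C w l *\<^sub>C R N l x"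
      by (rule cint_scaleC_left[OF D.r_ge wc])
    also have "cint m' r' (\<lambda>k. w' k / (k - l)) = 0"
      by (rule cint_Cauchy_outside[OF D.r_ge D.w_cball D.w_ball lc])
    finally show "cint m' r' (\<lambda>k. ?F k l) = 0" by simp
  qed
  also have "\<dots> = 0" using cint_scaleC_right[OF C.r_ge, of m "\<lambda>_. 0" 0] by simp
  finally show ?thesis .
qed

text \<open>The Riesz integral over a larger circle reproduces \<open>- W h x\<close>; it may be taken in a smaller
  space in which the larger circle avoids the spectrum.\<close>

lemma Riesz_integral_W:
  assumes "weighted_circle A N m r w" "weighted_circle A M m' r' (\<lambda>_. 1)"
    and sub: "cball m r \<subseteq> ball m' r'" "M \<subseteq> N" "sphere m' r' \<subseteq> rho M"
    and h: "continuous_on (cball m r) h" "h holomorphic_on ball m r" and x: "x \<in> N"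
    and M: "weighted_circle.W A N m r w h x \<in> M"
      "\<And>k. k \<in> sphere m' r' \<Longrightarrow> weighted_circle.W A N m r w (\<lambda>l. h l / (l - k)) x \<in> M"
  shows "weighted_circle.W A M m' r' (\<lambda>_. 1) (\<lambda>_. 1) (weighted_circle.W A N m r w h x)
    = - weighted_circle.W A N m r w h x"
proof -
  interpret C: weighted_circle A N m r w by fact
  interpret D: weighted_circle A M m' r' "\<lambda>_. 1" by fact
  have hs: "continuous_on (sphere m r) h" using continuous_on_subset[OF h(1) C.sphere_subset] .
  let ?F = "\<lambda>k l. (1 / (l - k) * h l) *\<^sub>C w l *\<^sub>C R N l x"
  have kc: "k \<notin> cball m r" if k: "k \<in> sphere m' r'" for k using sub(1) k by auto
  then have ne: "l \<noteq> k" if "l \<in> sphere m r" "k \<in> sphere m' r'" for l k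
    using that C.sphere_subset by blast
  have "D.W (\<lambda>_. 1) (C.W h x) = cint m' r' (\<lambda>k. cint m r (?F k))"
    unfolding D.W_def
  proof (intro cint_cong D.r_ge)
    fix k assume k: "k \<in> sphere m' r'"
    have "R M k (C.W h x) = C.W (\<lambda>l. h l / (l - k)) x"
      using k sub(3) M by (intro R_eqI C.W_outside_graph[OF h kc[OF k] x]) auto
    then show "1 *\<^sub>C 1 *\<^sub>C R M k (C.W h x) = cint m r (?F k)"
      unfolding C.W_def by (simp add: mult_ac)
  qed
  also have "\<dots> = cint m r (\<lambda>l. cint m' r' (\<lambda>k. ?F k l))"
  proof (rule cint_swap[OF D.r_ge C.r_ge])
    have 2: "continuous_on (sphere m' r' \<times> sphere m r) (\<lambda>p. h (snd p))"
      by (rule continuous_on_compose2[OF hs]) (auto intro: continuous_intros)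
    have 3: "continuous_on (sphere m' r' \<times> sphere m r) (\<lambda>p. w (snd p) *\<^sub>C R N (snd p) x)"
      by (rule continuous_on_compose2[OF C.wR_continuous[OF x]]) (auto intro: continuous_intros)
    show "continuous_on (sphere m' r' \<times> sphere m r) (\<lambda>(k, l). ?F k l)"
      unfolding case_prod_beta using ne by (intro continuous_intros 2 3) auto
  qed
  also have "\<dots> = cint m r (\<lambda>l. - (h l *\<^sub>C w l *\<^sub>C R N l x))"
  proof (intro cint_cong C.r_ge)
    fix l assume l: "l \<in> sphere m r"
    have wc: "continuous_on (sphere m' r') (\<lambda>k. 1 / (k - l))"
      by (rule D.pole_continuous) (use l ne in auto)
    have "cint m' r' (\<lambda>k. ?F k l) = cint m' r' (\<lambda>k. (1 / (k - l)) *\<^sub>C (- h l) *\<^sub>C w l *\<^sub>C R N l x)"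
      by (intro cint_cong D.r_ge) (simp only: scaleC_scaleC kernel_flip)
    also have "\<dots> = cint m' r' (\<lambda>k. 1 / (k - l)) *\<^sub>C (- h l) *\<^sub>C w l *\<^sub>C R N l x"
      by (rule cint_scaleC_left[OF D.r_ge wc])
    also have "cint m' r' (\<lambda>k. 1 / (k - l)) = 1"
      using sub(1) l C.sphere_subset by (intro cint_Cauchy_inside[of _ _ "\<lambda>_. 1"]) auto
    finally show "cint m' r' (\<lambda>k. ?F k l) = - (h l *\<^sub>C w l *\<^sub>C R N l x)" by simp
  qed
  also have "\<dots> = - C.W h x"
    unfolding C.W_def by (rule cint_minus[OF C.r_ge C.integrand_continuous[OF hs x]])
  finally show ?thesis .
qed

text \<open>The resolvent is entire, so shrinking the circle gives
  \<open>W (\<lambda>_. 1) x = 0\<close>. Then \<open>W\<close> with kernel 1 / l produces a vector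
  \<open>?v\<close> that \<open>A\<close> maps to \<open>x\<close>. As \<open>A\<close> is bounded
  on \<open>N\<close>, the resolvent on a large circle is at most 2 / r, and thus
  \<open>norm ?v\<close> is at most \<open>2 / r * norm x\<close>. For the chosen radius
  \<open>x\<close> is therefore at most half its own size.\<close>

lemma Liouville:
  assumes N: "invariant N" and rho: "rho N = UNIV"
    and dom: "\<And>x u. (x, u) \<in> A \<Longrightarrow> x \<in> N \<Longrightarrow> norm u \<le> K * norm x" and x: "x \<in> N"
  shows "x = 0"
proof -
  have C: "weighted_circle A N 0 s (\<lambda>_. 1)" if "s > 0" for s
    using weighted_circle_unit[OF N that, of 0] rho by simp
  have Nc: "csubspace N" using invariantD(1)[OF N] .
  have Rc: "continuous_on UNIV (\<lambda>l. R N l x)" using R_continuous[OF x Nc] by (simp add: rho)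
  have Rh: "(\<lambda>l. cinner (R N l x) y) holomorphic_on UNIV" for y
    by (rule R_holomorphic[OF _ _ x Nc]) (simp_all add: rho)
  obtain B where B: "B > 0" "\<And>k y. k \<in> cball 0 1 \<Longrightarrow> y \<in> N \<Longrightarrow> norm (R N k y) \<le> B * norm y"
    using R_compact_bound[of "cball 0 1" N] Nc by (auto simp: rho)
  \<comment> \<open>Large enough for \<open>K <= r / 2\<close>, which bounds the resolvent on the
    circle by 2 / r, and for \<open>|K| * (2 / r) <= 1 / 2\<close> in the final estimate.\<close>
  define r where "r = 4 * \<bar>K\<bar> + 2"
  have r: "r > 0" by (simp add: r_def add_nonneg_pos)
  interpret C: weighted_circle A N 0 r "\<lambda>_. 1" by (rule C[OF r])
  have "norm (C.W (\<lambda>_. 1) x) \<le> s * (B * norm x)" if s: "0 < s" "s \<le> 1" for s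
  proof -
    have "s \<le> r" using s by (simp add: r_def)
    then have "cint 0 s (\<lambda>l. R N l x) = cint 0 r (\<lambda>l. R N l x)"
      using s by (intro cint_radius_independent[of _ _ _ UNIV] Rc Rh) auto
    moreover have "norm (cint 0 s (\<lambda>l. R N l x)) \<le> s * (B * norm x)"
      using s x by (intro cint_norm_le continuous_on_subset[OF Rc] B(2)) auto
    ultimately show ?thesis by (simp add: C.W_def)
  qed
  then have "norm (C.W (\<lambda>_. 1) x) \<le> 0 + e" if "e > 0" for e
  proof -
    define s where "s = min 1 (e / (B * norm x + 1))"
    have pos: "B * norm x + 1 > 0" using B(1) by (simp add: add_nonneg_pos)
    have s: "0 < s" "s \<le> 1" using that pos by (auto simp: s_def)
    have "s * (B * norm x) \<le> e / (B * norm x + 1) * (B * norm x + 1)"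
      using s that pos B(1) by (intro mult_mono) (auto simp: s_def)
    also have "\<dots> = e" using pos by simp
    finally show ?thesis using \<open>\<And>s. 0 < s \<Longrightarrow> s \<le> 1 \<Longrightarrow> norm (C.W (\<lambda>_. 1) x) \<le> s * (B * norm x)\<close>[OF s] by simp
  qed
  then have W0: "C.W (\<lambda>_. 1) x = 0" using field_le_epsilon[of "norm (C.W (\<lambda>_. 1) x)" 0] by simp
  let ?v = "C.W (\<lambda>l. 1 / (l - 0)) x"
  have "(?v, C.W (\<lambda>_. 1) x + cint 0 r (\<lambda>l. 1 * 1 / (l - 0)) *\<^sub>C x + 0 *\<^sub>C ?v) \<in> A"
    using r by (intro C.W_pole(1) x) auto
  moreover have "cint 0 r (\<lambda>l. 1 * 1 / (l - 0)) = 1"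
    using cint_Cauchy_inside[of 0 r "\<lambda>_. 1" 0] r by simp
  ultimately have v: "(?v, x) \<in> A" using W0 by simp
  have hc: "continuous_on (sphere 0 r) (\<lambda>l. 1 / (l - 0::complex))" using r by (intro continuous_intros) auto
  have vN: "?v \<in> N" by (rule C.W_in[OF hc x])
  have "norm ((1 / (l - 0)) *\<^sub>C 1 *\<^sub>C R N l x) \<le> 1 / r * (2 / r * norm x)" if l: "l \<in> sphere 0 r" for l
  proof -
    let ?y = "R N l x"
    have lr: "cmod l = r" using l by simp
    have y: "(?y, x + l *\<^sub>C ?y) \<in> A" "?y \<in> N" using R_in[of l N x] x rho by auto
    have "r * norm ?y = norm (l *\<^sub>C ?y)" by (simp add: norm_scaleC lr)
    also have "\<dots> \<le> norm (x + l *\<^sub>C ?y) + norm x" by (metis add_diff_cancel_left' norm_triangle_ineq4)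
    also have "\<dots> \<le> K * norm ?y + norm x" using dom[OF y] by simp
    also have "\<dots> \<le> r / 2 * norm ?y + norm x" by (intro add_right_mono mult_right_mono) (auto simp: r_def)
    finally have "norm ?y \<le> 2 / r * norm x" using r by (simp add: field_simps)
    then have "1 / r * norm ?y \<le> 1 / r * (2 / r * norm x)" using r by (intro mult_left_mono) auto
    then show ?thesis using r by (simp add: norm_scaleC lr norm_divide)
  qed
  then have "norm ?v \<le> r * (1 / r * (2 / r * norm x))"
    unfolding C.W_def[of "\<lambda>l. 1 / (l - 0)"] by (intro cint_norm_le C.r_ge C.integrand_continuous hc x)
  then have "norm ?v \<le> 2 / r * norm x" using r by simp
  then have "norm x \<le> \<bar>K\<bar> * (2 / r * norm x)"
    using dom[OF v vN] by (smt (verit) mult_left_mono mult_right_mono norm_ge_zero)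
  also have "\<dots> \<le> norm x / 2"
  proof -
    have "\<bar>K\<bar> * (2 / r) \<le> 1 / 2" using r by (simp add: r_def field_simps)
    then have "\<bar>K\<bar> * (2 / r) * norm x \<le> 1 / 2 * norm x" by (intro mult_right_mono) auto
    then show ?thesis by (simp add: mult.assoc)
  qed
  finally show "x = 0" by simp
qed

end

section \<open>Points of positive type\<close>

context G_symmetric_operator
begin

text \<open>Quantitative form of type \<open>\<pi>\<^sub>+\<close>, stable under small changes of the spectral parameter.
  Here \<open>M\<close> is a subspace of the graph of \<open>A\<close> that is closed in the graph norm.\<close>

definition robust :: "('a \<times> 'a) set \<Rightarrow> complex \<Rightarrow> bool"
  where "robust M t \<longleftrightarrow> csubspace M \<and> closed M \<and> M \<subseteq> A \<and> finite_codim A M \<and>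
    (\<exists>e>0. \<exists>d>0. \<exists>C>0. \<forall>l\<in>ball t e. \<forall>(x, u)\<in>M. d * (norm x)\<^sup>2 \<le> gq x + C * (norm (u - l *\<^sub>C x))\<^sup>2)"

text \<open>Moving the spectral parameter costs half of \<open>d\<close> and doubles
  \<open>C\<close>, by (a + b)^2 <= 2 a^2 + 2 b^2. As \<open>u\<close> is arbitrary, this serves for
  \<open>A\<close> and for its Cayley transform alike.\<close>

lemma perturb_ineq:
  assumes "d * (norm x)\<^sup>2 \<le> q + C * (norm (u - t *\<^sub>C x))\<^sup>2" "C > 0" "4 * C * (cmod (l - t))\<^sup>2 \<le> d"
  shows "d / 2 * (norm x)\<^sup>2 \<le> q + 2 * C * (norm (u - l *\<^sub>C (x::'b::complex_inner)))\<^sup>2"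
proof -
  have "u - t *\<^sub>C x = (u - l *\<^sub>C x) + (l - t) *\<^sub>C x" by (simp add: scaleC_diff_left)
  then have "norm (u - t *\<^sub>C x) \<le> norm (u - l *\<^sub>C x) + cmod (l - t) * norm x"
    by (metis norm_scaleC norm_triangle_ineq)
  then have "(norm (u - t *\<^sub>C x))\<^sup>2 \<le> (norm (u - l *\<^sub>C x) + cmod (l - t) * norm x)\<^sup>2"
    by (intro power_mono) auto
  also have "\<dots> \<le> 2 * (norm (u - l *\<^sub>C x))\<^sup>2 + 2 * (cmod (l - t) * norm x)\<^sup>2"
    using sum_squares_bound[of "norm (u - l *\<^sub>C x)" "cmod (l - t) * norm x"] by (simp add: power2_sum)
  finally have "C * (norm (u - t *\<^sub>C x))\<^sup>2 \<le> C * (2 * (norm (u - l *\<^sub>C x))\<^sup>2 + 2 * (cmod (l - t) * norm x)\<^sup>2)"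
    using assms(2) by (intro mult_left_mono) auto
  also have "\<dots> = 2 * C * (norm (u - l *\<^sub>C x))\<^sup>2 + (4 * C * (cmod (l - t))\<^sup>2) / 2 * (norm x)\<^sup>2"
    by (simp add: algebra_simps power_mult_distrib)
  also have "\<dots> \<le> 2 * C * (norm (u - l *\<^sub>C x))\<^sup>2 + d / 2 * (norm x)\<^sup>2"
    using assms(3) by (intro add_left_mono mult_right_mono) auto
  finally show ?thesis using assms(1) by (simp add: field_simps)
qed

lemma robustI:
  assumes M: "csubspace M" "closed M" "M \<subseteq> A" "finite_codim A M" and dC: "d > 0" "C > 0"
    and ineq: "\<And>x u. (x, u) \<in> M \<Longrightarrow> d * (norm x)\<^sup>2 \<le> gq x + C * (norm (u - t *\<^sub>C x))\<^sup>2"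
  shows "robust M t"
proof -
  define e where "e = sqrt (d / (4 * C))"
  have e: "e > 0" using dC by (simp add: e_def)
  have "d / 2 * (norm x)\<^sup>2 \<le> gq x + 2 * C * (norm (u - l *\<^sub>C x))\<^sup>2" if l: "l \<in> ball t e" and x: "(x, u) \<in> M" for l x u
  proof (rule perturb_ineq[OF ineq[OF x] dC(2)])
    have "(cmod (l - t))\<^sup>2 \<le> e\<^sup>2" using l by (intro power_mono) (auto simp: dist_norm norm_minus_commute)
    also have "e\<^sup>2 = d / (4 * C)" using dC by (simp add: e_def)
    finally show "4 * C * (cmod (l - t))\<^sup>2 \<le> d" using dC by (simp add: field_simps)
  qed
  then show ?thesis
    unfolding robust_def using M e dC
    by (intro conjI exI[of _ e] exI[of _ "d / 2"] exI[of _ "2 * C"]) auto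
qed

text \<open>If no \<open>e\<close> were suitable, counterexamples for \<open>1 / Suc n\<close>,
  normalised, would form an approximate eigensequence in \<open>M\<close> with limes inferior at
  most 0. This settles the vectors with small \<open>u - t x\<close>; for the others the term with
  \<open>C\<close> compensates for the form.\<close>

lemma positive_type_bound:
  assumes M: "csubspace M"
    and pos: "positive_type_on G A t M"
  obtains d C where "d > 0" "C > 0"
    "\<And>x u. (x, u) \<in> A \<Longrightarrow> x \<in> M \<Longrightarrow> d * (norm x)\<^sup>2 \<le> gq x + C * (norm (u - t *\<^sub>C x))\<^sup>2"
proof -
  obtain g where g: "g > 0" "\<And>x. \<bar>gq x\<bar> \<le> g * (norm x)\<^sup>2" using gq_bound by blast
  have "\<exists>e>0. \<forall>x u. (x, u) \<in> A \<longrightarrow> x \<in> M \<longrightarrow> norm (u - t *\<^sub>C x) \<le> e * norm x \<longrightarrow> e * (norm x)\<^sup>2 \<le> gq x"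
  proof (rule ccontr)
    assume neg: "\<not> ?thesis"
    have "\<exists>x u. (x, u) \<in> A \<and> x \<in> M \<and> norm x = 1 \<and> norm (u - t *\<^sub>C x) \<le> 1 / real (Suc n) \<and> gq x < 1 / real (Suc n)" for n
    proof -
      have "1 / real (Suc n) > 0" by simp
      then obtain x u where x: "(x, u) \<in> A" "x \<in> M" "norm (u - t *\<^sub>C x) \<le> 1 / real (Suc n) * norm x"
        "gq x < 1 / real (Suc n) * (norm x)\<^sup>2" using neg by (meson not_le)
      have nz: "norm x > 0" using x(4) by (cases "x = 0") auto
      let ?c = "1 / norm x"
      have "(?c *\<^sub>R x, ?c *\<^sub>R u) \<in> A" using A_scaleR[OF x(1)] .
      moreover have "?c *\<^sub>R x \<in> M" using subspace_scale[OF csubspace_imp_subspace[OF M] x(2)] .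
      moreover have "?c *\<^sub>R u - t *\<^sub>C ?c *\<^sub>R x = ?c *\<^sub>R (u - t *\<^sub>C x)"
        by (simp add: scaleC_of_real[symmetric] scaleC_algebra mult.commute)
      then have "norm (?c *\<^sub>R u - t *\<^sub>C ?c *\<^sub>R x) \<le> 1 / real (Suc n)"
        using x(3) nz by (simp add: divide_le_eq)
      moreover have "gq (?c *\<^sub>R x) < 1 / real (Suc n)"
        using x(4) nz by (simp add: gq_scaleR power_divide divide_less_eq)
      ultimately show ?thesis using nz by (intro exI[of _ "?c *\<^sub>R x"] exI[of _ "?c *\<^sub>R u"]) simp
    qed
    then obtain x u where xu: "\<And>n. (x n, u n) \<in> A" "\<And>n. x n \<in> M" "\<And>n. norm (x n) = 1"
      "\<And>n. norm (u n - t *\<^sub>C x n) \<le> 1 / real (Suc n)" "\<And>n. gq (x n) < 1 / real (Suc n)" by metis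
    have "(\<lambda>n. u n - t *\<^sub>C x n) \<longlonglongrightarrow> 0"
      by (rule Lim_null_comparison[OF always_eventually LIMSEQ_inverse_real_of_nat])
        (use xu(4) in \<open>simp add: inverse_eq_divide\<close>)
    then have "approx_eigenseq A t x" using xu by (auto simp: approx_eigenseq_def)
    then have "0 < liminf (\<lambda>n. ereal (gq (x n)))" using pos xu(2) by (simp add: positive_type_on_def)
    also have "liminf (\<lambda>n. ereal (gq (x n))) \<le> liminf (\<lambda>n. ereal (inverse (real (Suc n))))"
      by (intro Liminf_mono always_eventually) (use xu(5) in \<open>auto simp: inverse_eq_divide less_imp_le\<close>)
    also have "\<dots> = 0"
      by (intro lim_imp_Liminf) (use LIMSEQ_inverse_real_of_nat in \<open>auto simp: zero_ereal_def\<close>)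
    finally show False by simp
  qed
  then obtain e where e: "e > 0"
    "\<And>x u. (x, u) \<in> A \<Longrightarrow> x \<in> M \<Longrightarrow> norm (u - t *\<^sub>C x) \<le> e * norm x \<Longrightarrow> e * (norm x)\<^sup>2 \<le> gq x" by blast
  \<comment> \<open>If \<open>norm (u - t x) > e * norm x\<close>, the last term exceeds
    \<open>(e + g) * norm x ^ 2\<close>, which pays for the worst value of the form and for the
    left-hand side.\<close>
  have "e * (norm x)\<^sup>2 \<le> gq x + (e + g) / e\<^sup>2 * (norm (u - t *\<^sub>C x))\<^sup>2" if x: "(x, u) \<in> A" "x \<in> M" for x u
  proof (cases "norm (u - t *\<^sub>C x) \<le> e * norm x")
    case True
    have "0 \<le> (e + g) / e\<^sup>2 * (norm (u - t *\<^sub>C x))\<^sup>2" using e(1) g(1) by simp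
    then show ?thesis using e(2)[OF x True] by linarith
  next
    case False
    then have "(e * norm x)\<^sup>2 \<le> (norm (u - t *\<^sub>C x))\<^sup>2" using e(1) by (intro power_mono) auto
    then have "(e + g) / e\<^sup>2 * (e * norm x)\<^sup>2 \<le> (e + g) / e\<^sup>2 * (norm (u - t *\<^sub>C x))\<^sup>2"
      using e(1) g(1) by (intro mult_left_mono) auto
    moreover have "(e + g) / e\<^sup>2 * (e * norm x)\<^sup>2 = e * (norm x)\<^sup>2 + g * (norm x)\<^sup>2"
      using e(1) by (simp add: power_mult_distrib field_simps)
    ultimately show ?thesis using g(2)[of x] by linarith
  qed
  then show ?thesis using that[of e "(e + g) / e\<^sup>2"] e(1) g(1) by simp
qed

text \<open>The subspace in the definition of type \<pi>+ need not be closed. All terms of the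
  inequality are continuous in the graph norm, so one may pass to the closure inside the graph of
  \<open>A\<close>.\<close>

lemma positive_type_robust:
  assumes M: "csubspace M" "finite_codim UNIV M" and pos: "positive_type_on G A t M"
  shows "robust (closure {p \<in> A. fst p \<in> M}) t"
proof -
  let ?M = "{p \<in> A. fst p \<in> M}"
  obtain d C where dC: "d > 0" "C > 0"
    "\<And>x u. (x, u) \<in> A \<Longrightarrow> x \<in> M \<Longrightarrow> d * (norm x)\<^sup>2 \<le> gq x + C * (norm (u - t *\<^sub>C x))\<^sup>2"
    by (rule positive_type_bound[OF M(1) pos]) (rule that; assumption)
  have c: "csubspace ?M"
    unfolding complex_vector.subspace_def
    by (simp add: complex_vector.subspace_0[OF A_csubspace] complex_vector.subspace_0[OF M(1)]
        complex_vector.subspace_add[OF A_csubspace] complex_vector.subspace_add[OF M(1)]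
        complex_vector.subspace_scale[OF A_csubspace] complex_vector.subspace_scale[OF M(1)])
  have sub: "closure ?M \<subseteq> A" by (rule closure_minimal[OF _ A_closed]) auto
  have fc: "finite_codim A ?M"
    by (rule finite_codim_preimage[of _ UNIV]) (simp_all add: A_csubspace M)
  show ?thesis
  proof (rule robustI[OF csubspace_closure[OF c] closed_closure sub finite_codim_mono[OF fc closure_subset] dC(1,2)])
    fix x u assume "(x, u) \<in> closure ?M"
    then obtain p where p: "\<And>n. p n \<in> ?M" "p \<longlonglongrightarrow> (x, u)" unfolding closure_sequential by blast
    have f: "(\<lambda>n. fst (p n)) \<longlonglongrightarrow> x" "(\<lambda>n. snd (p n)) \<longlonglongrightarrow> u"
      using tendsto_fst[OF p(2)] tendsto_snd[OF p(2)] by auto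
    have "(\<lambda>n. gq (fst (p n)) + C * (norm (snd (p n) - t *\<^sub>C fst (p n)))\<^sup>2 - d * (norm (fst (p n)))\<^sup>2)
        \<longlonglongrightarrow> gq x + C * (norm (u - t *\<^sub>C x))\<^sup>2 - d * (norm x)\<^sup>2"
      by (intro tendsto_intros f)
    moreover have "0 \<le> gq (fst (p n)) + C * (norm (snd (p n) - t *\<^sub>C fst (p n)))\<^sup>2 - d * (norm (fst (p n)))\<^sup>2" for n
      using dC(3)[of "fst (p n)" "snd (p n)"] p(1)[of n] by simp
    ultimately show "d * (norm x)\<^sup>2 \<le> gq x + C * (norm (u - t *\<^sub>C x))\<^sup>2"
      using LIMSEQ_le_const[of _ "gq x + C * (norm (u - t *\<^sub>C x))\<^sup>2 - d * (norm x)\<^sup>2" 0] by auto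
  qed
qed

lemma positive_type_UNIV_robust: "positive_type_on G A t UNIV \<Longrightarrow> robust A t"
  using positive_type_robust[of UNIV t] finite_codim_refl[of UNIV] A_closed by (simp add: closure_closed)

lemma robust_point:
  assumes "robust A t"
  obtains e d C where "e > 0" "d > 0" "C > 0"
    "\<And>l x u. l \<in> ball t e \<Longrightarrow> (x, u) \<in> A \<Longrightarrow> d * (norm x)\<^sup>2 \<le> gq x + C * (norm (u - l *\<^sub>C x))\<^sup>2"
  using assms unfolding robust_def by fast

text \<open>For x = R y the symmetry of \<open>A\<close> gives Im l [x, x] = - Im [y, x]. If
  \<open>x\<close> were too large compared with \<open>y\<close>, both the form at \<open>x\<close>
  and y = (A - l) x would be too small for the positivity inequality. The constant \<open>K\<close>
  is chosen such that \<open>d * K = g + C + d\<close>.\<close>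

lemma resolvent_growth:
  assumes d: "d > 0" and C: "C > 0"
    and ineq: "\<And>x u. (x, u) \<in> A \<Longrightarrow> x \<in> N \<Longrightarrow> d * (norm x)\<^sup>2 \<le> gq x + C * (norm (u - l *\<^sub>C x))\<^sup>2"
    and g: "g > 0" "\<And>x y. cmod (gi x y) \<le> g * norm x * norm y"
    and l: "l \<in> rho N" "Im l \<noteq> 0" "\<bar>Im l\<bar> \<le> 1" and y: "y \<in> N"
  shows "norm (R N l y) \<le> ((g + C) / d + 1) / \<bar>Im l\<bar> * norm y"
proof (rule ccontr)
  let ?x = "R N l y" and ?h = "\<bar>Im l\<bar>"
  define K where "K = (g + C) / d + 1"
  assume "\<not> ?thesis"
  then have gt: "K / ?h * norm y < norm ?x" by (simp add: K_def)
  have x: "(?x, y + l *\<^sub>C ?x) \<in> A" "?x \<in> N" using R_in[OF l(1) y] by auto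
  have h: "?h > 0" using l(2) by simp
  have K: "K \<ge> 1" using g(1) C d by (simp add: K_def)
  have y_le: "norm y \<le> ?h / K * norm ?x" using gt h K by (simp add: field_simps)
  have xpos: "norm ?x > 0"
    using gt h K by (metis divide_nonneg_pos le_less_trans mult_nonneg_nonneg norm_ge_zero order_trans zero_le_one)
  have "gi (y + l *\<^sub>C ?x) ?x = gi ?x (y + l *\<^sub>C ?x)" using gi_A[OF x(1) x(1)] .
  then have "gi y ?x + l * gi ?x ?x = cnj (gi y ?x) + cnj l * gi ?x ?x"
    using gi_commute[of ?x y] by (simp add: gi_algebra)
  then have "Im (gi y ?x + l * complex_of_real (gq ?x)) = Im (cnj (gi y ?x) + cnj l * complex_of_real (gq ?x))"
    using gi_self[of ?x] by metis
  then have "Im l * gq ?x = - Im (gi y ?x)" by simp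
  then have "?h * \<bar>gq ?x\<bar> = \<bar>Im (gi y ?x)\<bar>" by (metis abs_minus_cancel abs_mult)
  also have "\<dots> \<le> g * norm y * norm ?x" using abs_Im_le_cmod g(2) order_trans by blast
  also have "\<dots> \<le> g * (?h / K * norm ?x) * norm ?x"
    using y_le g(1) by (intro mult_right_mono mult_left_mono) auto
  also have "\<dots> = ?h * (g / K * (norm ?x)\<^sup>2)"
    by (simp add: power2_eq_square)
  finally have "\<bar>gq ?x\<bar> \<le> g / K * (norm ?x)\<^sup>2"
    using h by (rule mult_left_le_imp_le)
  then have q: "gq ?x \<le> g / K * (norm ?x)\<^sup>2" by linarith
  have "norm y \<le> 1 / K * norm ?x"
    using y_le l(3) K by (smt (verit, best) divide_right_mono mult_right_mono norm_ge_zero)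
  then have "(norm y)\<^sup>2 \<le> (1 / K * norm ?x)\<^sup>2" by (intro power_mono) auto
  also have "\<dots> = 1 / K * (1 / K) * (norm ?x)\<^sup>2" by (simp add: power2_eq_square)
  also have "\<dots> \<le> 1 / K * 1 * (norm ?x)\<^sup>2" using K by (intro mult_right_mono mult_left_mono) auto
  finally have "C * (norm y)\<^sup>2 \<le> C / K * (norm ?x)\<^sup>2"
    using C mult_left_mono[of "(norm y)\<^sup>2" "1 / K * 1 * (norm ?x)\<^sup>2" C] by simp
  moreover have "d * (norm ?x)\<^sup>2 \<le> gq ?x + C * (norm y)\<^sup>2" using ineq[OF x] by simp
  ultimately have "d * (norm ?x)\<^sup>2 \<le> (g + C) / K * (norm ?x)\<^sup>2"
    using q by (simp add: add_divide_distrib algebra_simps)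
  moreover have "(g + C) / K < d"
  proof -
    have "d * K = g + C + d" using d by (simp add: K_def field_simps)
    then show ?thesis using K d by (simp add: divide_less_eq)
  qed
  moreover have "(norm ?x)\<^sup>2 > 0" using xpos by simp
  ultimately show False by (meson mult_right_le_imp_le not_le)
qed

section \<open>Isolated spectral points of positive type are eigenvalues\<close>

text \<open>The vectors \<open>c k x\<close> are Laurent coefficients of the resolvent at
  \<open>t\<close>, up to sign. The growth bound makes the singularity a pole, definiteness of the
  form on eigenvectors excludes Jordan chains, and the absence of eigenvectors in \<open>N\<close>
  removes the remaining simple pole. The residue then vanishes, which puts \<open>t\<close> into
  \<open>rho N\<close>.\<close>

lemma isolated_point_rho:
  assumes N: "invariant N" and e: "e > 0"
    and punct: "\<And>l. l \<in> ball (of_real t) e \<Longrightarrow> l \<noteq> of_real t \<Longrightarrow> l \<in> rho N"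
    and K: "K \<ge> 0" "\<And>l x. l \<in> ball (of_real t) e \<Longrightarrow> Im l \<noteq> 0 \<Longrightarrow> x \<in> N \<Longrightarrow>
      norm (R N l x) \<le> K / \<bar>Im l\<bar> * norm x"
    and definite: "\<And>x. (x, of_real t *\<^sub>C x) \<in> A \<Longrightarrow> gq x = 0 \<Longrightarrow> x = 0"
    and noeig: "\<And>x. (x, of_real t *\<^sub>C x) \<in> A \<Longrightarrow> x \<in> N \<Longrightarrow> x = 0"
  shows "of_real t \<in> rho N"
proof -
  let ?t = "complex_of_real t"
  let ?S = "ball ?t e - {?t}"
  have Nc: "csubspace N" using invariantD(1)[OF N] .
  have sphere_sub: "sphere ?t s \<subseteq> ?S" if "0 < s" "s < e" for s using that by auto
  have unit: "weighted_circle A N ?t s (\<lambda>_. 1)" if "0 < s" "s < e" for s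
    by (rule weighted_circle_unit[OF N that(1)]) (use sphere_sub[OF that] punct in blast)
  define r where "r = e / 2"
  have r: "0 < r" "r < e" using e by (auto simp: r_def)
  interpret C: weighted_circle A N ?t r "\<lambda>_. 1" by (rule unit[OF r])
  define c where "c k x = C.W (\<lambda>l. (l - ?t) ^ k) x" for k :: nat and x
  have hk: "continuous_on X (\<lambda>l. (l - ?t) ^ k)" for k X by (intro continuous_intros)
  have c_in: "c k x \<in> N" if "x \<in> N" for k x unfolding c_def by (rule C.W_in[OF hk that])
  have c_step: "(c k x, c (Suc k) x + ?t *\<^sub>C c k x) \<in> A" if x: "x \<in> N" for k x
  proof -
    have "C.W (\<lambda>l. (l - ?t) ^ k * l) x = C.W (\<lambda>l. (l - ?t) ^ Suc k + ?t * (l - ?t) ^ k) x"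
      by (rule arg_cong[of _ _ "\<lambda>h. C.W h x"]) (auto simp: algebra_simps)
    also have "\<dots> = c (Suc k) x + ?t *\<^sub>C c k x"
      unfolding c_def by (simp only: C.W_add_weight[OF hk continuous_on_mult[OF continuous_on_const hk] x]
          C.W_scale_weight[OF hk x])
    finally have "C.W (\<lambda>l. (l - ?t) ^ k * l) x = c (Suc k) x + ?t *\<^sub>C c k x" .
    moreover have "cint ?t r (\<lambda>l. (l - ?t) ^ k * 1) = 0"
      using r by (intro cint_Cauchy_0 continuous_intros holomorphic_intros) auto
    ultimately show ?thesis using C.W_graph[OF hk x, of k] unfolding c_def[symmetric] by simp
  qed
  have indep: "cint ?t s (\<lambda>l. (l - ?t) ^ k *\<^sub>C R N l x) = c k x" if s: "0 < s" "s \<le> r" and x: "x \<in> N" for s k x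
  proof -
    have Ssub: "?S \<subseteq> rho N" using punct by blast
    have "(\<lambda>l. cinner ((l - ?t) ^ k *\<^sub>C R N l x) y) holomorphic_on ?S" for y
      unfolding cinner_scaleC_left
      by (intro holomorphic_intros R_holomorphic[OF _ Ssub x Nc] open_delete open_ball)
    moreover have "continuous_on ?S (\<lambda>l. (l - ?t) ^ k *\<^sub>C R N l x)"
      by (intro continuous_intros continuous_on_subset[OF R_continuous[OF x Nc] Ssub])
    ultimately have "cint ?t s (\<lambda>l. (l - ?t) ^ k *\<^sub>C R N l x) = cint ?t r (\<lambda>l. (l - ?t) ^ k *\<^sub>C R N l x)"
      using s r by (intro cint_radius_independent[of _ _ _ ?S]) auto
    then show ?thesis by (simp add: c_def C.W_def)
  qed
  \<comment> \<open>The weight expands as (l - t)^4 - 2 s^2 (l - t)^2 + s^4. Its integral over the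
    circle of radius \<open>s\<close> is of order s^4 by the growth bound, so the coefficient
    \<open>c 4 x\<close>, which does not depend on \<open>s\<close>, is of order s^2.\<close>
  have c4: "c 4 x = 0" if x: "x \<in> N" for x
  proof -
    have bound: "norm (c 4 x) \<le> s\<^sup>2 * (4 * K * norm x + 2 * norm (c 2 x) + norm (c 0 x))"
      if s: "0 < s" "s \<le> r" "s \<le> 1" for s
    proof -
      have s': "s < e" using s r by simp
      interpret D: weighted_circle A N ?t s "\<lambda>_. 1" by (rule unit[OF s(1) s'])
      have D: "D.W (\<lambda>l. (l - ?t) ^ k) x = c k x" for k
        unfolding indep[OF s(1,2) x, symmetric] D.W_def by simp
      have "D.W (q_weight t s) x = D.W (\<lambda>l. (l - ?t) ^ 4 + (- 2 * of_real (s\<^sup>2) * (l - ?t) ^ 2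
          + (of_real (s\<^sup>2))\<^sup>2 * (l - ?t) ^ 0)) x"
        by (rule arg_cong[of _ _ "\<lambda>h. D.W h x"])
          (auto simp: q_weight_def power2_eq_square power4_eq_xxxx algebra_simps)
      also have "\<dots> = c 4 x + ((- 2 * of_real (s\<^sup>2)) *\<^sub>C c 2 x + (of_real (s\<^sup>2))\<^sup>2 *\<^sub>C c 0 x)"
        by (simp only: D.W_add_weight[OF hk continuous_on_add[OF continuous_on_mult[OF continuous_on_const hk]
              continuous_on_mult[OF continuous_on_const hk]] x]
            D.W_add_weight[OF continuous_on_mult[OF continuous_on_const hk] continuous_on_mult[OF continuous_on_const hk] x]
            D.W_scale_weight[OF hk x] D)
      finally have eq: "D.W (q_weight t s) x = c 4 x + ((- 2 * of_real (s\<^sup>2)) *\<^sub>C c 2 x + (of_real (s\<^sup>2))\<^sup>2 *\<^sub>C c 0 x)" .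
      have "norm (D.W (q_weight t s) x) \<le> s * (4 * s\<^sup>2 * s * K * norm x)"
        unfolding D.W_def
      proof (rule cint_norm_le[OF D.r_ge D.integrand_continuous[OF _ x]])
        show "continuous_on (sphere ?t s) (q_weight t s)" unfolding q_weight_def by (intro continuous_intros)
        fix l assume l: "l \<in> sphere ?t s"
        have lb: "l \<in> ball ?t e" using l s' by auto
        have "\<bar>Im l\<bar> \<le> s" using abs_Im_le_cmod[of "l - ?t"] l by (simp add: dist_norm norm_minus_commute)
        then have "4 * s\<^sup>2 * \<bar>Im l\<bar> * K * norm x \<le> 4 * s\<^sup>2 * s * K * norm x"
          using K(1) by (intro mult_right_mono mult_left_mono) auto
        then show "norm (q_weight t s l *\<^sub>C 1 *\<^sub>C R N l x) \<le> 4 * s\<^sup>2 * s * K * norm x"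
          using q_weight_R_bound[OF l D.r_ge K(1), of N x] K(2)[OF lb _ x] by simp
      qed
      moreover have "norm (c 4 x) \<le> norm (D.W (q_weight t s) x) + (2 * s\<^sup>2 * norm (c 2 x) + (s\<^sup>2)\<^sup>2 * norm (c 0 x))"
      proof -
        have "c 4 x = D.W (q_weight t s) x - ((- 2 * of_real (s\<^sup>2)) *\<^sub>C c 2 x + (of_real (s\<^sup>2))\<^sup>2 *\<^sub>C c 0 x)"
          using eq by simp
        then have "norm (c 4 x) \<le> norm (D.W (q_weight t s) x)
            + norm ((- 2 * complex_of_real (s\<^sup>2)) *\<^sub>C c 2 x + (complex_of_real (s\<^sup>2))\<^sup>2 *\<^sub>C c 0 x)"
          by (simp only: norm_triangle_ineq4)
        also have "norm ((- 2 * complex_of_real (s\<^sup>2)) *\<^sub>C c 2 x + (complex_of_real (s\<^sup>2))\<^sup>2 *\<^sub>C c 0 x)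
            \<le> norm ((- 2 * complex_of_real (s\<^sup>2)) *\<^sub>C c 2 x) + norm ((complex_of_real (s\<^sup>2))\<^sup>2 *\<^sub>C c 0 x)"
          by (rule norm_triangle_ineq)
        finally show ?thesis unfolding norm_scaleC by (simp add: norm_mult norm_power)
      qed
      moreover have "s * (4 * s\<^sup>2 * s * K * norm x) \<le> s\<^sup>2 * (4 * K * norm x)"
        using s K(1) mult_right_mono[of "s\<^sup>2 * s\<^sup>2" "s\<^sup>2 * 1" "4 * K * norm x"]
        by (simp add: power2_eq_square algebra_simps mult_le_one)
      moreover have "(s\<^sup>2)\<^sup>2 * norm (c 0 x) \<le> s\<^sup>2 * 1 * norm (c 0 x)"
        using s by (intro mult_right_mono) (auto simp: power2_eq_square mult_le_one)
      ultimately show ?thesis by (simp add: algebra_simps)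
    qed
    define Q where "Q = 4 * K * norm x + 2 * norm (c 2 x) + norm (c 0 x)"
    have Q: "Q \<ge> 0" using K(1) by (simp add: Q_def)
    have "((\<lambda>s. s\<^sup>2 * Q) \<longlongrightarrow> 0\<^sup>2 * Q) (at_right 0)" by (intro tendsto_intros)
    moreover have "eventually (\<lambda>s. norm (c 4 x) \<le> s\<^sup>2 * Q) (at_right 0)"
      using bound r(1) unfolding eventually_at_right_field Q_def by (intro exI[of _ "min r 1"]) auto
    ultimately have "norm (c 4 x) \<le> 0\<^sup>2 * Q"
      by (intro tendsto_lowerbound[of _ _ "at_right 0"]) auto
    then show ?thesis by simp
  qed
  \<comment> \<open>If the chain ends at \<open>c (Suc k) x\<close>, this is an eigenvector and also
    the image of \<open>c k x\<close> under A - t. Symmetry makes it neutral, hence zero.\<close>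
  have step: "c (Suc k) x = 0" if x: "x \<in> N" and k: "c (Suc (Suc k)) x = 0" for k x
  proof -
    have 1: "(c (Suc k) x, ?t *\<^sub>C c (Suc k) x) \<in> A" using c_step[OF x, of "Suc k"] k by simp
    have "gi (c (Suc k) x + ?t *\<^sub>C c k x) (c (Suc k) x) = gi (c k x) (?t *\<^sub>C c (Suc k) x)"
      by (rule gi_A[OF c_step[OF x] 1])
    then have "gi (c (Suc k) x) (c (Suc k) x) = 0" by (simp add: gi_algebra)
    then show ?thesis using definite[OF 1] by simp
  qed
  have "c 0 x = 0" if x: "x \<in> N" for x
  proof -
    have "c 3 x = 0" using step[OF x, of 2] c4[OF x] by (simp add: numeral_eq_Suc)
    then have "c 2 x = 0" using step[OF x, of 1] by (simp add: numeral_eq_Suc)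
    then have "c (Suc 0) x = 0" using step[OF x, of 0] by (simp add: numeral_eq_Suc)
    then have "(c 0 x, ?t *\<^sub>C c 0 x) \<in> A" using c_step[OF x, of 0] by simp
    then show ?thesis using noeig c_in[OF x] by blast
  qed
  then have "{x \<in> N. C.W (\<lambda>_. 1) x = 0 *\<^sub>C x} = N" by (auto simp: c_def)
  moreover have "cint ?t r (\<lambda>l. 1 * 1 / (l - ?t)) = 1"
    using r by (intro C.residue_inside) auto
  ultimately show ?thesis using C.rho_eigenspace_pole[of ?t 0] r by simp
qed

end

section \<open>Uniform positivity on bounded parts of the operator\<close>

lemma roots_of_unity_orthogonal:
  assumes "n < P" "m < P"
  shows "(\<Sum>k<P. cnj (cis (2 * pi * real k / real P)) ^ n * cis (2 * pi * real k / real P) ^ m)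
    = (if n = m then of_nat P else 0)"
proof -
  define \<zeta> where "\<zeta> = cis (2 * pi * (real m - real n) / real P)"
  have "cnj (cis (2 * pi * real k / real P)) ^ n * cis (2 * pi * real k / real P) ^ m = \<zeta> ^ k" for k
    by (simp add: \<zeta>_def cis_cnj Complex.DeMoivre cis_mult field_simps diff_divide_distrib)
  then have eq: "(\<Sum>k<P. cnj (cis (2 * pi * real k / real P)) ^ n * cis (2 * pi * real k / real P) ^ m)
      = (\<Sum>k<P. \<zeta> ^ k)" by simp
  show ?thesis
  proof (cases "n = m")
    case True
    then have "\<zeta> = 1" by (simp add: \<zeta>_def)
    then show ?thesis using eq True by simp
  next
    case False
    have P: "real P > 0" using assms by simp
    have "\<zeta> \<noteq> 1"
    proof
      assume "\<zeta> = 1"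
      then have "cos (2 * pi * (real m - real n) / real P) = 1" by (simp add: \<zeta>_def complex_eq_iff)
      then obtain j :: int where "2 * pi * (real m - real n) / real P = of_int j * 2 * pi"
        using cos_one_2pi_int by blast
      then have "2 * pi * (real m - real n) = 2 * pi * (of_int j * real P)" using P by (simp add: field_simps)
      then have "real m - real n = of_int j * real P" by simp
      then have "real_of_int (int m - int n) = real_of_int (j * int P)" by simp
      then have "int m - int n = j * int P" by (simp only: of_int_eq_iff)
      then have "int P dvd int m - int n" by simp
      moreover have "\<bar>int m - int n\<bar> < int P" using assms by linarith
      ultimately show False using False zdvd_imp_le[of "int P" "\<bar>int m - int n\<bar>"] by auto
    qed
    moreover have "\<zeta> ^ P = 1"
    proof -
      have "\<zeta> ^ P = cis (2 * pi * (real m - real n))" using P by (simp add: \<zeta>_def Complex.DeMoivre)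
      also have "\<dots> = 1"
        using cis_multiple_2pi[of "real m - real n"] by (simp add: Ints_diff)
      finally show ?thesis .
    qed
    ultimately have "(\<Sum>k<P. \<zeta> ^ k) = 0" by (simp add: geometric_sum)
    then show ?thesis using eq False by simp
  qed
qed

text \<open>An arbitrary sesquilinear \<open>h\<close>, so that the identity applies both to the
  inner product and to the indefinite form.\<close>

lemma Parseval_roots_of_unity:
  fixes h :: "'a::complex_vector \<Rightarrow> 'a \<Rightarrow> complex"
  assumes "\<And>f y. h (\<Sum>n<P. f n) y = (\<Sum>n<P. h (f n) y)" "\<And>f y. h y (\<Sum>n<P. f n) = (\<Sum>n<P. h y (f n))"
    and "\<And>c x y. h (c *\<^sub>C x) y = c * h x y" "\<And>c x y. h x (c *\<^sub>C y) = cnj c * h x y"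
  defines "y \<equiv> \<lambda>k v. \<Sum>n<P. cnj (cis (2 * pi * real k / real P)) ^ n *\<^sub>C v n"
  shows "(\<Sum>k<P. h (y k v) (y k v)) = of_nat P * (\<Sum>n<P. h (v n) (v n))"
proof -
  let ?w = "\<lambda>k. cis (2 * pi * real k / real P)"
  have "h (y k v) (y k v) = (\<Sum>n<P. \<Sum>m<P. cnj (?w k) ^ n * ?w k ^ m * h (v n) (v m))" for k
  proof -
    have yk: "y k v = (\<Sum>n<P. cnj (?w k) ^ n *\<^sub>C v n)" by (simp add: y_def)
    have "h (y k v) (y k v) = (\<Sum>n<P. cnj (?w k) ^ n * h (v n) (y k v))"
      by (subst yk) (simp only: assms(1,3))
    moreover have "h (v n) (y k v) = (\<Sum>m<P. ?w k ^ m * h (v n) (v m))" for n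
      unfolding yk by (simp only: assms(2,4) complex_cnj_power complex_cnj_cnj)
    ultimately show ?thesis by (simp only: sum_distrib_left mult.assoc)
  qed
  then have "(\<Sum>k<P. h (y k v) (y k v)) = (\<Sum>k<P. \<Sum>n<P. \<Sum>m<P. cnj (?w k) ^ n * ?w k ^ m * h (v n) (v m))"
    by simp
  also have "\<dots> = (\<Sum>n<P. \<Sum>m<P. \<Sum>k<P. cnj (?w k) ^ n * ?w k ^ m * h (v n) (v m))"
    by (subst sum.swap) (intro sum.cong refl sum.swap)
  also have "\<dots> = (\<Sum>n<P. \<Sum>m<P. (if n = m then of_nat P else 0) * h (v n) (v m))"
    unfolding sum_distrib_right[symmetric]
    by (intro sum.cong refl arg_cong2[of _ _ _ _ "(*)"] roots_of_unity_orthogonal) auto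
  also have "\<dots> = of_nat P * (\<Sum>n<P. h (v n) (v n))"
    by (simp add: sum_distrib_left if_distrib[of "\<lambda>c. c * _"] sum.delta cong: if_cong)
  finally show ?thesis .
qed

lemma cint_inverse_power:
  assumes "s > 0"
  shows "cint 0 s (\<lambda>z. 1 / z ^ Suc (Suc n)) = (0::complex)"
proof -
  have "((\<lambda>u. 1 / (u - 0) ^ Suc (Suc n)) has_contour_integral
      (2 * pi * \<i> / fact (Suc n) * (deriv ^^ Suc n) (\<lambda>_. 1) 0)) (circlepath 0 s)"
    using assms by (intro Cauchy_has_contour_integral_higher_derivative_circlepath) auto
  moreover have "(deriv ^^ Suc n) (\<lambda>_. 1) (0::complex) = 0" by (simp add: higher_deriv_const)
  ultimately show ?thesis by (simp add: cint_eq_contour_integral contour_integral_unique)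
qed

section \<open>The Cayley transform of a bounded part of the operator\<close>

locale bounded_part = G_symmetric_operator A G for A :: "'a::chilbert_space operator" and G +
  fixes L :: "'a set" and B :: real
  assumes L: "invariant L"
    and B: "B \<ge> 0"
    and bounded: "x \<in> L \<Longrightarrow> \<exists>u. (x, u) \<in> A \<and> norm u \<le> B * norm x"
    and nonreal: "Im l \<noteq> 0 \<Longrightarrow> l \<in> rho L"
begin

lemmas L_csubspace = invariantD(1)[OF L]
lemmas L_closed = invariantD(2)[OF L]

lemmas L_zero [simp] = complex_vector.subspace_0[OF L_csubspace]
lemmas L_add = complex_vector.subspace_add[OF L_csubspace]
lemmas L_diff = complex_vector.subspace_diff[OF L_csubspace]
lemmas L_scale = complex_vector.subspace_scale[OF L_csubspace]

definition T :: "'a \<Rightarrow> 'a"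
  where "T x = (SOME u. (x, u) \<in> A)"

lemma T: "x \<in> L \<Longrightarrow> (x, T x) \<in> A"
  unfolding T_def using bounded by (metis (mono_tags) someI_ex)

lemma T_in: "x \<in> L \<Longrightarrow> T x \<in> L"
  using T invariantD(3)[OF L] by blast

lemma T_bound: "x \<in> L \<Longrightarrow> norm (T x) \<le> B * norm x"
  using bounded[of x] A_unique[OF T] by metis

lemma T_eq: "x \<in> L \<Longrightarrow> (x, u) \<in> A \<Longrightarrow> T x = u"
  using A_unique[OF T] by blast

lemma T_add: "x \<in> L \<Longrightarrow> y \<in> L \<Longrightarrow> T (x + y) = T x + T y"
  by (rule T_eq[OF L_add A_add]) (auto intro: T)

lemma T_diff: "x \<in> L \<Longrightarrow> y \<in> L \<Longrightarrow> T (x - y) = T x - T y"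
  by (rule T_eq[OF L_diff A_diff]) (auto intro: T)

lemma T_scale: "x \<in> L \<Longrightarrow> T (c *\<^sub>C x) = c *\<^sub>C T x"
  by (rule T_eq[OF L_scale A_scale]) (auto intro: T)

text \<open>For \<open>c = \<i>\<close> and \<open>c = - \<i>\<close> these are the Cayley transform of \<open>T\<close> and its inverse.\<close>

definition cayley :: "complex \<Rightarrow> 'a \<Rightarrow> 'a"
  where "cayley c x = x - (2 * c) *\<^sub>C R L (- c) x"

lemma cayley_in: "Im c \<noteq> 0 \<Longrightarrow> x \<in> L \<Longrightarrow> cayley c x \<in> L"
  unfolding cayley_def by (intro L_diff L_scale R_in nonreal) auto

lemma cayley_add: "Im c \<noteq> 0 \<Longrightarrow> x \<in> L \<Longrightarrow> y \<in> L \<Longrightarrow> cayley c (x + y) = cayley c x + cayley c y"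
  by (simp add: cayley_def R_add nonreal L_csubspace scaleC_add_right)

lemma cayley_scale: "Im c \<noteq> 0 \<Longrightarrow> x \<in> L \<Longrightarrow> cayley c (d *\<^sub>C x) = d *\<^sub>C cayley c x"
  by (simp add: cayley_def R_scale nonreal L_csubspace scaleC_diff_right mult.commute)

lemma cayley_zero: "Im c \<noteq> 0 \<Longrightarrow> cayley c 0 = 0"
  using cayley_scale[of c 0 0] by simp

lemma cayley_sum:
  "Im c \<noteq> 0 \<Longrightarrow> (\<And>n. n < k \<Longrightarrow> v n \<in> L) \<Longrightarrow>
    (\<Sum>n<k. v n) \<in> L \<and> cayley c (\<Sum>n<k. v n) = (\<Sum>n<k::nat. cayley c (v n))"
  by (induction k) (auto simp: cayley_zero cayley_add L_add)

lemma cayley_inverse: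
  assumes c: "Im c \<noteq> 0" and x: "x \<in> L"
  shows "cayley (- c) (cayley c x) = x"
proof -
  have r: "- c \<in> rho L" "c \<in> rho L" using c by (auto intro: nonreal)
  let ?y = "R L (- c) x"
  have y: "?y \<in> L" using R_in(1)[OF r(1) x] .
  have "R L c (cayley c x) = R L c x - (2 * c) *\<^sub>C R L c ?y"
    unfolding cayley_def by (simp only: R_diff[OF r(2) x L_scale[OF y] L_csubspace] R_scale[OF r(2) y L_csubspace])
  also have "(2 * c) *\<^sub>C R L c ?y = R L c x - ?y"
    using resolvent_identity[OF r(2,1) x L_csubspace] by simp
  finally have "R L c (cayley c x) = ?y" by simp
  then show ?thesis by (simp add: cayley_def)
qed

text \<open>With respect to the form, the adjoint of \<open>cayley c\<close> is
  \<open>cayley (- c)\<close>, which is also its inverse.\<close>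

lemma cayley_isometry:
  assumes c: "c = \<i> \<or> c = - \<i>" and x: "x \<in> L" "y \<in> L"
  shows "gi (cayley c x) (cayley c y) = gi x y"
proof -
  have im: "Im c \<noteq> 0" "cnj c = - c" using c by auto
  have *: "gi (cayley c x) z = gi x (cayley (- c) z)" if "z \<in> L" for z
    using R_symmetric[of "- c" L x z] that x im
    by (simp add: cayley_def gi_algebra nonreal)
  show ?thesis using *[OF cayley_in[OF im(1) x(2)]] cayley_inverse[OF im(1) x(2)] by simp
qed

lemma cayley_eq_T:
  assumes "Im c \<noteq> 0" "x \<in> L"
  shows "x = T (R L (- c) x) + c *\<^sub>C R L (- c) x" "cayley c x = T (R L (- c) x) - c *\<^sub>C R L (- c) x"
proof -
  have r: "- c \<in> rho L" using assms by (auto intro: nonreal)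
  have eq: "T (R L (- c) x) = x - c *\<^sub>C R L (- c) x"
    using T_eq[OF R_in(1)[OF r assms(2)] R_in(2)[OF r assms(2)]] by simp
  show "x = T (R L (- c) x) + c *\<^sub>C R L (- c) x" unfolding eq by simp
  have "(2 * c) *\<^sub>C R L (- c) x = c *\<^sub>C R L (- c) x + c *\<^sub>C R L (- c) x"
    unfolding mult_2 by (rule scaleC_add_left)
  then show "cayley c x = T (R L (- c) x) - c *\<^sub>C R L (- c) x" unfolding eq cayley_def by simp
qed

text \<open>The sum of the Neumann series of \<open>z *\<^sub>C cayley c\<close>, which exists for \<open>|z| < 1\<close> because
  the Cayley transform has its spectrum on the unit circle.\<close>

definition neumann :: "complex \<Rightarrow> complex \<Rightarrow> 'a \<Rightarrow> 'a"
  where "neumann c z x =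
    (1 / (1 - z)) *\<^sub>C (x - (2 * c * z / (1 - z)) *\<^sub>C R L (- (c * ((1 + z) / (1 - z)))) x)"

text \<open>The Moebius map (1 + z) / (1 - z) sends the unit disc to the right half-plane, and
  multiplication by i or -i turns this into a half-plane of nonreal points.\<close>

lemma neumann_point:
  assumes c: "c = \<i> \<or> c = - \<i>" and z: "cmod z < 1"
  shows "Im (- (c * ((1 + z) / (1 - z)))) \<noteq> 0"
proof -
  have z1: "z \<noteq> 1" using z by auto
  have "Re ((1 + z) / (1 - z)) = (1 - (cmod z)\<^sup>2) / (cmod (1 - z))\<^sup>2"
    unfolding Re_divide cmod_power2 by (simp add: power2_eq_square algebra_simps)
  moreover have "(cmod z)\<^sup>2 < 1" using z by (simp add: power_less_one_iff)
  ultimately have "Re ((1 + z) / (1 - z)) > 0" using z1 by simp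
  moreover have "Im (- (c * w)) \<noteq> 0" if "Re w > 0" for w using c that by auto
  ultimately show ?thesis by blast
qed

text \<open>With U = (T - c) (T + c)^-1 one has 1 - z U = ((1 - z) T + c (1 + z)) (T + c)^-1.
  Inverting this and expressing T + c through T - l yields the formula of \<open>neumann\<close>.
  The lemma says that it is a left inverse of 1 - z U.\<close>

lemma neumann_step:
  assumes c: "c = \<i> \<or> c = - \<i>" and z: "cmod z < 1" and x: "x \<in> L"
  shows "neumann c z x = x + z *\<^sub>C neumann c z (cayley c x)"
proof -
  let ?l = "- (c * ((1 + z) / (1 - z)))"
  have z1: "1 - z \<noteq> 0" using z by auto
  have im: "Im c \<noteq> 0" using c by auto
  have r: "?l \<in> rho L" "- c \<in> rho L"
    using nonreal[OF neumann_point[OF c z]] im nonreal[of "- c"] by simp_all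
  let ?y = "R L (- c) x" and ?v = "R L ?l x"
  have y: "?y \<in> L" using R_in(1)[OF r(2) x] .
  have id: "?v - ?y = (?l + c) *\<^sub>C R L ?l ?y" using resolvent_identity[OF r x L_csubspace] by simp
  have lc: "(1 - z) * (?l + c) = - (2 * c * z)" using z1 by (simp add: field_simps)
  have "(2 * c * z) *\<^sub>C R L ?l ?y = - ((1 - z) *\<^sub>C (?v - ?y))"
    unfolding id scaleC_scaleC lc by simp
  moreover have "R L ?l (cayley c x) = ?v - (2 * c) *\<^sub>C R L ?l ?y"
    unfolding cayley_def by (simp only: R_diff[OF r(1) x L_scale[OF y] L_csubspace] R_scale[OF r(1) y L_csubspace])
  ultimately have "z *\<^sub>C R L ?l (cayley c x) = z *\<^sub>C ?v + (1 - z) *\<^sub>C (?v - ?y)"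
    by (simp add: scaleC_diff_right mult_ac)
  then have key: "z *\<^sub>C R L ?l (cayley c x) = ?v - (1 - z) *\<^sub>C ?y"
    by (simp add: scaleC_algebra)
  have "z *\<^sub>C neumann c z (cayley c x)
      = (1 / (1 - z)) *\<^sub>C (z *\<^sub>C cayley c x - (2 * c * z / (1 - z)) *\<^sub>C (z *\<^sub>C R L ?l (cayley c x)))"
    unfolding neumann_def by (simp add: scaleC_diff_right mult_ac)
  also have "\<dots> = (1 / (1 - z)) *\<^sub>C (z *\<^sub>C x - (2 * c * z / (1 - z)) *\<^sub>C ?v)"
  proof -
    have e1: "(2 * c * z / (1 - z)) *\<^sub>C (?v - (1 - z) *\<^sub>C ?y)
        = (2 * c * z / (1 - z)) *\<^sub>C ?v - (2 * c * z) *\<^sub>C ?y"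
      using z1 by (simp add: scaleC_diff_right)
    have e2: "z *\<^sub>C cayley c x = z *\<^sub>C x - (2 * c * z) *\<^sub>C ?y"
      by (simp add: cayley_def scaleC_diff_right mult_ac)
    show ?thesis unfolding key e1 e2 by simp
  qed
  finally have "x + z *\<^sub>C neumann c z (cayley c x)
      = (1 / (1 - z)) *\<^sub>C (1 - z) *\<^sub>C x + (1 / (1 - z)) *\<^sub>C (z *\<^sub>C x - (2 * c * z / (1 - z)) *\<^sub>C ?v)"
    using z1 by simp
  also have "\<dots> = neumann c z x"
    unfolding neumann_def scaleC_add_right[symmetric] by (simp add: scaleC_diff_left)
  finally show ?thesis ..
qed

lemma neumann_continuous:
  assumes c: "c = \<i> \<or> c = - \<i>" and x: "x \<in> L"
  shows "continuous_on (ball 0 1) (\<lambda>z. neumann c z x)"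
proof -
  have ne: "1 - z \<noteq> 0" if "z \<in> ball 0 1" for z :: complex using that by auto
  have "continuous_on (ball 0 1) (\<lambda>z. - (c * ((1 + z) / (1 - z))))"
    by (intro continuous_intros) (use ne in auto)
  moreover have "(\<lambda>z. - (c * ((1 + z) / (1 - z)))) ` ball 0 1 \<subseteq> rho L"
    using nonreal[OF neumann_point[OF c]] by (auto simp: dist_norm)
  ultimately have "continuous_on (ball 0 1) (\<lambda>z. R L (- (c * ((1 + z) / (1 - z)))) x)"
    using continuous_on_compose2[OF R_continuous[OF x L_csubspace]] by blast
  then show ?thesis
    unfolding neumann_def by (intro continuous_intros) (use ne in auto)
qed

lemma neumann_holomorphic:
  assumes c: "c = \<i> \<or> c = - \<i>" and x: "x \<in> L"
  shows "(\<lambda>z. cinner (neumann c z x) y) holomorphic_on ball 0 1"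
proof -
  have ne: "1 - z \<noteq> 0" if "z \<in> ball 0 1" for z :: complex using that by auto
  let ?S = "{l. Im l \<noteq> 0}"
  have "open ?S" by (rule open_Collect_neq) (intro continuous_intros)+
  then have "(\<lambda>l. cinner (R L l x) y) holomorphic_on ?S"
    by (rule R_holomorphic[OF _ _ x L_csubspace]) (auto intro: nonreal)
  moreover have "(\<lambda>z. - (c * ((1 + z) / (1 - z)))) holomorphic_on ball 0 1"
    by (intro holomorphic_intros) (use ne in auto)
  moreover have "(\<lambda>z. - (c * ((1 + z) / (1 - z)))) ` ball 0 1 \<subseteq> ?S"
    using neumann_point[OF c] by (simp add: image_subset_iff dist_norm)
  ultimately have "((\<lambda>l. cinner (R L l x) y) \<circ> (\<lambda>z. - (c * ((1 + z) / (1 - z))))) holomorphic_on ball 0 1"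
    using holomorphic_on_compose_gen by blast
  then have "(\<lambda>z. cinner (R L (- (c * ((1 + z) / (1 - z)))) x) y) holomorphic_on ball 0 1"
    by (simp add: o_def)
  then show ?thesis
    unfolding neumann_def cinner_scaleC_left cinner_diff_left by (intro holomorphic_intros) (use ne in auto)
qed

lemma neumann_bound:
  assumes c: "c = \<i> \<or> c = - \<i>" and s: "0 < s" "s < 1"
  obtains K where "K > 0" "\<And>z x. z \<in> sphere 0 s \<Longrightarrow> x \<in> L \<Longrightarrow> norm (neumann c z x) \<le> K * norm x"
proof -
  have ne: "1 - z \<noteq> 0" if "z \<in> sphere 0 s" for z :: complex using that s by auto
  have "compact ((\<lambda>z. - (c * ((1 + z) / (1 - z)))) ` sphere 0 s)"
    by (intro compact_continuous_image continuous_intros compact_sphere) (use ne in auto)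
  moreover have "(\<lambda>z. - (c * ((1 + z) / (1 - z)))) ` sphere 0 s \<subseteq> rho L"
    using nonreal[OF neumann_point[OF c]] s by (auto simp: dist_norm)
  ultimately obtain K where K: "K > 0"
    "\<And>k y. k \<in> (\<lambda>z. - (c * ((1 + z) / (1 - z)))) ` sphere 0 s \<Longrightarrow> y \<in> L \<Longrightarrow> norm (R L k y) \<le> K * norm y"
    using R_compact_bound L_csubspace by metis
  have "norm (neumann c z x) \<le> (1 / (1 - s) * (1 + 2 * s / (1 - s) * K)) * norm x"
    if z: "z \<in> sphere 0 s" and x: "x \<in> L" for z x
  proof -
    let ?v = "R L (- (c * ((1 + z) / (1 - z)))) x"
    have v: "norm ?v \<le> K * norm x" using K(2) z x by blast
    have zs: "cmod z = s" using z by simp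
    have c1: "cmod c = 1" using c by auto
    have le: "1 - s \<le> cmod (1 - z)" using norm_triangle_ineq2[of 1 z] zs by simp
    then have pos: "cmod (1 - z) > 0" using s by linarith
    have 1: "1 / cmod (1 - z) \<le> 1 / (1 - s)" using le pos s by (intro divide_left_mono mult_pos_pos) auto
    have "2 * s / cmod (1 - z) \<le> 2 * s / (1 - s)" using le pos s by (intro divide_left_mono mult_pos_pos) auto
    then have "2 * s / cmod (1 - z) * norm ?v \<le> 2 * s / (1 - s) * (K * norm x)"
      using v s K(1) by (intro mult_mono) auto
    moreover have "norm ((2 * c * z / (1 - z)) *\<^sub>C ?v) = 2 * s / cmod (1 - z) * norm ?v"
      by (simp add: norm_scaleC norm_mult norm_divide zs c1)
    ultimately have "norm (x - (2 * c * z / (1 - z)) *\<^sub>C ?v) \<le> norm x + 2 * s / (1 - s) * (K * norm x)"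
      using norm_triangle_ineq4[of x "(2 * c * z / (1 - z)) *\<^sub>C ?v"] by linarith
    then have "1 / cmod (1 - z) * norm (x - (2 * c * z / (1 - z)) *\<^sub>C ?v)
        \<le> 1 / (1 - s) * (norm x + 2 * s / (1 - s) * (K * norm x))"
      using 1 s by (intro mult_mono) auto
    moreover have "norm (neumann c z x) = 1 / cmod (1 - z) * norm (x - (2 * c * z / (1 - z)) *\<^sub>C ?v)"
      unfolding neumann_def norm_scaleC by (simp add: norm_divide)
    moreover have "1 / (1 - s) * (norm x + 2 * s / (1 - s) * (K * norm x))
        = (1 / (1 - s) * (1 + 2 * s / (1 - s) * K)) * norm x"
      by (simp add: distrib_left distrib_right)
    ultimately show ?thesis by (simp only:)
  qed
  moreover have "1 / (1 - s) * (1 + 2 * s / (1 - s) * K) > 0"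
    using s K(1) by (intro mult_pos_pos add_pos_pos divide_pos_pos) auto
  ultimately show ?thesis using that by blast
qed

lemma cayley_power_in: "Im c \<noteq> 0 \<Longrightarrow> x \<in> L \<Longrightarrow> (cayley c ^^ n) x \<in> L"
  by (induction n) (auto intro: cayley_in)

text \<open>The iterates of \<open>cayley c\<close> at \<open>x\<close> are the Taylor coefficients
  of \<open>neumann c z x\<close> in \<open>z\<close>; \<open>neumann_step\<close> gives the
  recursion. Cauchy's estimate on the circle of radius \<open>1 / s\<close> costs the factor
  \<open>s ^ n\<close>.\<close>

lemma cayley_power_bound:
  assumes c: "c = \<i> \<or> c = - \<i>" and s: "s > 1"
  obtains K where "K \<ge> 1" "\<And>n x. x \<in> L \<Longrightarrow> norm ((cayley c ^^ n) x) \<le> K * s ^ n * norm x"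
proof -
  define \<sigma> where "\<sigma> = 1 / s"
  have \<sigma>: "0 < \<sigma>" "\<sigma> < 1" using s by (auto simp: \<sigma>_def)
  have im: "Im c \<noteq> 0" using c by auto
  obtain K where K: "K > 0" "\<And>z x. z \<in> sphere 0 \<sigma> \<Longrightarrow> x \<in> L \<Longrightarrow> norm (neumann c z x) \<le> K * norm x"
    using neumann_bound[OF c \<sigma>] by metis
  have sub: "sphere 0 \<sigma> \<subseteq> ball (0::complex) 1" "cball 0 \<sigma> \<subseteq> ball (0::complex) 1" using \<sigma> by auto
  have nz: "z \<noteq> 0" if "z \<in> sphere 0 \<sigma>" for z :: complex using that \<sigma> by auto
  have cont: "continuous_on (sphere 0 \<sigma>) (\<lambda>z. neumann c z x)" if "x \<in> L" for x
    using continuous_on_subset[OF neumann_continuous[OF c that] sub(1)] .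
  have cont1: "continuous_on (sphere 0 \<sigma>) (\<lambda>z. (1 / z ^ Suc n) *\<^sub>C neumann c z x)" if "x \<in> L" for n x
    by (intro continuous_intros cont that) (use nz in auto)
  have cont2: "continuous_on (sphere 0 \<sigma>) (\<lambda>z::complex. 1 / z ^ Suc n)" for n
    by (intro continuous_intros) (use nz in auto)
  define a where "a n x = cint 0 \<sigma> (\<lambda>z. (1 / z ^ Suc n) *\<^sub>C neumann c z x)" for n x
  have zero: "cint 0 \<sigma> (\<lambda>z. neumann c z x) = 0" if x: "x \<in> L" for x
  proof (rule cinner_eq_zero_imp)
    fix y
    have "cinner (cint 0 \<sigma> (\<lambda>z. neumann c z x)) y = cint 0 \<sigma> (\<lambda>z. cinner (neumann c z x) y)"
      using \<sigma> by (intro cint_cinner cont x) auto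
    also have "\<dots> = 0"
      using \<sigma> sub(2)
      by (intro cint_Cauchy_0 holomorphic_on_subset[OF neumann_holomorphic[OF c x]]
          holomorphic_on_imp_continuous_on) auto
    finally show "cinner (cint 0 \<sigma> (\<lambda>z. neumann c z x)) y = 0" .
  qed
  have step: "(1 / z ^ Suc n) *\<^sub>C neumann c z x = (1 / z ^ Suc n) *\<^sub>C x + (1 / z ^ n) *\<^sub>C neumann c z (cayley c x)"
    if z: "z \<in> sphere 0 \<sigma>" and x: "x \<in> L" for z n x
    using neumann_step[OF c _ x, of z] z \<sigma> nz[OF z] by (simp add: scaleC_add_right)
  have a0: "a 0 x = x" if x: "x \<in> L" for x
  proof -
    have "a 0 x = cint 0 \<sigma> (\<lambda>z. (1 / z ^ Suc 0) *\<^sub>C x + neumann c z (cayley c x))"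
      unfolding a_def using step[OF _ x, of _ 0] \<sigma> by (intro cint_cong) auto
    also have "\<dots> = cint 0 \<sigma> (\<lambda>z. (1 / z ^ Suc 0) *\<^sub>C x) + cint 0 \<sigma> (\<lambda>z. neumann c z (cayley c x))"
      using \<sigma> by (intro cint_add continuous_on_scaleC cont2 continuous_on_const cont cayley_in im x) auto
    also have "\<dots> = cint 0 \<sigma> (\<lambda>z. 1 / z ^ Suc 0) *\<^sub>C x"
      using \<sigma> cint_scaleC_left[OF _ cont2[of 0], of x] zero[OF cayley_in[OF im x]] by simp
    also have "cint 0 \<sigma> (\<lambda>z. 1 / z ^ Suc 0) = (1::complex)"
      using cint_Cauchy_inside[of 0 \<sigma> "\<lambda>_. 1" 0] \<sigma> by simp
    finally show ?thesis by simp
  qed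
  have a_Suc: "a (Suc n) x = a n (cayley c x)" if x: "x \<in> L" for n x
  proof -
    have "a (Suc n) x = cint 0 \<sigma> (\<lambda>z. (1 / z ^ Suc (Suc n)) *\<^sub>C x + (1 / z ^ Suc n) *\<^sub>C neumann c z (cayley c x))"
      unfolding a_def using step[OF _ x, of _ "Suc n"] \<sigma> by (intro cint_cong) auto
    also have "\<dots> = cint 0 \<sigma> (\<lambda>z. (1 / z ^ Suc (Suc n)) *\<^sub>C x) + a n (cayley c x)"
      unfolding a_def
      using \<sigma> by (intro cint_add continuous_on_scaleC cont2 continuous_on_const cont1 cayley_in im x) auto
    also have "cint 0 \<sigma> (\<lambda>z. (1 / z ^ Suc (Suc n)) *\<^sub>C x) = 0"
      using \<sigma> cint_scaleC_left[OF _ cont2[of "Suc n"], of x] cint_inverse_power[OF \<sigma>(1), of n] by simp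
    finally show ?thesis by simp
  qed
  have power: "(cayley c ^^ n) x = a n x" if "x \<in> L" for n x
    using that
  proof (induction n arbitrary: x)
    case (Suc n)
    then show ?case using a_Suc cayley_in[OF im] by (simp add: funpow_Suc_right del: funpow.simps)
  qed (simp add: a0)
  have "norm ((cayley c ^^ n) x) \<le> (K + 1) * s ^ n * norm x" if x: "x \<in> L" for n x
  proof -
    have "norm (a n x) \<le> \<sigma> * (1 / \<sigma> ^ Suc n * (K * norm x))"
      unfolding a_def
    proof (rule cint_norm_le[OF _ cont1[OF x]])
      fix z :: complex assume z: "z \<in> sphere 0 \<sigma>"
      have "norm ((1 / z ^ Suc n) *\<^sub>C neumann c z x) = 1 / \<sigma> ^ Suc n * norm (neumann c z x)"
        using z by (simp add: norm_scaleC norm_divide norm_power norm_mult)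
      also have "\<dots> \<le> 1 / \<sigma> ^ Suc n * (K * norm x)" using K(2)[OF z x] \<sigma> by (intro mult_left_mono) auto
      finally show "norm ((1 / z ^ Suc n) *\<^sub>C neumann c z x) \<le> 1 / \<sigma> ^ Suc n * (K * norm x)" .
    qed (use \<sigma> in auto)
    also have "\<dots> = s ^ n * (K * norm x)" using s by (simp add: \<sigma>_def power_divide)
    also have "\<dots> = (s ^ n * norm x) * K" by (simp add: mult_ac)
    also have "\<dots> \<le> (s ^ n * norm x) * (K + 1)" using s by (intro mult_left_mono) auto
    finally show ?thesis using power[OF x] by (simp add: mult_ac)
  qed
  then show ?thesis using that[of "K + 1"] K(1) by simp
qed

section \<open>Positivity inequalities for the Cayley transform on the unit circle\<close>

lemma T_sequentially:
  assumes "\<And>n. x n \<in> L" "x \<longlonglongrightarrow> y" "y \<in> L"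
  shows "(\<lambda>n. T (x n)) \<longlonglongrightarrow> T y"
proof -
  have le: "norm (T (x n) - T y) \<le> B * norm (x n - y)" for n
    using T_bound[OF L_diff[OF assms(1)[of n] assms(3)]] T_diff[OF assms(1)[of n] assms(3)] by simp
  have "(\<lambda>n. B * norm (x n - y)) \<longlonglongrightarrow> 0"
    using assms(2) by (intro tendsto_mult_right_zero tendsto_norm_zero) (simp add: LIM_zero)
  then have "(\<lambda>n. T (x n) - T y) \<longlonglongrightarrow> 0"
    by (rule Lim_null_comparison[OF always_eventually[OF allI[OF le]]])
  then show ?thesis by (rule LIM_zero_cancel)
qed

lemma graph_preimage:
  assumes "csubspace M" "closed M" "M \<subseteq> A" "finite_codim A M"
  shows "csubspace {y \<in> L. (y, T y) \<in> M}" "closed {y \<in> L. (y, T y) \<in> M}"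
    "finite_codim L {y \<in> L. (y, T y) \<in> M}"
proof -
  show "csubspace {y \<in> L. (y, T y) \<in> M}"
    unfolding complex_vector.subspace_def
  proof (intro conjI allI ballI)
    show "0 \<in> {y \<in> L. (y, T y) \<in> M}"
      using T_scale[of 0 0] complex_vector.subspace_0[OF assms(1)] by (simp add: zero_prod_def)
    show "x + y \<in> {y \<in> L. (y, T y) \<in> M}"
      if "x \<in> {y \<in> L. (y, T y) \<in> M}" "y \<in> {y \<in> L. (y, T y) \<in> M}" for x y
      using that complex_vector.subspace_add[OF assms(1), of "(x, T x)" "(y, T y)"] L_add T_add by simp
    show "c *\<^sub>C x \<in> {y \<in> L. (y, T y) \<in> M}" if "x \<in> {y \<in> L. (y, T y) \<in> M}" for c x
      using that complex_vector.subspace_scale[OF assms(1), of "(x, T x)" c] L_scale T_scale by simp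
  qed
  show "closed {y \<in> L. (y, T y) \<in> M}"
    unfolding closed_sequential_limits
  proof (intro allI impI)
    fix x y assume *: "(\<forall>n. x n \<in> {y \<in> L. (y, T y) \<in> M}) \<and> x \<longlonglongrightarrow> y"
    then have x: "\<And>n. x n \<in> L" "\<And>n. (x n, T (x n)) \<in> M" "x \<longlonglongrightarrow> y" by auto
    have y: "y \<in> L" by (rule closed_sequentially[OF L_closed x(1,3)])
    have "(\<lambda>n. (x n, T (x n))) \<longlonglongrightarrow> (y, T y)"
      by (intro tendsto_Pair x(3) T_sequentially x(1) y)
    then have "(y, T y) \<in> M" by (rule closed_sequentially[OF assms(2) x(2)])
    then show "y \<in> {y \<in> L. (y, T y) \<in> M}" using y by simp
  qed
  show "finite_codim L {y \<in> L. (y, T y) \<in> M}"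
    by (rule finite_codim_preimage[OF L_csubspace A_csubspace assms(1) _ _ _ assms(4)])
      (simp_all add: T_add T_scale T)
qed

text \<open>The counterpart of \<open>robust\<close> for the Cayley transform. As the transform is
  bounded on \<open>L\<close>, the subspace of finite codimension can be taken in \<open>L\<close>
  instead of the graph.\<close>

definition inequality_at :: "real \<Rightarrow> real \<Rightarrow> 'a set \<Rightarrow> complex \<Rightarrow> bool"
  where "inequality_at d C V w \<longleftrightarrow> csubspace V \<and> closed V \<and> V \<subseteq> L \<and> finite_codim L V \<and>
    (\<forall>y\<in>V. d * (norm y)\<^sup>2 \<le> gq y + C * (norm (cayley \<i> y - w *\<^sub>C y))\<^sup>2)"

lemma inequality_at_bounded_below:
  assumes "\<And>y. y \<in> L \<Longrightarrow> norm y \<le> c * norm (cayley \<i> y - w *\<^sub>C y)"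
  shows "\<exists>C>0. inequality_at 1 C L w"
proof -
  obtain g where g: "g > 0" "\<And>x. \<bar>gq x\<bar> \<le> g * (norm x)\<^sup>2" using gq_bound by blast
  have "1 * (norm y)\<^sup>2 \<le> gq y + ((1 + g) * (c\<^sup>2 + 1)) * (norm (cayley \<i> y - w *\<^sub>C y))\<^sup>2" if y: "y \<in> L" for y
  proof -
    have "(norm y)\<^sup>2 \<le> (c * norm (cayley \<i> y - w *\<^sub>C y))\<^sup>2"
      using assms[OF y] by (intro power_mono) auto
    also have "\<dots> \<le> (c\<^sup>2 + 1) * (norm (cayley \<i> y - w *\<^sub>C y))\<^sup>2"
      by (simp add: power_mult_distrib algebra_simps)
    finally have "(1 + g) * (norm y)\<^sup>2 \<le> (1 + g) * ((c\<^sup>2 + 1) * (norm (cayley \<i> y - w *\<^sub>C y))\<^sup>2)"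
      using g(1) by (intro mult_left_mono) auto
    moreover have "(1 + g) * (norm y)\<^sup>2 = (norm y)\<^sup>2 + g * (norm y)\<^sup>2" by (simp add: algebra_simps)
    ultimately show ?thesis using g(2)[of y] unfolding mult.assoc by linarith
  qed
  moreover have "(1 + g) * (c\<^sup>2 + 1) > 0" using g(1) by (intro mult_pos_pos add_nonneg_pos) auto
  ultimately show ?thesis
    unfolding inequality_at_def using L_csubspace L_closed finite_codim_refl[OF L_csubspace] by blast
qed

text \<open>With v = (T + i)^-1 y and p = (T - l) v one has U y - w y = (1 - w) p and T y - l y = (T
  + i) p, and T + i is bounded by \<open>B + 1\<close>.\<close>

lemma cayley_transfer:
  assumes w: "w \<noteq> 1" and y: "y \<in> L"
  defines "l \<equiv> \<i> * (1 + w) / (1 - w)"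
  shows "norm (T y - l *\<^sub>C y) \<le> (B + 1) / cmod (1 - w) * norm (cayley \<i> y - w *\<^sub>C y)"
proof -
  let ?v = "R L (- \<i>) y"
  define p where "p = T ?v - l *\<^sub>C ?v"
  have v: "?v \<in> L" by (rule R_in(1)) (auto intro: nonreal y)
  have p: "p \<in> L" unfolding p_def by (intro L_diff L_scale T_in v)
  have y_eq: "y = T ?v + \<i> *\<^sub>C ?v" and c_eq: "cayley \<i> y = T ?v - \<i> *\<^sub>C ?v"
    using cayley_eq_T[of \<i> y] y by auto
  have "cayley \<i> y - w *\<^sub>C y = T ?v - \<i> *\<^sub>C ?v - w *\<^sub>C (T ?v + \<i> *\<^sub>C ?v)"
    using y_eq c_eq by metis
  also have "\<dots> = (1 - w) *\<^sub>C T ?v - (\<i> * (1 + w)) *\<^sub>C ?v"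
    by (simp add: scaleC_algebra algebra_simps)
  also have "\<dots> = (1 - w) *\<^sub>C p"
    using w by (simp add: p_def l_def scaleC_diff_right)
  finally have np: "norm (cayley \<i> y - w *\<^sub>C y) = cmod (1 - w) * norm p" by (simp add: norm_scaleC)
  have "T y - l *\<^sub>C y = T (T ?v + \<i> *\<^sub>C ?v) - l *\<^sub>C (T ?v + \<i> *\<^sub>C ?v)"
    using y_eq by metis
  also have "\<dots> = T p + \<i> *\<^sub>C p"
    unfolding p_def using v
    by (simp add: T_add T_diff T_scale T_in L_scale scaleC_algebra mult.commute)
  finally have "norm (T y - l *\<^sub>C y) \<le> norm (T p) + norm p"
    using norm_triangle_ineq[of "T p" "\<i> *\<^sub>C p"] by (simp add: norm_scaleC)
  also have "\<dots> \<le> (B + 1) * norm p" using T_bound[OF p] by (simp add: algebra_simps)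
  also have "(B + 1) * norm p = (B + 1) / cmod (1 - w) * (cmod (1 - w) * norm p)" using w by simp
  finally show ?thesis unfolding np .
qed

text \<open>A point w of the unit circle other than 1 corresponds to a real \<open>l\<close>, where
  either the resolvent or \<open>robust\<close> gives the inequality. The point 1 corresponds to
  infinity; there U - 1 is bounded below since \<open>T\<close> is bounded. The clause on
  \<open>V\<close> records that no codimension is lost when all \<open>M t\<close> are the whole
  graph.\<close>

lemma inequality_at_circle:
  assumes w: "cmod w = 1"
    and real: "\<And>t::real. of_real t \<in> rho L \<or> robust (M t) (of_real t)"
  shows "\<exists>d>0. \<exists>C>0. \<exists>V. inequality_at d C V w \<and> ((\<forall>t. M t = A) \<longrightarrow> V = L)"
proof (cases "w = 1")
  case True
  have "norm y \<le> (B + 1) / 2 * norm (cayley \<i> y - w *\<^sub>C y)" if y: "y \<in> L" for y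
  proof -
    let ?v = "R L (- \<i>) y"
    have v: "?v \<in> L" by (rule R_in(1)) (auto intro: nonreal y)
    have y_eq: "y = T ?v + \<i> *\<^sub>C ?v" using cayley_eq_T[of \<i> y] y by auto
    have "norm y \<le> norm (T ?v) + norm (\<i> *\<^sub>C ?v)" using norm_triangle_ineq[of "T ?v" "\<i> *\<^sub>C ?v"] y_eq by metis
    also have "\<dots> \<le> (B + 1) * norm ?v" using T_bound[OF v] by (simp add: norm_scaleC algebra_simps)
    also have "norm (cayley \<i> y - w *\<^sub>C y) = 2 * norm ?v"
      by (simp add: True cayley_def norm_scaleC norm_mult)
    ultimately show ?thesis by (simp add: cayley_def True norm_scaleC norm_mult)
  qed
  from inequality_at_bounded_below[OF this] show ?thesis by (intro exI[of _ 1]) auto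
next
  case False
  define l where "l = \<i> * (1 + w) / (1 - w)"
  have l_real: "l = of_real (Re l)"
  proof -
    have "cnj w * w = 1" using w complex_norm_square[of w] by (simp add: mult.commute)
    then have w0: "w \<noteq> 0" "cnj w = 1 / w" by (auto simp: eq_divide_eq)
    have "cnj l = - \<i> * (1 + 1 / w) / (1 - 1 / w)" by (simp add: l_def w0)
    also have "\<dots> = l" using w0 False by (simp add: l_def field_simps)
    finally show ?thesis by (metis Reals_cnj_iff complex_is_Real_iff complex_eqI Im_complex_of_real Re_complex_of_real)
  qed
  let ?c = "(B + 1) / cmod (1 - w)"
  have transfer: "norm (T y - l *\<^sub>C y) \<le> ?c * norm (cayley \<i> y - w *\<^sub>C y)" if "y \<in> L" for y
    using cayley_transfer[OF False that] by (simp add: l_def)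
  show ?thesis
  proof (cases "l \<in> rho L")
    case True
    obtain K where K: "K > 0" "\<And>y. y \<in> L \<Longrightarrow> norm (R L l y) \<le> K * norm y" using R_bound[OF True] by metis
    have "norm y \<le> (K * ?c) * norm (cayley \<i> y - w *\<^sub>C y)" if y: "y \<in> L" for y
    proof -
      have "norm y \<le> K * norm (T y - l *\<^sub>C y)"
        using K(2)[of "T y - l *\<^sub>C y"] R_eq[OF True T[OF y] y L_csubspace] L_diff L_scale T_in y by metis
      also have "\<dots> \<le> K * (?c * norm (cayley \<i> y - w *\<^sub>C y))"
        using transfer[OF y] K(1) by (intro mult_left_mono) auto
      finally show ?thesis by (simp add: mult.assoc)
    qed
    from inequality_at_bounded_below[OF this] show ?thesis by (intro exI[of _ 1]) auto
  next
    case nrho: False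
    let ?M = "M (Re l)"
    have "robust ?M l" using real[of "Re l"] nrho l_real by auto
    then obtain e d C where M: "csubspace ?M" "closed ?M" "?M \<subseteq> A" "finite_codim A ?M"
      and dC: "e > 0" "d > 0" "C > 0"
      and ineq: "\<forall>k\<in>ball l e. \<forall>(x, u)\<in>?M. d * (norm x)\<^sup>2 \<le> gq x + C * (norm (u - k *\<^sub>C x))\<^sup>2"
      unfolding robust_def by blast
    let ?V = "{y \<in> L. (y, T y) \<in> ?M}"
    have "d * (norm y)\<^sup>2 \<le> gq y + (C * (?c\<^sup>2 + 1)) * (norm (cayley \<i> y - w *\<^sub>C y))\<^sup>2" if y: "y \<in> ?V" for y
    proof -
      have "d * (norm y)\<^sup>2 \<le> gq y + C * (norm (T y - l *\<^sub>C y))\<^sup>2" using ineq dC(1) y by fastforce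
      moreover have "(norm (T y - l *\<^sub>C y))\<^sup>2 \<le> (?c * norm (cayley \<i> y - w *\<^sub>C y))\<^sup>2"
        using transfer y by (intro power_mono) auto
      moreover have "(?c * norm (cayley \<i> y - w *\<^sub>C y))\<^sup>2 \<le> (?c\<^sup>2 + 1) * (norm (cayley \<i> y - w *\<^sub>C y))\<^sup>2"
        unfolding power_mult_distrib by (intro mult_right_mono) auto
      ultimately have "C * (norm (T y - l *\<^sub>C y))\<^sup>2 \<le> C * ((?c\<^sup>2 + 1) * (norm (cayley \<i> y - w *\<^sub>C y))\<^sup>2)"
        using dC(3) by (intro mult_left_mono) linarith+
      then show ?thesis using \<open>d * (norm y)\<^sup>2 \<le> gq y + C * (norm (T y - l *\<^sub>C y))\<^sup>2\<close>
        unfolding mult.assoc by linarith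
    qed
    then have "inequality_at d (C * (?c\<^sup>2 + 1)) ?V w"
      unfolding inequality_at_def using graph_preimage[OF M] by auto
    moreover have "C * (?c\<^sup>2 + 1) > 0" using dC(3) by (intro mult_pos_pos add_nonneg_pos) auto
    moreover have "?V = L" if "\<forall>t. M t = A" using that T by auto
    ultimately show ?thesis using dC(2) by blast
  qed
qed

lemma inequality_at_weaken:
  assumes "inequality_at d C V w" "d' \<le> d" "C \<le> C'"
  shows "inequality_at d' C' V w"
proof -
  have "d' * (norm y)\<^sup>2 \<le> gq y + C' * (norm (cayley \<i> y - w *\<^sub>C y))\<^sup>2" if "y \<in> V" for y
  proof -
    have "d' * (norm y)\<^sup>2 \<le> d * (norm y)\<^sup>2" using assms(2) by (intro mult_right_mono) auto
    moreover have "C * (norm (cayley \<i> y - w *\<^sub>C y))\<^sup>2 \<le> C' * (norm (cayley \<i> y - w *\<^sub>C y))\<^sup>2"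
      using assms(3) by (intro mult_right_mono) auto
    ultimately show ?thesis using assms(1) that unfolding inequality_at_def by fastforce
  qed
  then show ?thesis using assms(1) by (auto simp: inequality_at_def)
qed

text \<open>Compactness of the circle: each inequality persists on a ball with half of
  \<open>d\<close> and twice \<open>C\<close>, and finitely many balls give common constants. The
  subspaces \<open>V w\<close> may still vary with the point.\<close>

lemma inequality_uniform:
  assumes real: "\<And>t::real. of_real t \<in> rho L \<or> robust (M t) (of_real t)"
  obtains d C V where "d > 0" "C > 0" "\<And>w. cmod w = 1 \<Longrightarrow> inequality_at d C (V w) w"
    "\<And>w. cmod w = 1 \<Longrightarrow> (\<forall>t. M t = A) \<Longrightarrow> V w = L"
proof -
  define Q where "Q d C k \<longleftrightarrow> (\<exists>V. inequality_at d C V k \<and> ((\<forall>t. M t = A) \<longrightarrow> V = L))" for d C k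
  have "\<exists>e d C. e > 0 \<and> d > 0 \<and> C > 0 \<and> (\<forall>k\<in>ball w e. Q d C k)"
    if w: "w \<in> sphere 0 1" for w
  proof -
    have "\<exists>d>0. \<exists>C>0. \<exists>V. inequality_at d C V w \<and> ((\<forall>t. M t = A) \<longrightarrow> V = L)"
      by (rule inequality_at_circle[OF _ real]) (use w in simp)
    then obtain d C V where V: "d > 0" "C > 0" "inequality_at d C V w" "(\<forall>t. M t = A) \<longrightarrow> V = L"
      by blast
    define e where "e = sqrt (d / (4 * C))"
    have e: "e > 0" using V by (simp add: e_def)
    have "inequality_at (d / 2) (2 * C) V k" if k: "k \<in> ball w e" for k
    proof -
      have "(cmod (k - w))\<^sup>2 \<le> e\<^sup>2" using k by (intro power_mono) (auto simp: dist_norm norm_minus_commute)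
      also have "e\<^sup>2 = d / (4 * C)" using V by (simp add: e_def)
      finally have "4 * C * (cmod (k - w))\<^sup>2 \<le> d" using V by (simp add: field_simps)
      then have "d / 2 * (norm y)\<^sup>2 \<le> gq y + 2 * C * (norm (cayley \<i> y - k *\<^sub>C y))\<^sup>2" if "y \<in> V" for y
        using V(3) that by (intro perturb_ineq[of _ _ _ _ _ w] V) (auto simp: inequality_at_def)
      then show ?thesis using V(3) by (auto simp: inequality_at_def)
    qed
    then have "\<forall>k\<in>ball w e. Q (d / 2) (2 * C) k" using V(4) unfolding Q_def by blast
    then show ?thesis using e V by (intro exI[of _ e] exI[of _ "d / 2"] exI[of _ "2 * C"]) auto
  qed
  then have "\<forall>w\<in>sphere 0 1. \<exists>e d C. e > 0 \<and> d > 0 \<and> C > 0 \<and> (\<forall>k\<in>ball w e. Q d C k)" by blast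
  then obtain e d C where *: "\<forall>w\<in>sphere 0 1. e w > 0 \<and> d w > 0 \<and> C w > 0 \<and> (\<forall>k\<in>ball w (e w). Q (d w) (C w) k)"
    by metis
  have "sphere (0::complex) 1 \<subseteq> (\<Union>w\<in>sphere 0 1. ball w (e w))"
    using * by (force simp del: mem_sphere)
  then obtain D where D: "D \<subseteq> sphere 0 1" "finite D" "sphere (0::complex) 1 \<subseteq> (\<Union>w\<in>D. ball w (e w))"
    using compactE_image[OF compact_sphere[of "0::complex" 1], of "sphere 0 1" "\<lambda>w. ball w (e w)"]
      open_ball by (metis (no_types, lifting))
  define d0 where "d0 = Min (insert 1 (d ` D))"
  define C0 where "C0 = Max (insert 1 (C ` D))"
  have d0: "d0 > 0" unfolding d0_def using D * by (subst Min_gr_iff) auto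
  have C0: "C0 \<ge> 1" unfolding C0_def using D(2) by auto
  have "Q d0 C0 k" if k: "cmod k = 1" for k
  proof -
    obtain w where w: "w \<in> D" "k \<in> ball w (e w)" using D(3) k by force
    have "Q (d w) (C w) k" using * w D(1) by blast
    moreover have "d0 \<le> d w" "C w \<le> C0" unfolding d0_def C0_def using D(2) w(1) by auto
    ultimately show ?thesis unfolding Q_def using inequality_at_weaken by blast
  qed
  then have "\<forall>k. \<exists>V. cmod k = 1 \<longrightarrow> inequality_at d0 C0 V k \<and> ((\<forall>t. M t = A) \<longrightarrow> V = L)"
    unfolding Q_def by blast
  then obtain V where "\<forall>k. cmod k = 1 \<longrightarrow> inequality_at d0 C0 (V k) k \<and> ((\<forall>t. M t = A) \<longrightarrow> V k = L)"
    by (rule choice[THEN exE])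
  then show ?thesis using that[of d0 C0 V] d0 C0 by auto
qed

lemma gi_sesquilinear_Parseval:
  "(\<Sum>k<P. gi (\<Sum>n<P. cnj (cis (2 * pi * real k / real P)) ^ n *\<^sub>C v n)
      (\<Sum>n<P. cnj (cis (2 * pi * real k / real P)) ^ n *\<^sub>C v n)) = of_nat P * (\<Sum>n<P. gi (v n) (v n))"
  by (rule Parseval_roots_of_unity) (simp_all add: gi_sum_left gi_sum_right gi_scale_left gi_scale_right)

lemma gq_Parseval:
  "(\<Sum>k<P. gq (\<Sum>n<P. cnj (cis (2 * pi * real k / real P)) ^ n *\<^sub>C v n)) = real P * (\<Sum>n<P. gq (v n))"
  using arg_cong[OF gi_sesquilinear_Parseval[of P v], of Re] by (simp add: Re_sum)

lemma norm_Parseval: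
  fixes v :: "nat \<Rightarrow> 'b::complex_inner"
  shows "(\<Sum>k<P. (norm (\<Sum>n<P. cnj (cis (2 * pi * real k / real P)) ^ n *\<^sub>C v n))\<^sup>2)
    = real P * (\<Sum>n<P. (norm (v n))\<^sup>2)"
proof -
  have "(\<Sum>k<P. cinner (\<Sum>n<P. cnj (cis (2 * pi * real k / real P)) ^ n *\<^sub>C v n)
      (\<Sum>n<P. cnj (cis (2 * pi * real k / real P)) ^ n *\<^sub>C v n)) = of_nat P * (\<Sum>n<P. cinner (v n) (v n))"
    by (rule Parseval_roots_of_unity)
      (simp_all add: cinner_sum_left cinner_sum_right cinner_scaleC_left cinner_scaleC_right)
  from arg_cong[OF this, of Re] show ?thesis by (simp add: Re_sum cinner_self)
qed

end

lemma finite_codim_INT: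
  assumes L: "csubspace L" and M: "\<And>k. k < (P::nat) \<Longrightarrow> csubspace (M k) \<and> M k \<subseteq> L \<and> finite_codim L (M k)"
  shows "csubspace (L \<inter> (\<Inter>k<P. M k)) \<and> finite_codim L (L \<inter> (\<Inter>k<P. M k))"
  using M
proof (induction P)
  case 0
  then show ?case using L finite_codim_refl by simp
next
  case (Suc P)
  have "L \<inter> (\<Inter>k<Suc P. M k) = (L \<inter> (\<Inter>k<P. M k)) \<inter> M P" by (auto simp: lessThan_Suc)
  moreover have "csubspace (L \<inter> (\<Inter>k<P. M k)) \<and> finite_codim L (L \<inter> (\<Inter>k<P. M k))" using Suc by simp
  ultimately show ?case
    using Suc.prems[of P] L
    by (auto intro!: finite_codim_Int complex_vector.subspace_inter)
qed

context bounded_part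
begin

text \<open>The tent-shaped weights \<open>\<phi>\<close> grow and decay at a rate \<open>s\<close> close to 1, so that the
  Fourier transform \<open>y\<close> of the weighted orbit \<open>\<phi> n *\<^sub>R cayley \<i> ^ n z\<close> is an
  approximate eigenvector of the Cayley transform in quadratic mean, while subexponential growth of
  the orbit makes the contribution of the end points negligible.\<close>

lemma uniform_positivity:
  assumes real: "\<And>t::real. of_real t \<in> rho L \<or> robust (M t) (of_real t)"
  shows "\<exists>V c. csubspace V \<and> closed V \<and> V \<subseteq> L \<and> finite_codim L V \<and> c > 0 \<and>
    (\<forall>x\<in>V. c * (norm x)\<^sup>2 \<le> gq x) \<and> ((\<forall>t. M t = A) \<longrightarrow> V = L)"
proof -
  obtain d C V where dC: "d > 0" "C > 0" and V: "\<And>w. cmod w = 1 \<Longrightarrow> inequality_at d C (V w) w"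
    "\<And>w. cmod w = 1 \<Longrightarrow> (\<forall>t. M t = A) \<Longrightarrow> V w = L"
    using inequality_uniform[OF real] by blast
  let ?W = "cayley \<i>"
  have im: "Im \<i> \<noteq> 0" "Im (- \<i>) \<noteq> 0" by auto
  \<comment> \<open>Chosen such that \<open>C * (s\<^sup>2 - 1)\<^sup>2 = d / 2\<close>, so that the
    error from the slopes of the tent uses up half of the left-hand side.\<close>
  define s where "s = sqrt (1 + sqrt (d / (2 * C)))"
  have s2: "s\<^sup>2 - 1 = sqrt (d / (2 * C))" using dC by (simp add: s_def)
  have s: "s > 1" using dC by (simp add: s_def)
  have s4: "C * (s\<^sup>2 - 1)\<^sup>2 = d / 2" using dC by (simp add: s2)
  obtain K1 where K1: "K1 \<ge> 1" "\<And>n x. x \<in> L \<Longrightarrow> norm ((cayley \<i> ^^ n) x) \<le> K1 * s ^ n * norm x"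
    using cayley_power_bound[of \<i> s] s by auto
  obtain K2 where K2: "K2 \<ge> 1" "\<And>n x. x \<in> L \<Longrightarrow> norm ((cayley (- \<i>) ^^ n) x) \<le> K2 * s ^ n * norm x"
    using cayley_power_bound[of "- \<i>" s] s by auto
  define K where "K = max K1 K2"
  have K: "K \<ge> 1" using K1(1) by (simp add: K_def)
  have up: "norm ((?W ^^ n) x) \<le> K * s ^ n * norm x" if "x \<in> L" for n x
  proof -
    have "K1 * s ^ n * norm x \<le> K * s ^ n * norm x"
      using s by (intro mult_right_mono) (auto simp: K_def)
    then show ?thesis using K1(2)[OF that, of n] by linarith
  qed
  have down: "norm x \<le> K * s ^ n * norm ((?W ^^ n) x)" if x: "x \<in> L" for n x
  proof -
    have "(cayley (- \<i>) ^^ n) ((?W ^^ n) x) = x"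
    proof (induction n)
      case (Suc n)
      have "(cayley (- \<i>) ^^ Suc n) ((?W ^^ Suc n) x)
          = (cayley (- \<i>) ^^ n) (cayley (- \<i>) (?W ((?W ^^ n) x)))"
        by (simp add: funpow_swap1)
      then show ?case using Suc cayley_inverse[OF im(1) cayley_power_in[OF im(1) x]] by simp
    qed simp
    then have "norm x \<le> K2 * s ^ n * norm ((?W ^^ n) x)"
      using K2(2)[OF cayley_power_in[OF im(1) x, of n], of n] by simp
    also have "\<dots> \<le> K * s ^ n * norm ((?W ^^ n) x)"
      using s by (intro mult_right_mono) (auto simp: K_def)
    finally show ?thesis .
  qed
  \<comment> \<open>\<open>C\<close> times the two end contributions is then at most
    \<open>d / 4\<close> times the squared norm at the peak of the tent, leaving
    \<open>d / 4\<close> for the conclusion.\<close>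
  obtain N where N: "C * (K\<^sup>2 * (1 + s\<^sup>2)) / s ^ (2 * N) \<le> d / 4"
  proof -
    have "(\<lambda>n. (1 / s) ^ n) \<longlonglongrightarrow> 0" using s by (intro LIMSEQ_realpow_zero) auto
    then have "(\<lambda>n. C * (K\<^sup>2 * (1 + s\<^sup>2)) * (1 / s) ^ n) \<longlonglongrightarrow> C * (K\<^sup>2 * (1 + s\<^sup>2)) * 0"
      by (intro tendsto_mult tendsto_const)
    then have "eventually (\<lambda>n. C * (K\<^sup>2 * (1 + s\<^sup>2)) * (1 / s) ^ n < d / 4) sequentially"
      using dC by (intro order_tendstoD(2)) auto
    then obtain n where n: "\<And>k. k \<ge> n \<Longrightarrow> C * (K\<^sup>2 * (1 + s\<^sup>2)) * (1 / s) ^ k < d / 4"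
      unfolding eventually_sequentially by blast
    show ?thesis using n[of "2 * n"] that[of n] by (simp add: power_divide)
  qed
  \<comment> \<open>The weight \<open>\<phi>\<close> lives on 0, ..., 2 N and its shift reaches 2 N
    + 1, so with this period there is no wrap-around.\<close>
  define P where "P = 2 * N + 2"
  define \<phi> :: "nat \<Rightarrow> real" where
    "\<phi> n = (if n \<le> N then s ^ (2 * n) / s ^ (2 * N) else if n \<le> 2 * N then s ^ (2 * N) / s ^ (2 * n) else 0)" for n
  \<comment> \<open>The coefficients left after the transform has shifted the weighted orbit by one
    place and the original has been subtracted. The case \<open>n = 0\<close> encodes that the
    weight is 0 before its start.\<close>
  define \<psi> where "\<psi> n = (if n = 0 then 0 else \<phi> (n - 1)) - \<phi> n" for n
  have \<phi>_pos: "\<phi> n \<ge> 0" for n using s by (simp add: \<phi>_def)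
  have \<phi>N: "\<phi> N = 1" using s by (simp add: \<phi>_def)
  have \<phi>0: "\<phi> 0 = 1 / s ^ (2 * N)" by (simp add: \<phi>_def)
  have \<phi>2N: "\<phi> (2 * N) = 1 / s ^ (2 * N)"
  proof (cases "N = 0")
    case False
    have "s ^ (2 * (2 * N)) = s ^ (2 * N) * s ^ (2 * N)" by (simp flip: power_add)
    then show ?thesis using s False by (simp add: \<phi>_def)
  qed (simp add: \<phi>_def)
  have \<psi>_mid: "(\<psi> n)\<^sup>2 \<le> (s\<^sup>2 - 1)\<^sup>2 * (\<phi> n)\<^sup>2" if n: "1 \<le> n" "n \<le> 2 * N" for n
  proof -
    have s21: "s\<^sup>2 > 1" using s by simp
    obtain k where k: "n = Suc k" using n(1) by (cases n) auto
    have "\<bar>\<psi> n\<bar> \<le> (s\<^sup>2 - 1) * \<phi> n"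
    proof (cases "n \<le> N")
      case True
      have "\<phi> n = s\<^sup>2 * \<phi> k" using True by (simp add: \<phi>_def k power2_eq_square)
      then have "\<psi> n = - ((s\<^sup>2 - 1) * \<phi> k)" by (simp add: \<psi>_def k algebra_simps)
      then have "\<bar>\<psi> n\<bar> = (s\<^sup>2 - 1) * \<phi> k" using s21 \<phi>_pos[of k] by (simp add: abs_mult)
      also have "\<dots> \<le> (s\<^sup>2 - 1) * \<phi> n"
        using s21 \<phi>_pos[of k] \<open>\<phi> n = s\<^sup>2 * \<phi> k\<close> mult_right_mono[of 1 "s\<^sup>2" "\<phi> k"] by (intro mult_left_mono) auto
      finally show ?thesis .
    next
      case False
      have "\<phi> k = s\<^sup>2 * \<phi> n"
      proof (cases "k = N")
        case True
        then show ?thesis using False n s by (simp add: \<phi>_def k power2_eq_square)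
      next
        case kN: False
        then show ?thesis using False n s by (simp add: \<phi>_def k power2_eq_square)
      qed
      then have "\<psi> n = (s\<^sup>2 - 1) * \<phi> n" by (simp add: \<psi>_def k algebra_simps)
      then show ?thesis using s21 \<phi>_pos[of n] by (simp add: abs_mult)
    qed
    then have "\<bar>\<psi> n\<bar>\<^sup>2 \<le> ((s\<^sup>2 - 1) * \<phi> n)\<^sup>2" by (intro power_mono) auto
    then show ?thesis by (simp add: power_mult_distrib)
  qed
  define \<omega> where "\<omega> k = cis (2 * pi * real k / real P)" for k
  have \<omega>1: "cmod (\<omega> k) = 1" for k by (simp add: \<omega>_def)
  have \<omega>inv: "\<omega> k * cnj (\<omega> k) = 1" for k
    using complex_norm_square[of "\<omega> k"] by (simp add: \<omega>1)
  define v where "v n z = \<phi> n *\<^sub>R (?W ^^ n) z" for n z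
  define y where "y k z = (\<Sum>n<P. cnj (\<omega> k) ^ n *\<^sub>C v n z)" for k z
  have Wn: "(?W ^^ n) z \<in> L" if "z \<in> L" for n z by (rule cayley_power_in[OF im(1) that])
  have v_in: "v n z \<in> L" if "z \<in> L" for n z
    unfolding v_def using Wn[OF that] by (simp flip: scaleC_of_real add: L_scale)
  have y_in: "y k z \<in> L" if "z \<in> L" for k z
    unfolding y_def using v_in[OF that] L_scale cayley_sum[OF im(1), of P "\<lambda>n. cnj (\<omega> k) ^ n *\<^sub>C v n z"] by blast
  \<comment> \<open>Applying the transform raises the index by one; the phase lost in this shift is
    restored by the factor \<open>\<omega> k\<close>.\<close>
  have W_y: "?W (y k z) - \<omega> k *\<^sub>C y k z = \<omega> k *\<^sub>C (\<Sum>n<P. cnj (\<omega> k) ^ n *\<^sub>C (\<psi> n *\<^sub>R (?W ^^ n) z))"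
    if z: "z \<in> L" for k z
  proof -
    have "?W (y k z) = (\<Sum>n<P. ?W (cnj (\<omega> k) ^ n *\<^sub>C v n z))"
      unfolding y_def using v_in[OF z] L_scale cayley_sum[OF im(1), of P "\<lambda>n. cnj (\<omega> k) ^ n *\<^sub>C v n z"] by blast
    also have "\<dots> = (\<Sum>n<P. (cnj (\<omega> k) ^ n * of_real (\<phi> n)) *\<^sub>C (?W ^^ Suc n) z)"
    proof (intro sum.cong refl)
      fix n
      have "cnj (\<omega> k) ^ n *\<^sub>C v n z = (cnj (\<omega> k) ^ n * of_real (\<phi> n)) *\<^sub>C (?W ^^ n) z"
        by (simp add: v_def flip: scaleC_of_real)
      then show "?W (cnj (\<omega> k) ^ n *\<^sub>C v n z) = (cnj (\<omega> k) ^ n * of_real (\<phi> n)) *\<^sub>C (?W ^^ Suc n) z"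
        using cayley_scale[OF im(1) Wn[OF z]] by simp
    qed
    also have "\<dots> = (\<Sum>n<Suc (2 * N). (cnj (\<omega> k) ^ n * of_real (\<phi> n)) *\<^sub>C (?W ^^ Suc n) z)"
      by (simp add: P_def \<phi>_def)
    also have "\<dots> = (\<Sum>n<Suc (2 * N). \<omega> k *\<^sub>C (cnj (\<omega> k) ^ Suc n * of_real (\<phi> n)) *\<^sub>C (?W ^^ Suc n) z)"
      using \<omega>inv[of k] by (intro sum.cong refl) (simp add: scaleC_scaleC flip: mult.assoc)
    also have "\<dots> = (\<Sum>n<P. \<omega> k *\<^sub>C (cnj (\<omega> k) ^ n * of_real (if n = 0 then 0 else \<phi> (n - 1))) *\<^sub>C (?W ^^ n) z)"
      unfolding P_def by (simp only: add_2_eq_Suc' sum.lessThan_Suc_shift) simp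
    finally have W: "?W (y k z) = (\<Sum>n<P. \<omega> k *\<^sub>C (cnj (\<omega> k) ^ n * of_real (if n = 0 then 0 else \<phi> (n - 1))) *\<^sub>C (?W ^^ n) z)" .
    have E: "\<omega> k *\<^sub>C y k z = (\<Sum>n<P. \<omega> k *\<^sub>C (cnj (\<omega> k) ^ n * of_real (\<phi> n)) *\<^sub>C (?W ^^ n) z)"
      unfolding y_def v_def by (simp add: scaleC_sum_right flip: scaleC_of_real)
    show ?thesis
      unfolding W E scaleC_sum_right sum_subtractf[symmetric]
      by (intro sum.cong refl)
        (simp add: \<psi>_def scaleC_diff_left scaleC_diff_right mult.assoc flip: scaleC_of_real)
  qed
  have W_add: "(?W ^^ n) (x + z) = (?W ^^ n) x + (?W ^^ n) z" if "x \<in> L" "z \<in> L" for n x z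
    by (induction n) (simp_all add: cayley_add[OF im(1)] Wn that)
  have W_scale: "(?W ^^ n) (c *\<^sub>C x) = c *\<^sub>C (?W ^^ n) x" if "x \<in> L" for n x c
    by (induction n) (simp_all add: cayley_scale[OF im(1)] Wn that)
  have y_add: "y k (x + z) = y k x + y k z" if "x \<in> L" "z \<in> L" for k x z
    unfolding y_def v_def
    by (simp add: W_add[OF that] scaleR_add_right scaleC_add_right sum.distrib)
  have y_scale: "y k (c *\<^sub>C x) = c *\<^sub>C y k x" if "x \<in> L" for k x c
    unfolding y_def v_def
    by (simp add: W_scale[OF that] scaleC_sum_right mult_ac flip: scaleC_of_real)
  define Y where "Y = (\<Sum>n<P. \<phi> n * (K * s ^ n))"
  have y_bound: "norm (y k z) \<le> Y * norm z" if z: "z \<in> L" for k z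
  proof -
    have "norm (y k z) \<le> (\<Sum>n<P. norm (cnj (\<omega> k) ^ n *\<^sub>C v n z))" unfolding y_def by (rule norm_sum)
    also have "\<dots> \<le> (\<Sum>n<P. \<phi> n * (K * s ^ n) * norm z)"
    proof (rule sum_mono)
      fix n
      have "norm (cnj (\<omega> k) ^ n *\<^sub>C v n z) = \<phi> n * norm ((?W ^^ n) z)"
        using \<phi>_pos by (simp add: v_def norm_scaleC norm_power \<omega>1)
      also have "\<dots> \<le> \<phi> n * (K * s ^ n * norm z)" using up[OF z] \<phi>_pos by (intro mult_left_mono)
      finally show "norm (cnj (\<omega> k) ^ n *\<^sub>C v n z) \<le> \<phi> n * (K * s ^ n) * norm z" by (simp add: mult.assoc)
    qed
    finally show ?thesis by (simp add: Y_def sum_distrib_right)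
  qed
  have Vk: "csubspace (V (\<omega> k))" "closed (V (\<omega> k))" "V (\<omega> k) \<subseteq> L" "finite_codim L (V (\<omega> k))"
    "x \<in> V (\<omega> k) \<Longrightarrow> d * (norm x)\<^sup>2 \<le> gq x + C * (norm (?W x - \<omega> k *\<^sub>C x))\<^sup>2" for k x
    using V(1)[OF \<omega>1] by (auto simp: inequality_at_def)
  \<comment> \<open>One condition for each frequency, pulled back along the bounded map
    \<open>y k\<close>; it retains finite codimension in \<open>L\<close>.\<close>
  define U where "U k = {z \<in> L. y k z \<in> V (\<omega> k)}" for k
  have U: "csubspace (U k) \<and> closed (U k) \<and> U k \<subseteq> L \<and> finite_codim L (U k)" for k
  proof (intro conjI)
    have y0: "y k 0 = 0" using y_scale[of 0 k 0] by simp
    show "csubspace (U k)"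
      unfolding complex_vector.subspace_def U_def
      by (simp add: y0 y_add y_scale L_add L_scale complex_vector.subspace_0[OF Vk(1)]
          complex_vector.subspace_add[OF Vk(1)] complex_vector.subspace_scale[OF Vk(1)])
    show "closed (U k)"
      unfolding closed_sequential_limits
    proof (intro allI impI)
      fix x z assume *: "(\<forall>n. x n \<in> U k) \<and> x \<longlonglongrightarrow> z"
      then have x: "\<And>n. x n \<in> L" "\<And>n. y k (x n) \<in> V (\<omega> k)" "x \<longlonglongrightarrow> z" by (auto simp: U_def)
      have z: "z \<in> L" by (rule closed_sequentially[OF L_closed x(1,3)])
      have "y k (x n - z) = y k (x n) - y k z" for n
        using y_add[OF L_diff[OF x(1)[of n] z] z, of k] by simp
      then have le: "norm (y k (x n) - y k z) \<le> Y * norm (x n - z)" for n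
        using y_bound[OF L_diff[OF x(1)[of n] z], of k] by simp
      have "(\<lambda>n. Y * norm (x n - z)) \<longlonglongrightarrow> 0"
        using x(3) by (intro tendsto_mult_right_zero tendsto_norm_zero) (simp add: LIM_zero)
      then have "(\<lambda>n. y k (x n) - y k z) \<longlonglongrightarrow> 0"
        by (rule Lim_null_comparison[OF always_eventually[OF allI[OF le]]])
      then have "(\<lambda>n. y k (x n)) \<longlonglongrightarrow> y k z" by (rule LIM_zero_cancel)
      then have "y k z \<in> V (\<omega> k)" by (rule closed_sequentially[OF Vk(2) x(2)])
      then show "z \<in> U k" using z by (simp add: U_def)
    qed
    show "finite_codim L (U k)"
      unfolding U_def
      by (rule finite_codim_preimage[OF L_csubspace L_csubspace Vk(1) _ _ _ Vk(4)])
        (simp_all add: y_add y_scale y_in)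
  qed (simp add: U_def)
  define \<Phi> where "\<Phi> = (\<Sum>n<P. (\<phi> n)\<^sup>2)"
  have NP: "N < P" by (simp add: P_def)
  have \<Phi>: "\<Phi> \<ge> 1"
    using member_le_sum[of N "{..<P}" "\<lambda>n. (\<phi> n)\<^sup>2"] NP \<phi>N by (simp add: \<Phi>_def)
  have P: "real P > 0" by (simp add: P_def)
  \<comment> \<open>Combines d / 4 times the squared norm at the peak, which is at most
    \<open>\<Phi> * gq z\<close>, with the bound \<open>K\<^sup>2 * s ^ (2 * N)\<close> for
    returning from the peak to \<open>z\<close>.\<close>
  define c where "c = d / 4 / (K\<^sup>2 * s ^ (2 * N) * \<Phi>)"
  have den: "K\<^sup>2 * s ^ (2 * N) * \<Phi> > 0" using K s \<Phi> by (intro mult_pos_pos) auto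
  have c: "c > 0" unfolding c_def using dC(1) den by (intro divide_pos_pos) auto
  have main: "c * (norm z)\<^sup>2 \<le> gq z" if z: "z \<in> L" and zU: "\<And>k. k < P \<Longrightarrow> z \<in> U k" for z
  proof -
    define a where "a n = (norm ((?W ^^ n) z))\<^sup>2" for n
    have a_pos: "a n \<ge> 0" for n by (simp add: a_def)
    have gq_W: "gq ((?W ^^ n) z) = gq z" for n
      by (induction n) (simp_all add: cayley_isometry[OF _ Wn[OF z] Wn[OF z]])
    have 1: "(\<Sum>k<P. (norm (y k z))\<^sup>2) = real P * (\<Sum>n<P. (\<phi> n)\<^sup>2 * a n)"
      unfolding y_def \<omega>_def norm_Parseval by (simp add: v_def a_def power_mult_distrib)
    have 2: "(\<Sum>k<P. gq (y k z)) = real P * (\<Phi> * gq z)"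
      unfolding y_def \<omega>_def gq_Parseval by (simp add: v_def gq_scaleR gq_W \<Phi>_def sum_distrib_right)
    have 3: "(\<Sum>k<P. (norm (?W (y k z) - \<omega> k *\<^sub>C y k z))\<^sup>2) = real P * (\<Sum>n<P. (\<psi> n)\<^sup>2 * a n)"
      unfolding W_y[OF z] norm_scaleC \<omega>1 mult_1_left unfolding \<omega>_def norm_Parseval
      by (simp add: a_def power_mult_distrib)
    have "(\<Sum>k<P. d * (norm (y k z))\<^sup>2) \<le> (\<Sum>k<P. gq (y k z) + C * (norm (?W (y k z) - \<omega> k *\<^sub>C y k z))\<^sup>2)"
      using zU by (intro sum_mono Vk(5)) (auto simp: U_def)
    then have "real P * (d * (\<Sum>n<P. (\<phi> n)\<^sup>2 * a n)) \<le> real P * (\<Phi> * gq z + C * (\<Sum>n<P. (\<psi> n)\<^sup>2 * a n))"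
      unfolding sum.distrib sum_distrib_left[symmetric] 1 2 3 by (simp add: algebra_simps)
    then have 4: "d * (\<Sum>n<P. (\<phi> n)\<^sup>2 * a n) \<le> \<Phi> * gq z + C * (\<Sum>n<P. (\<psi> n)\<^sup>2 * a n)"
      using P by simp
    have a0: "a 0 \<le> K\<^sup>2 * s ^ (2 * N) * a N"
    proof -
      have "(norm z)\<^sup>2 \<le> (K * s ^ N * norm ((?W ^^ N) z))\<^sup>2" using down[OF z] by (intro power_mono) auto
      then show ?thesis by (simp add: a_def power_mult_distrib power_mult[symmetric] mult.commute)
    qed
    have a2N: "a (Suc (2 * N)) \<le> K\<^sup>2 * s ^ (2 * N) * s\<^sup>2 * a N"
    proof -
      have "(?W ^^ Suc (2 * N)) z = (?W ^^ Suc N) ((?W ^^ N) z)"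
        using funpow_add[of "Suc N" N ?W] by (simp add: mult_2)
      then have "a (Suc (2 * N)) \<le> (K * s ^ Suc N * norm ((?W ^^ N) z))\<^sup>2"
        unfolding a_def using up[OF Wn[OF z, of N], of "Suc N"] by (intro power_mono) auto
      also have "\<dots> = K\<^sup>2 * s ^ (2 * N) * s\<^sup>2 * a N"
        by (simp add: a_def power_mult_distrib power_mult[symmetric] mult_ac)
      finally show ?thesis .
    qed
    \<comment> \<open>Inside the tent the slopes are controlled by \<open>\<psi>_mid\<close>; the
      jumps at 0 and 2 N + 1 are the two separate terms.\<close>
    have \<psi>_le: "(\<psi> n)\<^sup>2 * a n \<le> (s\<^sup>2 - 1)\<^sup>2 * ((\<phi> n)\<^sup>2 * a n)
        + ((if n = 0 then (\<phi> 0)\<^sup>2 * a 0 else 0) + (if n = Suc (2 * N) then (\<phi> (2 * N))\<^sup>2 * a (Suc (2 * N)) else 0))"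
      if n: "n < P" for n
    proof -
      consider "n = 0" | "1 \<le> n" "n \<le> 2 * N" | "n = Suc (2 * N)" using n by (auto simp: P_def) linarith
      then show ?thesis
      proof cases
        case 1
        then show ?thesis by (simp add: \<psi>_def a_pos)
      next
        case 2
        then show ?thesis using mult_right_mono[OF \<psi>_mid[OF 2] a_pos[of n]] by (simp add: mult.assoc)
      next
        case 3
        have "\<phi> (Suc (2 * N)) = 0" by (simp add: \<phi>_def)
        then show ?thesis using 3 by (simp add: \<psi>_def)
      qed
    qed
    have "(\<Sum>n<P. (\<psi> n)\<^sup>2 * a n) \<le> (s\<^sup>2 - 1)\<^sup>2 * (\<Sum>n<P. (\<phi> n)\<^sup>2 * a n)
        + ((\<phi> 0)\<^sup>2 * a 0 + (\<phi> (2 * N))\<^sup>2 * a (Suc (2 * N)))"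
    proof -
      have "(\<Sum>n<P. (\<psi> n)\<^sup>2 * a n) \<le> (\<Sum>n<P. (s\<^sup>2 - 1)\<^sup>2 * ((\<phi> n)\<^sup>2 * a n)
        + ((if n = 0 then (\<phi> 0)\<^sup>2 * a 0 else 0) + (if n = Suc (2 * N) then (\<phi> (2 * N))\<^sup>2 * a (Suc (2 * N)) else 0)))"
        using \<psi>_le by (intro sum_mono) auto
      also have "\<dots> = (s\<^sup>2 - 1)\<^sup>2 * (\<Sum>n<P. (\<phi> n)\<^sup>2 * a n)
        + ((\<phi> 0)\<^sup>2 * a 0 + (\<phi> (2 * N))\<^sup>2 * a (Suc (2 * N)))"
        unfolding sum.distrib sum_distrib_left by (simp add: sum.delta P_def)
      finally show ?thesis .
    qed
    also have "(\<phi> 0)\<^sup>2 * a 0 + (\<phi> (2 * N))\<^sup>2 * a (Suc (2 * N))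
        \<le> (1 / s ^ (2 * N))\<^sup>2 * (K\<^sup>2 * s ^ (2 * N) * a N) + (1 / s ^ (2 * N))\<^sup>2 * (K\<^sup>2 * s ^ (2 * N) * s\<^sup>2 * a N)"
      unfolding \<phi>0 \<phi>2N by (intro add_mono mult_left_mono a0 a2N) auto
    also have "\<dots> = K\<^sup>2 * (1 + s\<^sup>2) / s ^ (2 * N) * a N"
    proof -
      have "(1 / q)\<^sup>2 * (k * q * b) + (1 / q)\<^sup>2 * (k * q * e * b) = k * (1 + e) / q * b"
        if "q > 0" for q k b e :: real
        using that by (simp add: power2_eq_square field_simps)
      moreover have "s ^ (2 * N) > 0" using s by simp
      ultimately show ?thesis by blast
    qed
    finally have "C * (\<Sum>n<P. (\<psi> n)\<^sup>2 * a n)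
        \<le> C * ((s\<^sup>2 - 1)\<^sup>2 * (\<Sum>n<P. (\<phi> n)\<^sup>2 * a n) + K\<^sup>2 * (1 + s\<^sup>2) / s ^ (2 * N) * a N)"
      using dC(2) by (intro mult_left_mono) auto
    also have "\<dots> = C * (s\<^sup>2 - 1)\<^sup>2 * (\<Sum>n<P. (\<phi> n)\<^sup>2 * a n) + C * (K\<^sup>2 * (1 + s\<^sup>2)) / s ^ (2 * N) * a N"
      by (simp add: distrib_left)
    also have "\<dots> \<le> d / 2 * (\<Sum>n<P. (\<phi> n)\<^sup>2 * a n) + d / 4 * a N"
      unfolding s4 by (intro add_left_mono mult_right_mono N a_pos)
    finally have 5: "C * (\<Sum>n<P. (\<psi> n)\<^sup>2 * a n) \<le> d / 2 * (\<Sum>n<P. (\<phi> n)\<^sup>2 * a n) + d / 4 * a N" .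
    have "a N \<le> (\<Sum>n<P. (\<phi> n)\<^sup>2 * a n)"
      using member_le_sum[of N "{..<P}" "\<lambda>n. (\<phi> n)\<^sup>2 * a n"] NP \<phi>N a_pos by simp
    then have "d / 2 * a N \<le> d / 2 * (\<Sum>n<P. (\<phi> n)\<^sup>2 * a n)" using dC(1) by (intro mult_left_mono) auto
    then have 6: "d / 4 * a N \<le> \<Phi> * gq z" using 4 5 by (simp add: field_simps)
    have "d / 4 * (norm z)\<^sup>2 \<le> d / 4 * (K\<^sup>2 * s ^ (2 * N) * a N)"
      using a0 dC(1) by (intro mult_left_mono) (auto simp: a_def)
    also have "\<dots> = (K\<^sup>2 * s ^ (2 * N)) * (d / 4 * a N)" by simp
    also have "\<dots> \<le> (K\<^sup>2 * s ^ (2 * N)) * (\<Phi> * gq z)" using 6 s by (intro mult_left_mono) auto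
    also have "\<dots> = (K\<^sup>2 * s ^ (2 * N) * \<Phi>) * gq z" by simp
    finally show ?thesis using den unfolding c_def by (simp add: divide_le_eq mult.commute)
  qed
  let ?U = "L \<inter> (\<Inter>k<P. U k)"
  have "csubspace ?U \<and> finite_codim L ?U"
    by (rule finite_codim_INT[OF L_csubspace]) (use U in auto)
  moreover have "closed ?U" using U L_closed by (intro closed_Int closed_INT) auto
  moreover have "?U = L" if M: "\<forall>t. M t = A"
  proof -
    have "U k = L" for k using V(2)[OF \<omega>1 M] y_in by (auto simp: U_def)
    then show ?thesis by auto
  qed
  moreover have "c * (norm x)\<^sup>2 \<le> gq x" if "x \<in> ?U" for x using main that by auto
  ultimately show ?thesis using c by (intro exI[of _ ?U] exI[of _ c]) auto
qed

end

section \<open>Projections onto uniformly positive subspaces\<close>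

context G_symmetric_operator
begin

lemma gq_parallelogram: "gq (x - y) = 2 * gq x + 2 * gq y - 4 * gq ((1 / 2) *\<^sub>R (x + y))"
  unfolding gq_scaleR gq_add gq_diff by (simp add: power2_eq_square field_simps)

text \<open>Minimise the form of \<open>y - p\<close> over \<open>p\<close> in \<open>L\<close>. The
  form may be negative elsewhere, but completing the square bounds it below along \<open>L\<close>.
  Differences of near minimisers lie in \<open>L\<close>, so the parallelogram identity and uniform
  positivity make them a Cauchy sequence. A nonzero \<open>gi (y - q) z\<close> would allow a step
  along \<open>z\<close> below the minimum.\<close>

lemma uniformly_positive_best_approximation:
  assumes L: "csubspace L" "closed L" and c: "c > 0" "\<And>x. x \<in> L \<Longrightarrow> c * (norm x)\<^sup>2 \<le> gq x"
  shows "\<exists>p\<in>L. \<forall>z\<in>L. gi (y - p) z = 0"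
proof -
  obtain g where g: "g > 0" "\<And>x y. cmod (gi x y) \<le> g * norm x * norm y" using gi_bound by blast
  define f where "f p = gq (y - p)" for p
  have below: "gq y - (g * norm y)\<^sup>2 / c \<le> f p" if "p \<in> L" for p
  proof -
    have "Re (gi y p) \<le> g * norm y * norm p" using complex_Re_le_cmod g(2) order_trans by blast
    then have "f p \<ge> gq y + c * (norm p)\<^sup>2 - 2 * (g * norm y * norm p)"
      unfolding f_def gq_diff using c(2)[OF that] by linarith
    moreover have "0 \<le> (g * norm y - c * norm p)\<^sup>2 / c" using c(1) by simp
    moreover have "(g * norm y - c * norm p)\<^sup>2 / c = (g * norm y)\<^sup>2 / c - 2 * (g * norm y * norm p) + c * (norm p)\<^sup>2"
      using c(1) by (simp add: power2_diff field_simps) (simp add: power2_eq_square)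
    ultimately show ?thesis by linarith
  qed
  have L0: "0 \<in> L" by (rule complex_vector.subspace_0[OF L(1)])
  have bb: "bdd_below (f ` L)" using below by (intro bdd_belowI2)
  define m where "m = Inf (f ` L)"
  have m_le: "m \<le> f p" if "p \<in> L" for p unfolding m_def using that bb by (intro cInf_lower) auto
  have "\<exists>p\<in>L. f p < m + 1 / real (Suc n)" for n
    using cInf_lessD[of "f ` L" "m + 1 / real (Suc n)"] L0 by (auto simp: m_def)
  then obtain p where p: "\<And>n. p n \<in> L" "\<And>n. f (p n) < m + 1 / real (Suc n)" by metis
  have near: "c * (norm (p n - p k))\<^sup>2 \<le> 4 / real (Suc N)" if "n \<ge> N" "k \<ge> N" for n k N
  proof -
    have mid: "(1 / 2) *\<^sub>R (p n + p k) \<in> L"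
      using csubspace_imp_subspace[OF L(1)] p(1) by (simp add: subspace_add subspace_scale)
    have "(1 / 2) *\<^sub>R ((y - p n) + (y - p k)) = y - (1 / 2) *\<^sub>R (p n + p k)"
      by (simp add: algebra_simps flip: scaleR_add_left)
    then have "gq ((y - p n) - (y - p k)) = 2 * f (p n) + 2 * f (p k) - 4 * f ((1 / 2) *\<^sub>R (p n + p k))"
      unfolding f_def by (subst gq_parallelogram) simp
    moreover have "gq (p n - p k) = gq ((y - p n) - (y - p k))"
      using gq_scaleR[of "-1" "p n - p k"] by simp
    moreover have "1 / real (Suc n) \<le> 1 / real (Suc N)" "1 / real (Suc k) \<le> 1 / real (Suc N)"
      using that by (auto intro!: divide_left_mono)
    ultimately have "gq (p n - p k) \<le> 4 * (1 / real (Suc N))"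
      using p(2)[of n] p(2)[of k] m_le[OF mid] by linarith
    then show ?thesis using c(2)[OF complex_vector.subspace_diff[OF L(1) p(1) p(1), of n k]] by simp
  qed
  have "Cauchy p"
  proof (rule metric_CauchyI)
    fix e :: real assume e: "e > 0"
    obtain N where N: "4 / (c * e\<^sup>2) < real (Suc N)" using reals_Archimedean2 less_Suc_eq
      by (metis less_trans of_nat_less_iff lessI)
    have "dist (p n) (p k) < e" if "n \<ge> N" "k \<ge> N" for n k
    proof -
      have "4 / real (Suc N) < c * e\<^sup>2" using N c(1) e by (simp add: field_simps)
      then have "c * (norm (p n - p k))\<^sup>2 < c * e\<^sup>2" using near[OF that] by linarith
      then have "(norm (p n - p k))\<^sup>2 < e\<^sup>2" using c(1) by simp
      then show ?thesis using e by (simp add: dist_norm power_less_imp_less_base)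
    qed
    then show "\<exists>M. \<forall>n\<ge>M. \<forall>k\<ge>M. dist (p n) (p k) < e" by blast
  qed
  then obtain q where q: "p \<longlonglongrightarrow> q" using Cauchy_convergent convergent_def by blast
  have qL: "q \<in> L" using closed_sequentially[OF L(2) p(1) q] .
  have "(\<lambda>n. f (p n)) \<longlonglongrightarrow> f q" unfolding f_def by (intro tendsto_intros q)
  moreover have "(\<lambda>n. m + 1 / real (Suc n)) \<longlonglongrightarrow> m + 0"
    by (intro tendsto_intros) (use LIMSEQ_inverse_real_of_nat in \<open>simp add: inverse_eq_divide\<close>)
  ultimately have fq: "f q \<le> m"
    using p(2) by (intro LIMSEQ_le[of "\<lambda>n. f (p n)" _ "\<lambda>n. m + 1 / real (Suc n)"]) (auto intro: less_imp_le)
  have "gi (y - q) z = 0" if z: "z \<in> L" for z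
  proof (rule ccontr)
    let ?w = "gi (y - q) z"
    assume w: "?w \<noteq> 0"
    have gz: "gq z \<ge> 0" using c(1) c(2)[OF z] by (meson mult_nonneg_nonneg less_imp_le order_trans zero_le_power2)
    \<comment> \<open>Short enough that \<open>t * gq z < 1\<close>, so the quadratic term cannot
      make up for the linear gain.\<close>
    define t where "t = 1 / (gq z + 1)"
    have t: "t > 0" using gz by (simp add: t_def)
    define s where "s = complex_of_real t * ?w"
    have "q + s *\<^sub>C z \<in> L" using qL z complex_vector.subspace_add[OF L(1)] complex_vector.subspace_scale[OF L(1)] by blast
    then have "f q \<le> f (q + s *\<^sub>C z)" using m_le fq by force
    also have "f (q + s *\<^sub>C z) = gq ((y - q) - s *\<^sub>C z)" by (simp add: f_def algebra_simps)
    also have "\<dots> = f q + (cmod s)\<^sup>2 * gq z - 2 * Re (gi (y - q) (s *\<^sub>C z))"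
      unfolding gq_diff gq_scaleC f_def ..
    also have "gi (y - q) (s *\<^sub>C z) = complex_of_real (t * (cmod ?w)\<^sup>2)"
    proof -
      have "gi (y - q) (s *\<^sub>C z) = complex_of_real t * (?w * cnj ?w)" by (simp add: gi_scale_right s_def)
      then show ?thesis by (simp only: complex_norm_square[symmetric] of_real_mult)
    qed
    also have "(cmod s)\<^sup>2 = t\<^sup>2 * (cmod ?w)\<^sup>2" by (simp add: s_def norm_mult power_mult_distrib)
    finally have "2 * (t * (cmod ?w)\<^sup>2) \<le> t\<^sup>2 * (cmod ?w)\<^sup>2 * gq z" by simp
    then have "2 * (t * (cmod ?w)\<^sup>2) \<le> (t * gq z) * (t * (cmod ?w)\<^sup>2)" by (simp add: power2_eq_square mult_ac)
    moreover have "t * (cmod ?w)\<^sup>2 > 0" using t w by simp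
    ultimately have "2 \<le> t * gq z" using mult_right_le_imp_le by blast
    moreover have "t * gq z < 1" using gz by (simp add: t_def)
    ultimately show False by simp
  qed
  then show ?thesis using qL by blast
qed

text \<open>Boundedness of \<open>Q\<close> comes from c |Q x|^2 <= [Q x, Q x] = [x, Q x].\<close>

lemma uniformly_positive_projection:
  assumes L: "csubspace L" "closed L" and c: "c > 0" "\<And>x. x \<in> L \<Longrightarrow> c * (norm x)\<^sup>2 \<le> gq x"
  obtains Q where "bounded_projection Q" "range Q = L" "\<And>x y. gi (Q x) y = gi x (Q y)"
    "\<And>y. Q y = 0 \<longleftrightarrow> (\<forall>z\<in>L. gi y z = 0)"
proof -
  obtain g where g: "g > 0" "\<And>x y. cmod (gi x y) \<le> g * norm x * norm y" using gi_bound by blast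
  have "\<forall>y. \<exists>p. p \<in> L \<and> (\<forall>z\<in>L. gi (y - p) z = 0)"
    using uniformly_positive_best_approximation[OF L c] by blast
  then obtain Q where "\<forall>y. Q y \<in> L \<and> (\<forall>z\<in>L. gi (y - Q y) z = 0)" using choice by metis
  then have Q: "\<And>y. Q y \<in> L" "\<And>y z. z \<in> L \<Longrightarrow> gi (y - Q y) z = 0" by auto
  have uniq: "Q y = p" if "p \<in> L" "\<And>z. z \<in> L \<Longrightarrow> gi (y - p) z = 0" for y p
  proof -
    have d: "p - Q y \<in> L" using that(1) Q(1) complex_vector.subspace_diff[OF L(1)] by blast
    have "gi (p - Q y) (p - Q y) = gi (y - Q y) (p - Q y) - gi (y - p) (p - Q y)"
      by (simp add: gi_diff_left)
    then have "gq (p - Q y) = 0" using Q(2)[OF d] that(2)[OF d] by simp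
    then have "c * (norm (p - Q y))\<^sup>2 \<le> 0" using c(2)[OF d] by simp
    then show ?thesis using c(1) by (simp add: mult_le_0_iff)
  qed
  have bc: "bounded_clinear Q"
  proof (rule bounded_clinearI[of _ "g / c"])
    show "Q (x + y) = Q x + Q y" for x y
    proof (rule uniq)
      show "gi (x + y - (Q x + Q y)) z = 0" if "z \<in> L" for z
        using Q(2)[OF that, of x] Q(2)[OF that, of y] by (simp add: gi_algebra)
    qed (use Q(1) complex_vector.subspace_add[OF L(1)] in blast)
    show "Q (k *\<^sub>C x) = k *\<^sub>C Q x" for k x
    proof (rule uniq)
      show "gi (k *\<^sub>C x - k *\<^sub>C Q x) z = 0" if "z \<in> L" for z
        using Q(2)[OF that, of x] by (simp add: gi_algebra)
    qed (use Q(1) complex_vector.subspace_scale[OF L(1)] in blast)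
    show "norm (Q x) \<le> g / c * norm x" for x
    proof (cases "Q x = 0")
      case True
      then show ?thesis using g(1) c(1) by simp
    next
      case False
      have "c * (norm (Q x))\<^sup>2 \<le> gq (Q x)" using c(2) Q(1) by blast
      also have "gi (Q x) (Q x) = gi x (Q x)" using Q(2)[OF Q(1)[of x], of x] by (simp add: gi_diff_left)
      also have "Re (gi x (Q x)) \<le> g * norm x * norm (Q x)" using complex_Re_le_cmod g(2) order_trans by blast
      finally have "c * norm (Q x) \<le> g * norm x" using False by (simp add: power2_eq_square)
      then show ?thesis using c(1) by (simp add: field_simps)
    qed
  qed
  have id: "Q x = x" if "x \<in> L" for x by (rule uniq[OF that]) simp
  have "bounded_projection Q" using bc id Q(1) by (auto simp: bounded_projection_def fun_eq_iff)
  moreover have "range Q = L" using id Q(1) by (metis image_subset_iff rangeI subsetI subset_antisym)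
  moreover have "gi (Q x) y = gi x (Q y)" for x y
  proof -
    have "gi (Q x) y = cnj (gi y (Q x))" by (rule gi_commute)
    also have "gi y (Q x) = gi (Q y) (Q x)" using Q(2)[OF Q(1)[of x], of y] by (simp add: gi_diff_left)
    also have "cnj (gi (Q y) (Q x)) = gi (Q x) (Q y)" using gi_commute[of "Q x" "Q y"] by simp
    also have "\<dots> = gi x (Q y)" using Q(2)[OF Q(1)[of y], of x] by (simp add: gi_diff_left)
    finally show ?thesis .
  qed
  moreover have "Q y = 0 \<longleftrightarrow> (\<forall>z\<in>L. gi y z = 0)" for y
  proof
    assume "Q y = 0"
    then show "\<forall>z\<in>L. gi y z = 0" using Q(2)[of _ y] by simp
  next
    assume "\<forall>z\<in>L. gi y z = 0"
    then show "Q y = 0" by (intro uniq) (auto simp: complex_vector.subspace_0[OF L(1)])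
  qed
  ultimately show ?thesis using that by blast
qed

section \<open>Eigenvectors at exceptional points\<close>

text \<open>Instead of a weak limit of the approximate eigenvectors we take a minimizing sequence of
  the form over sets that contain the convex hulls of their tails; it converges in norm because the
  form is uniformly convex on these sets up to small errors.\<close>

lemma nonpositive_eigenvector:
  assumes M: "robust M t" and p: "\<And>n::nat. p n \<in> A" "\<And>n. norm (fst (p n)) = 1"
    "(\<lambda>n. snd (p n) - t *\<^sub>C fst (p n)) \<longlonglongrightarrow> 0" "\<And>n. gq (fst (p n)) \<le> 1 / real (Suc n)"
  shows "\<exists>x. x \<noteq> 0 \<and> (x, t *\<^sub>C x) \<in> A \<and> gq x \<le> 0"
proof -
  obtain e0 d C where Ms: "csubspace M" "closed M" "M \<subseteq> A" "finite_codim A M" and dC: "d > 0" "C > 0" "e0 > 0"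
    and ineq0: "\<forall>l\<in>ball t e0. \<forall>(x, u)\<in>M. d * (norm x)\<^sup>2 \<le> gq x + C * (norm (u - l *\<^sub>C x))\<^sup>2"
    using M unfolding robust_def by blast
  have ineq: "d * (norm (fst w))\<^sup>2 \<le> gq (fst w) + C * (norm (snd w - t *\<^sub>C fst w))\<^sup>2" if "w \<in> M" for w
    using ineq0 dC(3) that by (force simp: case_prod_beta)
  obtain g where g: "g > 0" "\<And>x y. cmod (gi x y) \<le> g * norm x * norm y" using gi_bound by blast
  obtain K where K: "\<And>n. norm (snd (p n) - t *\<^sub>C fst (p n)) \<le> K"
    using convergent_imp_Bseq[OF convergentI[OF p(3)]] unfolding Bseq_def by blast
  have pb: "norm (p n) \<le> 1 + (K + cmod t)" for n
  proof -
    have "norm (snd (p n)) \<le> norm (snd (p n) - t *\<^sub>C fst (p n)) + norm (t *\<^sub>C fst (p n))"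
      by (metis diff_add_cancel norm_triangle_ineq)
    then have "norm (snd (p n)) \<le> K + cmod t" using K[of n] p(2) by (simp add: norm_scaleC)
    moreover have "norm (p n) \<le> norm (fst (p n)) + norm (snd (p n))" by (metis norm_Pair_le prod.collapse)
    ultimately show ?thesis using p(2)[of n] by simp
  qed
  \<comment> \<open>Along a subsequence the terms differ from elements of \<open>M\<close>, where
    the inequality holds, by a convergent sequence. Differences of late terms are then close to
    \<open>M\<close>.\<close>
  obtain r v l where rv: "strict_mono (r::nat \<Rightarrow> nat)" "\<And>n. v n \<in> A" "v \<longlonglongrightarrow> l" "\<And>n. p (r n) - v n \<in> M"
    using finite_codim_subseq[where x = p, OF Ms(4,1,2,3) A_csubspace p(1) pb] by blast
  define B where "B = 1 + (K + cmod t)"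
  have B: "B \<ge> 0" using pb[of 0] norm_ge_zero[of "p 0"] unfolding B_def by linarith
  \<comment> \<open>Unlike the terms of the sequence, these sets are closed under midpoints, as the
    minimisation requires. Their members are approximate eigenvectors of bounded graph norm, and any
    two of them differ by an element of \<open>M\<close> up to an error of size 2 e.\<close>
  define H where "H e = {q \<in> A. norm q \<le> B \<and> norm (snd q - t *\<^sub>C fst q) \<le> e \<and>
    (\<exists>v\<in>A. q - v \<in> M \<and> norm (v - l) \<le> e)}" for e
  have H_mono: "H e \<subseteq> H e'" if "e \<le> e'" for e e' using that by (force simp: H_def)
  have H_mid: "(1 / 2) *\<^sub>R (q + q') \<in> H e" if q: "q \<in> H e" "q' \<in> H e" for q q' e
  proof -
    obtain v v' where v: "v \<in> A" "q - v \<in> M" "norm (v - l) \<le> e" "v' \<in> A" "q' - v' \<in> M" "norm (v' - l) \<le> e"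
      using q by (auto simp: H_def)
    have half: "norm ((1 / 2) *\<^sub>R (x + y)) \<le> b" if "norm x \<le> b" "norm y \<le> b" for x y :: "'c::real_normed_vector" and b
      using that norm_triangle_ineq[of x y] by simp
    have sA: "subspace A" "subspace M" using csubspace_imp_subspace A_csubspace Ms(1) by blast+
    have A1: "(1 / 2) *\<^sub>R (q + q') \<in> A" "(1 / 2) *\<^sub>R (v + v') \<in> A"
      using q v sA by (auto simp: H_def intro!: subspace_scale subspace_add)
    have 1: "norm ((1 / 2) *\<^sub>R (q + q')) \<le> B" using q by (intro half) (auto simp: H_def)
    have "snd ((1 / 2) *\<^sub>R (q + q')) - t *\<^sub>C fst ((1 / 2) *\<^sub>R (q + q'))
        = (1 / 2) *\<^sub>R ((snd q - t *\<^sub>C fst q) + (snd q' - t *\<^sub>C fst q'))"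
      by (simp add: scaleR_diff_right scaleR_add_right scaleC_algebra mult.commute flip: scaleC_of_real)
    then have 2: "norm (snd ((1 / 2) *\<^sub>R (q + q')) - t *\<^sub>C fst ((1 / 2) *\<^sub>R (q + q'))) \<le> e"
      using q half[of "snd q - t *\<^sub>C fst q" e "snd q' - t *\<^sub>C fst q'"] by (simp add: H_def)
    have "(1 / 2) *\<^sub>R (q + q') - (1 / 2) *\<^sub>R (v + v') = (1 / 2) *\<^sub>R ((q - v) + (q' - v'))"
      by (simp add: algebra_simps)
    then have 3: "(1 / 2) *\<^sub>R (q + q') - (1 / 2) *\<^sub>R (v + v') \<in> M"
      using v sA(2) by (simp add: subspace_scale subspace_add)
    have "(1 / 2) *\<^sub>R (v + v') - l = (1 / 2) *\<^sub>R ((v - l) + (v' - l))"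
      by (simp add: algebra_simps flip: scaleR_add_left)
    then have 4: "norm ((1 / 2) *\<^sub>R (v + v') - l) \<le> e" using half v by metis
    show ?thesis using A1 1 2 3 4 by (auto simp: H_def)
  qed
  have gb: "\<bar>Re (gi x z)\<bar> \<le> g * a * b" if "norm x \<le> a" "norm z \<le> b" for x z a b
  proof -
    have "\<bar>Re (gi x z)\<bar> \<le> g * norm x * norm z" using abs_Re_le_cmod g(2) order_trans by blast
    also have "\<dots> \<le> g * a * b"
      using that g(1) order_trans[OF norm_ge_zero that(1)] by (intro mult_mono) auto
    finally show ?thesis .
  qed
  \<comment> \<open>Collects the errors of replacing a difference of two members of
    \<open>H e\<close> by an element of \<open>M\<close>. Terms quadratic in \<open>e\<close> are
    bounded linearly because \<open>e <= 1\<close>.\<close>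
  define c1 where "c1 = 2 * (4 * g + 8 * g * B) + 2 * C * (2 + 2 * (1 + cmod t))\<^sup>2 + 8 * d"
  have H_diff: "d * (norm (fst q - fst q'))\<^sup>2 \<le> 2 * gq (fst q - fst q') + c1 * e"
    if q: "q \<in> H e" "q' \<in> H e" and e: "0 < e" "e \<le> 1" for q q' e
  proof -
    obtain v v' where v: "q - v \<in> M" "norm (v - l) \<le> e" "q' - v' \<in> M" "norm (v' - l) \<le> e"
      using q by (auto simp: H_def)
    define w where "w = (q - v) - (q' - v')"
    define h where "h = v - v'"
    have w: "w \<in> M" unfolding w_def using v complex_vector.subspace_diff[OF Ms(1)] by blast
    have h: "norm h \<le> 2 * e" unfolding h_def using v norm_triangle_ineq4[of "v - l" "v' - l"] by simp
    have fh: "norm (fst h) \<le> 2 * e" "norm (snd h) \<le> 2 * e"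
      using h norm_fst_le[of "fst h" "snd h"] norm_snd_le[of "snd h" "fst h"] by auto
    have e2: "e * e \<le> e" using e mult_left_mono[of e 1 e] by simp
    let ?x = "fst q - fst q'"
    have x: "?x = fst w + fst h" "snd q - snd q' = snd w + snd h" by (auto simp: w_def h_def)
    have nx: "norm ?x \<le> 2 * B"
    proof -
      have "norm (fst q) \<le> B" "norm (fst q') \<le> B"
        using q norm_fst_le[of "fst q" "snd q"] norm_fst_le[of "fst q'" "snd q'"] by (auto simp: H_def)
      then show ?thesis using norm_triangle_ineq4[of "fst q" "fst q'"] by linarith
    qed
    have "gq (fst w) = gq ?x + gq (fst h) - 2 * Re (gi ?x (fst h))"
      using gq_diff[of ?x "fst h"] x(1) by simp
    moreover have "gq (fst h) \<le> g * (2 * e) * (2 * e)"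
      using gb[OF fh(1) fh(1)] by linarith
    moreover have "- Re (gi ?x (fst h)) \<le> g * (2 * B) * (2 * e)"
      using gb[OF nx fh(1)] by linarith
    moreover have "g * (2 * e) * (2 * e) \<le> 4 * g * e" using e2 g(1) by (simp add: mult.assoc)
    ultimately have gw: "gq (fst w) \<le> gq ?x + (4 * g + 8 * g * B) * e" by (simp add: algebra_simps)
    have sw: "snd w - t *\<^sub>C fst w = (snd q - t *\<^sub>C fst q) - (snd q' - t *\<^sub>C fst q') - (snd h - t *\<^sub>C fst h)"
      using x by (simp add: w_def h_def scaleC_diff_right algebra_simps)
    have "norm (snd w - t *\<^sub>C fst w) \<le> norm (snd q - t *\<^sub>C fst q) + norm (snd q' - t *\<^sub>C fst q') + (norm (snd h) + norm (t *\<^sub>C fst h))"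
      unfolding sw
      using norm_triangle_ineq4[of "(snd q - t *\<^sub>C fst q) - (snd q' - t *\<^sub>C fst q')" "snd h - t *\<^sub>C fst h"]
        norm_triangle_ineq4[of "snd q - t *\<^sub>C fst q" "snd q' - t *\<^sub>C fst q'"] norm_triangle_ineq4[of "snd h" "t *\<^sub>C fst h"]
      by linarith
    also have "\<dots> \<le> e + e + (2 * e + cmod t * (2 * e))"
      using q fh by (intro add_mono) (auto simp: H_def norm_scaleC mult_left_mono)
    also have "\<dots> = (2 + 2 * (1 + cmod t)) * e" by (simp add: algebra_simps)
    finally have "(norm (snd w - t *\<^sub>C fst w))\<^sup>2 \<le> ((2 + 2 * (1 + cmod t)) * e)\<^sup>2" by (intro power_mono) auto
    also have "\<dots> \<le> (2 + 2 * (1 + cmod t))\<^sup>2 * e"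
      unfolding power_mult_distrib using e2 by (intro mult_left_mono) (auto simp: power2_eq_square)
    finally have "C * (norm (snd w - t *\<^sub>C fst w))\<^sup>2 \<le> C * ((2 + 2 * (1 + cmod t))\<^sup>2 * e)"
      using dC(2) by (intro mult_left_mono) auto
    then have dw: "d * (norm (fst w))\<^sup>2 \<le> gq ?x + ((4 * g + 8 * g * B) + C * (2 + 2 * (1 + cmod t))\<^sup>2) * e"
      using ineq[OF w] gw by (simp add: algebra_simps)
    have "norm ?x \<le> norm (fst w) + 2 * e" using x(1) norm_triangle_ineq[of "fst w" "fst h"] fh(1) by simp
    then have "(norm ?x)\<^sup>2 \<le> (norm (fst w) + 2 * e)\<^sup>2" by (intro power_mono) auto
    also have "\<dots> \<le> 2 * (norm (fst w))\<^sup>2 + 2 * (2 * e)\<^sup>2"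
      using sum_squares_bound[of "norm (fst w)" "2 * e"] by (simp add: power2_sum)
    also have "(2 * e)\<^sup>2 \<le> 4 * e" using e2 by (simp add: power2_eq_square)
    finally have "(norm ?x)\<^sup>2 \<le> 2 * (norm (fst w))\<^sup>2 + 8 * e" by simp
    then have "d * (norm ?x)\<^sup>2 \<le> d * (2 * (norm (fst w))\<^sup>2 + 8 * e)" using dC(1) by (intro mult_left_mono) auto
    then show ?thesis using dw by (simp add: c1_def algebra_simps)
  qed
  define f where "f q = gq (fst q)" for q :: "'a \<times> 'a"
  have f_below: "- (g * B * B) \<le> f q" if "q \<in> H e" for q e
  proof -
    have n: "norm (fst q) \<le> B" using that norm_fst_le[of "fst q" "snd q"] by (auto simp: H_def)
    have "\<bar>f q\<bar> \<le> g * norm (fst q) * norm (fst q)" unfolding f_def using abs_Re_le_cmod g(2) order_trans by blast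
    also have "\<dots> \<le> g * B * B" using n g(1) B by (intro mult_mono) auto
    finally show ?thesis by linarith
  qed
  have H_p: "\<exists>n. p (r n) \<in> H e \<and> f (p (r n)) \<le> e" if e: "e > 0" for e
  proof -
    have "eventually (\<lambda>n. dist (v n) l < e) sequentially" using tendstoD[OF rv(3) e] .
    moreover have "eventually (\<lambda>n. dist (snd (p (r n)) - t *\<^sub>C fst (p (r n))) 0 < e) sequentially"
      using tendstoD[OF LIMSEQ_subseq_LIMSEQ[OF p(3) rv(1)] e] by (simp add: o_def)
    moreover have "eventually (\<lambda>n. 1 / real (Suc (r n)) < e) sequentially"
      using order_tendstoD(2)[OF LIMSEQ_subseq_LIMSEQ[OF LIMSEQ_inverse_real_of_nat rv(1)] e]
      by (simp add: o_def inverse_eq_divide)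
    ultimately have "eventually (\<lambda>n. dist (v n) l < e \<and> dist (snd (p (r n)) - t *\<^sub>C fst (p (r n))) 0 < e
        \<and> 1 / real (Suc (r n)) < e) sequentially" by eventually_elim simp
    then obtain n where n: "dist (v n) l < e" "dist (snd (p (r n)) - t *\<^sub>C fst (p (r n))) 0 < e" "1 / real (Suc (r n)) < e"
      unfolding eventually_sequentially by blast
    have "p (r n) \<in> H e"
      unfolding H_def using n pb[of "r n"] p(1) rv(2,4)[of n]
      by (auto simp: B_def dist_norm intro!: bexI[of _ "v n"])
    moreover have "f (p (r n)) \<le> e" using p(4)[of "r n"] n(3) by (simp add: f_def)
    ultimately show ?thesis by blast
  qed
  define m where "m e = Inf (f ` H e)" for e
  have bdd: "bdd_below (f ` H e)" for e using f_below by (intro bdd_belowI2)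
  have m_le: "m e \<le> f q" if "q \<in> H e" for e q unfolding m_def using that bdd by (intro cInf_lower) auto
  have m_mono: "m e' \<le> m e" if "e \<le> e'" "e > 0" for e e'
    unfolding m_def using H_mono[OF that(1)] H_p[OF that(2)] bdd by (intro cInf_superset_mono) auto
  have m_below: "- (g * B * B) \<le> m e" if "e > 0" for e
    unfolding m_def using H_p[OF that] f_below by (intro cInf_greatest) auto
  have m_nonpos: "m e \<le> 0" if "e > 0" for e
  proof (rule field_le_epsilon)
    fix \<epsilon> :: real assume "\<epsilon> > 0"
    then obtain n where "p (r n) \<in> H (min e \<epsilon>)" "f (p (r n)) \<le> min e \<epsilon>" using H_p[of "min e \<epsilon>"] \<open>e > 0\<close> by auto
    then show "m e \<le> 0 + \<epsilon>" using m_le[of "p (r n)" e] H_mono[of "min e \<epsilon>" e] by auto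
  qed
  define \<epsilon> where "\<epsilon> n = 1 / real (Suc n)" for n
  have \<epsilon>: "\<epsilon> n > 0" "\<epsilon> n \<le> 1" for n by (auto simp: \<epsilon>_def)
  have \<epsilon>_mono: "\<epsilon> k \<le> \<epsilon> n" if "n \<le> k" for n k using that by (auto simp: \<epsilon>_def intro!: divide_left_mono)
  have \<epsilon>_lim: "\<epsilon> \<longlonglongrightarrow> 0" unfolding \<epsilon>_def using LIMSEQ_inverse_real_of_nat by (simp add: inverse_eq_divide)
  have "incseq (\<lambda>n. m (\<epsilon> n))" using m_mono \<epsilon>_mono \<epsilon> by (auto simp: incseq_def)
  then obtain m0 where m0: "(\<lambda>n. m (\<epsilon> n)) \<longlonglongrightarrow> m0" "\<And>n. m (\<epsilon> n) \<le> m0"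
    using incseq_convergent[of "\<lambda>n. m (\<epsilon> n)" 0] m_nonpos \<epsilon> by metis
  have m0_nonpos: "m0 \<le> 0" using LIMSEQ_le_const2[OF m0(1)] m_nonpos \<epsilon> by blast
  \<comment> \<open>Near minimisers converge: midpoints stay in \<open>H\<close>, so the
    parallelogram identity makes the form of a difference small, and \<open>H_diff\<close> turns
    this into smallness of its norm.\<close>
  have conv: "\<exists>x. (\<lambda>n. fst (q n)) \<longlonglongrightarrow> x \<and> (x, t *\<^sub>C x) \<in> A \<and> gq x = m0"
    if q: "\<And>n. q n \<in> H (\<epsilon> n)" "\<And>n. f (q n) \<le> m (\<epsilon> n) + \<theta> n" and \<theta>: "\<theta> \<longlonglongrightarrow> 0" for q \<theta>
  proof -
    have diff: "d * (norm (fst (q n) - fst (q k)))\<^sup>2 \<le> 8 * (m0 - m (\<epsilon> n)) + 4 * \<bar>\<theta> n\<bar> + 4 * \<bar>\<theta> k\<bar> + c1 * \<epsilon> n" if nk: "n \<le> k" for n k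
    proof -
      have k: "q k \<in> H (\<epsilon> n)" using q(1) H_mono \<epsilon>_mono nk by blast
      have "f ((1 / 2) *\<^sub>R (q n + q k)) \<ge> m (\<epsilon> n)" by (rule m_le[OF H_mid[OF q(1) k]])
      moreover have "f ((1 / 2) *\<^sub>R (q n + q k)) = gq ((1 / 2) *\<^sub>R (fst (q n) + fst (q k)))" by (simp add: f_def)
      ultimately have "gq (fst (q n) - fst (q k)) \<le> 2 * f (q n) + 2 * f (q k) - 4 * m (\<epsilon> n)"
        unfolding gq_parallelogram[of "fst (q n)"] f_def by linarith
      also have "\<dots> \<le> 4 * (m0 - m (\<epsilon> n)) + 2 * \<bar>\<theta> n\<bar> + 2 * \<bar>\<theta> k\<bar>"
      proof -
        have "2 * a + 2 * b - 4 * c \<le> 4 * (e - c) + 2 * a' + 2 * b'"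
          if "a \<le> c + x" "b \<le> c' + y" "c \<le> e" "c' \<le> e" "x \<le> a'" "y \<le> b'" for a b c c' e x y a' b' :: real
          using that by argo
        then show ?thesis
          using q(2)[of n] q(2)[of k] m0(2)[of n] m0(2)[of k] abs_ge_self[of "\<theta> n"] abs_ge_self[of "\<theta> k"] by blast
      qed
      finally show ?thesis using H_diff[OF q(1) k \<epsilon>] by linarith
    qed
    have "(\<lambda>n. 8 * (m0 - m (\<epsilon> n)) + 4 * \<bar>\<theta> n\<bar> + 4 * \<bar>\<theta> n\<bar> + c1 * \<epsilon> n) \<longlonglongrightarrow> 8 * (m0 - m0) + 4 * \<bar>0\<bar> + 4 * \<bar>0\<bar> + c1 * 0"
      by (intro tendsto_intros m0(1) \<theta> \<epsilon>_lim)
    then have lim0: "(\<lambda>n. 8 * (m0 - m (\<epsilon> n)) + 4 * \<bar>\<theta> n\<bar> + 4 * \<bar>\<theta> n\<bar> + c1 * \<epsilon> n) \<longlonglongrightarrow> 0" by simp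
    have "Cauchy (\<lambda>n. fst (q n))"
    proof (rule metric_CauchyI)
      fix \<eta> :: real assume \<eta>: "\<eta> > 0"
      let ?b = "d * \<eta>\<^sup>2 / 2"
      have b: "?b > 0" using dC(1) \<eta> by simp
      obtain N1 where N1: "\<And>n. n \<ge> N1 \<Longrightarrow> 8 * (m0 - m (\<epsilon> n)) + 4 * \<bar>\<theta> n\<bar> + 4 * \<bar>\<theta> n\<bar> + c1 * \<epsilon> n < ?b"
        using order_tendstoD(2)[OF lim0 b] unfolding eventually_sequentially by blast
      have "(\<lambda>n. 4 * \<bar>\<theta> n\<bar>) \<longlonglongrightarrow> 4 * \<bar>0\<bar>" by (intro tendsto_intros \<theta>)
      then have lim\<theta>: "(\<lambda>n. 4 * \<bar>\<theta> n\<bar>) \<longlonglongrightarrow> 0" by simp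
      obtain N2 where N2: "\<And>n. n \<ge> N2 \<Longrightarrow> 4 * \<bar>\<theta> n\<bar> < ?b"
        using order_tendstoD(2)[OF lim\<theta> b] unfolding eventually_sequentially by blast
      have less: "dist (fst (q n)) (fst (q k)) < \<eta>" if "n \<ge> max N1 N2" "n \<le> k" for n k
      proof -
        have "d * (norm (fst (q n) - fst (q k)))\<^sup>2 < ?b + ?b"
          using diff[OF that(2)] N1[of n] N2[of k] that abs_ge_zero[of "\<theta> n"] by linarith
        then have "d * (norm (fst (q n) - fst (q k)))\<^sup>2 < d * \<eta>\<^sup>2" by simp
        then have "(norm (fst (q n) - fst (q k)))\<^sup>2 < \<eta>\<^sup>2" using dC(1) by simp
        then show ?thesis using \<eta> by (simp add: dist_norm power_less_imp_less_base)
      qed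
      show "\<exists>N. \<forall>n\<ge>N. \<forall>k\<ge>N. dist (fst (q n)) (fst (q k)) < \<eta>"
      proof (intro exI allI impI)
        fix n k assume "n \<ge> max N1 N2" "k \<ge> max N1 N2"
        then show "dist (fst (q n)) (fst (q k)) < \<eta>"
          using less[of n k] less[of k n] by (cases "n \<le> k") (auto simp: dist_commute)
      qed
    qed
    then obtain x where x: "(\<lambda>n. fst (q n)) \<longlonglongrightarrow> x" using Cauchy_convergent convergent_def by blast
    have le: "norm (snd (q n) - t *\<^sub>C fst (q n)) \<le> \<epsilon> n" for n using q(1)[of n] by (simp add: H_def)
    have "(\<lambda>n. snd (q n) - t *\<^sub>C fst (q n)) \<longlonglongrightarrow> 0"
      by (rule Lim_null_comparison[OF always_eventually[OF allI[OF le]] \<epsilon>_lim])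
    then have "(\<lambda>n. (snd (q n) - t *\<^sub>C fst (q n)) + t *\<^sub>C fst (q n)) \<longlonglongrightarrow> 0 + t *\<^sub>C x"
      by (intro tendsto_add tendsto_scaleC tendsto_const x)
    then have s: "(\<lambda>n. snd (q n)) \<longlonglongrightarrow> t *\<^sub>C x" by simp
    have "(x, t *\<^sub>C x) \<in> A" by (rule A_limit[OF _ x s]) (use q(1) in \<open>simp add: H_def\<close>)
    moreover have "gq x = m0"
    proof (rule LIMSEQ_unique)
      show "(\<lambda>n. gq (fst (q n))) \<longlonglongrightarrow> gq x" by (intro tendsto_intros x)
      have "(\<lambda>n. m (\<epsilon> n) + \<theta> n) \<longlonglongrightarrow> m0 + 0" by (intro tendsto_add m0(1) \<theta>)
      then have up: "(\<lambda>n. m (\<epsilon> n) + \<theta> n) \<longlonglongrightarrow> m0" by simp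
      have "\<forall>n. m (\<epsilon> n) \<le> gq (fst (q n))" "\<forall>n. gq (fst (q n)) \<le> m (\<epsilon> n) + \<theta> n"
        using q(2) m_le[OF q(1)] unfolding f_def by blast+
      from tendsto_sandwich[OF this[THEN always_eventually] m0(1) up]
      show "(\<lambda>n. gq (fst (q n))) \<longlonglongrightarrow> m0" .
    qed
    ultimately show ?thesis using x by blast
  qed
  show ?thesis
  \<comment> \<open>A negative limit value makes the limit of any near minimisers nonzero. If it is
    0, the given vectors are themselves near minimisers, and their limit keeps the norm 1.\<close>
  proof (cases "m0 < 0")
    case True
    have "\<exists>q. q \<in> H (\<epsilon> n) \<and> f q \<le> m (\<epsilon> n) + \<epsilon> n" for n
      using cInf_lessD[of "f ` H (\<epsilon> n)" "m (\<epsilon> n) + \<epsilon> n"] H_p[OF \<epsilon>(1)] \<epsilon>(1)[of n]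
      by (fastforce simp: m_def intro: less_imp_le)
    then obtain q where q: "\<And>n. q n \<in> H (\<epsilon> n)" "\<And>n. f (q n) \<le> m (\<epsilon> n) + \<epsilon> n" by metis
    obtain x where "(x, t *\<^sub>C x) \<in> A" "gq x = m0" using conv[OF q \<epsilon>_lim] by blast
    then show ?thesis using True by (intro exI[of _ x]) auto
  next
    case False
    then have m00: "m0 = 0" using m0_nonpos by simp
    obtain s where s: "\<And>n. p (r (s n)) \<in> H (\<epsilon> n)" "\<And>n. f (p (r (s n))) \<le> \<epsilon> n" using H_p[OF \<epsilon>(1)] by metis
    have "(\<lambda>n. \<epsilon> n - m (\<epsilon> n)) \<longlonglongrightarrow> 0 - m0" by (intro tendsto_diff \<epsilon>_lim m0(1))
    then have \<theta>: "(\<lambda>n. \<epsilon> n - m (\<epsilon> n)) \<longlonglongrightarrow> 0" by (simp add: m00)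
    obtain x where x: "(\<lambda>n. fst (p (r (s n)))) \<longlonglongrightarrow> x" "(x, t *\<^sub>C x) \<in> A" "gq x = m0"
      using conv[of "\<lambda>n. p (r (s n))", OF s(1) _ \<theta>] s(2) by auto
    have "(\<lambda>n. norm (fst (p (r (s n))))) \<longlonglongrightarrow> norm x" by (intro tendsto_norm x(1))
    then have "norm x = 1" using p(2) LIMSEQ_unique[of "\<lambda>n. 1::real"] by simp
    then show ?thesis using x m00 by (intro exI[of _ x]) auto
  qed
qed

end

text \<open>A map that is bounded below on a subspace of finite codimension is semi-Fredholm; the two
  lemmas state what is needed of this: solutions of controlled size, and closed range.\<close>

lemma finite_codim_bounded_below:
  fixes V M :: "'a::chilbert_space set" and D :: "'a \<Rightarrow> 'b::real_normed_vector"
  assumes V: "csubspace V" "closed V" and M: "csubspace M" "closed M" "M \<subseteq> V" "finite_codim V M"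
    and D: "bounded_linear D" and c: "\<And>v. v \<in> M \<Longrightarrow> norm v \<le> c * norm (D v)"
  obtains K where "K > 0" "\<And>v. v \<in> V \<Longrightarrow> \<exists>v'\<in>V. D v' = D v \<and> norm v' \<le> K * norm (D v)"
proof -
  interpret D: bounded_linear D by fact
  have sV: "subspace V" using csubspace_imp_subspace V(1) by blast
  have "\<exists>K>0. \<forall>v\<in>V. \<exists>v'\<in>V. D v' = D v \<and> norm v' \<le> K * norm (D v)"
  proof (rule ccontr)
    assume neg: "\<not> ?thesis"
    \<comment> \<open>A solution of nearly least norm, normalised: it has distance at least 1 / 2
      from every kernel vector in \<open>V\<close>, although its image is small. A convergent
      subsequence would end at such a kernel vector.\<close>
    have "\<exists>w. w \<in> V \<and> norm w = 1 \<and> norm (D w) \<le> 1 / real (Suc n) \<and> (\<forall>k\<in>V. D k = 0 \<longrightarrow> 1 / 2 \<le> norm (w - k))" for n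
    proof -
      have "real (Suc n) > 0" by simp
      then obtain v where v: "v \<in> V" "\<And>v'. v' \<in> V \<Longrightarrow> D v' = D v \<Longrightarrow> \<not> norm v' \<le> real (Suc n) * norm (D v)"
        using neg by meson
      define N where "N = {norm v' | v'. v' \<in> V \<and> D v' = D v}"
      have ne: "N \<noteq> {}" using v(1) by (auto simp: N_def)
      have bdd: "bdd_below N" by (rule bdd_belowI[of _ 0]) (auto simp: N_def)
      have Dv: "D v \<noteq> 0"
      proof
        assume "D v = 0"
        then show False using v(2)[of 0] sV subspace_0 D.zero by force
      qed
      have "real (Suc n) * norm (D v) \<le> Inf N"
        by (rule cInf_greatest[OF ne]) (use v(2) in \<open>force simp: N_def\<close>)
      moreover have "real (Suc n) * norm (D v) > 0" using Dv by simp
      ultimately have inf: "Inf N > 0" by linarith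
      then have "Inf N < 2 * Inf N" by simp
      then obtain v' where v': "v' \<in> V" "D v' = D v" "norm v' < 2 * Inf N"
        using cInf_lessD[OF ne, of "2 * Inf N"] by (auto simp: N_def)
      have nv: "norm v' > 0" using v' Dv D.zero by auto
      define w where "w = (1 / norm v') *\<^sub>R v'"
      have "w \<in> V" unfolding w_def using v'(1) sV by (intro subspace_scale)
      moreover have "norm w = 1" using nv by (simp add: w_def)
      moreover have "norm (D w) \<le> 1 / real (Suc n)"
      proof -
        have "real (Suc n) * norm (D v) \<le> norm v'" using v(2)[OF v'(1,2)] by simp
        then have "norm (D v) / norm v' \<le> 1 / real (Suc n)" using nv by (simp add: field_simps)
        then show ?thesis by (simp add: w_def D.scaleR v'(2))
      qed
      moreover have "1 / 2 \<le> norm (w - k)" if k: "k \<in> V" "D k = 0" for k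
      proof -
        have "v' - norm v' *\<^sub>R k \<in> V" using v'(1) k(1) sV by (intro subspace_diff subspace_scale)
        moreover have "D (v' - norm v' *\<^sub>R k) = D v" using k(2) v'(2) by (simp add: D.diff D.scaleR)
        ultimately have "Inf N \<le> norm (v' - norm v' *\<^sub>R k)" using bdd by (intro cInf_lower) (auto simp: N_def)
        also have "v' - norm v' *\<^sub>R k = norm v' *\<^sub>R (w - k)" using nv by (simp add: w_def scaleR_diff_right)
        finally have "Inf N \<le> norm v' * norm (w - k)" by simp
        then have "norm v' * (1 / 2) \<le> norm v' * norm (w - k)" using v'(3) by linarith
        then show ?thesis using nv by simp
      qed
      ultimately show ?thesis by blast
    qed
    then obtain w where w: "\<And>n. w n \<in> V" "\<And>n. norm (w n) = 1" "\<And>n. norm (D (w n)) \<le> 1 / real (Suc n)"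
      "\<And>n k. k \<in> V \<Longrightarrow> D k = 0 \<Longrightarrow> 1 / 2 \<le> norm (w n - k)" by metis
    have w1: "norm (w n) \<le> 1" for n using w(2)[of n] by simp
    obtain r u l where ru: "strict_mono (r::nat \<Rightarrow> nat)" "\<And>n. u n \<in> V" "u \<longlonglongrightarrow> l" "\<And>n. w (r n) - u n \<in> M"
      using finite_codim_subseq[where x = w, OF M(4,1,2,3) V(1) w(1) w1] by blast
    have Dw: "(\<lambda>n. D (w n)) \<longlonglongrightarrow> 0"
      by (rule Lim_null_comparison[OF always_eventually LIMSEQ_inverse_real_of_nat])
        (use w(3) in \<open>simp add: inverse_eq_divide\<close>)
    then have Dwr: "(\<lambda>n. D (w (r n))) \<longlonglongrightarrow> 0" using LIMSEQ_subseq_LIMSEQ[OF _ ru(1)] by (force simp: o_def)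
    have "(\<lambda>n. D (w (r n)) - D (u n)) \<longlonglongrightarrow> 0 - D l" by (intro tendsto_diff Dwr D.tendsto ru(3))
    then have CD: "Cauchy (\<lambda>n. D (w (r n) - u n))" by (simp add: LIMSEQ_imp_Cauchy D.diff)
    have "Cauchy (\<lambda>n. w (r n) - u n)"
    proof (rule metric_CauchyI)
      fix e :: real assume e: "e > 0"
      then obtain N where N: "\<And>i j. i \<ge> N \<Longrightarrow> j \<ge> N \<Longrightarrow> dist (D (w (r i) - u i)) (D (w (r j) - u j)) < e / (\<bar>c\<bar> + 1)"
        using metric_CauchyD[OF CD, of "e / (\<bar>c\<bar> + 1)"] by (auto simp: add_nonneg_pos)
      have "dist (w (r i) - u i) (w (r j) - u j) < e" if "i \<ge> N" "j \<ge> N" for i j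
      proof -
        let ?d = "(w (r i) - u i) - (w (r j) - u j)"
        have "norm ?d \<le> c * norm (D ?d)" using c complex_vector.subspace_diff[OF M(1) ru(4) ru(4)] by blast
        also have "\<dots> \<le> (\<bar>c\<bar> + 1) * norm (D ?d)" by (intro mult_right_mono) auto
        also have "\<dots> < (\<bar>c\<bar> + 1) * (e / (\<bar>c\<bar> + 1))"
          using N[OF that] by (intro mult_strict_left_mono) (auto simp: dist_norm D.diff add_nonneg_pos)
        also have "\<dots> = e"
        proof -
          have "\<bar>c\<bar> + 1 \<noteq> 0" by (metis abs_ge_zero add_nonneg_pos less_irrefl zero_less_one)
          then show ?thesis by simp
        qed
        finally show ?thesis by (simp add: dist_norm)
      qed
      then show "\<exists>N. \<forall>i\<ge>N. \<forall>j\<ge>N. dist (w (r i) - u i) (w (r j) - u j) < e" by blast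
    qed
    then obtain a where "(\<lambda>n. w (r n) - u n) \<longlonglongrightarrow> a" using Cauchy_convergent convergent_def by blast
    then have "(\<lambda>n. (w (r n) - u n) + u n) \<longlonglongrightarrow> a + l" by (intro tendsto_add ru(3))
    then have lim: "(\<lambda>n. w (r n)) \<longlonglongrightarrow> a + l" by simp
    have k: "a + l \<in> V" by (rule closed_sequentially[OF V(2) w(1) lim])
    have "D (a + l) = 0" using LIMSEQ_unique[OF D.tendsto[OF lim] Dwr] .
    then have "1 / 2 \<le> norm (w (r n) - (a + l))" for n using w(4)[OF k] by blast
    moreover have "(\<lambda>n. norm (w (r n) - (a + l))) \<longlonglongrightarrow> 0" using lim by (intro tendsto_norm_zero) (simp add: LIM_zero)
    ultimately show False using LIMSEQ_le_const[of "\<lambda>n. norm (w (r n) - (a + l))" 0 "1 / 2"] by force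
  qed
  then show ?thesis using that by blast
qed

lemma closed_range_from_bounded_solutions:
  fixes V :: "'a::chilbert_space set" and D :: "'a \<Rightarrow> 'b::real_normed_vector"
  assumes V: "subspace V" "closed V" and D: "bounded_linear D"
    and K: "\<And>v. v \<in> V \<Longrightarrow> \<exists>v'\<in>V. D v' = D v \<and> norm v' \<le> K * norm (D v)" and K0: "K > 0"
    and y: "\<And>n. y n \<in> D ` V" "y \<longlonglongrightarrow> z"
  shows "z \<in> D ` V"
proof -
  interpret D: bounded_linear D by fact
  have "\<exists>i\<ge>j. norm (y i - z) < (1 / 2) ^ n" for n j
  proof -
    have "((1::real) / 2) ^ n > 0" by simp
    then obtain i0 where "\<And>i. i \<ge> i0 \<Longrightarrow> norm (y i - z) < (1 / 2) ^ n" using LIMSEQ_D[OF y(2)] by blast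
    then show ?thesis by (intro exI[of _ "max i0 j"]) simp
  qed
  then obtain s where s: "\<And>n. norm (y (s n) - z) < (1 / 2) ^ n" by metis
  have "\<forall>n. \<exists>v. v \<in> V \<and> y n = D v" using y(1) by blast
  then obtain v where v: "\<And>n. v n \<in> V" "\<And>n. y n = D (v n)" by metis
  \<comment> \<open>The increments of a rapidly convergent subsequence are lifted to vectors of
    comparable size, so the lifted series converges and its sum is mapped to the limit.\<close>
  have "\<exists>q\<in>V. D q = y (s (Suc n)) - y (s n) \<and> norm q \<le> K * (2 * (1 / 2) ^ n)" for n
  proof -
    have "v (s (Suc n)) - v (s n) \<in> V" using v(1) V(1) subspace_diff by blast
    from K[OF this] obtain q where q: "q \<in> V" "D q = y (s (Suc n)) - y (s n)" "norm q \<le> K * norm (y (s (Suc n)) - y (s n))"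
      by (auto simp: D.diff v(2))
    have "norm (y (s (Suc n)) - y (s n)) \<le> norm (y (s (Suc n)) - z) + norm (y (s n) - z)"
      using norm_triangle_ineq4[of "y (s (Suc n)) - z" "y (s n) - z"] by simp
    also have "norm (y (s (Suc n)) - z) < (1 / 2) ^ n"
      using s[of "Suc n"] by (rule less_le_trans) simp
    finally have "norm (y (s (Suc n)) - y (s n)) \<le> 2 * (1 / 2) ^ n" using s[of n] by linarith
    then have "K * norm (y (s (Suc n)) - y (s n)) \<le> K * (2 * (1 / 2) ^ n)"
      using K0 by (intro mult_left_mono) auto
    then show ?thesis using q order_trans by blast
  qed
  then obtain q where q: "\<And>n. q n \<in> V" "\<And>n. D (q n) = y (s (Suc n)) - y (s n)" "\<And>n. norm (q n) \<le> K * (2 * (1 / 2) ^ n)"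
    by metis
  have "summable q"
    by (rule summable_comparison_test[of _ "\<lambda>n. K * (2 * (1 / 2) ^ n)"])
      (use q(3) in \<open>auto intro!: summable_mult summable_geometric\<close>)
  then have lim: "(\<lambda>n. \<Sum>k<n. q k) \<longlonglongrightarrow> suminf q" by (rule summable_LIMSEQ)
  have inV: "(\<Sum>k<n. q k) \<in> V" for n using q(1) V(1) by (intro subspace_sum)
  have sV: "suminf q \<in> V" by (rule closed_sequentially[OF V(2) inV lim])
  have "(\<lambda>n. D (\<Sum>k<n. q k)) \<longlonglongrightarrow> D (suminf q)" by (rule D.tendsto[OF lim])
  moreover have "D (\<Sum>k<n. q k) = y (s n) - y (s 0)" for n
    using sum_lessThan_telescope[of "\<lambda>n. y (s n)" n] by (simp add: D.sum q(2))
  ultimately have 1: "(\<lambda>n. y (s n) - y (s 0)) \<longlonglongrightarrow> D (suminf q)" by simp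
  have "(\<lambda>n. y (s n) - z) \<longlonglongrightarrow> 0"
    by (rule Lim_null_comparison[OF always_eventually LIMSEQ_realpow_zero[of "1 / 2"]]) (use s in \<open>auto intro: less_imp_le\<close>)
  then have "(\<lambda>n. y (s n)) \<longlonglongrightarrow> z" by (rule LIM_zero_cancel)
  then have "(\<lambda>n. y (s n) - y (s 0)) \<longlonglongrightarrow> z - y (s 0)" by (intro tendsto_diff tendsto_const)
  then have "z = D (suminf q) + D (v (s 0))" using LIMSEQ_unique[OF 1] v(2) by (simp add: algebra_simps)
  also have "\<dots> = D (suminf q + v (s 0))" by (simp add: D.add)
  finally show ?thesis using subspace_add[OF V(1) sV v(1)] by blast
qed

context G_symmetric_operator
begin

text \<open>Failure of positive type yields an approximate eigensequence whose form values have
  limes inferior at most 0; suitable terms of it are fed to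
  \<open>nonpositive_eigenvector\<close>.\<close>

lemma exceptional_eigenvector:
  assumes "t \<in> sigma_pi_plus G A" "t \<notin> sigma_plus G A"
  shows "\<exists>x. x \<noteq> 0 \<and> (x, t *\<^sub>C x) \<in> A \<and> gq x \<le> 0"
proof -
  obtain M where M: "csubspace M" "finite_codim UNIV M" "positive_type_on G A t M" and ap: "t \<in> sigma_ap A"
    using assms(1) by (auto simp: sigma_pi_plus_def)
  have "\<not> positive_type_on G A t UNIV" using assms(2) ap by (simp add: sigma_plus_def)
  then obtain x where x: "approx_eigenseq A t x" "\<not> 0 < liminf (\<lambda>n. ereal (gq (x n)))"
    by (auto simp: positive_type_on_def)
  then obtain u where u: "\<And>n. norm (x n) = 1" "\<And>n. (x n, u n) \<in> A" "(\<lambda>n. u n - t *\<^sub>C x n) \<longlonglongrightarrow> 0"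
    by (auto simp: approx_eigenseq_def)
  have "\<exists>k. gq (x k) \<le> 1 / real (Suc n) \<and> norm (u k - t *\<^sub>C x k) < 1 / real (Suc n)" for n
  proof (rule ccontr)
    assume neg: "\<not> ?thesis"
    have e: "1 / real (Suc n) > 0" by simp
    obtain N where N: "\<And>k. k \<ge> N \<Longrightarrow> norm (u k - t *\<^sub>C x k) < 1 / real (Suc n)"
      using LIMSEQ_D[OF u(3) e] by auto
    then have "1 / real (Suc n) \<le> gq (x k)" if "k \<ge> N" for k using neg that by force
    then have "eventually (\<lambda>k. ereal (1 / real (Suc n)) \<le> ereal (gq (x k))) sequentially"
      unfolding eventually_sequentially by auto
    then have "ereal (1 / real (Suc n)) \<le> liminf (\<lambda>n. ereal (gq (x n)))" by (rule Liminf_bounded)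
    then show False using x(2) e by (metis ereal_less(2) less_le_trans)
  qed
  then obtain k where k: "\<And>n. gq (x (k n)) \<le> 1 / real (Suc n)" "\<And>n. norm (u (k n) - t *\<^sub>C x (k n)) < 1 / real (Suc n)"
    by metis
  have "(\<lambda>n. u (k n) - t *\<^sub>C x (k n)) \<longlonglongrightarrow> 0"
    by (rule Lim_null_comparison[OF always_eventually LIMSEQ_inverse_real_of_nat])
      (use k(2) in \<open>simp add: inverse_eq_divide less_imp_le\<close>)
  then show ?thesis
    using u k by (intro nonpositive_eigenvector[OF positive_type_robust[OF M], of "\<lambda>n. (x (k n), u (k n))"]) auto
qed

text \<open>If exceptional points accumulated at \<open>t\<close>, then \<open>A - t\<close> would be surjective with a
  nontrivial kernel on the closed span of the corresponding nonpositive eigenvectors. Kernels of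
  surjective operators are stable, so \<open>A\<close> would have nonreal eigenvalues close to \<open>t\<close>.\<close>

lemma exceptional_points_isolated:
  fixes \<tau> :: "nat \<Rightarrow> real"
  assumes M: "robust M (of_real t)" and \<tau>: "inj \<tau>" "\<And>n. \<tau> n \<noteq> t" "\<tau> \<longlonglongrightarrow> t"
    and x: "\<And>n. x n \<noteq> 0" "\<And>n. (x n, of_real (\<tau> n) *\<^sub>C x n) \<in> A" "\<And>n. gq (x n) \<le> 0"
    and e: "e > 0" "\<And>l. l \<in> ball (of_real t) e \<Longrightarrow> Im l \<noteq> 0 \<Longrightarrow> l \<in> rho UNIV"
  shows False
proof -
  let ?t = "complex_of_real t"
  obtain e0 d C where Ms: "csubspace M" "closed M" "M \<subseteq> A" "finite_codim A M" and dC: "d > 0" "C > 0" "e0 > 0"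
    and ineq0: "\<forall>l\<in>ball ?t e0. \<forall>(x, u)\<in>M. d * (norm x)\<^sup>2 \<le> gq x + C * (norm (u - l *\<^sub>C x))\<^sup>2"
    using M unfolding robust_def by blast
  have ineq: "d * (norm (fst w))\<^sup>2 \<le> gq (fst w) + C * (norm (snd w - ?t *\<^sub>C fst w))\<^sup>2" if "w \<in> M" for w
    using ineq0 dC(3) that by (force simp: case_prod_beta)
  \<comment> \<open>Eigenvectors for distinct real eigenvalues are orthogonal in the form, so the
    form is nonpositive on their whole span.\<close>
  have orth: "gi (x n) (x k) = 0" if "n \<noteq> k" for n k
  proof -
    have "gi (of_real (\<tau> n) *\<^sub>C x n) (x k) = gi (x n) (of_real (\<tau> k) *\<^sub>C x k)" by (rule gi_A[OF x(2) x(2)])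
    then have "complex_of_real (\<tau> n - \<tau> k) * gi (x n) (x k) = 0" by (simp add: gi_algebra algebra_simps)
    then show ?thesis using that \<tau>(1) by (auto simp: inj_def)
  qed
  define p where "p n = (x n, complex_of_real (\<tau> n) *\<^sub>C x n)" for n
  define Z where "Z = {\<Sum>n<N. c n *\<^sub>C p n | c N. True}"
  have Z_sub: "csubspace Z"
    unfolding complex_vector.subspace_def
  proof (intro conjI allI ballI)
    show "0 \<in> Z" unfolding Z_def by (intro CollectI exI[of _ "\<lambda>_. 0"] exI[of _ 0]) simp
  next
    fix a b assume "a \<in> Z" "b \<in> Z"
    then obtain c N c' N' where ab: "a = (\<Sum>n<N. c n *\<^sub>C p n)" "b = (\<Sum>n<N'. c' n *\<^sub>C p n)" by (auto simp: Z_def)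
    have ext: "(\<Sum>n<K. c n *\<^sub>C p n) = (\<Sum>n<max N N'. (if n < K then c n else 0) *\<^sub>C p n)" if "K \<le> max N N'" for K c
    proof -
      have "(\<Sum>n<max N N'. (if n < K then c n else 0) *\<^sub>C p n) = (\<Sum>n<K. (if n < K then c n else 0) *\<^sub>C p n)"
        by (rule sum.mono_neutral_right) (use that in auto)
      then show ?thesis by simp
    qed
    have "a + b = (\<Sum>n<max N N'. ((if n < N then c n else 0) + (if n < N' then c' n else 0)) *\<^sub>C p n)"
      unfolding ab ext[of N, simplified] ext[of N', simplified] by (simp only: sum.distrib[symmetric] scaleC_add_left)
    then show "a + b \<in> Z" by (auto simp: Z_def)
  next
    fix k a assume "a \<in> Z"
    then obtain c N where "a = (\<Sum>n<N. c n *\<^sub>C p n)" by (auto simp: Z_def)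
    then have "k *\<^sub>C a = (\<Sum>n<N. (k * c n) *\<^sub>C p n)" by (simp only: scaleC_sum_right scaleC_scaleC)
    then show "k *\<^sub>C a \<in> Z" by (auto simp: Z_def)
  qed
  have Z_A: "Z \<subseteq> A"
  proof -
    have "p n \<in> A" for n using x(2) by (simp add: p_def)
    then have "(\<Sum>n<N. c n *\<^sub>C p n) \<in> A" for c N
      by (intro complex_vector.subspace_sum[OF A_csubspace] complex_vector.subspace_scale[OF A_csubspace])
    then show ?thesis by (auto simp: Z_def)
  qed
  have fst_p: "fst (\<Sum>n<N. c n *\<^sub>C p n) = (\<Sum>n<N. c n *\<^sub>C x n)" for c N
    by (induction N) (auto simp: p_def)
  have Z_nonpos: "gq (fst a) \<le> 0" if aZ: "a \<in> Z" for a
  proof -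
    obtain c N where a: "a = (\<Sum>n<N. c n *\<^sub>C p n)" using aZ by (auto simp: Z_def)
    have "gi (fst a) (fst a) = (\<Sum>n<N. \<Sum>k<N. c n * (cnj (c k) * gi (x n) (x k)))"
      unfolding a fst_p gi_sum_left gi_sum_right gi_scale_left gi_scale_right sum_distrib_left
      by (subst sum.swap) (simp add: mult_ac)
    also have "\<dots> = (\<Sum>n<N. \<Sum>k<N. if k = n then c n * cnj (c n) * gi (x n) (x n) else 0)"
      by (intro sum.cong refl) (auto simp: orth)
    also have "\<dots> = (\<Sum>n<N. gi (c n *\<^sub>C x n) (c n *\<^sub>C x n))" by (simp add: sum.delta gi_algebra mult_ac)
    finally have "gq (fst a) = (\<Sum>n<N. (cmod (c n))\<^sup>2 * gq (x n))" by (simp only: Re_sum gq_scaleC)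
    also have "\<dots> \<le> 0" using x(3) by (intro sum_nonpos mult_nonneg_nonpos) auto
    finally show ?thesis .
  qed
  define V where "V = closure Z"
  have V: "csubspace V" "closed V" "V \<subseteq> A"
    unfolding V_def using csubspace_closure[OF Z_sub] closure_minimal[OF Z_A A_closed] by auto
  have V_nonpos: "gq (fst a) \<le> 0" if a: "a \<in> V" for a
  proof -
    obtain z where z: "\<And>n. z n \<in> Z" "z \<longlonglongrightarrow> a" using a unfolding V_def closure_sequential by blast
    have "(\<lambda>n. gq (fst (z n))) \<longlonglongrightarrow> gq (fst a)" by (intro tendsto_intros z(2))
    then show ?thesis using LIMSEQ_le_const2[of "\<lambda>n. gq (fst (z n))"] Z_nonpos z(1) by blast
  qed
  define D :: "'a \<times> 'a \<Rightarrow> 'a" where "D q = snd q - ?t *\<^sub>C fst q" for q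
  have D: "bounded_linear D"
    unfolding D_def
    by (intro bounded_linear_sub bounded_linear_snd bounded_linear_compose[OF bounded_linear_scaleC_right bounded_linear_fst])
  interpret D: bounded_linear D by (rule D)
  have VM: "csubspace (V \<inter> M)" "closed (V \<inter> M)" "V \<inter> M \<subseteq> V"
    using V Ms complex_vector.subspace_inter by auto
  have VMc: "finite_codim V (V \<inter> M)"
  proof -
    have "finite_codim V {q \<in> V. id q \<in> M}"
      by (rule finite_codim_preimage[OF V(1) A_csubspace Ms(1) _ _ _ Ms(4)]) (use V(3) in auto)
    then show ?thesis by (simp add: Int_def)
  qed
  define c where "c = sqrt (C / d)"
  \<comment> \<open>On \<open>V\<close> the form is at most 0, so the robust inequality reduces to a
    lower bound for \<open>D\<close> on \<open>V \<inter> M\<close>, even in the graph norm.\<close>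
  have below: "norm w \<le> (c + (1 + cmod ?t * c)) * norm (D w)" if w: "w \<in> V \<inter> M" for w
  proof -
    have "d * (norm (fst w))\<^sup>2 \<le> C * (norm (D w))\<^sup>2" using ineq[of w] V_nonpos[of w] w by (simp add: D_def)
    then have "(norm (fst w))\<^sup>2 \<le> C / d * (norm (D w))\<^sup>2" using dC(1) by (simp add: field_simps)
    also have "\<dots> = (c * norm (D w))\<^sup>2" using dC by (simp add: c_def power_mult_distrib)
    finally have "(norm (fst w))\<^sup>2 \<le> (c * norm (D w))\<^sup>2" .
    moreover have "0 \<le> c * norm (D w)" using dC by (simp add: c_def)
    ultimately have f: "norm (fst w) \<le> c * norm (D w)" by (rule power2_le_imp_le)
    have "norm (snd w) \<le> norm (D w) + norm (?t *\<^sub>C fst w)" unfolding D_def by (metis diff_add_cancel norm_triangle_ineq)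
    also have "\<dots> \<le> norm (D w) + cmod ?t * (c * norm (D w))"
      using f unfolding norm_scaleC by (intro add_left_mono mult_left_mono) auto
    finally have "norm (snd w) \<le> (1 + cmod ?t * c) * norm (D w)" by (simp add: algebra_simps)
    moreover have "norm w \<le> norm (fst w) + norm (snd w)" by (metis norm_Pair_le prod.collapse)
    ultimately show ?thesis using f by (simp add: distrib_right)
  qed
  obtain K where K: "K > 0" "\<And>v. v \<in> V \<Longrightarrow> \<exists>v'\<in>V. D v' = D v \<and> norm v' \<le> K * norm (D v)"
    using finite_codim_bounded_below[OF V(1,2) VM VMc D below] by blast
  have pZ: "p n \<in> Z" for n
  proof -
    have "p n = (\<Sum>k<Suc n. (if k = n then 1 else 0) *\<^sub>C p k)" by simp
    then show ?thesis
      unfolding Z_def by (intro CollectI exI[of _ "\<lambda>k. if k = n then 1 else 0"] exI[of _ "Suc n"]) simp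
  qed
  have ZV: "Z \<subseteq> V" by (simp add: V_def closure_subset)
  have Dp: "D (p n) = of_real (\<tau> n - t) *\<^sub>C x n" for n by (simp add: D_def p_def scaleC_diff_left)
  \<comment> \<open>If \<open>D\<close> were injective on \<open>V\<close>, it would be bounded
    below by 1 / K. But \<open>D\<close> multiplies the first component of \<open>p n\<close> by
    \<open>\<tau> n - t\<close>, which tends to 0.\<close>
  have "\<exists>q\<in>V. D q = 0 \<and> q \<noteq> 0"
  proof (rule ccontr)
    assume neg: "\<not> ?thesis"
    have inj: "v' = v" if "v \<in> V" "v' \<in> V" "D v' = D v" for v v'
      using neg complex_vector.subspace_diff[OF V(1) that(2,1)] that(3) by (metis D.diff eq_iff_diff_eq_0)
    have "1 \<le> K * \<bar>\<tau> n - t\<bar>" for n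
    proof -
      have "norm (p n) \<le> K * norm (D (p n))" using K(2)[of "p n"] inj pZ ZV by blast
      also have "\<dots> = K * \<bar>\<tau> n - t\<bar> * norm (x n)" by (simp add: Dp norm_scaleC flip: of_real_diff)
      finally have "norm (x n) \<le> K * \<bar>\<tau> n - t\<bar> * norm (x n)"
        using norm_fst_le[of "x n" "complex_of_real (\<tau> n) *\<^sub>C x n"] unfolding p_def by linarith
      then show ?thesis using x(1)[of n] by simp
    qed
    moreover have "(\<lambda>n. K * \<bar>\<tau> n - t\<bar>) \<longlonglongrightarrow> K * \<bar>t - t\<bar>" by (intro tendsto_intros \<tau>(3))
    ultimately show False using LIMSEQ_le_const[of "\<lambda>n. K * \<bar>\<tau> n - t\<bar>" "K * \<bar>t - t\<bar>" 1] by force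
  qed
  then obtain q0 where q0: "q0 \<in> V" "D q0 = 0" "q0 \<noteq> 0" by blast
  have f0: "fst q0 \<noteq> 0" using q0(2,3) by (auto simp: D_def prod_eq_iff)
  \<comment> \<open>The first components of the generators are hit by \<open>D\<close> because every
    \<open>\<tau> n\<close> differs from \<open>t\<close>; the closed range then covers all of
    \<open>V\<close>.\<close>
  have range_Z: "fst a \<in> D ` V" if aZ: "a \<in> Z" for a
  proof -
    obtain c N where a: "a = (\<Sum>n<N. c n *\<^sub>C p n)" using aZ by (auto simp: Z_def)
    define b where "b = (\<Sum>n<N. (c n / of_real (\<tau> n - t)) *\<^sub>C p n)"
    have "b \<in> Z"
      unfolding b_def Z_def by (intro CollectI exI[of _ "\<lambda>n. c n / of_real (\<tau> n - t)"] exI[of _ N]) simp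
    moreover have "D b = fst a"
    proof -
      have Dscale: "D (k *\<^sub>C q) = k *\<^sub>C D q" for k q by (simp add: D_def scaleC_diff_right mult.commute)
      have "D b = (\<Sum>n<N. c n *\<^sub>C x n)"
        unfolding b_def D.sum Dscale Dp scaleC_scaleC using \<tau>(2) by (intro sum.cong refl) simp
      then show ?thesis by (simp add: a fst_p)
    qed
    ultimately show ?thesis using ZV by (metis image_eqI subsetD)
  qed
  have sV: "subspace V" using csubspace_imp_subspace V(1) by blast
  have range_V: "\<exists>q\<in>V. D q = fst a \<and> norm q \<le> K * norm (fst a)" if a: "a \<in> V" for a
  proof -
    obtain z where z: "\<And>n. z n \<in> Z" "z \<longlonglongrightarrow> a" using a unfolding V_def closure_sequential by blast
    have "fst a \<in> D ` V"
      by (rule closed_range_from_bounded_solutions[OF sV V(2) D K(2,1) range_Z[OF z(1)] tendsto_fst[OF z(2)]])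
    then obtain v where "v \<in> V" "D v = fst a" by auto
    then show ?thesis using K(2)[of v] by simp
  qed
  define step where "step a = (SOME q. q \<in> V \<and> D q = fst a \<and> norm q \<le> K * norm (fst a))" for a :: "'a \<times> 'a"
  have step: "step a \<in> V" "D (step a) = fst a" "norm (step a) \<le> K * norm (fst a)" if "a \<in> V" for a
    using someI_ex[of "\<lambda>q. q \<in> V \<and> D q = fst a \<and> norm q \<le> K * norm (fst a)"] range_V[OF that]
    unfolding step_def by blast+
  define q where "q n = (step ^^ n) q0" for n
  have qV: "q n \<in> V" for n by (induction n) (auto simp: q_def q0 step)
  have q_Suc: "D (q (Suc n)) = fst (q n)" "norm (q (Suc n)) \<le> K * norm (q n)" for n
  proof -
    show "D (q (Suc n)) = fst (q n)" using step(2)[OF qV] by (simp add: q_def)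
    have "norm (q (Suc n)) \<le> K * norm (fst (q n))" using step(3)[OF qV] by (simp add: q_def)
    also have "\<dots> \<le> K * norm (q n)"
      using K(1) norm_fst_le[of "fst (q n)" "snd (q n)"] by (intro mult_left_mono) auto
    finally show "norm (q (Suc n)) \<le> K * norm (q n)" .
  qed
  have q_norm: "norm (q n) \<le> K ^ n * norm q0" for n
  proof (induction n)
    case (Suc n)
    have "norm (q (Suc n)) \<le> K * norm (q n)" by (rule q_Suc(2))
    also have "\<dots> \<le> K * (K ^ n * norm q0)" using Suc K(1) by (intro mult_left_mono) auto
    finally show ?case by (simp add: mult.assoc)
  qed (simp add: q_def)
  define P where "P = norm q0 + 1"
  define F where "F = norm (fst q0)"
  have F: "0 < F" "F \<le> norm q0" using f0 norm_fst_le[of "fst q0" "snd q0"] by (auto simp: F_def)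
  have P: "P > 0" "norm q0 \<le> P" by (auto simp: P_def add_nonneg_pos)
  \<comment> \<open>The bound e / 2 keeps t + i \<eta> among the resolvent points. The other one
    gives \<open>\<eta> * K <= 1 / 4\<close> and
    \<open>\<eta> * K * norm q0 <= norm (fst q0) / 4\<close>, so the series below converges and its
    tail cannot cancel its first term.\<close>
  define \<eta> where "\<eta> = min (e / 2) (F / (4 * K * P))"
  have \<eta>: "\<eta> > 0" unfolding \<eta>_def using e(1) F K(1) P by simp
  have "\<eta> * K \<le> F / (4 * K * P) * K" using K(1) by (intro mult_right_mono) (auto simp: \<eta>_def)
  also have "\<dots> = F / (4 * P)" using K(1) by simp
  finally have \<eta>K: "\<eta> * K \<le> F / (4 * P)" .
  have \<eta>K2: "\<eta> * K \<le> 1 / 4" "\<eta> * K * norm q0 \<le> 1 / 4 * norm (fst q0)"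
  proof -
    have "F / (4 * P) \<le> 1 / 4" using F P by (simp add: field_simps)
    then show "\<eta> * K \<le> 1 / 4" using \<eta>K by linarith
    have "\<eta> * K * norm q0 \<le> F / (4 * P) * P" using \<eta>K P F \<eta> K(1) by (intro mult_mono) auto
    also have "\<dots> = 1 / 4 * F" using P by simp
    finally show "\<eta> * K * norm q0 \<le> 1 / 4 * norm (fst q0)" by (simp add: F_def)
  qed
  \<comment> \<open>The kernel vector \<open>q0\<close> is continued to the point t + i \<eta> by a
    power series: since \<open>D (q (Suc n)) = fst (q n)\<close>, the sum y satisfies D y = i \<eta>
    times the first component of y.\<close>
  define z where "z n = (\<i> * of_real \<eta>) ^ n *\<^sub>C q n" for n
  have z_norm: "norm (z n) \<le> (1 / 4) ^ n * norm q0" for n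
  proof -
    have "norm (z n) = \<eta> ^ n * norm (q n)" using \<eta> by (simp add: z_def norm_scaleC norm_power norm_mult)
    also have "\<dots> \<le> \<eta> ^ n * (K ^ n * norm q0)" using q_norm \<eta> by (intro mult_left_mono) auto
    also have "\<dots> = (\<eta> * K) ^ n * norm q0" by (simp add: power_mult_distrib)
    also have "\<dots> \<le> (1 / 4) ^ n * norm q0" using \<eta>K2 \<eta> K(1) by (intro mult_right_mono power_mono) auto
    finally show ?thesis .
  qed
  have sz: "summable (\<lambda>n. norm (z n))"
    by (rule summable_comparison_test[of _ "\<lambda>n. (1 / 4) ^ n * norm q0"])
      (use z_norm in \<open>auto intro!: summable_mult2 summable_geometric\<close>)
  then have szv: "summable z" by (rule summable_norm_cancel)
  define y where "y = suminf z"
  have lim: "(\<lambda>n. \<Sum>k<n. z k) \<longlonglongrightarrow> y" unfolding y_def by (rule summable_LIMSEQ[OF szv])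
  have zV: "z n \<in> V" for n unfolding z_def using qV complex_vector.subspace_scale[OF V(1)] by blast
  have yV: "y \<in> V" by (rule closed_sequentially[OF V(2) _ lim]) (rule complex_vector.subspace_sum[OF V(1) zV])
  let ?l = "?t + \<i> * of_real \<eta>"
  have "D y = (\<i> * of_real \<eta>) *\<^sub>C fst y"
  proof (rule LIMSEQ_unique)
    show "(\<lambda>n. D (\<Sum>k<Suc n. z k)) \<longlonglongrightarrow> D y" by (rule D.tendsto[OF LIMSEQ_Suc[OF lim]])
    have "D (\<Sum>k<Suc n. z k) = (\<i> * of_real \<eta>) *\<^sub>C fst (\<Sum>k<n. z k)" for n
    proof -
      have Dscale: "D (k *\<^sub>C q) = k *\<^sub>C D q" for k q by (simp add: D_def scaleC_diff_right mult.commute)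
      have 1: "D (\<Sum>k<Suc n. z k) = D (z 0) + (\<Sum>k<n. D (z (Suc k)))"
        by (simp only: sum.lessThan_Suc_shift D.add D.sum)
      have 2: "D (z 0) = 0" by (simp add: z_def q_def q0)
      have 3: "D (z (Suc k)) = (\<i> * of_real \<eta>) *\<^sub>C fst (z k)" for k
        unfolding z_def Dscale q_Suc by (simp add: scaleC_scaleC)
      show ?thesis unfolding 1 2 3 by (simp add: fst_sum scaleC_sum_right)
    qed
    then show "(\<lambda>n. D (\<Sum>k<Suc n. z k)) \<longlonglongrightarrow> (\<i> * of_real \<eta>) *\<^sub>C fst y"
      by (simp only:) (intro tendsto_intros tendsto_fst[OF lim])
  qed
  then have "snd y = ?l *\<^sub>C fst y" by (simp add: D_def scaleC_add_left algebra_simps)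
  then have yA: "(fst y, ?l *\<^sub>C fst y) \<in> A" using yV V(3) by (metis prod.collapse subsetD)
  have "?l \<in> rho UNIV" using \<eta> by (intro e(2)) (auto simp: dist_norm norm_mult \<eta>_def)
  then have fst_y: "fst y = 0"
    using R_eq[of ?l UNIV "fst y" "?l *\<^sub>C fst y"] R_scale[of ?l UNIV 0 0] yA by simp
  \<comment> \<open>The tail is at most a geometric series with sum (1 / 4) (4 / 3) = 1 / 3 of
    \<open>norm (fst q0)\<close>, so the first component of \<open>y\<close> cannot vanish.\<close>
  have y_q0: "norm (y - q0) \<le> 1 / 3 * norm (fst q0)"
  proof -
    have z_Suc: "norm (z (Suc n)) \<le> (1 / 4) ^ n * (1 / 4 * norm (fst q0))" for n
    proof -
      have "norm (z (Suc n)) = \<eta> ^ Suc n * norm (q (Suc n))" using \<eta> by (simp add: z_def norm_scaleC norm_power norm_mult)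
      also have "\<dots> \<le> \<eta> ^ Suc n * (K ^ Suc n * norm q0)" using \<eta> by (intro mult_left_mono q_norm) auto
      also have "\<dots> = (\<eta> * K) ^ n * (\<eta> * K * norm q0)" by (simp add: power_mult_distrib mult_ac)
      also have "\<dots> \<le> (1 / 4) ^ n * (1 / 4 * norm (fst q0))"
        using \<eta> K(1) by (intro mult_mono[OF power_mono[OF \<eta>K2(1)] \<eta>K2(2)]) auto
      finally show ?thesis .
    qed
    have sz1: "summable (\<lambda>n. norm (z (Suc n)))" using sz summable_Suc_iff[of "\<lambda>n. norm (z n)"] by simp
    have "z 0 = q0" by (simp add: z_def q_def)
    then have "y - q0 = (\<Sum>n. z (Suc n))" using suminf_split_head[OF szv] by (simp add: y_def)
    also have "norm \<dots> \<le> (\<Sum>n. norm (z (Suc n)))"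
      by (rule summable_norm[OF sz1])
    also have "\<dots> \<le> (\<Sum>n. (1 / 4) ^ n * (1 / 4 * norm (fst q0)))"
      by (intro suminf_le z_Suc sz1 summable_mult2 summable_geometric) simp
    also have "\<dots> = (\<Sum>n. (1 / 4) ^ n) * (1 / 4 * norm (fst q0))"
      by (rule suminf_mult2[symmetric]) (simp add: summable_geometric)
    also have "(\<Sum>n. (1 / 4 :: real) ^ n) = 4 / 3" using suminf_geometric[of "1 / 4 :: real"] by simp
    finally show ?thesis by simp
  qed
  have "norm (fst y - fst q0) \<le> norm (y - q0)"
    using norm_fst_le[of "fst (y - q0)" "snd (y - q0)"] unfolding prod.collapse by simp
  then have "F \<le> norm (y - q0)" by (simp add: fst_y F_def)
  then show False using F(1) y_q0 unfolding F_def by linarith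
qed

end

section \<open>Commuting projections\<close>

context closed_operator
begin

lemma kernel_invariant:
  assumes T: "bounded_clinear T" "commutes_with T A"
  shows "invariant {x. T x = 0}"
proof -
  have "csubspace {x. T x = 0}"
    unfolding complex_vector.subspace_def by (simp add: bounded_clinearD[OF T(1)])
  moreover have "closed {x. T x = 0}"
    by (intro closed_Collect_eq linear_continuous_on bounded_clinearD[OF T(1)] continuous_on_const)
  moreover have "T u = 0" if "(x, u) \<in> A" "T x = 0" for x u
  proof -
    have "(T x, T u) \<in> A" using T(2) that(1) by (auto simp: commutes_with_def)
    then show ?thesis using that(2) A_unique[OF _ A_zero] by simp
  qed
  ultimately show ?thesis by (auto simp: invariant_def)
qed

lemma rho_inter_kernel:
  assumes T: "bounded_clinear T" "commutes_with T A" and N: "invariant N" "\<And>x. x \<in> N \<Longrightarrow> T x \<in> N"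
    and l: "l \<in> rho N"
  shows "l \<in> rho (N \<inter> {x. T x = 0})"
proof (rule rho_subspace[OF l invariant_Int[OF N(1) kernel_invariant[OF T]]])
  fix y assume y: "y \<in> N \<inter> {x. T x = 0}"
  have "T (R N l y) = R N l (T y)"
    by (rule R_intertwine[OF l l]) (use y N(2) T in \<open>auto simp: bounded_clinearD commutes_with_def\<close>)
  also have "\<dots> = 0" using y R_scale[OF l _ invariantD(1)[OF N(1)], of y 0] by simp
  finally show "R N l y \<in> N \<inter> {x. T x = 0}" using R_in(1)[OF l] y by simp
qed auto

lemma R_bounded_clinear:
  assumes "l \<in> rho UNIV"
  shows "bounded_clinear (R UNIV l)"
proof -
  obtain K where "\<And>y. norm (R UNIV l y) \<le> K * norm y" using R_bound[OF assms] by (metis UNIV_I)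
  then show ?thesis
    by (intro bounded_clinearI) (simp_all add: R_add[OF assms] R_scale[OF assms])
qed

lemma R_commutes_with: 
  assumes l: "l \<in> rho UNIV"
  shows "commutes_with (R UNIV l) A"
  unfolding commutes_with_def
proof (clarify)
  fix x u assume x: "(x, u) \<in> A"
  have "R UNIV l u = x + l *\<^sub>C R UNIV l x"
    using R_eq[OF l x] R_diff[OF l, of u "l *\<^sub>C x"] R_scale[OF l, of x l] by (simp add: algebra_simps)
  then show "(R UNIV l x, R UNIV l u) \<in> A" using R_in(2)[OF l, of x] by simp
qed

lemma projection_range: "P \<circ> P = P \<Longrightarrow> range P = {x. P x = x}"
  by (auto simp: fun_eq_iff) (metis rangeI)

lemma complement_range:
  assumes "bounded_projection P"
  shows "range (\<lambda>x. x - P x) = {x. P x = 0}"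
proof -
  have P: "bounded_clinear P" "P (P x) = P x" for x
    using assms by (auto simp: bounded_projection_def fun_eq_iff)
  have "P (x - P x) = 0" for x by (simp add: bounded_clinearD(4)[OF P(1)] P(2))
  moreover have "x \<in> range (\<lambda>x. x - P x)" if "P x = 0" for x
    using that by (intro range_eqI[of _ _ x]) simp
  ultimately show ?thesis by auto
qed

lemma bounded_clinear_compose:
  "bounded_clinear P \<Longrightarrow> bounded_clinear Q \<Longrightarrow> bounded_clinear (\<lambda>x. P (Q x))"
  by (auto simp: bounded_clinear_def intro: bounded_linear_compose)

lemma bounded_clinear_id_minus: "bounded_clinear P \<Longrightarrow> bounded_clinear (\<lambda>x. x - P x)"
  by (auto simp: bounded_clinear_def scaleC_diff_right intro: bounded_linear_sub bounded_linear_ident)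

lemma commutes_id_minus: "commutes_with P A \<Longrightarrow> commutes_with (\<lambda>x. x - P x) A"
  by (auto simp: commutes_with_def intro: A_diff)

lemma projection_bounded_projection_complement:
  "bounded_projection P \<Longrightarrow> bounded_projection (\<lambda>x. x - P x)"
  by (auto simp: bounded_projection_def bounded_clinear_id_minus fun_eq_iff bounded_clinearD)

lemma range_invariant:
  assumes "bounded_projection P" "commutes_with P A"
  shows "invariant (range P)"
proof -
  have "range P = {x. x - P x = 0}"
    using assms(1) projection_range[of P] by (auto simp: bounded_projection_def)
  then show ?thesis
    using kernel_invariant[OF bounded_clinear_id_minus commutes_id_minus, of P] assms
    by (simp add: bounded_projection_def)
qed

lemma rho_range:
  assumes P: "bounded_projection P" "commutes_with P A" and N: "invariant N" "range P \<subseteq> N" and l: "l \<in> rho N"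
  shows "l \<in> rho (range P)"
proof (rule rho_subspace[OF l range_invariant[OF P] N(2)])
  fix y assume y: "y \<in> range P"
  have Py: "P y = y" using y P(1) by (auto simp: bounded_projection_def fun_eq_iff)
  have "P (R N l y) = R N l (P y)"
    by (rule R_intertwine[OF l l])
      (use y N(2) P in \<open>auto simp: bounded_clinearD commutes_with_def bounded_projection_def\<close>)
  then show "R N l y \<in> range P" using Py by (metis rangeI)
qed

lemma rho_range_UNIV:
  "bounded_projection P \<Longrightarrow> commutes_with P A \<Longrightarrow> l \<in> rho UNIV \<Longrightarrow> l \<in> rho (range P)"
  using rho_range[OF _ _ invariant_UNIV] by blast

lemma rho_range_sum:
  assumes P: "bounded_projection P" "commutes_with P A" and Q: "bounded_projection Q" "commutes_with Q A"
    and PQ: "\<And>x. P (Q x) = 0" "\<And>x. Q (P x) = 0"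
    and l: "l \<in> rho (range P)" "l \<in> rho (range Q)"
    and E: "bounded_projection E" "commutes_with E A" "\<And>x. E x = P x + Q x"
  shows "l \<in> rho (range E)"
proof -
  obtain KP where KP: "KP > 0" "\<And>y. y \<in> range P \<Longrightarrow> norm (R (range P) l y) \<le> KP * norm y" using R_bound[OF l(1)] by metis
  obtain KQ where KQ: "KQ > 0" "\<And>y. y \<in> range Q \<Longrightarrow> norm (R (range Q) l y) \<le> KQ * norm y" using R_bound[OF l(2)] by metis
  have Pb: "bounded_clinear P" "bounded_clinear Q" and PP: "P (P x) = P x" "Q (Q x) = Q x" for x
    using P(1) Q(1) by (auto simp: bounded_projection_def fun_eq_iff)
  obtain NP where NP: "NP > 0" "\<And>x. norm (P x) \<le> norm x * NP"
    using bounded_linear.pos_bounded[OF bounded_clinearD(1)[OF Pb(1)]] by blast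
  obtain NQ where NQ: "NQ > 0" "\<And>x. norm (Q x) \<le> norm x * NQ"
    using bounded_linear.pos_bounded[OF bounded_clinearD(1)[OF Pb(2)]] by blast
  show ?thesis
  proof (rule rhoI[OF range_invariant[OF E(1,2)]])
    fix y assume "y \<in> range E"
    then have y: "y = P y + Q y"
      using E(1,3) by (auto simp: bounded_projection_def fun_eq_iff bounded_clinearD[OF Pb(1)] bounded_clinearD[OF Pb(2)] PP PQ)
    define x where "x = R (range P) l (P y) + R (range Q) l (Q y)"
    have r: "R (range P) l (P y) \<in> range P" "(R (range P) l (P y), P y + l *\<^sub>C R (range P) l (P y)) \<in> A"
      "R (range Q) l (Q y) \<in> range Q" "(R (range Q) l (Q y), Q y + l *\<^sub>C R (range Q) l (Q y)) \<in> A"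
      using R_in[OF l(1)] R_in[OF l(2)] by auto
    have "E x = x"
      using r(1,3) by (auto simp: x_def E(3) bounded_clinearD[OF Pb(1)] bounded_clinearD[OF Pb(2)] PP PQ)
    then have "x \<in> range E" by (metis rangeI)
    moreover have "(x, y + l *\<^sub>C x) \<in> A"
      using A_add[OF r(2,4)] y by (simp add: x_def scaleC_add_right algebra_simps) (metis add.assoc)
    ultimately show "\<exists>x\<in>range E. (x, y + l *\<^sub>C x) \<in> A" by blast
  next
    fix x u assume x: "(x, u) \<in> A" "x \<in> range E"
    have xx: "x = P x + Q x"
      using x(2) E(1,3) by (auto simp: bounded_projection_def fun_eq_iff bounded_clinearD[OF Pb(1)] bounded_clinearD[OF Pb(2)] PP PQ)
    have xP: "(P x, P u) \<in> A" "(Q x, Q u) \<in> A" using x(1) P(2) Q(2) by (auto simp: commutes_with_def)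
    have "norm (P x) \<le> KP * (norm (u - l *\<^sub>C x) * NP)"
    proof -
      have "P x = R (range P) l (P u - l *\<^sub>C P x)"
        using R_eq[OF l(1) xP(1) _ invariantD(1)[OF range_invariant[OF P]]] by simp
      also have "P u - l *\<^sub>C P x = P (u - l *\<^sub>C x)" by (simp add: bounded_clinearD[OF Pb(1)])
      finally have "norm (P x) \<le> KP * norm (P (u - l *\<^sub>C x))" using KP(2) by (metis rangeI)
      also have "\<dots> \<le> KP * (norm (u - l *\<^sub>C x) * NP)" using NP(2) KP(1) by (intro mult_left_mono) auto
      finally show ?thesis .
    qed
    moreover have "norm (Q x) \<le> KQ * (norm (u - l *\<^sub>C x) * NQ)"
    proof -
      have "Q x = R (range Q) l (Q u - l *\<^sub>C Q x)"
        using R_eq[OF l(2) xP(2) _ invariantD(1)[OF range_invariant[OF Q]]] by simp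
      also have "Q u - l *\<^sub>C Q x = Q (u - l *\<^sub>C x)" by (simp add: bounded_clinearD[OF Pb(2)])
      finally have "norm (Q x) \<le> KQ * norm (Q (u - l *\<^sub>C x))" using KQ(2) by (metis rangeI)
      also have "\<dots> \<le> KQ * (norm (u - l *\<^sub>C x) * NQ)" using NQ(2) KQ(1) by (intro mult_left_mono) auto
      finally show ?thesis .
    qed
    moreover have "norm x \<le> norm (P x) + norm (Q x)" using xx norm_triangle_ineq by metis
    ultimately show "norm x \<le> (KP * NP + KQ * NQ) * norm (u - l *\<^sub>C x)" by (simp add: algebra_simps)
  qed
qed

end

context G_symmetric_operator
begin

text \<open>Commuting with every bounded operator that commutes with \<open>A\<close> makes any two
  of these projections commute, which is what Boolean operations on them rest on.\<close>

definition spectral_projection :: "('a \<Rightarrow> 'a) \<Rightarrow> bool"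
  where "spectral_projection P \<longleftrightarrow> bounded_projection P \<and> commutes_with P A \<and>
    (\<forall>x y. gi (P x) y = gi x (P y)) \<and>
    (\<forall>T. bounded_clinear T \<longrightarrow> commutes_with T A \<longrightarrow> (\<forall>x. T (P x) = P (T x)))"

lemma spectral_projectionD:
  assumes "spectral_projection P"
  shows "bounded_projection P" "bounded_clinear P" "P (P x) = P x" "commutes_with P A"
    "gi (P x) y = gi x (P y)"
    "bounded_clinear T \<Longrightarrow> commutes_with T A \<Longrightarrow> T (P x) = P (T x)"
  using assms by (auto simp: spectral_projection_def bounded_projection_def fun_eq_iff)

lemma spectral_projection_commute:
  "spectral_projection P \<Longrightarrow> spectral_projection Q \<Longrightarrow> P (Q x) = Q (P x)"
  using spectral_projectionD by metis

lemma spectral_projection_compose: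
  assumes P: "spectral_projection P" and Q: "spectral_projection Q"
  shows "spectral_projection (\<lambda>x. P (Q x))"
  unfolding spectral_projection_def bounded_projection_def
proof (intro conjI allI impI)
  show "bounded_clinear (\<lambda>x. P (Q x))"
    by (rule bounded_clinear_compose[OF spectral_projectionD(2)[OF P] spectral_projectionD(2)[OF Q]])
  show "(\<lambda>x. P (Q x)) \<circ> (\<lambda>x. P (Q x)) = (\<lambda>x. P (Q x))"
  proof (rule ext)
    fix x
    have "P (Q (P (Q x))) = P (P (Q (Q x)))"
      unfolding spectral_projection_commute[OF P Q, of "Q x", symmetric] ..
    then show "((\<lambda>x. P (Q x)) \<circ> (\<lambda>x. P (Q x))) x = P (Q x)"
      using spectral_projectionD(3)[OF P] spectral_projectionD(3)[OF Q] by simp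
  qed
  show "commutes_with (\<lambda>x. P (Q x)) A"
    using spectral_projectionD(4)[OF P] spectral_projectionD(4)[OF Q] by (auto simp: commutes_with_def)
  show "gi (P (Q x)) y = gi x (P (Q y))" for x y
    using spectral_projectionD(5)[OF P] spectral_projectionD(5)[OF Q] spectral_projection_commute[OF P Q] by metis
  show "T (P (Q x)) = P (Q (T x))" if "bounded_clinear T" "commutes_with T A" for T x
    using spectral_projectionD(6)[OF P that] spectral_projectionD(6)[OF Q that] by metis
qed

lemma spectral_projection_complement:
  assumes P: "spectral_projection P"
  shows "spectral_projection (\<lambda>x. x - P x)"
  unfolding spectral_projection_def
  using projection_bounded_projection_complement[OF spectral_projectionD(1)[OF P]]
    commutes_id_minus[OF spectral_projectionD(4)[OF P]] spectral_projectionD(5)[OF P]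
    spectral_projectionD(6)[OF P]
  by (auto simp: gi_algebra bounded_clinearD)

lemma spectral_projection_union:
  assumes P: "spectral_projection P" and Q: "spectral_projection Q"
  shows "spectral_projection (\<lambda>x. P x + Q x - P (Q x))"
proof -
  have "spectral_projection (\<lambda>x. x - (\<lambda>x. (\<lambda>x. x - P x) ((\<lambda>x. x - Q x) x)) x)"
    by (intro spectral_projection_complement spectral_projection_compose[of "\<lambda>x. x - P x" "\<lambda>x. x - Q x"] P Q)
  moreover have "x - (\<lambda>x. (\<lambda>x. x - P x) ((\<lambda>x. x - Q x) x)) x = P x + Q x - P (Q x)" for x
    by (simp add: bounded_clinearD[OF spectral_projectionD(2)[OF P]])
  ultimately show ?thesis by simp
qed

lemma spectral_projection_zero: "spectral_projection (\<lambda>x. 0)"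
  unfolding spectral_projection_def bounded_projection_def
  by (auto simp: bounded_clinear_def commutes_with_def fun_eq_iff dest: bounded_clinearD)
    (auto simp: bounded_linear_zero linear_simps)

lemma range_spectral_projection: "spectral_projection P \<Longrightarrow> range P = {x. P x = x}"
  using projection_range[of P] spectral_projectionD(1)[of P] by (simp add: bounded_projection_def)

lemma invariant_spectral_projection: "spectral_projection P \<Longrightarrow> invariant (range P)"
  using range_invariant spectral_projectionD by blast

lemma rho_compose:
  assumes P: "spectral_projection P" and Q: "spectral_projection Q" and l: "l \<in> rho (range P)"
  shows "l \<in> rho (range (\<lambda>x. P (Q x)))"
  using spectral_projectionD[OF spectral_projection_compose[OF P Q]]
  by (intro rho_range[OF _ _ invariant_spectral_projection[OF P] _ l]) auto

lemma rho_compose2: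
  assumes P: "spectral_projection P" and Q: "spectral_projection Q" and l: "l \<in> rho (range Q)"
  shows "l \<in> rho (range (\<lambda>x. P (Q x)))"
  using rho_compose[OF Q P l] spectral_projection_commute[OF P Q] by simp

lemma rho_disjoint_sum:
  assumes P: "spectral_projection P" and Q: "spectral_projection Q" and E: "spectral_projection E"
    and "\<And>x. P (Q x) = 0" "\<And>x. E x = P x + Q x" "l \<in> rho (range P)" "l \<in> rho (range Q)"
  shows "l \<in> rho (range E)"
proof (rule rho_range_sum[OF _ _ _ _ assms(4) _ assms(6,7) _ _ assms(5)])
  show "Q (P x) = 0" for x using assms(4) spectral_projection_commute[OF P Q] by simp
qed (simp_all add: spectral_projectionD(1,4) P Q E)

section \<open>Spectral projections of intervals\<close>

text \<open>\<open>P\<close> is the value at \<open>D\<close> of a spectral function. The last clause decides to which side the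
  eigenvectors at the boundary points of \<open>D\<close> belong; together the clauses determine \<open>P\<close>.\<close>

definition spectral_value :: "real set \<Rightarrow> ('a \<Rightarrow> 'a) \<Rightarrow> bool"
  where "spectral_value D P \<longleftrightarrow> spectral_projection P \<and>
    (\<exists>K. \<forall>x\<in>range P. \<exists>u. (x, u) \<in> A \<and> norm u \<le> K * norm x) \<and>
    (\<forall>l. l \<notin> of_real ` closure D \<longrightarrow> l \<in> rho (range P)) \<and>
    (\<forall>t\<in>interior D. of_real t \<in> rho (range (\<lambda>x. x - P x))) \<and>
    (\<forall>t x. (x, of_real t *\<^sub>C x) \<in> A \<longrightarrow> P x = (if t \<in> D then x else 0))"

section \<open>Symmetry of circle integrals with respect to the form\<close>

lemma integral_reflect_unit_interval:
  fixes f :: "real \<Rightarrow> 'b::banach"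
  assumes "f integrable_on {0..1}"
  shows "integral {0..1} (\<lambda>t. f (1 - t)) = integral {0..1} f"
proof -
  have "(f has_integral integral {0..1} f) (cbox 0 1)" using assms by (simp add: integrable_integral)
  from has_integral_affinity[OF this, of "-1" 1]
  have "((\<lambda>t. f (1 - t)) has_integral integral {0..1} f) ((\<lambda>t. 1 - t) ` {0..1})"
    by (simp add: algebra_simps)
  moreover have "(\<lambda>t. 1 - t) ` {0..1::real} = {0..1}"
    by (auto intro!: image_eqI[of _ _ "1 - _"])
  ultimately show ?thesis by (simp add: integral_unique)
qed

text \<open>As the centre is real, conjugation runs through the circle backwards:
  \<open>circlepath\<close> at \<open>1 - t\<close> is the conjugate of its value at
  \<open>t\<close>. This compensates for the conjugate linear second argument of the form.\<close>

lemma gi_cint: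
  assumes "r \<ge> 0" "continuous_on (sphere (of_real m) r) f"
  shows "gi x (cint (of_real m) r f) = cint (of_real m) r (\<lambda>l. gi x (f (cnj l)))"
proof -
  let ?c = "\<lambda>t. circlepath (complex_of_real m) r t"
  have cnj: "?c (1 - t) = cnj (?c t)" for t
    by (simp add: circlepath_eq exp_cnj right_diff_distrib exp_diff exp_minus divide_inverse)
  have bl: "bounded_linear (\<lambda>y. cinner (G x) y)"
    by (rule bounded_bilinear.bounded_linear_right[OF bounded_bilinear_cinner])
  have int: "(\<lambda>t. (?c t - of_real m) *\<^sub>C f (?c t)) integrable_on {0..1}"
    by (intro integrable_continuous_real cint_integrand_continuous assms)
  have "gi x (cint (of_real m) r f) = integral {0..1} ((\<lambda>y. cinner (G x) y) \<circ> (\<lambda>t. (?c t - of_real m) *\<^sub>C f (?c t)))"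
    unfolding cint_def G_inner_def by (rule integral_linear[OF int bl, symmetric])
  also have "\<dots> = integral {0..1} (\<lambda>t. ((\<lambda>y. cinner (G x) y) \<circ> (\<lambda>t. (?c t - of_real m) *\<^sub>C f (?c t))) (1 - t))"
    by (rule integral_reflect_unit_interval[OF integrable_linear[OF int bl], symmetric])
  also have "\<dots> = cint (of_real m) r (\<lambda>l. gi x (f (cnj l)))"
    unfolding cint_def o_def cnj cinner_scaleC_right by (simp add: G_inner_def)
  finally show ?thesis .
qed

lemma W_symmetric:
  assumes "weighted_circle A N (of_real m) r w" and w_cnj: "\<And>l. w (cnj l) = cnj (w l)" and x: "x \<in> N" and y: "y \<in> N"
  shows "gi (weighted_circle.W A N (of_real m) r w (\<lambda>_. 1) x) y = gi x (weighted_circle.W A N (of_real m) r w (\<lambda>_. 1) y)"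
proof -
  interpret W: weighted_circle A N "of_real m" r w by fact
  have c: "continuous_on (sphere (of_real m) r) (\<lambda>l. 1 *\<^sub>C w l *\<^sub>C R N l z)" if "z \<in> N" for z
    by (intro W.integrand_continuous continuous_on_const that)
  have "gi x (W.W (\<lambda>_. 1) y) = cint (of_real m) r (\<lambda>l. gi x (1 *\<^sub>C w (cnj l) *\<^sub>C R N (cnj l) y))"
    unfolding W.W_def by (rule gi_cint[OF W.r_ge c[OF y]])
  also have "\<dots> = cint (of_real m) r (\<lambda>l. gi (1 *\<^sub>C w l *\<^sub>C R N l x) y)"
  proof (intro cint_cong W.r_ge)
    fix l assume l: "l \<in> sphere (complex_of_real m) r"
    have cl: "cnj l \<in> sphere (complex_of_real m) r"
      using l by (simp add: dist_norm) (metis complex_cnj_complex_of_real complex_cnj_diff complex_mod_cnj)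
    show "gi x (1 *\<^sub>C w (cnj l) *\<^sub>C R N (cnj l) y) = gi (1 *\<^sub>C w l *\<^sub>C R N l x) y"
    proof (cases "w l = 0")
      case False
      then have "l \<in> rho N" "cnj l \<in> rho N" using W.w_rho l cl w_cnj by auto
      from R_symmetric[OF this x y] show ?thesis by (simp add: gi_algebra w_cnj)
    qed (simp add: w_cnj)
  qed
  also have "\<dots> = gi (W.W (\<lambda>_. 1) x) y"
  proof -
    have "bounded_linear (\<lambda>x. gi x y)" by (rule bounded_bilinear.bounded_linear_left[OF bounded_bilinear_gi])
    then show ?thesis
      unfolding W.W_def by (intro cint_linear[symmetric] W.r_ge c x) (auto simp: gi_scale_left)
  qed
  finally show ?thesis ..
qed

end

section \<open>Projections of intervals near a point of positive type\<close>

locale positive_point = G_symmetric_operator A G for A :: "'a::chilbert_space operator" and G +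
  fixes t0 \<epsilon> K d C :: real
  assumes nonreal: "l \<in> ball (of_real t0) \<epsilon> \<Longrightarrow> Im l \<noteq> 0 \<Longrightarrow> l \<in> rho UNIV"
    and K: "K \<ge> 0"
    and growth: "l \<in> ball (of_real t0) \<epsilon> \<Longrightarrow> Im l \<noteq> 0 \<Longrightarrow> norm (R UNIV l x) \<le> K / \<bar>Im l\<bar> * norm x"
    and dC: "d > 0" "C > 0"
    and positive: "l \<in> ball (of_real t0) \<epsilon> \<Longrightarrow> (x, u) \<in> A \<Longrightarrow> d * (norm x)\<^sup>2 \<le> gq x + C * (norm (u - l *\<^sub>C x))\<^sup>2"
begin

definition good :: "real \<Rightarrow> real \<Rightarrow> bool"
  where "good m r \<longleftrightarrow> r > 0 \<and> \<bar>m - t0\<bar> + r < \<epsilon>"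

lemma good_cball:
  assumes g: "good m r" shows "cball (complex_of_real m) r \<subseteq> ball (of_real t0) \<epsilon>"
proof
  fix l :: complex assume "l \<in> cball (of_real m) r"
  with g have "good m r" "l \<in> cball (of_real m) r" by auto
  moreover have "dist (complex_of_real t0) l \<le> dist (complex_of_real t0) (of_real m) + dist (of_real m) l"
    by (rule dist_triangle)
  moreover have "dist (complex_of_real t0) (of_real m) = \<bar>m - t0\<bar>"
    by (simp add: dist_norm abs_minus_commute flip: of_real_diff)
  ultimately show "l \<in> ball (of_real t0) \<epsilon>" by (auto simp: good_def)
qed

lemma good_circle:
  assumes g: "good m r" shows "weighted_circle A UNIV (of_real m) r (q_weight m r)"
proof (rule weighted_circle_q[OF invariant_UNIV _ K])
  show "r > 0" using g by (simp add: good_def)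
  have sub: "sphere (complex_of_real m) r \<subseteq> ball (of_real t0) \<epsilon>" using good_cball[OF g] by auto
  then show "l \<in> rho UNIV" if "l \<in> sphere (of_real m) r" "Im l \<noteq> 0" for l using nonreal that by blast
  show "norm (R UNIV l x) \<le> K / \<bar>Im l\<bar> * norm x" if "l \<in> sphere (of_real m) r" "Im l \<noteq> 0" for l x
    using growth that sub by blast
qed

text \<open>Up to sign, \<open>B m r\<close> is \<open>q_weight m r\<close> applied to the part of \<open>A\<close> in the interval
  \<open>(m - r, m + r)\<close>, so the closure of its range is the spectral subspace of this interval and
  its kernel the complementary one.\<close>

definition B :: "real \<Rightarrow> real \<Rightarrow> 'a \<Rightarrow> 'a"
  where "B m r = weighted_circle.W A UNIV (of_real m) r (q_weight m r) (\<lambda>_. 1)"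

lemma const_continuous: "continuous_on S (\<lambda>_. 1 :: complex)"
  by simp

lemma B_bounded_clinear:
  assumes "good m r" shows "bounded_clinear (B m r)"
proof -
  interpret W: weighted_circle A UNIV "of_real m" r "q_weight m r" by (rule good_circle[OF assms])
  obtain K where "\<And>x. norm (W.W (\<lambda>_. 1) x) \<le> K * norm x"
    using W.W_bound[OF const_continuous] by (metis UNIV_I)
  then show ?thesis
    unfolding B_def by (intro bounded_clinearI W.W_add W.W_scale const_continuous UNIV_I)
qed

lemma B_commutes_with: "good m r \<Longrightarrow> commutes_with (B m r) A"
  using weighted_circle.W_commutes_A[OF good_circle const_continuous] by (auto simp: commutes_with_def B_def)

lemma B_commute:
  assumes "good m r" "bounded_clinear T" "commutes_with T A"
  shows "T (B m r x) = B m r (T x)"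
  using weighted_circle.W_commutes[OF good_circle[OF assms(1)] const_continuous UNIV_I assms(2) UNIV_I assms(3)]
  by (simp add: B_def)

lemma B_symmetric:
  assumes g: "good m r" shows "gi (B m r x) y = gi x (B m r y)"
  unfolding B_def by (rule W_symmetric[OF good_circle[OF g]]) (simp_all add: q_weight_def)

lemma kernel_B_invariant: "good m r \<Longrightarrow> invariant {x. B m r x = 0}"
  using kernel_invariant B_bounded_clinear B_commutes_with by blast

text \<open>The kernel is the eigenspace of the integral for the eigenvalue 0, and at an interior
  point the residue is the nonzero value of the weight, so \<open>rho_eigenspace_pole\<close>
  applies.\<close>

lemma rho_kernel_B:
  assumes g: "good m r" and t: "\<bar>t - m\<bar> < r"
  shows "of_real t \<in> rho {x. B m r x = 0}"
proof -
  interpret W: weighted_circle A UNIV "of_real m" r "q_weight m r" by (rule good_circle[OF g])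
  have in_ball: "complex_of_real t \<in> ball (of_real m) r"
    using t by (simp add: dist_norm abs_minus_commute flip: of_real_diff)
  have "q_weight m r (of_real t) \<noteq> 0"
    using t W.r by (auto simp: q_weight_eq simp flip: of_real_add of_real_diff)
  then have "0 + cint (of_real m) r (\<lambda>l. 1 * q_weight m r l / (l - of_real t)) \<noteq> 0"
    using W.residue_inside[OF in_ball] by simp
  moreover have "complex_of_real t \<notin> sphere (of_real m) r" using in_ball by auto
  ultimately have "of_real t \<in> rho {x \<in> UNIV. W.W (\<lambda>_. 1) x = 0 *\<^sub>C x}"
    by (intro W.rho_eigenspace_pole)
  then show ?thesis by (simp add: B_def)
qed

lemma B_eigenvector:
  assumes g: "good m r" and x: "(x, of_real t *\<^sub>C x) \<in> A"
  shows "B m r x = (if \<bar>t - m\<bar> < r then - (q_weight m r (of_real t) *\<^sub>C x) else 0)"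
proof -
  interpret W: weighted_circle A UNIV "of_real m" r "q_weight m r" by (rule good_circle[OF g])
  have eig: "B m r x = - (cint (of_real m) r (\<lambda>l. q_weight m r l / (l - of_real t)) *\<^sub>C x)"
    if "continuous_on (sphere (of_real m) r) (\<lambda>l. q_weight m r l / (l - of_real t))"
    unfolding B_def by (rule W.W_eigenvector[OF x UNIV_I that])
  have dist: "dist (complex_of_real m) (of_real t) = \<bar>t - m\<bar>"
    by (simp add: dist_norm abs_minus_commute flip: of_real_diff)
  consider "\<bar>t - m\<bar> < r" | "\<bar>t - m\<bar> > r" | "t = m + r" | "t = m - r" by linarith
  then show ?thesis
  proof cases
    case 1
    have "B m r x = - (cint (of_real m) r (\<lambda>l. q_weight m r l / (l - of_real t)) *\<^sub>C x)"
      by (rule eig) (intro W.pole_continuous W.w_sphere, use 1 dist in simp)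
    also have "cint (of_real m) r (\<lambda>l. q_weight m r l / (l - of_real t)) = q_weight m r (of_real t)"
      using W.residue_inside[of "of_real t"] 1 dist by simp
    finally show ?thesis using 1 by simp
  next
    case 2
    have "B m r x = - (cint (of_real m) r (\<lambda>l. q_weight m r l / (l - of_real t)) *\<^sub>C x)"
      by (rule eig) (intro W.pole_continuous W.w_sphere, use 2 dist in simp)
    also have "cint (of_real m) r (\<lambda>l. q_weight m r l / (l - of_real t)) = 0"
      using W.residue_outside[of "\<lambda>_. 1" "of_real t"] 2 dist by simp
    finally show ?thesis using 2 by simp
  next
    \<comment> \<open>The pole at an end point cancels one of the two zeros of the weight there;
      what remains is a polynomial, whose integral vanishes.\<close>
    case 3
    have eq: "q_weight m r l / (l - of_real t) = (l - of_real (m - r))\<^sup>2 * (l - of_real (m + r))" for l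
      unfolding q_weight_eq 3 by (cases "l = of_real (m + r)") (auto simp: power2_eq_square)
    have "B m r x = - (cint (of_real m) r (\<lambda>l. q_weight m r l / (l - of_real t)) *\<^sub>C x)"
      by (rule eig) (unfold eq, intro continuous_intros)
    also have "cint (of_real m) r (\<lambda>l. q_weight m r l / (l - of_real t)) = 0"
      unfolding eq by (intro cint_Cauchy_0 W.r_ge continuous_intros holomorphic_intros)
    finally show ?thesis using 3 W.r by simp
  next
    case 4
    have eq: "q_weight m r l / (l - of_real t) = (l - of_real (m - r)) * (l - of_real (m + r))\<^sup>2" for l
      unfolding q_weight_eq 4 by (cases "l = of_real (m - r)") (auto simp: power2_eq_square)
    have "B m r x = - (cint (of_real m) r (\<lambda>l. q_weight m r l / (l - of_real t)) *\<^sub>C x)"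
      by (rule eig) (unfold eq, intro continuous_intros)
    also have "cint (of_real m) r (\<lambda>l. q_weight m r l / (l - of_real t)) = 0"
      unfolding eq by (intro cint_Cauchy_0 W.r_ge continuous_intros holomorphic_intros)
    finally show ?thesis using 4 W.r by simp
  qed
qed

lemma real_cballs_disjoint:
  assumes "r + s < \<bar>m - n\<bar>"
  shows "cball (complex_of_real m) r \<inter> cball (of_real n) s = {}"
proof -
  have d: "dist (complex_of_real m) (of_real n) = \<bar>m - n\<bar>" by (simp add: dist_norm flip: of_real_diff)
  have "\<not> (dist (complex_of_real m) l \<le> r \<and> dist (complex_of_real n) l \<le> s)" for l
    using dist_triangle2[of "complex_of_real m" "of_real n" l] d assms by linarith
  then show ?thesis by (auto simp: disjoint_iff)
qed

lemma B_disjoint: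
  assumes "good m r" "good n s" "r + s < \<bar>m - n\<bar>"
    and "continuous_on (cball (of_real m) r) h" "h holomorphic_on ball (of_real m) r"
  shows "B n s (weighted_circle.W A UNIV (of_real m) r (q_weight m r) h x) = 0"
  unfolding B_def
  by (rule disjoint_circles[OF good_circle[OF assms(1)] good_circle[OF assms(2)]
        real_cballs_disjoint[OF assms(3)] assms(4,5) UNIV_I])

lemma B_B_disjoint: "good m r \<Longrightarrow> good n s \<Longrightarrow> r + s < \<bar>m - n\<bar> \<Longrightarrow> B n s (B m r x) = 0"
  using B_disjoint[of m r n s "\<lambda>_. 1"] by (simp add: B_def)

lemma robust_near:
  assumes "\<bar>t - t0\<bar> < \<epsilon>" shows "robust A (of_real t)"
proof (rule robustI[OF A_csubspace A_closed subset_refl finite_codim_refl[OF A_csubspace] dC])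
  fix x u assume "(x, u) \<in> A"
  with assms show "d * (norm x)\<^sup>2 \<le> gq x + C * (norm (u - of_real t *\<^sub>C x))\<^sup>2"
    by (intro positive) (simp_all add: dist_norm abs_minus_commute flip: of_real_diff)
qed

end

context closed_operator
begin

text \<open>A single resolvent suffices, because its range is the domain of
  \<open>A\<close>.\<close>

lemma commutes_with_from_resolvent:
  assumes l: "l \<in> rho UNIV" and Q: "bounded_clinear Q" "\<And>x. R UNIV l (Q x) = Q (R UNIV l x)"
  shows "commutes_with Q A"
proof -
  have "(Q x, Q u) \<in> A" if x: "(x, u) \<in> A" for x u
  proof -
    have "Q x = R UNIV l (Q (u - l *\<^sub>C x))"
      using R_eq[OF l x] Q(2) by simp
    then have "(Q x, Q (u - l *\<^sub>C x) + l *\<^sub>C Q x) \<in> A" using R_in(2)[OF l UNIV_I] by metis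
    then show ?thesis by (simp add: bounded_clinearD[OF Q(1)])
  qed
  then show ?thesis by (auto simp: commutes_with_def)
qed

lemma invariant_closure_range:
  assumes T: "bounded_clinear T" "bounded_clinear B" "\<And>x. T (B x) = B (T x)" and x: "x \<in> closure (range B)"
  shows "T x \<in> closure (range B)"
proof -
  have "T ` closure (range B) \<subseteq> closure (range B)"
  proof (rule image_closure_subset)
    show "continuous_on (closure (range B)) T" by (intro linear_continuous_on bounded_clinearD[OF T(1)])
    show "T ` range B \<subseteq> closure (range B)" using T(3) closure_subset by fastforce
  qed simp
  with x show ?thesis by blast
qed

lemma closure_range_subset:
  assumes B: "\<And>x. B x \<in> N" and N: "closed N" shows "closure (range B) \<subseteq> N"
  using assms by (intro closure_minimal) auto

lemma csubspace_closure_range: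
  assumes B: "bounded_clinear B" shows "csubspace (closure (range B))"
proof (rule csubspace_closure, unfold complex_vector.subspace_def, intro conjI ballI allI)
  show "0 \<in> range B" by (rule range_eqI[of _ _ 0]) (simp add: bounded_clinearD(5)[OF B])
  show "x + y \<in> range B" if "x \<in> range B" "y \<in> range B" for x y
    using that by (auto simp flip: bounded_clinearD(3)[OF B])
  show "c *\<^sub>C x \<in> range B" if "x \<in> range B" for c x
    using that by (auto simp flip: bounded_clinearD(2)[OF B])
qed

end

context positive_point
begin

text \<open>As [y, B B y] = [B y, B y], positivity identifies the kernel of \<open>B\<close> with
  the orthogonal companion of its closed range. An operator commuting with \<open>A\<close>
  preserves both the closed range and the kernel of \<open>B\<close>, hence commutes with
  \<open>Q\<close>.\<close>

lemma positive_projection: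
  assumes g: "good m r" and c: "c > 0" "\<And>x. x \<in> closure (range (B m r)) \<Longrightarrow> c * (norm x)\<^sup>2 \<le> gq x"
    and \<epsilon>: "\<epsilon> > 0"
  obtains Q where "spectral_projection Q" "range Q = closure (range (B m r))" "\<And>x. Q x = 0 \<longleftrightarrow> B m r x = 0"
proof -
  let ?L = "closure (range (B m r))"
  note Bb = B_bounded_clinear[OF g]
  have L: "csubspace ?L" "closed ?L" using csubspace_closure_range[OF Bb] by auto
  obtain Q where Q: "bounded_projection Q" "range Q = ?L" "\<And>x y. gi (Q x) y = gi x (Q y)"
    "\<And>y. Q y = 0 \<longleftrightarrow> (\<forall>z\<in>?L. gi y z = 0)"
    using uniformly_positive_projection[OF L c] by blast
  have Qb: "bounded_clinear Q" and QQ: "Q (Q x) = Q x" for x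
    using Q(1) by (auto simp: bounded_projection_def fun_eq_iff)
  have BL: "B m r x \<in> ?L" for x by (rule subsetD[OF closure_subset rangeI])
  have ker: "Q y = 0 \<longleftrightarrow> B m r y = 0" for y
  proof
    assume "Q y = 0"
    then have "gi y (B m r (B m r y)) = 0" using Q(4) BL by blast
    then have "gi (B m r y) (B m r y) = 0" by (simp add: B_symmetric[OF g])
    then have "c * (norm (B m r y))\<^sup>2 \<le> 0" using c(2)[OF BL, of y] by simp
    then show "B m r y = 0" using c(1) by (simp add: mult_le_0_iff)
  next
    assume y: "B m r y = 0"
    have "?L \<subseteq> {z. gi y z = 0}"
    proof (rule closure_range_subset)
      show "B m r x \<in> {z. gi y z = 0}" for x using B_symmetric[OF g, of y x] y by simp
      have "continuous_on UNIV (gi y)"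
        by (intro linear_continuous_on bounded_bilinear.bounded_linear_right[OF bounded_bilinear_gi])
      then show "closed {z. gi y z = 0}" by (intro closed_Collect_eq) auto
    qed
    then show "Q y = 0" using Q(4) by blast
  qed
  have comm: "T (Q x) = Q (T x)" if T: "bounded_clinear T" "commutes_with T A" for T x
  proof -
    have "T (Q x) \<in> ?L"
      using Q(2) by (intro invariant_closure_range[OF T(1) Bb] B_commute[OF g T]) auto
    then have 1: "Q (T (Q x)) = T (Q x)" using Q(2) QQ by (metis rangeE)
    have "Q (x - Q x) = 0" by (simp add: bounded_clinearD[OF Qb] QQ)
    then have "B m r (T (x - Q x)) = 0"
      using ker B_commute[OF g T, of "x - Q x"] bounded_clinearD(5)[OF T(1)] by simp
    then have "Q (T (x - Q x)) = 0" using ker by simp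
    then show ?thesis using 1 by (simp add: bounded_clinearD[OF Qb] bounded_clinearD[OF T(1)])
  qed
  define l where "l = complex_of_real t0 + of_real (\<epsilon> / 2) * \<i>"
  have "l \<in> rho UNIV"
    using \<epsilon> by (intro nonreal) (auto simp: l_def dist_norm norm_mult)
  then have "commutes_with Q A"
    by (intro commutes_with_from_resolvent[OF _ Qb] comm R_bounded_clinear R_commutes_with)
  then have "spectral_projection Q"
    using Q comm by (auto simp: spectral_projection_def)
  then show ?thesis using that Q(2) ker by blast
qed

lemma good_subinterval:
  "good m r \<Longrightarrow> s > 0 \<Longrightarrow> \<bar>n - m\<bar> + s \<le> r \<Longrightarrow> good n s"
  by (auto simp: good_def)

lemma dist_of_real_complex: "dist (complex_of_real s) (of_real t) = \<bar>s - t\<bar>"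
  by (simp add: dist_norm flip: of_real_diff)

text \<open>On the kernel of two operators \<open>B\<close> the spectrum has gaps around \<open>m - r - \<eta>\<close> and
  \<open>m + r + \<eta>\<close>, so that a Riesz projection separates the spectrum between them.\<close>

lemma surrounding_space:
  assumes g: "good m (r + 2 * \<eta>)" and r: "r > 0" and \<eta>: "\<eta> > 0"
  obtains N where "invariant N" "\<And>l. Im l \<noteq> 0 \<Longrightarrow> l \<in> rho N" "\<And>x. B m r x \<in> N"
    "\<And>t. \<bar>t - m\<bar> > r + \<eta> \<Longrightarrow> of_real t \<in> rho N"
    "\<exists>K\<ge>0. \<forall>x\<in>N. \<exists>u. (x, u) \<in> A \<and> norm u \<le> K * norm x"
proof -
  let ?r = "r + \<eta>"
  have g1: "good (m - ?r) (\<eta> / 2)" and g2: "good (m + ?r) (\<eta> / 2)" and g0: "good m r" and gr: "good m ?r"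
    using r \<eta> by (auto intro!: good_subinterval[OF g])
  define K1 where "K1 = {x. B (m - ?r) (\<eta> / 2) x = 0}"
  define K2 where "K2 = {x. B (m + ?r) (\<eta> / 2) x = 0}"
  have inv: "invariant K1" "invariant K2" using kernel_B_invariant g1 g2 by (auto simp: K1_def K2_def)
  have B1: "bounded_clinear (B (m - ?r) (\<eta> / 2))" "commutes_with (B (m - ?r) (\<eta> / 2)) A"
    and B2: "bounded_clinear (B (m + ?r) (\<eta> / 2))" "commutes_with (B (m + ?r) (\<eta> / 2)) A"
    using B_bounded_clinear B_commutes_with g1 g2 by auto
  have B12: "B (m - ?r) (\<eta> / 2) (B (m + ?r) (\<eta> / 2) x) = B (m + ?r) (\<eta> / 2) (B (m - ?r) (\<eta> / 2) x)" for x
    by (rule B_commute[OF g2 B1])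
  have K12: "l \<in> rho (K1 \<inter> K2)" if "l \<in> rho K1" for l
    unfolding K2_def
    by (rule rho_inter_kernel[OF B2 inv(1) _ that]) (simp add: K1_def B12 bounded_clinearD(5)[OF B2(1)])
  have K21: "l \<in> rho (K1 \<inter> K2)" if "l \<in> rho K2" for l
    unfolding K1_def Int_commute[of _ K2]
    by (rule rho_inter_kernel[OF B1 inv(2) _ that]) (simp add: K2_def B12[symmetric] bounded_clinearD(5)[OF B1(1)])
  have U1: "l \<in> rho K1" if "l \<in> rho UNIV" for l
    using rho_inter_kernel[OF B1 invariant_UNIV _ that] by (simp add: K1_def)
  \<comment> \<open>On \<open>M\<close> the two real points of the circle of radius r + \<eta>
    belong to the resolvent set, and its other points are nonreal; thus the Riesz integral
    exists.\<close>
  define M where "M = K1 \<inter> K2"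
  have M: "invariant M" unfolding M_def by (intro invariant_Int inv)
  have near: "l \<in> rho M" if "l \<in> cball (of_real m) ?r" "Im l \<noteq> 0" for l
    unfolding M_def using that good_cball[OF gr] by (intro K12 U1 nonreal) auto
  have sph: "sphere (of_real m) ?r \<subseteq> rho M"
  proof
    fix l assume l: "l \<in> sphere (complex_of_real m) ?r"
    show "l \<in> rho M"
    proof (cases "Im l = 0")
      case True
      then have lr: "l = of_real (Re l)" by (simp add: complex_eq_iff)
      then have "\<bar>m - Re l\<bar> = ?r" using l dist_of_real_complex[of m "Re l"] by simp
      then consider "Re l = m - ?r" | "Re l = m + ?r" by linarith
      then show ?thesis
      proof cases
        case 1
        have "complex_of_real (Re l) \<in> rho K1" unfolding K1_def
          by (rule rho_kernel_B[OF g1]) (use 1 \<eta> in simp)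
        then show ?thesis using lr K12 by (simp add: M_def)
      next
        case 2
        have "complex_of_real (Re l) \<in> rho K2" unfolding K2_def
          by (rule rho_kernel_B[OF g2]) (use 2 \<eta> in simp)
        then show ?thesis using lr K21 by (simp add: M_def)
      qed
    qed (use l near in simp)
  qed
  have circ: "weighted_circle A M (of_real m) ?r (\<lambda>_. 1)"
    using r \<eta> by (intro weighted_circle_unit M sph) simp
  interpret U: weighted_circle A M "of_real m" ?r "\<lambda>_. 1" by (rule circ)
  interpret W: weighted_circle A UNIV "of_real m" r "q_weight m r" by (rule good_circle[OF g0])
  \<comment> \<open>The two small discs are disjoint from the disc of radius \<open>r\<close>, so
    their operators annihilate every integral over its circle.\<close>
  have WM: "W.W h x \<in> M" if h: "continuous_on (cball (of_real m) r) h" "h holomorphic_on ball (of_real m) r" for h x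
    using B_disjoint[OF g0 g1 _ h] B_disjoint[OF g0 g2 _ h] r \<eta> by (simp add: M_def K1_def K2_def)
  have sub: "cball (complex_of_real m) r \<subseteq> ball (of_real m) ?r" using \<eta> by auto
  have B_fix: "B m r x \<in> U.fix_W" for x
  proof -
    have "U.W (\<lambda>_. 1) (W.W (\<lambda>_. 1) x) = - W.W (\<lambda>_. 1) x"
    proof (rule Riesz_integral_W[OF good_circle[OF g0] circ sub _ sph])
      show "W.W (\<lambda>l. 1 / (l - k)) x \<in> M" if "k \<in> sphere (of_real m) ?r" for k
        using that \<eta> by (intro WM continuous_intros holomorphic_intros) auto
    qed (auto intro!: WM)
    then show ?thesis by (auto simp: U.fix_W_def B_def intro!: WM)
  qed
  \<comment> \<open>On the fixed space the integral has eigenvalue -1 and the residue outside is 0.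
    Points beyond the circle therefore lie in the resolvent set, whatever the spectrum of
    \<open>A\<close> is there.\<close>
  have out: "k \<in> rho U.fix_W" if "k \<notin> cball (of_real m) ?r" for k
  proof -
    have "k \<in> rho {x \<in> M. U.W (\<lambda>_. 1) x = (- 1) *\<^sub>C x}"
    proof (rule U.rho_eigenspace_pole)
      show "k \<notin> sphere (of_real m) ?r" using that by auto
      have "cint (of_real m) ?r (\<lambda>l. 1 * 1 / (l - k)) = 0"
        using U.residue_outside[of "\<lambda>_. 1", OF _ _ that] by simp
      then show "- 1 + cint (of_real m) ?r (\<lambda>l. 1 * 1 / (l - k)) \<noteq> 0" by simp
    qed
    then show ?thesis by (simp add: U.fix_W_def)
  qed
  show ?thesis
  proof (rule that[of U.fix_W])
    show "invariant U.fix_W" by (rule U.fix_W_invariant)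
    show "l \<in> rho U.fix_W" if "Im l \<noteq> 0" for l
      using out near that U.rho_fix_W by blast
    show "B m r x \<in> U.fix_W" for x by (rule B_fix)
    show "of_real t \<in> rho U.fix_W" if "\<bar>t - m\<bar> > ?r" for t
      using that by (intro out) (simp add: dist_real_def abs_minus_commute)
    obtain K where K: "K > 0" "\<And>x. x \<in> M \<Longrightarrow> norm (U.W (\<lambda>l. 1 * l) x) \<le> K * norm x"
      using U.W_bound[of "\<lambda>l. 1 * l"] by (auto intro: continuous_intros)
    let ?c = "cint (of_real m) ?r (\<lambda>l. 1 * 1 :: complex)"
    have "\<exists>u. (x, u) \<in> A \<and> norm u \<le> (K + cmod ?c) * norm x" if "x \<in> U.fix_W" for x
    proof -
      have x: "x \<in> M" "x = - U.W (\<lambda>_. 1) x" using that by (auto simp: U.fix_W_def)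
      have "(- U.W (\<lambda>_. 1) x, - (U.W (\<lambda>l. 1 * l) x + ?c *\<^sub>C x)) \<in> A"
        by (intro A_minus U.W_graph const_continuous x)
      moreover have "norm (- (U.W (\<lambda>l. 1 * l) x + ?c *\<^sub>C x)) \<le> (K + cmod ?c) * norm x"
        using norm_triangle_ineq[of "U.W (\<lambda>l. 1 * l) x" "?c *\<^sub>C x"] K(2)[OF x(1)]
        by (simp only: norm_minus_cancel norm_scaleC distrib_right)
      ultimately show ?thesis using x(2) by metis
    qed
    then show "\<exists>K\<ge>0. \<forall>x\<in>U.fix_W. \<exists>u. (x, u) \<in> A \<and> norm u \<le> K * norm x"
      using K(1) by (intro exI[of _ "K + cmod ?c"]) auto
  qed
qed

lemma spectral_value_interval:
  assumes g: "good m r"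
  shows "\<exists>P. spectral_value {m - r<..<m + r} P"
proof -
  define \<eta> where "\<eta> = (\<epsilon> - \<bar>m - t0\<bar> - r) / 4"
  have r: "r > 0" and \<eta>: "\<eta> > 0" and g': "good m (r + 2 * \<eta>)" and \<epsilon>: "\<epsilon> > 0"
    using g by (auto simp: good_def \<eta>_def field_simps)
  obtain N KN where N: "invariant N" "\<And>l. Im l \<noteq> 0 \<Longrightarrow> l \<in> rho N" "\<And>x. B m r x \<in> N"
    "\<And>t. \<bar>t - m\<bar> > r + \<eta> \<Longrightarrow> of_real t \<in> rho N"
    and KN: "KN \<ge> 0" "\<And>x. x \<in> N \<Longrightarrow> \<exists>u. (x, u) \<in> A \<and> norm u \<le> KN * norm x"
    using surrounding_space[OF g' r \<eta>] by metis
  interpret N: bounded_part A G N KN by unfold_locales (use N KN in auto)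
  have "of_real t \<in> rho N \<or> robust A (of_real t)" for t :: real
  proof (cases "\<bar>t - m\<bar> > r + \<eta>")
    case False
    then have "\<bar>t - t0\<bar> < \<epsilon>" using g' \<eta> by (auto simp: good_def)
    then show ?thesis using robust_near by blast
  qed (use N(4) in blast)
  then obtain c where c: "c > 0" "\<And>x. x \<in> N \<Longrightarrow> c * (norm x)\<^sup>2 \<le> gq x"
    using N.uniform_positivity[of "\<lambda>_. A"] by blast
  have LN: "closure (range (B m r)) \<subseteq> N" using N(1,3) invariantD(2) by (intro closure_range_subset) auto
  obtain Q where Q: "spectral_projection Q" "range Q = closure (range (B m r))" "\<And>x. Q x = 0 \<longleftrightarrow> B m r x = 0"
    using positive_projection[OF g c(1) _ \<epsilon>] c(2) LN by (metis subsetD)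
  note QD = spectral_projectionD[OF Q(1)]
  have "l \<in> rho (range Q)" if l: "l \<notin> of_real ` {m - r..m + r}" for l
  proof (cases "Im l = 0")
    case False
    then show ?thesis using N(2) LN Q(2) by (intro rho_range[OF QD(1,4) N(1)]) auto
  next
    case True
    define t where "t = Re l"
    have lt: "l = of_real t" using True by (simp add: t_def complex_eq_iff)
    have t: "\<bar>t - m\<bar> > r" using l unfolding lt by (auto simp: image_iff)
    show ?thesis
    proof (cases "\<bar>t - m\<bar> > r + \<eta>")
      case True
      then show ?thesis using N(4) lt LN Q(2) by (intro rho_range[OF QD(1,4) N(1)]) auto
    next
      case False
      \<comment> \<open>\<open>N\<close> gives no information at distances between r and r + \<eta>
        from the centre. A circle around \<open>t\<close> whose radius is half the distance to the
        end point avoids the disc of \<open>B m r\<close>, so the range of \<open>Q\<close> lies in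
        the kernel of its operator.\<close>
      define s where "s = (\<bar>t - m\<bar> - r) / 2"
      have s: "s > 0" "s \<le> \<eta> / 2" using t False by (simp_all add: s_def)
      have s3: "r + s < \<bar>m - t\<bar>" 
      proof -
        have "r + (a - r) / 2 < a" if "r < a" for a :: real using that by (simp add: field_simps)
        from this[OF t] show ?thesis by (simp only: s_def abs_minus_commute[of m t])
      qed
      have gs: "good t s" by (rule good_subinterval[OF g']) (use s False \<eta> in auto)
      have ker: "closure (range (B m r)) \<subseteq> {x. B t s x = 0}"
        using invariantD(2)[OF kernel_B_invariant[OF gs]] B_B_disjoint[OF g gs s3]
        by (intro closure_range_subset) auto
      have "of_real t \<in> rho {x. B t s x = 0}" by (rule rho_kernel_B[OF gs]) (use s in simp)
      then show ?thesis
        unfolding lt using ker Q(2) by (intro rho_range[OF QD(1,4) kernel_B_invariant[OF gs]]) auto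
    qed
  qed
  moreover have "of_real t \<in> rho (range (\<lambda>x. x - Q x))" if "t \<in> {m - r<..<m + r}" for t
    unfolding complement_range[OF QD(1)] Q(3) using that by (intro rho_kernel_B[OF g]) auto
  moreover have "Q x = (if t \<in> {m - r<..<m + r} then x else 0)" if x: "(x, of_real t *\<^sub>C x) \<in> A" for t x
  proof (cases "\<bar>t - m\<bar> < r")
    case True
    let ?q = "q_weight m r (of_real t)"
    have q: "?q \<noteq> 0" using True by (auto simp: q_weight_eq simp flip: of_real_add of_real_diff)
    have "B m r ((- 1 / ?q) *\<^sub>C x) = x"
      using B_eigenvector[OF g x] True q by (simp add: bounded_clinearD[OF B_bounded_clinear[OF g]] scaleC_scaleC)
    then have "x \<in> range Q" unfolding Q(2) using closure_subset by (metis rangeI subsetD)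
    then have "Q x = x" using QD(3) by auto
    then show ?thesis using True by auto
  next
    case False
    then show ?thesis using B_eigenvector[OF g x] Q(3) by auto
  qed
  moreover have "\<exists>K. \<forall>x\<in>range Q. \<exists>u. (x, u) \<in> A \<and> norm u \<le> K * norm x"
    using KN LN Q(2) by blast
  moreover have "closure {m - r<..<m + r} = {m - r..m + r}" using r by simp
  ultimately show ?thesis
    unfolding spectral_value_def using Q(1) by (intro exI[of _ Q]) simp
qed

end

section \<open>Boolean operations on spectral projections\<close>

locale local_positive = G_symmetric_operator A G for A :: "'a::chilbert_space operator" and G +
  fixes I S :: "real set"
  assumes I_open: "open I"
    and nonreal_near: "t \<in> I \<Longrightarrow> \<exists>e>0. \<forall>l\<in>ball (of_real t) e. Im l \<noteq> 0 \<longrightarrow> l \<in> rho UNIV"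
    and robust_I: "t \<in> I \<Longrightarrow> \<exists>M. robust M (of_real t)"
    and robust_A: "t \<in> I \<Longrightarrow> t \<notin> S \<Longrightarrow> robust A (of_real t)"
    and S_discrete: "t \<in> I \<Longrightarrow> \<not> t islimpt S"
begin

text \<open>Finiteness of the frontier takes the place of being a finite union of intervals; it
  passes to intersections, differences and unions by inclusions between frontiers alone.\<close>

definition admissible :: "real set \<Rightarrow> bool"
  where "admissible D \<longleftrightarrow> bounded D \<and> closure D \<subseteq> I \<and> finite (frontier D) \<and> frontier D \<inter> S = {}"

lemma admissible_empty [simp]: "admissible {}"
  by (simp add: admissible_def)

lemma admissible_subset:
  assumes "admissible D" "D' \<subseteq> D" "finite (frontier D')" "frontier D' \<inter> S = {}"
  shows "admissible D'"
  using assms closure_mono[of D' D] bounded_subset[of D D'] by (auto simp: admissible_def)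

lemma admissible_Int_general:
  assumes "admissible D1" "finite (frontier D2)" "frontier D2 \<inter> S = {}"
  shows "admissible (D1 \<inter> D2)"
proof (rule admissible_subset[OF assms(1)])
  have "finite (frontier D1 \<union> frontier D2)" "(frontier D1 \<union> frontier D2) \<inter> S = {}"
    using assms by (auto simp: admissible_def)
  then show "finite (frontier (D1 \<inter> D2))" "frontier (D1 \<inter> D2) \<inter> S = {}"
    using frontier_Int_subset[of D1 D2] finite_subset by blast+
qed simp

lemma admissible_Diff_general:
  "admissible D1 \<Longrightarrow> finite (frontier D2) \<Longrightarrow> frontier D2 \<inter> S = {} \<Longrightarrow> admissible (D1 - D2)"
  using admissible_Int_general[of D1 "- D2"] by (simp add: Diff_eq frontier_complement)

lemma admissible_Int: "admissible D1 \<Longrightarrow> admissible D2 \<Longrightarrow> admissible (D1 \<inter> D2)"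
  by (rule admissible_Int_general) (auto simp: admissible_def)

lemma admissible_Diff: "admissible D1 \<Longrightarrow> admissible D2 \<Longrightarrow> admissible (D1 - D2)"
  by (rule admissible_Diff_general) (auto simp: admissible_def)

lemma admissible_Un:
  assumes "admissible D1" "admissible D2" shows "admissible (D1 \<union> D2)"
proof -
  have "finite (frontier D1 \<union> frontier D2)" "(frontier D1 \<union> frontier D2) \<inter> S = {}"
    using assms by (auto simp: admissible_def)
  then have "finite (frontier (D1 \<union> D2))" "frontier (D1 \<union> D2) \<inter> S = {}"
    using frontier_Un_subset[of D1 D2] finite_subset by blast+
  then show ?thesis using assms by (simp add: admissible_def)
qed

lemma admissible_frontier: "admissible D \<Longrightarrow> t \<in> frontier D \<Longrightarrow> t \<in> I - S"
  by (auto simp: admissible_def frontier_def)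

lemma isolated_point_projection:
  assumes P: "spectral_projection P" and t: "t \<in> I - S" and e: "e > 0"
    and punct: "\<And>s. s \<in> ball t e \<Longrightarrow> s \<noteq> t \<Longrightarrow> of_real s \<in> rho (range P)"
    and noeig: "\<And>x. (x, of_real t *\<^sub>C x) \<in> A \<Longrightarrow> P x = x \<Longrightarrow> x = 0"
  shows "of_real t \<in> rho (range P)"
proof -
  note PD = spectral_projectionD[OF P]
  obtain e1 where e1: "e1 > 0" "\<And>l. l \<in> ball (of_real t) e1 \<Longrightarrow> Im l \<noteq> 0 \<Longrightarrow> l \<in> rho UNIV"
    using nonreal_near[of t] t by blast
  obtain e2 d C where e2: "e2 > 0" "d > 0" "C > 0"
    "\<And>l x u. l \<in> ball (of_real t) e2 \<Longrightarrow> (x, u) \<in> A \<Longrightarrow> d * (norm x)\<^sup>2 \<le> gq x + C * (norm (u - l *\<^sub>C x))\<^sup>2"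
    using robust_point[OF robust_A[of t]] t by blast
  obtain g where g: "g > 0" "\<And>x y. cmod (gi x y) \<le> g * norm x * norm y" using gi_bound by blast
  define r where "r = min (min e e1) (min e2 1)"
  have r: "r > 0" "r \<le> e" "r \<le> e1" "r \<le> e2" "r \<le> 1" using e e1(1) e2(1) by (auto simp: r_def)
  have nonreal: "l \<in> rho (range P)" if "l \<in> ball (of_real t) r" "Im l \<noteq> 0" for l
    using that r(3) by (intro rho_range_UNIV PD(1,4) e1(2)) auto
  show ?thesis
  proof (rule isolated_point_rho[OF invariant_spectral_projection[OF P] r(1)])
    fix l assume l: "l \<in> ball (complex_of_real t) r" "l \<noteq> of_real t"
    show "l \<in> rho (range P)"
    proof (cases "Im l = 0")
      case True
      then have lr: "l = of_real (Re l)" by (simp add: complex_eq_iff)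
      have "dist (complex_of_real t) (of_real (Re l)) < r" using l(1) lr by simp
      then have "Re l \<in> ball t e" using r by (simp add: dist_of_real)
      moreover have "Re l \<noteq> t" using l(2) lr by auto
      ultimately show ?thesis using punct lr by metis
    qed (use nonreal l in blast)
  next
    show "((g + C) / d + 1) \<ge> 0" using g(1) e2(2,3) by simp
  next
    fix l x assume l: "l \<in> ball (complex_of_real t) r" "Im l \<noteq> 0" and x: "x \<in> range P"
    have "\<bar>Im l\<bar> \<le> cmod (l - of_real t)" using abs_Im_le_cmod[of "l - of_real t"] by simp
    then have Im: "\<bar>Im l\<bar> \<le> 1" using l(1) r(5) by (simp add: dist_norm norm_minus_commute)
    have ineq: "d * (norm y)\<^sup>2 \<le> gq y + C * (norm (v - l *\<^sub>C y))\<^sup>2" if "(y, v) \<in> A" "y \<in> range P" for y v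
      using l(1) r(4) by (intro e2(4) that(1)) auto
    show "norm (R (range P) l x) \<le> ((g + C) / d + 1) / \<bar>Im l\<bar> * norm x"
      by (rule resolvent_growth[OF e2(2,3) ineq g nonreal[OF l] l(2) Im x])
  next
    fix x assume x: "(x, of_real t *\<^sub>C x) \<in> A" "gq x = 0"
    have "d * (norm x)\<^sup>2 \<le> 0" using e2(4)[OF _ x(1), of "of_real t"] x(2) e2(1) by simp
    then show "x = 0" using e2(2) by (simp add: mult_le_0_iff)
  next
    fix x assume "(x, of_real t *\<^sub>C x) \<in> A" "x \<in> range P"
    then show "x = 0" using noeig PD(3) by auto
  qed
qed

text \<open>Near \<open>t\<close> the other exceptions keep a positive distance, so \<open>t\<close>
  is at worst an isolated spectral point of positive type, and without eigenvectors it lies in the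
  resolvent set.\<close>

lemma finite_exceptions_projection:
  assumes P: "spectral_projection P" and F: "finite F" "F \<subseteq> I - S" and U: "open U" "t \<in> U"
    and rho: "\<And>s. s \<in> U \<Longrightarrow> s \<notin> F \<Longrightarrow> of_real s \<in> rho (range P)"
    and noeig: "\<And>s x. s \<in> U \<Longrightarrow> (x, of_real s *\<^sub>C x) \<in> A \<Longrightarrow> P x = x \<Longrightarrow> x = 0"
  shows "of_real t \<in> rho (range P)"
proof (cases "t \<in> F")
  case True
  obtain e1 where e1: "e1 > 0" "ball t e1 \<subseteq> U" using U openE by blast
  obtain e2 where e2: "e2 > 0" "\<And>s. s \<in> F \<Longrightarrow> s \<noteq> t \<Longrightarrow> e2 \<le> dist t s"
    using finite_set_avoid[OF F(1), of t] by blast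
  show ?thesis
  proof (rule isolated_point_projection[OF P])
    show "min e1 e2 > 0" using e1(1) e2(1) by simp
    show "of_real s \<in> rho (range P)" if "s \<in> ball t (min e1 e2)" "s \<noteq> t" for s
      using that e1(2) e2(2)[of s] by (intro rho) auto
    show "x = 0" if "(x, of_real t *\<^sub>C x) \<in> A" "P x = x" for x by (rule noeig[OF U(2) that])
  qed (use True F in blast)
qed (use rho U in blast)

section \<open>Calculus of spectral values\<close>

lemma spectral_valueI:
  assumes "spectral_projection P"
    and "\<And>x. x \<in> range P \<Longrightarrow> \<exists>u. (x, u) \<in> A \<and> norm u \<le> K * norm x"
    and "\<And>l. l \<notin> of_real ` closure D \<Longrightarrow> l \<in> rho (range P)"
    and "\<And>t. t \<in> interior D \<Longrightarrow> of_real t \<in> rho (range (\<lambda>x. x - P x))"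
    and "\<And>t x. (x, of_real t *\<^sub>C x) \<in> A \<Longrightarrow> P x = (if t \<in> D then x else 0)"
  shows "spectral_value D P"
  using assms unfolding spectral_value_def by blast

lemma spectral_valueD:
  assumes "spectral_value D P"
  shows "spectral_projection P"
    "l \<notin> of_real ` closure D \<Longrightarrow> l \<in> rho (range P)"
    "t \<in> interior D \<Longrightarrow> of_real t \<in> rho (range (\<lambda>x. x - P x))"
    "(x, of_real t *\<^sub>C x) \<in> A \<Longrightarrow> P x = (if t \<in> D then x else 0)"
  using assms unfolding spectral_value_def by blast+

lemma spectral_value_bounded:
  assumes "spectral_value D P"
  shows "\<exists>K\<ge>0. \<forall>x\<in>range P. \<exists>u. (x, u) \<in> A \<and> norm u \<le> K * norm x"
proof -
  have "\<exists>K. \<forall>x\<in>range P. \<exists>u. (x, u) \<in> A \<and> norm u \<le> K * norm x"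
    using assms unfolding spectral_value_def by (elim conjE)
  then obtain K where K: "\<forall>x\<in>range P. \<exists>u. (x, u) \<in> A \<and> norm u \<le> K * norm x" ..
  have "\<exists>u. (x, u) \<in> A \<and> norm u \<le> max K 0 * norm x" if "x \<in> range P" for x
  proof -
    obtain u where "(x, u) \<in> A" "norm u \<le> K * norm x" using bspec[OF K \<open>x \<in> range P\<close>] by blast
    moreover have "K * norm x \<le> max K 0 * norm x" by (intro mult_right_mono) auto
    ultimately show ?thesis by (meson order_trans)
  qed
  then show ?thesis by (intro exI[of _ "max K 0"]) simp
qed

lemma spectral_value_rho_real:
  assumes "spectral_value D P" "t \<notin> closure D" shows "of_real t \<in> rho (range P)"
  using assms(2) by (intro spectral_valueD(2)[OF assms(1)]) auto

lemma spectral_value_rho_off_real: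
  assumes "spectral_value D P" "Im l \<noteq> 0" shows "l \<in> rho (range P)"
  using assms(2) by (intro spectral_valueD(2)[OF assms(1)]) auto

lemma spectral_value_empty: "spectral_value {} (\<lambda>x. 0)"
proof (rule spectral_valueI[where K=0])
  have inv: "invariant {0}"
    using A_unique[OF _ A_zero] by (auto simp: invariant_def complex_vector.subspace_def)
  show "l \<in> rho (range (\<lambda>x::'a. 0::'a))" for l
    by (intro rhoI[where C=0]) (auto intro: inv[unfolded insert_def, simplified] simp: inv)
qed (auto simp: spectral_projection_zero intro!: exI[of _ 0])

lemma frontier_exceptions:
  assumes "admissible D1" "admissible D2"
  shows "finite (frontier D1 \<union> frontier D2)" "frontier D1 \<union> frontier D2 \<subseteq> I - S"
  using assms admissible_frontier by (auto simp: admissible_def)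

lemma closure_or_interior: "t \<notin> frontier D \<Longrightarrow> t \<in> interior D \<or> t \<notin> closure D"
  by (auto simp: frontier_def)

lemma real_cases: "Im l \<noteq> 0 \<or> (\<exists>t. l = complex_of_real t)"
  by (metis complex_is_Real_iff Reals_cases)

text \<open>A point outside the closure of the intersection and off both frontiers is outside one of
  the two closures, so one factor settles it. Frontier points are isolated and carry no eigenvector
  in the range. The complement is handled by 1 - P Q = (1 - P) + P (1 - Q).\<close>

lemma spectral_value_Int:
  assumes P: "spectral_value D1 P" "admissible D1" and Q: "spectral_value D2 Q" "admissible D2"
  shows "spectral_value (D1 \<inter> D2) (\<lambda>x. P (Q x))"
proof -
  note p = spectral_valueD(1)[OF P(1)] and q = spectral_valueD(1)[OF Q(1)]
  obtain K where K: "\<forall>x\<in>range P. \<exists>u. (x, u) \<in> A \<and> norm u \<le> K * norm x"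
    using spectral_value_bounded[OF P(1)] by (elim exE conjE)
  have eig: "P (Q x) = (if t \<in> D1 \<inter> D2 then x else 0)" if "(x, of_real t *\<^sub>C x) \<in> A" for t x
    using spectral_valueD(4)[OF P(1) that] spectral_valueD(4)[OF Q(1) that]
    by (auto simp: bounded_clinearD(5)[OF spectral_projectionD(2)[OF p]])
  show ?thesis
  proof (rule spectral_valueI[where K=K])
    show "spectral_projection (\<lambda>x. P (Q x))" by (rule spectral_projection_compose[OF p q])
    show "\<exists>u. (x, u) \<in> A \<and> norm u \<le> K * norm x" if "x \<in> range (\<lambda>x. P (Q x))" for x
      by (rule bspec[OF K]) (use that in auto)
    show "P (Q x) = (if t \<in> D1 \<inter> D2 then x else 0)" if "(x, of_real t *\<^sub>C x) \<in> A" for t x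
      by (rule eig[OF that])
    show "l \<in> rho (range (\<lambda>x. P (Q x)))" if l: "l \<notin> of_real ` closure (D1 \<inter> D2)" for l
    proof (cases "Im l = 0")
      case True
      then obtain t where t: "l = of_real t" using real_cases by blast
      have "of_real t \<in> rho (range (\<lambda>x. P (Q x)))"
      proof (rule finite_exceptions_projection[OF spectral_projection_compose[OF p q] frontier_exceptions[OF P(2) Q(2)]])
        show "open (- closure (D1 \<inter> D2))" by (intro open_Compl closed_closure)
        show "t \<in> - closure (D1 \<inter> D2)" using l t by auto
        show "of_real s \<in> rho (range (\<lambda>x. P (Q x)))" if s: "s \<in> - closure (D1 \<inter> D2)" "s \<notin> frontier D1 \<union> frontier D2" for s
        proof (cases "s \<in> closure D1 \<and> s \<in> closure D2")
          case True
          then have "s \<in> interior (D1 \<inter> D2)" using s(2) closure_or_interior[of s D1] closure_or_interior[of s D2] by auto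
          then show ?thesis using s(1) interior_subset[of "D1 \<inter> D2"] closure_subset[of "D1 \<inter> D2"] by auto
        next
          case False
          then show ?thesis
            using rho_compose[OF p q spectral_value_rho_real[OF P(1)]]
              rho_compose2[OF p q spectral_value_rho_real[OF Q(1)]] by blast
        qed
        show "x = 0" if "s \<in> - closure (D1 \<inter> D2)" "(x, of_real s *\<^sub>C x) \<in> A" "P (Q x) = x" for s x
        proof -
          have "s \<notin> D1 \<inter> D2" using that(1) closure_subset[of "D1 \<inter> D2"] by auto
          then show ?thesis using eig[OF that(2)] that(3) by (auto split: if_splits)
        qed
      qed
      then show ?thesis by (simp add: t)
    qed (intro rho_compose[OF p q] spectral_value_rho_off_real[OF P(1)])
    show "of_real t \<in> rho (range (\<lambda>x. x - P (Q x)))" if t: "t \<in> interior (D1 \<inter> D2)" for t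
    proof (rule rho_disjoint_sum)
      show "spectral_projection (\<lambda>x. x - P x)" "spectral_projection (\<lambda>x. P (x - Q x))" "spectral_projection (\<lambda>x. x - P (Q x))"
        by (intro spectral_projection_complement spectral_projection_compose[OF p] spectral_projection_compose[OF p q] p q
            spectral_projection_compose[OF p spectral_projection_complement[OF q]])+
      show "P (x - Q x) - P (P (x - Q x)) = 0" for x by (simp add: spectral_projectionD(3)[OF p])
      show "x - P (Q x) = x - P x + P (x - Q x)" for x by (simp add: bounded_clinearD[OF spectral_projectionD(2)[OF p]])
      show "of_real t \<in> rho (range (\<lambda>x. x - P x))" using t by (intro spectral_valueD(3)[OF P(1)]) auto
      show "of_real t \<in> rho (range (\<lambda>x. P (x - Q x)))"
        using t by (intro rho_compose2[OF p spectral_projection_complement[OF q]] spectral_valueD(3)[OF Q(1)]) auto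
    qed
  qed
qed

text \<open>As for intersections, with the complement split by 1 - P (1 - Q) = (1 - P) + P
  Q.\<close>

lemma spectral_value_Diff:
  assumes P: "spectral_value D1 P" "admissible D1" and Q: "spectral_value D2 Q" "admissible D2"
  shows "spectral_value (D1 - D2) (\<lambda>x. P (x - Q x))"
proof -
  note p = spectral_valueD(1)[OF P(1)] and q = spectral_valueD(1)[OF Q(1)]
  note q' = spectral_projection_complement[OF q]
  note pq = spectral_projection_compose[OF p q']
  obtain K where K: "\<forall>x\<in>range P. \<exists>u. (x, u) \<in> A \<and> norm u \<le> K * norm x"
    using spectral_value_bounded[OF P(1)] by (elim exE conjE)
  have eig: "P (x - Q x) = (if t \<in> D1 - D2 then x else 0)" if "(x, of_real t *\<^sub>C x) \<in> A" for t x
    using spectral_valueD(4)[OF P(1) that] spectral_valueD(4)[OF Q(1) that]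
    by (auto simp: bounded_clinearD(5)[OF spectral_projectionD(2)[OF p]])
  show ?thesis
  proof (rule spectral_valueI[where K=K, OF pq])
    show "\<exists>u. (x, u) \<in> A \<and> norm u \<le> K * norm x" if "x \<in> range (\<lambda>x. P (x - Q x))" for x
      by (rule bspec[OF K]) (use that in auto)
    show "P (x - Q x) = (if t \<in> D1 - D2 then x else 0)" if "(x, of_real t *\<^sub>C x) \<in> A" for t x
      by (rule eig[OF that])
    show "l \<in> rho (range (\<lambda>x. P (x - Q x)))" if l: "l \<notin> of_real ` closure (D1 - D2)" for l
    proof (cases "Im l = 0")
      case True
      then obtain t where t: "l = of_real t" using real_cases by blast
      have "of_real t \<in> rho (range (\<lambda>x. P (x - Q x)))"
      proof (rule finite_exceptions_projection[OF pq frontier_exceptions[OF P(2) Q(2)]])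
        show "open (- closure (D1 - D2))" by (intro open_Compl closed_closure)
        show "t \<in> - closure (D1 - D2)" using l t by auto
        show "of_real s \<in> rho (range (\<lambda>x. P (x - Q x)))" if s: "s \<in> - closure (D1 - D2)" "s \<notin> frontier D1 \<union> frontier D2" for s
        proof (cases "s \<in> closure D1")
          case True
          then have "s \<in> D1" using s(2) closure_or_interior[of s D1] interior_subset[of D1] by auto
          then have "s \<in> D2" using s(1) closure_subset[of "D1 - D2"] by auto
          then have "s \<in> interior D2" using s(2) closure_or_interior[of s D2] closure_subset[of D2] by auto
          then show ?thesis by (intro rho_compose2[OF p q'] spectral_valueD(3)[OF Q(1)])
        qed (intro rho_compose[OF p q'] spectral_value_rho_real[OF P(1)])
        show "x = 0" if "s \<in> - closure (D1 - D2)" "(x, of_real s *\<^sub>C x) \<in> A" "P (x - Q x) = x" for s x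
        proof -
          have "s \<notin> D1 - D2" using that(1) closure_subset[of "D1 - D2"] by auto
          then show ?thesis using eig[OF that(2)] that(3) by (auto split: if_splits)
        qed
      qed
      then show ?thesis by (simp add: t)
    qed (intro rho_compose[OF p q'] spectral_value_rho_off_real[OF P(1)])
    show "of_real t \<in> rho (range (\<lambda>x. x - P (x - Q x)))" if t: "t \<in> interior (D1 - D2)" for t
    proof (rule rho_disjoint_sum)
      show "spectral_projection (\<lambda>x. x - P x)" by (rule spectral_projection_complement[OF p])
      show "spectral_projection (\<lambda>x. P (Q x))" by (rule spectral_projection_compose[OF p q])
      show "spectral_projection (\<lambda>x. x - P (x - Q x))" by (rule spectral_projection_complement[OF pq])
      show "P (Q x) - P (P (Q x)) = 0" for x by (simp add: spectral_projectionD(3)[OF p])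
      show "x - P (x - Q x) = x - P x + P (Q x)" for x by (simp add: bounded_clinearD[OF spectral_projectionD(2)[OF p]])
      show "of_real t \<in> rho (range (\<lambda>x. x - P x))"
        using t interior_mono[of "D1 - D2" D1] by (intro spectral_valueD(3)[OF P(1)]) auto
      have "t \<notin> closure D2"
        using t interior_mono[of "D1 - D2" "- D2"] by (auto simp: interior_complement)
      then show "of_real t \<in> rho (range (\<lambda>x. P (Q x)))"
        by (intro rho_compose2[OF p q] spectral_value_rho_real[OF Q(1)])
    qed
  qed
qed

text \<open>Here the frontier matters for the complement (1 - P) (1 - Q): a frontier point of the
  two sets may be interior to their union. For the union itself the two closures suffice.\<close>

lemma spectral_value_Un:
  assumes P: "spectral_value D1 P" "admissible D1" and Q: "spectral_value D2 Q" "admissible D2"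
  shows "spectral_value (D1 \<union> D2) (\<lambda>x. P x + Q x - P (Q x))"
proof -
  note p = spectral_valueD(1)[OF P(1)] and q = spectral_valueD(1)[OF Q(1)]
  note p' = spectral_projection_complement[OF p] and q' = spectral_projection_complement[OF q]
  note pq = spectral_projection_union[OF p q]
  note Pl = bounded_clinearD[OF spectral_projectionD(2)[OF p]]
  obtain K1 where K1: "K1 \<ge> 0" "\<forall>x\<in>range P. \<exists>u. (x, u) \<in> A \<and> norm u \<le> K1 * norm x"
    using spectral_value_bounded[OF P(1)] by (elim exE conjE)
  obtain K2 where K2: "K2 \<ge> 0" "\<forall>x\<in>range Q. \<exists>u. (x, u) \<in> A \<and> norm u \<le> K2 * norm x"
    using spectral_value_bounded[OF Q(1)] by (elim exE conjE)
  obtain N1 where N1: "N1 > 0" "\<And>x. norm (P x) \<le> norm x * N1"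
    using bounded_linear.pos_bounded[OF Pl(1)] by blast
  have rsum: "l \<in> rho (range (\<lambda>x. P x + Q x - P (Q x)))" if "l \<in> rho (range P)" "l \<in> rho (range Q)" for l
  proof (rule rho_disjoint_sum[OF p spectral_projection_compose[OF p' q] pq])
    show "P (Q x - P (Q x)) = 0" for x by (simp add: Pl spectral_projectionD(3)[OF p])
    show "l \<in> rho (range (\<lambda>x. Q x - P (Q x)))" using rho_compose2[OF p' q that(2)] by simp
  qed (simp_all add: that)
  have eig: "P x + Q x - P (Q x) = (if t \<in> D1 \<union> D2 then x else 0)" if "(x, of_real t *\<^sub>C x) \<in> A" for t x
    using spectral_valueD(4)[OF P(1) that] spectral_valueD(4)[OF Q(1) that]
    by (auto simp: Pl)
  have compl: "x - (P x + Q x - P (Q x)) = (x - Q x) - P (x - Q x)" for x by (simp add: Pl)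
  note p'q' = spectral_projection_compose[OF p' q']
  show ?thesis
  proof (rule spectral_valueI[where K="K1 * N1 + K2 * (1 + N1)", OF pq])
    show "\<exists>u. (x, u) \<in> A \<and> norm u \<le> (K1 * N1 + K2 * (1 + N1)) * norm x"
      if "x \<in> range (\<lambda>x. P x + Q x - P (Q x))" for x
    proof -
      have x: "x = P x + Q (x - P x)"
      proof -
        have "P x + Q x - P (Q x) = x" using that unfolding range_spectral_projection[OF pq] by simp
        moreover have "Q (x - P x) = Q x - P (Q x)"
          by (simp add: bounded_clinearD[OF spectral_projectionD(2)[OF q]] spectral_projection_commute[OF p q])
        ultimately show ?thesis by (metis add_diff_eq)
      qed
      obtain u where u: "(P x, u) \<in> A" "norm u \<le> K1 * norm (P x)" using bspec[OF K1(2), of "P x"] by blast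
      obtain v where v: "(Q (x - P x), v) \<in> A" "norm v \<le> K2 * norm (Q (x - P x))" using bspec[OF K2(2), of "Q (x - P x)"] by blast
      have "Q (x - P x) = x - P x" using x by (metis add_diff_cancel_left')
      then have "norm (Q (x - P x)) \<le> norm x + norm x * N1"
        using norm_triangle_ineq4[of x "P x"] N1(2)[of x] by simp
      then have "norm v \<le> K2 * (norm x + norm x * N1)"
        using v(2) mult_left_mono[OF _ K2(1)] order_trans by blast
      moreover have "norm u \<le> K1 * (norm x * N1)"
        using u(2) mult_left_mono[OF N1(2)[of x] K1(1)] by linarith
      ultimately have "norm (u + v) \<le> (K1 * N1 + K2 * (1 + N1)) * norm x"
        using norm_triangle_ineq[of u v] by (simp add: algebra_simps)
      moreover have "(x, u + v) \<in> A" using A_add[OF u(1) v(1)] x by simp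
      ultimately show ?thesis by blast
    qed
    show "P x + Q x - P (Q x) = (if t \<in> D1 \<union> D2 then x else 0)" if "(x, of_real t *\<^sub>C x) \<in> A" for t x
      by (rule eig[OF that])
    show "l \<in> rho (range (\<lambda>x. P x + Q x - P (Q x)))" if l: "l \<notin> of_real ` closure (D1 \<union> D2)" for l
      using l by (intro rsum spectral_valueD(2)[OF P(1)] spectral_valueD(2)[OF Q(1)]) (auto simp: closure_Un)
    show "of_real t \<in> rho (range (\<lambda>x. x - (P x + Q x - P (Q x))))" if t: "t \<in> interior (D1 \<union> D2)" for t
      unfolding compl
    proof (rule finite_exceptions_projection[OF p'q' frontier_exceptions[OF P(2) Q(2)] open_interior t])
      show "of_real s \<in> rho (range (\<lambda>x. (x - Q x) - P (x - Q x)))"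
        if s: "s \<in> interior (D1 \<union> D2)" "s \<notin> frontier D1 \<union> frontier D2" for s
      proof (cases "s \<in> interior D1")
        case True
        then show ?thesis using rho_compose[OF p' q' spectral_valueD(3)[OF P(1)]] by simp
      next
        case False
        then have "s \<notin> D1" using s(2) closure_or_interior[of s D1] closure_subset[of D1] by auto
        then have "s \<in> D2" using s(1) interior_subset[of "D1 \<union> D2"] by auto
        then have "s \<in> interior D2" using s(2) closure_or_interior[of s D2] closure_subset[of D2] by auto
        then show ?thesis using rho_compose2[OF p' q' spectral_valueD(3)[OF Q(1)]] by simp
      qed
      show "x = 0" if s: "s \<in> interior (D1 \<union> D2)" "(x, of_real s *\<^sub>C x) \<in> A" "(x - Q x) - P (x - Q x) = x" for s x
      proof -
        have "s \<in> D1 \<union> D2" using s(1) interior_subset[of "D1 \<union> D2"] by auto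
        then show ?thesis using eig[OF s(2)] s(3) compl[of x] by (auto split: if_splits)
      qed
    qed
  qed
qed

lemma Liouville_projection:
  assumes P: "spectral_projection P" and rho: "\<And>l. l \<in> rho (range P)"
    and K: "\<And>x. x \<in> range P \<Longrightarrow> \<exists>u. (x, u) \<in> A \<and> norm u \<le> K * norm x"
  shows "P x = 0"
proof (rule Liouville[OF invariant_spectral_projection[OF P], where K=K])
  show "norm u \<le> K * norm x" if "(x, u) \<in> A" "x \<in> range P" for x u
    using K[OF that(2)] A_unique that(1) by blast
qed (use rho in auto)

text \<open>P (1 - Q) is a spectral value of D - D, so it has empty spectrum and bounded action and
  vanishes by Liouville's theorem. By symmetry P = P Q and Q = Q P, and the two commute.\<close>

lemma spectral_value_unique:
  assumes P: "spectral_value D P" and Q: "spectral_value D Q" and D: "admissible D"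
  shows "P = Q"
proof -
  have *: "P (x - Q x) = 0" if P: "spectral_value D P" and Q: "spectral_value D Q" for P Q x
  proof -
    have "spectral_value {} (\<lambda>x. P (x - Q x))" using spectral_value_Diff[OF P D Q D] by simp
    note X = this
    obtain K where "\<forall>x\<in>range (\<lambda>x. P (x - Q x)). \<exists>u. (x, u) \<in> A \<and> norm u \<le> K * norm x"
      using spectral_value_bounded[OF X] by (elim exE conjE)
    then show ?thesis
      by (intro Liouville_projection[OF spectral_valueD(1)[OF X]] spectral_valueD(2)[OF X]) auto
  qed
  have "P x = P (Q x)" "Q x = Q (P x)" for x
    using *[OF P Q, of x] *[OF Q P, of x] spectral_valueD(1)[OF P] spectral_valueD(1)[OF Q] spectral_projectionD(2)
    by (metis bounded_clinearD(4) eq_iff_diff_eq_0)+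
  then show ?thesis
    using spectral_projection_commute[OF spectral_valueD(1)[OF P] spectral_valueD(1)[OF Q]] by (metis ext)
qed

end

context G_symmetric_operator
begin

lemma resolvent_growth_near:
  assumes t: "robust A (of_real t)" and e: "e > 0" "\<And>l. l \<in> ball (of_real t) e \<Longrightarrow> Im l \<noteq> 0 \<Longrightarrow> l \<in> rho UNIV"
  shows "\<exists>\<epsilon> K d C. 0 < \<epsilon> \<and> \<epsilon> \<le> e \<and> positive_point A G t \<epsilon> K d C"
proof -
  obtain e2 d C where e2: "e2 > 0" "d > 0" "C > 0"
    "\<And>l x u. l \<in> ball (of_real t) e2 \<Longrightarrow> (x, u) \<in> A \<Longrightarrow> d * (norm x)\<^sup>2 \<le> gq x + C * (norm (u - l *\<^sub>C x))\<^sup>2"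
    using robust_point[OF t] by blast
  obtain g where g: "g > 0" "\<And>x y. cmod (gi x y) \<le> g * norm x * norm y" using gi_bound by blast
  define r where "r = min e (min e2 1)"
  have r: "r > 0" "r \<le> e" "r \<le> e2" "r \<le> 1" using e(1) e2(1) by (auto simp: r_def)
  have "positive_point A G t r ((g + C) / d + 1) d C"
  proof unfold_locales
    show "l \<in> rho UNIV" if "l \<in> ball (of_real t) r" "Im l \<noteq> 0" for l
      using that r(2) by (intro e(2)) auto
    show "0 \<le> (g + C) / d + 1" using g(1) e2(2,3) by simp
    show "d * (norm x)\<^sup>2 \<le> gq x + C * (norm (u - l *\<^sub>C x))\<^sup>2" if "l \<in> ball (of_real t) r" "(x, u) \<in> A" for l x u
      using that r(3) by (intro e2(4)) auto
    show "norm (R UNIV l x) \<le> ((g + C) / d + 1) / \<bar>Im l\<bar> * norm x" if l: "l \<in> ball (of_real t) r" "Im l \<noteq> 0" for l x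
    proof -
      have "\<bar>Im l\<bar> \<le> cmod (l - of_real t)" using abs_Im_le_cmod[of "l - of_real t"] by simp
      then have Im: "\<bar>Im l\<bar> \<le> 1" using l(1) r(4) by (simp add: dist_norm norm_minus_commute)
      have ineq: "d * (norm y)\<^sup>2 \<le> gq y + C * (norm (v - l *\<^sub>C y))\<^sup>2" if "(y, v) \<in> A" "y \<in> UNIV" for y v
        using l(1) r(3) by (intro e2(4) that(1)) auto
      have "l \<in> rho UNIV" using l r(2) by (intro e(2)) auto
      from resolvent_growth[OF e2(2,3) ineq g this l(2) Im UNIV_I] show ?thesis .
    qed
  qed (use e2 in auto)
  then show ?thesis using r by blast
qed

end

section \<open>Existence away from the exceptional points\<close>

context local_positive
begin

lemma frontier_open_interval: "frontier {p<..<q} \<subseteq> {p, q :: real}"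
  by (cases "p < q") (auto simp: frontier_def)

lemma spectral_value_small_interval:
  assumes t: "t \<in> I - S"
  shows "\<exists>\<epsilon>>0. {t - \<epsilon><..<t + \<epsilon>} \<subseteq> I - S \<and>
    (\<forall>p q. t - \<epsilon> < p \<longrightarrow> p < q \<longrightarrow> q < t + \<epsilon> \<longrightarrow> (\<exists>P. spectral_value {p<..<q} P))"
proof -
  have tI: "t \<in> I" "t \<notin> S" using t by auto
  obtain e0 where e0: "e0 > 0" "ball t e0 \<subseteq> I" using openE[OF I_open tI(1)] by blast
  obtain e1 where e1: "e1 > 0" "\<forall>s\<in>S. s \<noteq> t \<longrightarrow> e1 \<le> dist s t"
    using S_discrete[OF tI(1)] unfolding islimpt_approachable by (meson not_le)
  obtain e2 where e2: "e2 > 0" "\<forall>l\<in>ball (of_real t) e2. Im l \<noteq> 0 \<longrightarrow> l \<in> rho UNIV"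
    using nonreal_near[OF tI(1)] by blast
  define e where "e = min (min e0 e1) e2"
  have e: "e > 0" "e \<le> e0" "e \<le> e1" "e \<le> e2" using e0(1) e1(1) e2(1) by (auto simp: e_def)
  obtain \<epsilon> K d C where \<epsilon>: "0 < \<epsilon>" "\<epsilon> \<le> e" "positive_point A G t \<epsilon> K d C"
    using resolvent_growth_near[OF robust_A[OF tI] e(1)] e2(2) e(4)
    by (metis mem_ball order_less_le_trans)
  interpret positive_point A G t \<epsilon> K d C by fact
  have "\<exists>P. spectral_value {p<..<q} P" if pq: "t - \<epsilon> < p" "p < q" "q < t + \<epsilon>" for p q
  proof -
    have "\<bar>(p + q) / 2 - t\<bar> + (q - p) / 2 < \<epsilon>"
      using pq by (cases "(p + q) / 2 - t \<ge> 0") (simp_all add: field_simps)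
    then have "good ((p + q) / 2) ((q - p) / 2)" using pq by (simp add: good_def)
    from spectral_value_interval[OF this] show ?thesis by (simp add: field_simps)
  qed
  moreover have "{t - \<epsilon><..<t + \<epsilon>} \<subseteq> I - S"
  proof
    fix s assume s: "s \<in> {t - \<epsilon><..<t + \<epsilon>}"
    then have "dist s t < \<epsilon>" by (auto simp: dist_real_def)
    then show "s \<in> I - S" using e0(2) e1(2) e(2,3) \<epsilon>(2) tI(2) by (force simp: dist_commute)
  qed
  ultimately show ?thesis using \<epsilon>(1) by blast
qed

text \<open>Locally, the points of the frontier cut a set into intervals and single points.\<close>

lemma spectral_value_local:
  assumes U: "{a<..<b} \<subseteq> I - S"
    and interval: "\<And>p q. a < p \<Longrightarrow> p < q \<Longrightarrow> q < b \<Longrightarrow> \<exists>P. spectral_value {p<..<q} P"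
    and D: "finite (frontier D)" and pq: "a < p" "q < b"
  shows "\<exists>P. spectral_value (D \<inter> {p<..<q}) P"
  using pq
proof (induction "card (frontier D \<inter> {p<..<q})" arbitrary: p q rule: less_induct)
  case less
  have adm: "admissible X" if X: "X \<subseteq> {p<..<q}" "finite (frontier X)" for X
  proof -
    have "closure X \<subseteq> closure {p<..<q}" by (rule closure_mono[OF X(1)])
    also have "\<dots> \<subseteq> {p..q}" by (rule closure_minimal) auto
    also have "\<dots> \<subseteq> {a<..<b}" using less.prems by auto
    also note U
    finally have "closure X \<subseteq> I - S" .
    moreover have "bounded X" by (rule bounded_subset[OF bounded_closed_interval[of p q]]) (use X(1) in force)
    moreover have "frontier X \<subseteq> closure X" by (auto simp: frontier_def)
    ultimately show ?thesis using X(2) by (auto simp: admissible_def)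
  qed
  have adm_int: "admissible ({u<..<v} :: real set)" if "p \<le> u" "v \<le> q" for u v
    by (rule adm) (use that finite_subset[OF frontier_open_interval] in auto)
  have adm_D: "admissible (D \<inter> {u<..<v})" if "p \<le> u" "v \<le> q" for u v
    using D finite_subset[OF frontier_Int_subset[of D "{u<..<v}"]] finite_subset[OF frontier_open_interval[of u v]] that
    by (intro adm) auto
  show ?case
  proof (cases "frontier D \<inter> {p<..<q} = {}")
    case True
    have "D \<inter> {p<..<q} = {} \<or> {p<..<q} \<subseteq> D"
      using connected_Int_frontier[of "{p<..<q}" D] True connected_Ioo[of p q] by blast
    then show ?thesis
    proof
      assume "D \<inter> {p<..<q} = {}"
      then show ?thesis using spectral_value_empty by metis
    next
      assume sub: "{p<..<q} \<subseteq> D"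
      show ?thesis
      proof (cases "p < q")
        case True
        then show ?thesis using interval[of p q] less.prems sub by (simp add: Int_absorb1)
      next
        case False
        then have "D \<inter> {p<..<q} = {}" by auto
        then show ?thesis using spectral_value_empty by metis
      qed
    qed
  next
    case False
    then obtain f where f: "f \<in> frontier D" "p < f" "f < q" by auto
    have fin: "finite (frontier D \<inter> {p<..<q})" using D by simp
    have "card (frontier D \<inter> {p<..<f}) < card (frontier D \<inter> {p<..<q})"
      by (rule psubset_card_mono[OF fin]) (use f in auto)
    then obtain P1 where P1: "spectral_value (D \<inter> {p<..<f}) P1"
      using less.hyps[of p f] less.prems f by auto
    have "card (frontier D \<inter> {f<..<q}) < card (frontier D \<inter> {p<..<q})"
      by (rule psubset_card_mono[OF fin]) (use f in auto)
    then obtain P2 where P2: "spectral_value (D \<inter> {f<..<q}) P2"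
      using less.hyps[of f q] less.prems f by auto
    obtain Q Q1 Q2 where Q: "spectral_value {p<..<q} Q" "spectral_value {p<..<f} Q1" "spectral_value {f<..<q} Q2"
      using interval[of p q] interval[of p f] interval[of f q] less.prems f by (metis order.strict_trans)
    \<comment> \<open>Only open intervals are available so far; the projection of a single frontier
      point arises as the difference of the large interval and its two halves.\<close>
    have single: "{p<..<q} - {p<..<f} - {f<..<q} = {f}" using f by auto
    have adm_f: "admissible {f}" by (rule adm) (use f in \<open>auto simp: frontier_def\<close>)
    have ints: "admissible {p<..<q}" "admissible {p<..<f}" "admissible {f<..<q}" using f by (auto intro!: adm_int)
    obtain P3 where P3: "spectral_value {f} P3"
      using spectral_value_Diff[OF spectral_value_Diff[OF Q(1) ints(1) Q(2) ints(2)] admissible_Diff[OF ints(1,2)] Q(3) ints(3)]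
      unfolding single by blast
    have parts: "admissible (D \<inter> {p<..<f})" "admissible (D \<inter> {f<..<q})" using f by (auto intro!: adm_D)
    obtain P12 where P12: "spectral_value (D \<inter> {p<..<f} \<union> D \<inter> {f<..<q}) P12"
      using spectral_value_Un[OF P1 parts(1) P2 parts(2)] by blast
    have adm12: "admissible (D \<inter> {p<..<f} \<union> D \<inter> {f<..<q})" by (intro admissible_Un parts)
    show ?thesis
    proof (cases "f \<in> D")
      case True
      then have "D \<inter> {p<..<q} = (D \<inter> {p<..<f} \<union> D \<inter> {f<..<q}) \<union> {f}" using f by force
      then show ?thesis using spectral_value_Un[OF P12 adm12 P3 adm_f] by metis
    next
      case False
      have "D \<inter> {p<..<q} = D \<inter> {p<..<f} \<union> D \<inter> {f<..<q}"
        using f False by (auto) (metis linorder_neqE_linordered_idom)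
      then show ?thesis using P12 by metis
    qed
  qed
qed

text \<open>The conditions on the frontier of \<open>U\<close> allow any admissible set to be cut
  along \<open>U\<close>, so that a finite cover of its closure can be processed one set at a
  time.\<close>

definition covering :: "real set \<Rightarrow> bool"
  where "covering U \<longleftrightarrow> finite (frontier U) \<and> frontier U \<inter> S = {} \<and>
    (\<forall>D. admissible D \<longrightarrow> D \<subseteq> U \<longrightarrow> (\<exists>P. spectral_value D P))"

lemma spectral_value_covered:
  assumes "finite F" "\<forall>U\<in>F. covering U" "admissible D" "D \<subseteq> \<Union>F"
  shows "\<exists>P. spectral_value D P"
  using assms
proof (induction F arbitrary: D rule: finite_induct)
  case empty
  then show ?case using spectral_value_empty by auto
next
  case (insert U F)
  have U: "finite (frontier U)" "frontier U \<inter> S = {}" using insert.prems(1) by (auto simp: covering_def)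
  have adm: "admissible (D \<inter> U)" "admissible (D - U)"
    using admissible_Int_general[OF insert.prems(2) U] admissible_Diff_general[OF insert.prems(2) U] by auto
  obtain P where P: "spectral_value (D \<inter> U) P" using insert.prems(1) adm(1) by (auto simp: covering_def)
  obtain Q where Q: "spectral_value (D - U) Q"
    using insert.IH[OF _ adm(2)] insert.prems by auto
  have "D \<inter> U \<union> (D - U) = D" by auto
  then show ?case using spectral_value_Un[OF P adm(1) Q adm(2)] by metis
qed

lemma covering_near:
  assumes "t \<in> I - S"
  shows "\<exists>U. covering U \<and> open U \<and> t \<in> U"
proof -
  obtain \<epsilon> where \<epsilon>: "\<epsilon> > 0" "{t - \<epsilon><..<t + \<epsilon>} \<subseteq> I - S"
    "\<And>p q. t - \<epsilon> < p \<Longrightarrow> p < q \<Longrightarrow> q < t + \<epsilon> \<Longrightarrow> \<exists>P. spectral_value {p<..<q} P"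
    using spectral_value_small_interval[OF assms] by blast
  let ?U = "{t - \<epsilon> / 2<..<t + \<epsilon> / 2}"
  have fr: "frontier ?U \<subseteq> {t - \<epsilon> / 2, t + \<epsilon> / 2}" by (rule frontier_open_interval)
  have "covering ?U"
    unfolding covering_def
  proof (intro conjI allI impI)
    show "finite (frontier ?U)" using fr finite_subset by blast
    have "{t - \<epsilon> / 2, t + \<epsilon> / 2} \<subseteq> {t - \<epsilon><..<t + \<epsilon>}" using \<epsilon>(1) by auto
    then show "frontier ?U \<inter> S = {}" using fr \<epsilon>(2) by blast
    fix D assume D: "admissible D" "D \<subseteq> ?U"
    have "\<exists>P. spectral_value (D \<inter> ?U) P"
      by (rule spectral_value_local[OF \<epsilon>(2,3)]) (use D(1) \<epsilon>(1) in \<open>auto simp: admissible_def\<close>)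
    then show "\<exists>P. spectral_value D P" using D(2) by (simp add: Int_absorb2)
  qed
  moreover have "open ?U" "t \<in> ?U" using \<epsilon>(1) by auto
  ultimately show ?thesis by blast
qed

lemma spectral_value_regular:
  assumes D: "admissible D" "closure D \<inter> S = {}"
  shows "\<exists>P. spectral_value D P"
proof -
  have "compact (closure D)" using D(1) by (simp add: admissible_def compact_closure)
  have "\<exists>U. covering U \<and> open U \<and> t \<in> U" if "t \<in> closure D" for t
    using covering_near that D by (auto simp: admissible_def)
  then obtain U where U: "\<And>t. t \<in> closure D \<Longrightarrow> covering (U t) \<and> open (U t) \<and> t \<in> U t" by metis
  obtain T where T: "T \<subseteq> closure D" "finite T" "closure D \<subseteq> (\<Union>t\<in>T. U t)"
    by (rule compactE_image[OF \<open>compact (closure D)\<close>, of "closure D" U]) (use U in blast)+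
  show ?thesis
    by (rule spectral_value_covered[of "U ` T"]) (use U T D(1) closure_subset[of D] in auto)
qed

end

section \<open>Existence of spectral projections\<close>

context G_symmetric_operator
begin

text \<open>Within the annulus the integral does not depend on the radius. Evaluating the outer of
  two such integrals on the larger circle gives W W = - W by \<open>Riesz_integral_W\<close>, so - W
  is idempotent. Composition with \<open>P0\<close> extends it to the whole space.\<close>

lemma Riesz_projection:
  assumes P0: "spectral_projection P0" and r: "0 < a" "a < r" "r < b"
    and annulus: "{l. a < dist (of_real m) l \<and> dist (of_real m) l < b} \<subseteq> rho (range P0)"
  obtains P where "spectral_projection P" "\<And>x. P0 (P x) = P x"
    "\<And>l. l \<notin> cball (of_real m) r \<Longrightarrow> l \<in> rho (range P)"
    "\<And>l. l \<in> ball (of_real m) r \<Longrightarrow> l \<in> rho (range (\<lambda>x. P0 (x - P x)))"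
    "\<exists>K. \<forall>x\<in>range P. \<exists>u. (x, u) \<in> A \<and> norm u \<le> K * norm x"
    "\<And>x t. (x, of_real t *\<^sub>C x) \<in> A \<Longrightarrow> P0 x = x \<Longrightarrow> \<bar>t - m\<bar> \<noteq> r \<Longrightarrow> P x = (if \<bar>t - m\<bar> < r then x else 0)"
proof -
  define N where "N = range P0"
  define s where "s = (r + b) / 2"
  have s: "r < s" "s < b" "0 < r" "0 < s" using r by (auto simp: s_def)
  note p0 = spectral_projectionD[OF P0]
  have N: "invariant N" unfolding N_def by (rule invariant_spectral_projection[OF P0])
  have N_fix: "x \<in> N \<longleftrightarrow> P0 x = x" for x unfolding N_def range_spectral_projection[OF P0] by simp
  have P0N: "P0 x \<in> N" for x by (simp add: N_def)
  have sph: "sphere (of_real m) r \<subseteq> rho N" "sphere (of_real m) s \<subseteq> rho N"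
    using annulus r s by (auto simp: N_def)
  have circ1: "weighted_circle A N (of_real m) r (\<lambda>_. 1)" and circ2: "weighted_circle A N (of_real m) s (\<lambda>_. 1)"
    using s by (auto intro!: weighted_circle_unit N sph)
  interpret W: weighted_circle A N "of_real m" r "\<lambda>_. 1" by (rule circ1)
  interpret V: weighted_circle A N "of_real m" s "\<lambda>_. 1" by (rule circ2)
  note one = continuous_on_const[of _ "1::complex"]
  have VW: "V.W (\<lambda>_. 1) x = W.W (\<lambda>_. 1) x" if x: "x \<in> N" for x
  proof -
    let ?S = "{l. a < dist (complex_of_real m) l \<and> dist (of_real m) l < b}"
    have opn: "open ?S" by (intro open_Collect_conj open_Collect_less continuous_intros)
    have "cint (of_real m) r (\<lambda>l. R N l x) = cint (of_real m) s (\<lambda>l. R N l x)"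
    proof (rule cint_radius_independent[OF _ _ _ opn])
      show "cball (complex_of_real m) s - ball (of_real m) r \<subseteq> ?S" using r s by auto
      show "(\<lambda>l. cinner (R N l x) y) holomorphic_on ?S" for y
        by (rule R_holomorphic[OF opn _ x invariantD(1)[OF N]]) (use annulus in \<open>simp add: N_def\<close>)
      show "continuous_on ?S (\<lambda>l. R N l x)"
        by (rule continuous_on_subset[OF R_continuous[OF x invariantD(1)[OF N]]]) (use annulus in \<open>simp add: N_def\<close>)
    qed (use s in auto)
    then show ?thesis by (simp add: V.W_def W.W_def)
  qed
  have WW: "W.W (\<lambda>_. 1) (W.W (\<lambda>_. 1) x) = - W.W (\<lambda>_. 1) x" if x: "x \<in> N" for x
  proof -
    have "V.W (\<lambda>_. 1) (W.W (\<lambda>_. 1) x) = - W.W (\<lambda>_. 1) x"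
    proof (rule Riesz_integral_W[OF circ1 circ2 _ subset_refl sph(2) _ _ x])
      show "W.W (\<lambda>l. 1 / (l - k)) x \<in> N" if "k \<in> sphere (of_real m) s" for k
        using that s by (intro W.W_in W.pole_continuous one x) auto
    qed (use s in \<open>auto intro!: W.W_in one x\<close>)
    then show ?thesis by (simp add: VW W.W_in x)
  qed
  define P where "P x = - W.W (\<lambda>_. 1) (P0 x)" for x
  have PN: "P x \<in> N" for x
    unfolding P_def using W.W_in[OF one P0N] complex_vector.subspace_neg[OF invariantD(1)[OF N]] by blast
  have P0P: "P0 (P x) = P x" for x using PN N_fix by blast
  have PP: "P (P x) = P x" for x
  proof -
    have "W.W (\<lambda>_. 1) (P x) = (- 1) *\<^sub>C W.W (\<lambda>_. 1) (W.W (\<lambda>_. 1) (P0 x))"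
      using W.W_scale[OF one W.W_in[OF one P0N[of x]], of "- 1"] by (simp add: P_def)
    then have "W.W (\<lambda>_. 1) (P x) = W.W (\<lambda>_. 1) (P0 x)" by (simp add: WW[OF P0N])
    then show ?thesis by (subst P_def) (simp add: P0P, simp add: P_def)
  qed
  have Pb: "bounded_clinear P"
  proof -
    obtain K where K: "K > 0" "\<And>x. x \<in> N \<Longrightarrow> norm (W.W (\<lambda>_. 1) x) \<le> K * norm x" using W.W_bound[OF one] by blast
    obtain B where B: "\<And>x. norm (P0 x) \<le> norm x * B"
      using bounded_linear.pos_bounded[OF bounded_clinearD(1)[OF p0(2)]] by blast
    have "norm (P x) \<le> (K * B) * norm x" for x
    proof -
      have "norm (P x) \<le> K * norm (P0 x)" using K(2)[OF P0N] by (simp add: P_def)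
      also have "\<dots> \<le> K * (norm x * B)" using K(1) B by (intro mult_left_mono) auto
      finally show ?thesis by (simp add: mult_ac)
    qed
    then show ?thesis
      by (intro bounded_clinearI[where K="K * B"])
        (simp_all add: P_def bounded_clinearD[OF p0(2)] W.W_add[OF one P0N P0N] W.W_scale[OF one P0N])
  qed
  have spec: "spectral_projection P"
    unfolding spectral_projection_def bounded_projection_def
  proof (intro conjI allI impI Pb)
    show "P \<circ> P = P" using PP by (auto simp: fun_eq_iff)
    show "commutes_with P A"
    proof -
      have "(P x, P u) \<in> A" if "(x, u) \<in> A" for x u
      proof -
        have "(P0 x, P0 u) \<in> A" using p0(4) that by (auto simp: commutes_with_def)
        then show ?thesis unfolding P_def by (intro A_minus W.W_commutes_A[OF one] P0N)
      qed
      then show ?thesis by (auto simp: commutes_with_def)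
    qed
    show "gi (P x) y = gi x (P y)" for x y
    proof -
      have "gi (P x) y = gi (P x) (P0 y)" using p0(5)[of "P x" y] P0P[of x] by simp
      also have "\<dots> = gi (P0 x) (P y)"
        unfolding P_def by (simp add: W_symmetric[OF circ1 _ P0N P0N])
      also have "\<dots> = gi x (P y)" using p0(5)[of x "P y"] P0P[of y] by simp
      finally show ?thesis .
    qed
    show "T (P x) = P (T x)" if T: "bounded_clinear T" "commutes_with T A" for T x
    proof -
      have "T (W.W (\<lambda>_. 1) (P0 x)) = W.W (\<lambda>_. 1) (T (P0 x))"
      proof (rule W.W_commutes[OF one P0N T(1) _ T(2)])
        show "T y \<in> N" if "y \<in> N" for y using that p0(6)[OF T, of y] by (simp add: N_fix)
      qed
      then show ?thesis by (simp add: P_def bounded_clinearD[OF T(1)] p0(6)[OF T])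
    qed
  qed
  note p = spectral_projectionD[OF spec]
  have range_P: "range P \<subseteq> {x \<in> N. W.W (\<lambda>_. 1) x = (- 1) *\<^sub>C x}"
  proof
    fix x assume "x \<in> range P"
    then have "P x = x" "x \<in> N" using PP PN by auto
    then show "x \<in> {x \<in> N. W.W (\<lambda>_. 1) x = (- 1) *\<^sub>C x}"
      using N_fix[of x] by (auto simp: P_def) (metis minus_minus)
  qed
  have eig_inv: "invariant {x \<in> N. W.W (\<lambda>_. 1) x = c *\<^sub>C x}" for c by (rule W.eigenspace_W_invariant)
  show ?thesis
  proof (rule that[OF spec P0P])
    show "l \<in> rho (range P)" if l: "l \<notin> cball (of_real m) r" for l
    proof (rule rho_range[OF p(1,4) eig_inv range_P])
      show "l \<in> rho {x \<in> N. W.W (\<lambda>_. 1) x = (- 1) *\<^sub>C x}"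
      proof (rule W.rho_eigenspace_pole)
        show "l \<notin> sphere (of_real m) r" using l by auto
        have "cint (of_real m) r (\<lambda>k. 1 * 1 / (k - l)) = 0"
          using W.residue_outside[of "\<lambda>_. 1", OF _ _ l] by simp
        then show "- 1 + cint (of_real m) r (\<lambda>k. 1 * 1 / (k - l)) \<noteq> 0" by simp
      qed
    qed
    show "l \<in> rho (range (\<lambda>x. P0 (x - P x)))" if l: "l \<in> ball (of_real m) r" for l
    proof (rule rho_range[OF _ _ eig_inv[of 0]])
      have "spectral_projection (\<lambda>x. P0 (x - P x))"
        by (rule spectral_projection_compose[OF P0 spectral_projection_complement[OF spec]])
      then show "bounded_projection (\<lambda>x. P0 (x - P x))" "commutes_with (\<lambda>x. P0 (x - P x)) A"
        by (rule spectral_projectionD)+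
      have "P (P0 (x - P x)) = 0" for x
        using spectral_projection_commute[OF P0 spec] P0P PP by (simp add: bounded_clinearD[OF Pb] bounded_clinearD[OF p0(2)])
      then have "W.W (\<lambda>_. 1) (P0 (x - P x)) = 0" for x
        using p0(3) by (simp add: P_def)
      then show "range (\<lambda>x. P0 (x - P x)) \<subseteq> {x \<in> N. W.W (\<lambda>_. 1) x = 0 *\<^sub>C x}" using P0N by auto
      show "l \<in> rho {x \<in> N. W.W (\<lambda>_. 1) x = 0 *\<^sub>C x}"
      proof (rule W.rho_eigenspace_pole)
        show "l \<notin> sphere (of_real m) r" using l by auto
        show "0 + cint (of_real m) r (\<lambda>k. 1 * 1 / (k - l)) \<noteq> 0" using W.residue_inside[OF l] by simp
      qed
    qed
    obtain K where K: "K > 0" "\<And>x. x \<in> N \<Longrightarrow> norm (W.W (\<lambda>l. 1 * l) x) \<le> K * norm x"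
      using W.W_bound[of "\<lambda>l. 1 * l"] by (auto intro: continuous_intros)
    let ?c = "cint (of_real m) r (\<lambda>l. 1 * 1 :: complex)"
    have "\<exists>u. (x, u) \<in> A \<and> norm u \<le> (K + cmod ?c) * norm x" if "x \<in> range P" for x
    proof -
      have x: "x \<in> N" "x = - W.W (\<lambda>_. 1) x" using range_P that by auto
      have "(- W.W (\<lambda>_. 1) x, - (W.W (\<lambda>l. 1 * l) x + ?c *\<^sub>C x)) \<in> A"
        by (intro A_minus W.W_graph one x)
      moreover have "norm (- (W.W (\<lambda>l. 1 * l) x + ?c *\<^sub>C x)) \<le> (K + cmod ?c) * norm x"
        using norm_triangle_ineq[of "W.W (\<lambda>l. 1 * l) x" "?c *\<^sub>C x"] K(2)[OF x(1)]
        by (simp only: norm_minus_cancel norm_scaleC distrib_right)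
      ultimately show ?thesis using x(2) by metis
    qed
    then show "\<exists>K. \<forall>x\<in>range P. \<exists>u. (x, u) \<in> A \<and> norm u \<le> K * norm x" by blast
    show "P x = (if \<bar>t - m\<bar> < r then x else 0)"
      if x: "(x, of_real t *\<^sub>C x) \<in> A" "P0 x = x" and t: "\<bar>t - m\<bar> \<noteq> r" for x t
    proof -
      have xN: "x \<in> N" using x(2) N_fix by blast
      have d: "dist (complex_of_real m) (of_real t) = \<bar>t - m\<bar>"
        by (simp add: dist_real_def abs_minus_commute)
      have c: "continuous_on (sphere (of_real m) r) (\<lambda>l. 1 / (l - complex_of_real t))"
        by (intro W.pole_continuous one) (use d t in auto)
      have "P x = cint (of_real m) r (\<lambda>l. 1 / (l - of_real t)) *\<^sub>C x"
        using W.W_eigenvector[OF x(1) xN c] x(2) by (simp add: P_def)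
      moreover have "cint (of_real m) r (\<lambda>l. 1 / (l - of_real t)) = (if \<bar>t - m\<bar> < r then 1 else 0)"
        using W.residue_inside[of "of_real t"] W.residue_outside[of "\<lambda>_. 1" "of_real t"] d t by auto
      ultimately show ?thesis by simp
    qed
  qed
qed

end

context local_positive
begin

text \<open>A Riesz projection around \<open>s\<close> exists after splitting off the spectral subspaces of an
  interval to the left and one to the right of \<open>s\<close>.\<close>

lemma exceptional_interval:
  assumes s: "s \<in> I" and e: "e > 0"
  shows "\<exists>K P. spectral_value K P \<and> admissible K \<and> s \<in> interior K \<and> K \<subseteq> ball s e"
proof -
  obtain e0 where e0: "e0 > 0" "ball s e0 \<subseteq> I" using openE[OF I_open s] by blast
  obtain e1 where e1: "e1 > 0" "\<forall>t\<in>S. t \<noteq> s \<longrightarrow> e1 \<le> dist t s"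
    using S_discrete[OF s] unfolding islimpt_approachable by (meson not_le)
  obtain e2 where e2: "e2 > 0" "\<forall>l\<in>ball (of_real s) e2. Im l \<noteq> 0 \<longrightarrow> l \<in> rho UNIV"
    using nonreal_near[OF s] by blast
  \<comment> \<open>Four times this radius stays within all four bounds: the intervals to be removed
    occupy distances from \<eta> to 3 \<eta> on either side, and the Riesz circle has radius 2
    \<eta>.\<close>
  define \<eta> where "\<eta> = min (min e0 e1) (min e2 e) / 4"
  have \<eta>: "\<eta> > 0" "4 * \<eta> \<le> e0" "4 * \<eta> \<le> e1" "4 * \<eta> \<le> e2" "4 * \<eta> \<le> e"
    using e0(1) e1(1) e2(1) e by (auto simp: \<eta>_def)
  have in_I: "t \<in> I" if "\<bar>t - s\<bar> < 4 * \<eta>" for t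
    using that e0(2) \<eta>(2) by (auto simp: dist_real_def subset_iff abs_minus_commute)
  have not_S: "t \<notin> S" if "t \<noteq> s" "\<bar>t - s\<bar> < 4 * \<eta>" for t
    using that e1(2) \<eta>(3) by (force simp: dist_real_def)
  define D1 where "D1 = {s - 3 * \<eta><..<s - \<eta>}"
  define D2 where "D2 = {s + \<eta><..<s + 3 * \<eta>}"
  \<comment> \<open>Closed, since the removed intervals are open: eigenvectors at the end points of
    \<open>K\<close> survive in \<open>P0\<close> and are captured by the Riesz projection.\<close>
  define K where "K = {s - \<eta>..s + \<eta>}"
  have cl: "closure D1 = {s - 3 * \<eta>..s - \<eta>}" "closure D2 = {s + \<eta>..s + 3 * \<eta>}" "closure K = K"
    using \<eta>(1) by (auto simp: D1_def D2_def K_def)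
  have fr: "finite (frontier D1)" "finite (frontier D2)" "frontier K = {s - \<eta>, s + \<eta>}"
    using \<eta>(1) finite_subset[OF frontier_open_interval] by (auto simp: D1_def D2_def K_def frontier_def)
  have D1S: "closure D1 \<inter> S = {}" and D2S: "closure D2 \<inter> S = {}"
    unfolding cl using \<eta>(1) not_S by force+
  have adm: "admissible D" if "closure D \<subseteq> {s - 3 * \<eta>..s + 3 * \<eta>}" "finite (frontier D)" "frontier D \<inter> S = {}" for D
  proof -
    have "bounded (closure D)" by (rule bounded_subset[OF bounded_closed_interval that(1)])
    then have "bounded D" using closure_subset bounded_subset by blast
    moreover have "closure D \<subseteq> I"
    proof
      fix t assume "t \<in> closure D"
      then have "s - 3 * \<eta> \<le> t" "t \<le> s + 3 * \<eta>" using that(1) by auto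
      then show "t \<in> I" using \<eta>(1) by (intro in_I) (simp add: abs_less_iff)
    qed
    ultimately show ?thesis using that by (simp add: admissible_def)
  qed
  have "frontier D \<subseteq> closure D" for D :: "real set" by (auto simp: frontier_def)
  then have frS: "frontier D1 \<inter> S = {}" "frontier D2 \<inter> S = {}" using D1S D2S by blast+
  have adm1: "admissible D1" and adm2: "admissible D2"
    using fr(1,2) frS \<eta>(1) by (auto intro!: adm simp: cl)
  have admK: "admissible K"
    using \<eta>(1) not_S[of "s - \<eta>"] not_S[of "s + \<eta>"] unfolding K_def[symmetric]
    by (intro adm) (auto simp: cl fr, auto simp: K_def)
  obtain Q1 Q2 where Q1: "spectral_value D1 Q1" and Q2: "spectral_value D2 Q2"
    using spectral_value_regular[OF adm1 D1S] spectral_value_regular[OF adm2 D2S] by metis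
  note q1 = spectral_valueD(1)[OF Q1] and q2 = spectral_valueD(1)[OF Q2]
  note q1' = spectral_projection_complement[OF q1] and q2' = spectral_projection_complement[OF q2]
  define P0 where "P0 x = (x - Q1 x) - Q2 (x - Q1 x)" for x
  have P0: "spectral_projection P0" unfolding P0_def by (rule spectral_projection_compose[OF q2' q1'])
  note p0 = spectral_projectionD[OF P0]
  have nonreal: "l \<in> rho UNIV" if "dist (of_real s) l < 4 * \<eta>" "Im l \<noteq> 0" for l
    using that e2(2) \<eta>(4) by auto
  have gap: "of_real t \<in> rho (range P0)" if "\<eta> < \<bar>t - s\<bar>" "\<bar>t - s\<bar> < 3 * \<eta>" for t
  proof (cases "t < s")
    case True
    then have "t \<in> interior D1" using that by (auto simp: D1_def)
    then show ?thesis unfolding P0_def by (intro rho_compose2[OF q2' q1'] spectral_valueD(3)[OF Q1])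
  next
    case False
    then have "t \<in> interior D2" using that by (auto simp: D2_def)
    then show ?thesis unfolding P0_def by (intro rho_compose[OF q2' q1'] spectral_valueD(3)[OF Q2])
  qed
  have annulus: "{l. \<eta> < dist (of_real s) l \<and> dist (of_real s) l < 3 * \<eta>} \<subseteq> rho (range P0)"
  proof
    fix l assume l: "l \<in> {l. \<eta> < dist (complex_of_real s) l \<and> dist (of_real s) l < 3 * \<eta>}"
    show "l \<in> rho (range P0)"
    proof (cases "Im l = 0")
      case True
      then obtain t where t: "l = of_real t" using real_cases by blast
      then show ?thesis using l gap[of t] by (auto simp: dist_real_def abs_minus_commute)
    next
      case False
      then show ?thesis using l \<eta>(1) by (intro rho_range_UNIV p0 nonreal) auto
    qed
  qed
  have radii: "0 < \<eta>" "\<eta> < 2 * \<eta>" "2 * \<eta> < 3 * \<eta>" using \<eta>(1) by auto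
  obtain P where P: "spectral_projection P" "\<And>x. P0 (P x) = P x"
    "\<And>l. l \<notin> cball (of_real s) (2 * \<eta>) \<Longrightarrow> l \<in> rho (range P)"
    "\<And>l. l \<in> ball (of_real s) (2 * \<eta>) \<Longrightarrow> l \<in> rho (range (\<lambda>x. P0 (x - P x)))"
    "\<exists>K. \<forall>x\<in>range P. \<exists>u. (x, u) \<in> A \<and> norm u \<le> K * norm x"
    "\<And>x t. (x, of_real t *\<^sub>C x) \<in> A \<Longrightarrow> P0 x = x \<Longrightarrow> \<bar>t - s\<bar> \<noteq> 2 * \<eta> \<Longrightarrow> P x = (if \<bar>t - s\<bar> < 2 * \<eta> then x else 0)"
    by (rule Riesz_projection[OF P0 radii annulus]) (rule that; blast)
  note p = spectral_projectionD[OF P(1)]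
  obtain M where M: "\<forall>x\<in>range P. \<exists>u. (x, u) \<in> A \<and> norm u \<le> M * norm x" using P(5) ..
  have "spectral_value K P"
  proof (rule spectral_valueI[OF P(1) bspec[OF M]])
    show "l \<in> rho (range P)" if l: "l \<notin> of_real ` closure K" for l
    proof (cases "l \<in> cball (of_real s) (2 * \<eta>)")
      case True
      show ?thesis
      proof (cases "Im l = 0")
        case True
        then obtain t where t: "l = of_real t" using real_cases by blast
        have "t \<notin> K" using l t cl(3) by auto
        then have "\<eta> < \<bar>t - s\<bar>" by (auto simp: K_def)
        moreover have "\<bar>t - s\<bar> < 3 * \<eta>"
          using \<open>l \<in> cball _ _\<close> t \<eta>(1) by (simp add: dist_real_def abs_minus_commute)
        ultimately have "of_real t \<in> rho (range P0)" by (rule gap)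
        then show ?thesis
          unfolding t using P(2) by (intro rho_range[OF p(1,4) invariant_spectral_projection[OF P0]]) (auto, metis rangeI)
      next
        case False
        then show ?thesis using True \<eta>(1) by (intro rho_range_UNIV p nonreal) auto
      qed
    qed (rule P(3))
    show "of_real t \<in> rho (range (\<lambda>x. x - P x))" if t: "t \<in> interior K" for t
    proof -
      have t: "\<bar>t - s\<bar> < \<eta>" using t by (auto simp: K_def abs_less_iff)
      have "of_real t \<in> rho (range (\<lambda>x. x - P0 x))"
      proof (rule rho_disjoint_sum[OF q1 spectral_projection_compose[OF q2 q1'] spectral_projection_complement[OF P0]])
        show "Q1 (Q2 (x - Q1 x)) = 0" for x
          unfolding spectral_projection_commute[OF q1 q2]
          by (simp add: bounded_clinearD[OF spectral_projectionD(2)[OF q1]] spectral_projectionD(3)[OF q1]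
              bounded_clinearD(5)[OF spectral_projectionD(2)[OF q2]])
        show "x - P0 x = Q1 x + Q2 (x - Q1 x)" for x by (simp add: P0_def)
        show "of_real t \<in> rho (range Q1)"
          using t by (intro spectral_value_rho_real[OF Q1]) (auto simp: cl abs_less_iff)
        have "of_real t \<in> rho (range Q2)"
          using t by (intro spectral_value_rho_real[OF Q2]) (auto simp: cl abs_less_iff)
        then show "of_real t \<in> rho (range (\<lambda>x. Q2 (x - Q1 x)))" by (rule rho_compose[OF q2 q1'])
      qed
      moreover have "of_real t \<in> rho (range (\<lambda>x. P0 (x - P x)))"
        using t \<eta>(1) by (intro P(4)) (simp add: dist_real_def abs_minus_commute)
      ultimately show ?thesis
      proof (rule rho_disjoint_sum[OF spectral_projection_complement[OF P0]
            spectral_projection_compose[OF P0 spectral_projection_complement[OF P(1)]]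
            spectral_projection_complement[OF P(1)], rotated 2])
        show "P0 (x - P x) - P0 (P0 (x - P x)) = 0" for x by (simp add: p0(3))
        show "x - P x = x - P0 x + P0 (x - P x)" for x by (simp add: bounded_clinearD[OF p0(2)] P(2))
      qed
    qed
    show "P x = (if t \<in> K then x else 0)" if x: "(x, of_real t *\<^sub>C x) \<in> A" for t x
    proof -
      note Qx = spectral_valueD(4)[OF Q1 x] spectral_valueD(4)[OF Q2 x]
      note Q0 = bounded_clinearD(5)[OF spectral_projectionD(2)[OF q1]] bounded_clinearD(5)[OF spectral_projectionD(2)[OF q2]]
      show ?thesis
      proof (cases "t \<in> D1 \<union> D2")
        case True
        then have "P0 x = 0" using Qx Q0 by (auto simp: P0_def D1_def D2_def split: if_splits)
        then have "P x = 0"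
          using P(2)[of x] spectral_projection_commute[OF P0 P(1), of x] bounded_clinearD(5)[OF p(2)] by simp
        moreover have "t \<notin> K" using True \<eta>(1) by (auto simp: D1_def D2_def K_def)
        ultimately show ?thesis by simp
      next
        case False
        then have "P0 x = x" using Qx by (simp add: P0_def)
        moreover have "\<bar>t - s\<bar> \<noteq> 2 * \<eta>" using False \<eta>(1) by (auto simp: D1_def D2_def abs_if split: if_splits)
        ultimately have "P x = (if \<bar>t - s\<bar> < 2 * \<eta> then x else 0)" using P(6)[OF x] by blast
        moreover have "\<bar>t - s\<bar> < 2 * \<eta> \<longleftrightarrow> t \<in> K" using False \<eta>(1) by (auto simp: D1_def D2_def K_def abs_if)
        ultimately show ?thesis by simp
      qed
    qed
  qed
  moreover have "s \<in> interior K" using \<eta>(1) by (simp add: K_def)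
  moreover have "K \<subseteq> ball s e" using \<eta>(1,5) by (auto simp: K_def dist_real_def)
  ultimately show ?thesis using admK by blast
qed

lemma finite_exceptional:
  assumes "admissible D" shows "finite (S \<inter> closure D)"
proof -
  have "finite (closure D \<inter> S)"
    using assms S_discrete by (intro finite_not_islimpt_in_compact) (auto simp: admissible_def compact_closure)
  then show ?thesis by (simp add: Int_commute)
qed

text \<open>Induction on the number of exceptional points in the closure. Such a point is not in the
  frontier, so it has a small admissible neighbourhood inside \<open>D\<close> with a spectral
  value; removing this neighbourhood lowers the count.\<close>

lemma spectral_value_exists: "admissible D \<Longrightarrow> \<exists>P. spectral_value D P"
proof (induction "card (S \<inter> closure D)" arbitrary: D rule: less_induct)
  case less
  show ?case
  proof (cases "closure D \<inter> S = {}")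
    case True
    then show ?thesis using spectral_value_regular less.prems by blast
  next
    case False
    then obtain s where s: "s \<in> S" "s \<in> closure D" by blast
    have "s \<in> I" using s(2) less.prems by (auto simp: admissible_def)
    have "s \<notin> frontier D" using s(1) less.prems by (auto simp: admissible_def)
    then have "s \<in> interior D" using s(2) closure_or_interior by blast
    then obtain e where e: "e > 0" "ball s e \<subseteq> D" by (auto simp: mem_interior)
    obtain K P where K: "spectral_value K P" "admissible K" "s \<in> interior K" "K \<subseteq> ball s e"
      using exceptional_interval[OF \<open>s \<in> I\<close> e(1)] by blast
    have adm: "admissible (D - K)" by (rule admissible_Diff[OF less.prems K(2)])
    have "closure (D - K) \<subseteq> - interior K"
      using interior_subset[of K] by (intro closure_minimal) auto
    then have "s \<notin> closure (D - K)" using K(3) by blast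
    moreover have "closure (D - K) \<subseteq> closure D" by (intro closure_mono) auto
    ultimately have "card (S \<inter> closure (D - K)) < card (S \<inter> closure D)"
      using s by (intro psubset_card_mono finite_exceptional[OF less.prems]) blast
    then obtain Q where Q: "spectral_value (D - K) Q" using less.hyps adm by blast
    have "(D - K) \<union> K = D" using K(4) e(2) by blast
    then show ?thesis using spectral_value_Un[OF Q adm K(1,2)] by metis
  qed
qed

end

section \<open>The local spectral function\<close>

text \<open>In a perfect set, deleting one point leaves a relatively open dense set. Deleting every
  point of a countable set in this way leaves nothing, against Baire's theorem.\<close>

lemma countable_perfect_empty:
  fixes T :: "real set"
  assumes T: "closed T" "countable T" and perfect: "\<And>t. t \<in> T \<Longrightarrow> t islimpt T"
  shows "T = {}"
proof -
  let ?G = "(\<lambda>t. T - {t}) ` T"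
  have "T \<subseteq> closure (\<Inter>?G)" if "T \<noteq> {}"
  proof (rule Baire[OF T(1)])
    show "countable ?G" using T(2) by simp
    show "openin (top_of_set T) X \<and> T \<subseteq> closure X" if X: "X \<in> ?G" for X
    proof -
      obtain t where t: "t \<in> T" "X = T - {t}" using X by blast
      have "X = T \<inter> (- {t})" using t by auto
      moreover have "openin (top_of_set T) (T \<inter> (- {t}))" by (intro openin_open_Int) auto
      moreover have "t islimpt X" using perfect[OF t(1)] t(2) by (simp add: islimpt_def) blast
      then have "T \<subseteq> closure X" using t(2) closure_subset[of X] by (auto simp: closure_def)
      ultimately show ?thesis by simp
    qed
  qed
  moreover have "\<Inter>?G = {}" if "T \<noteq> {}" using that by auto
  ultimately show ?thesis by auto
qed

context local_positive
begin

definition E :: "real set \<Rightarrow> 'a \<Rightarrow> 'a"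
  where "E D = (SOME P. spectral_value D P)"

lemma E_value: "admissible D \<Longrightarrow> spectral_value D (E D)"
  unfolding E_def using spectral_value_exists by (rule someI_ex)

lemma E_eqI: "spectral_value D P \<Longrightarrow> admissible D \<Longrightarrow> E D = P"
  using spectral_value_unique[OF E_value] by blast

lemma E_projection: "admissible D \<Longrightarrow> spectral_projection (E D)"
  using spectral_valueD(1)[OF E_value] by blast

lemma E_empty: "E {} = (\<lambda>x. 0)"
  by (rule E_eqI[OF spectral_value_empty admissible_empty])

lemma E_Int:
  assumes "admissible D1" "admissible D2"
  shows "E (D1 \<inter> D2) = E D1 \<circ> E D2"
  using E_eqI[OF spectral_value_Int[OF E_value[OF assms(1)] assms(1) E_value[OF assms(2)] assms(2)] admissible_Int[OF assms]]
  by (simp add: o_def)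

lemma E_Un_disjoint:
  assumes "admissible D1" "admissible D2" "D1 \<inter> D2 = {}"
  shows "E (D1 \<union> D2) x = E D1 x + E D2 x"
proof -
  have "E D1 (E D2 x) = 0" using E_Int[OF assms(1,2)] assms(3) E_empty by (simp add: fun_eq_iff)
  then show ?thesis
    using E_eqI[OF spectral_value_Un[OF E_value[OF assms(1)] assms(1) E_value[OF assms(2)] assms(2)] admissible_Un[OF assms(1,2)]]
    by simp
qed

lemma E_bounded_part:
  assumes D: "admissible D"
  obtains K where "bounded_part A G (range (E D)) K"
proof -
  obtain K where K: "K \<ge> 0" "\<forall>x\<in>range (E D). \<exists>u. (x, u) \<in> A \<and> norm u \<le> K * norm x"
    using spectral_value_bounded[OF E_value[OF D]] by (elim exE conjE)
  have "bounded_part A G (range (E D)) K"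
    by unfold_locales
      (use K invariant_spectral_projection[OF E_projection[OF D]] spectral_value_rho_off_real[OF E_value[OF D]] in auto)
  then show ?thesis by (rule that)
qed

lemma E_almost_pontryagin:
  assumes D: "admissible D"
  shows "almost_pontryagin G (range (E D))"
proof -
  obtain K where "bounded_part A G (range (E D)) K" by (rule E_bounded_part[OF D])
  then interpret bp: bounded_part A G "range (E D)" K .
  define M where "M t = (SOME M. robust M (of_real t))" for t :: real
  have "of_real t \<in> rho (range (E D)) \<or> robust (M t) (of_real t)" for t
  proof (cases "t \<in> closure D")
    case True
    then have "t \<in> I" using D by (auto simp: admissible_def)
    then show ?thesis unfolding M_def using someI_ex[OF robust_I] by blast
  next
    case False
    then show ?thesis using spectral_value_rho_real[OF E_value[OF D]] by blast
  qed
  from bp.uniform_positivity[OF this] show ?thesis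
    using invariantD(1,2)[OF bp.L] unfolding almost_pontryagin_def by blast
qed

lemma E_uniformly_positive:
  assumes D: "admissible D" "closure D \<inter> S = {}"
  shows "\<exists>c>0. \<forall>x\<in>range (E D). c * (norm x)\<^sup>2 \<le> gq x"
proof -
  obtain K where "bounded_part A G (range (E D)) K" by (rule E_bounded_part[OF D(1)])
  then interpret bp: bounded_part A G "range (E D)" K .
  have "of_real t \<in> rho (range (E D)) \<or> robust A (of_real t)" for t
  proof (cases "t \<in> closure D")
    case True
    then have "t \<in> I" "t \<notin> S" using D by (auto simp: admissible_def)
    then show ?thesis using robust_A by blast
  next
    case False
    then show ?thesis using spectral_value_rho_real[OF E_value[OF D(1)]] by blast
  qed
  from bp.uniform_positivity[of "\<lambda>_. A", OF this] show ?thesis by blast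
qed

text \<open>Exceptional points avoid the frontiers, so one in the closure of \<open>C n\<close> lies
  in \<open>C n\<close>. Only finitely many are in question, and each leaves the sets at some
  stage.\<close>

lemma decreasing_avoids_exceptional:
  assumes C: "\<And>n. admissible (C n)" "\<And>n. C (Suc n) \<subseteq> C n" "(\<Inter>n. C n) = {}"
  shows "\<exists>n. closure (C n) \<inter> S = {}"
proof -
  have dec: "C n \<subseteq> C m" if "m \<le> n" for m n :: nat using lift_Suc_antimono_le[of C, OF C(2) that] .
  have "\<exists>n. s \<notin> C n" for s using C(3) by blast
  then obtain k where k: "\<And>s. s \<notin> C (k s)" by metis
  have fin: "finite (S \<inter> closure (C 0))" by (rule finite_exceptional[OF C(1)])
  define n where "n = Max (insert 0 (k ` (S \<inter> closure (C 0))))"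
  have "False" if s: "s \<in> closure (C n)" "s \<in> S" for s
  proof -
    have "s \<in> closure (C 0)" using s(1) closure_mono[OF dec[of 0 n]] by auto
    then have "k s \<le> n" unfolding n_def using fin s(2) by (intro Max_ge) auto
    then have "s \<notin> C n" using dec k by blast
    moreover have "s \<notin> frontier (C n)" using s(2) C(1)[of n] by (auto simp: admissible_def)
    ultimately show False using s(1) closure_or_interior[of s "C n"] interior_subset by blast
  qed
  then show ?thesis by blast
qed

text \<open>The form of \<open>P m x - P n x\<close> is the drop of the nonincreasing sequence of
  form values of \<open>P n x\<close>, which is bounded below by 0. Uniform positivity on the first
  range turns this into norm convergence.\<close>

lemma decreasing_projections_limit:
  assumes P: "\<And>n. spectral_projection (P n)" "\<And>m n x. m \<le> n \<Longrightarrow> P n (P m x) = P n x"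
    and c: "c > 0" "\<And>x. x \<in> range (P 0) \<Longrightarrow> c * (norm x)\<^sup>2 \<le> gq x"
  shows "\<exists>Y. spectral_projection Y \<and> (\<forall>x. (\<lambda>n. P n x) \<longlonglongrightarrow> Y x) \<and> (\<forall>n x. P n (Y x) = Y x)"
proof -
  note p = spectral_projectionD[OF P(1)]
  have PP: "P m (P n x) = P n x" if "m \<le> n" for m n x
    using P(2)[OF that] spectral_projection_commute[OF P(1) P(1)] by metis
  have in0: "P n x \<in> range (P 0)" for n x using PP[of 0 n x] by (metis le0 rangeI)
  define a where "a x n = gq (P n x)" for x n
  have diff: "gq (P m x - P n x) = a x m - a x n" if "m \<le> n" for m n x
  proof -
    have "gi (P m x) (P n x) = gi (P m x) (P n (P n x))" by (simp add: p(3))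
    also have "\<dots> = gi (P n x) (P n x)" using p(5)[of n "P m x" "P n x"] P(2)[OF that] by simp
    finally show ?thesis by (simp add: gq_diff a_def)
  qed
  have diff0: "P m x - P n x \<in> range (P 0)" for m n x
  proof -
    have "P m x - P n x = P 0 (P m x - P n x)" by (simp add: bounded_clinearD[OF p(2)] PP)
    then show ?thesis by (metis rangeI)
  qed
  have dist: "c * (norm (P m x - P n x))\<^sup>2 \<le> a x m - a x n" if "m \<le> n" for m n x
    using c(2)[OF diff0[of m x n]] diff[OF that] by simp
  have dec: "decseq (a x)" for x
  proof (rule decseq_SucI)
    fix n
    have "0 \<le> c * (norm (P n x - P (Suc n) x))\<^sup>2" using c(1) by simp
    also have "\<dots> \<le> a x n - a x (Suc n)" by (rule dist) simp
    finally show "a x (Suc n) \<le> a x n" by simp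
  qed
  have a0: "0 \<le> a x n" for x n
  proof -
    have "0 \<le> c * (norm (P n x))\<^sup>2" using c(1) by simp
    also have "\<dots> \<le> a x n" unfolding a_def by (rule c(2)[OF in0])
    finally show ?thesis .
  qed
  have "Cauchy (\<lambda>n. P n x)" for x
  proof -
    obtain L where L: "a x \<longlonglongrightarrow> L" "\<forall>i. L \<le> a x i"
      by (rule decseq_convergent[OF dec[of x], of 0]) (use a0 in auto)
    show ?thesis
      unfolding Cauchy_altdef
    proof (intro allI impI)
      fix e :: real assume e: "e > 0"
      have "eventually (\<lambda>n. a x n < L + c * e\<^sup>2) sequentially"
        using e c(1) by (intro order_tendstoD[OF L(1)]) simp
      then obtain M where M: "\<And>n. n \<ge> M \<Longrightarrow> a x n < L + c * e\<^sup>2" by (auto simp: eventually_sequentially)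
      have "dist (P m x) (P n x) < e" if "m \<ge> M" "n > m" for m n
      proof -
        have "c * (norm (P m x - P n x))\<^sup>2 \<le> a x m - a x n" using dist that(2) by simp
        also have "\<dots> < c * e\<^sup>2" using M[OF that(1)] spec[OF L(2), of n] by linarith
        finally have "(norm (P m x - P n x))\<^sup>2 < e\<^sup>2" using c(1) by simp
        then show ?thesis using e by (simp add: dist_norm power2_less_imp_less)
      qed
      then show "\<exists>M. \<forall>m\<ge>M. \<forall>n>m. dist (P m x) (P n x) < e" by blast
    qed
  qed
  then have "\<exists>y. (\<lambda>n. P n x) \<longlonglongrightarrow> y" for x
    using Cauchy_convergent convergent_def by blast
  then obtain Y where Y: "\<And>x. (\<lambda>n. P n x) \<longlonglongrightarrow> Y x" by metis
  have uniq: "Y x = y" if "(\<lambda>n. P n x) \<longlonglongrightarrow> y" for x y using LIMSEQ_unique[OF Y that] .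
  obtain g where g: "g > 0" "\<And>x. \<bar>gq x\<bar> \<le> g * (norm x)\<^sup>2" using gq_bound by blast
  obtain B where B: "B > 0" "\<And>x. norm (P 0 x) \<le> norm x * B"
    using bounded_linear.pos_bounded[OF bounded_clinearD(1)[OF p(2)]] by blast
  define K where "K = sqrt (g / c) * B"
  have "norm (P n x) \<le> K * norm x" for n x
  proof -
    have "c * (norm (P n x))\<^sup>2 \<le> a x n" unfolding a_def by (rule c(2)[OF in0])
    also have "\<dots> \<le> a x 0" using dec[of x] by (auto simp: decseq_def)
    also have "\<dots> \<le> g * (norm (P 0 x))\<^sup>2" using g(2)[of "P 0 x"] by (simp add: a_def)
    also have "\<dots> \<le> g * (norm x * B)\<^sup>2" using g(1) B(2)[of x] by (intro mult_left_mono power_mono) auto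
    finally have "(norm (P n x))\<^sup>2 \<le> (g / c) * (norm x * B)\<^sup>2" using c(1) by (simp add: field_simps)
    also have "\<dots> = (K * norm x)\<^sup>2" using g(1) c(1) by (simp add: K_def power_mult_distrib mult_ac)
    finally show ?thesis by (rule power2_le_imp_le) (use B(1) g(1) c(1) in \<open>simp add: K_def\<close>)
  qed
  then have YK: "norm (Y x) \<le> K * norm x" for x
    by (intro LIMSEQ_le_const2[OF tendsto_norm[OF Y]]) auto
  have Yb: "bounded_clinear Y"
  proof (rule bounded_clinearI[OF _ _ YK])
    show "Y (x + y) = Y x + Y y" for x y
      by (rule uniq) (use tendsto_add[OF Y[of x] Y[of y]] in \<open>simp add: bounded_clinearD[OF p(2)]\<close>)
    show "Y (k *\<^sub>C x) = k *\<^sub>C Y x" for k x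
      by (rule uniq) (use tendsto_scaleC[OF tendsto_const[of k] Y[of x]] in \<open>simp add: bounded_clinearD[OF p(2)]\<close>)
  qed
  have PY: "P m (Y x) = Y x" for m x
  proof -
    have "(\<lambda>n. P m (P n x)) \<longlonglongrightarrow> P m (Y x)"
      by (rule bounded_linear.tendsto[OF bounded_clinearD(1)[OF p(2)] Y])
    moreover have "(\<lambda>n. P m (P n x)) \<longlonglongrightarrow> Y x"
      by (rule Lim_transform_eventually[OF Y]) (auto simp: eventually_sequentially PP intro!: exI[of _ m])
    ultimately show ?thesis by (rule LIMSEQ_unique)
  qed
  have "spectral_projection Y"
    unfolding spectral_projection_def bounded_projection_def
  proof (intro conjI allI impI Yb)
    have "Y (Y x) = Y x" for x by (rule uniq) (simp add: PY)
    then show "Y \<circ> Y = Y" by auto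
    have "(Y x, Y u) \<in> A" if "(x, u) \<in> A" for x u
      by (rule A_limit[OF _ Y Y]) (use p(4) that in \<open>auto simp: commutes_with_def\<close>)
    then show "commutes_with Y A" by (auto simp: commutes_with_def)
    show "gi (Y x) y = gi x (Y y)" for x y
      using tendsto_gi[OF Y[of x] tendsto_const[of y]] tendsto_gi[OF tendsto_const[of x] Y[of y]] p(5)
      by (simp add: LIMSEQ_unique)
    show "T (Y x) = Y (T x)" if T: "bounded_clinear T" "commutes_with T A" for T x
      using bounded_linear.tendsto[OF bounded_clinearD(1)[OF T(1)] Y[of x]] p(6)[OF T]
      by (intro uniq[symmetric]) simp
  qed
  then show ?thesis using Y PY by blast
qed

text \<open>In the range of the limit projection \<open>Y\<close> the spectrum is contained in the countable set of
  frontier points of the sets. If it were nonempty, it would have an isolated point by Baire's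
  theorem; this would be an eigenvalue, but eigenvectors are annihilated by \<open>E (C n)\<close> for large
  \<open>n\<close>.\<close>

lemma E_decreasing:
  assumes C: "\<And>n. admissible (C n)" "\<And>n. C (Suc n) \<subseteq> C n" "(\<Inter>n. C n) = {}"
  shows "(\<lambda>n. E (C n) x) \<longlonglongrightarrow> 0"
proof -
  have dec: "C n \<subseteq> C m" if "m \<le> n" for m n :: nat using lift_Suc_antimono_le[of C, OF C(2) that] .
  obtain k where k: "closure (C k) \<inter> S = {}" using decreasing_avoids_exceptional[of C, OF C] by blast
  \<comment> \<open>The initial sets are dropped so that no exceptional point remains in the
    closures and the form is uniformly positive from the start.\<close>
  define D where "D n = C (n + k)" for n
  have D: "admissible (D n)" for n by (simp add: D_def C(1))
  have D0: "D n \<subseteq> D 0" for n unfolding D_def by (intro dec) simp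
  have empty: "\<exists>n. t \<notin> D n" for t
  proof -
    obtain n where "t \<notin> C n" using C(3) by blast
    then have "t \<notin> D n" unfolding D_def using dec[of n "n + k"] by auto
    then show ?thesis by blast
  qed
  obtain c where c: "c > 0" "\<And>x. x \<in> range (E (D 0)) \<Longrightarrow> c * (norm x)\<^sup>2 \<le> gq x"
    using E_uniformly_positive[OF D[of 0]] k by (auto simp: D_def)
  have comp: "E (D n) (E (D m) x) = E (D n) x" if "m \<le> n" for m n x
  proof -
    have "D n \<inter> D m = D n" unfolding D_def using dec[of "m + k" "n + k"] that by auto
    then show ?thesis using E_Int[OF D[of n] D[of m]] by (simp add: fun_eq_iff)
  qed
  obtain Y where Y: "spectral_projection Y" "\<And>x. (\<lambda>n. E (D n) x) \<longlonglongrightarrow> Y x" "\<And>n x. E (D n) (Y x) = Y x"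
    using decreasing_projections_limit[of "\<lambda>n. E (D n)", OF E_projection[OF D] comp c] by blast
  note y = spectral_projectionD[OF Y(1)]
  have range_Y: "range Y \<subseteq> range (E (D n))" for n using Y(3)[of n] by (metis image_subsetI rangeI)
  have rho_Y: "l \<in> rho (range Y)" if "l \<notin> of_real ` closure (D n)" for l n
    by (rule rho_range[OF y(1,4) invariant_spectral_projection[OF E_projection[OF D]] range_Y])
      (rule spectral_valueD(2)[OF E_value[OF D] that])
  define X where "X = {t. complex_of_real t \<notin> rho (range Y)}"
  have XD: "X \<subseteq> closure (D n)" for n
  proof
    fix t assume "t \<in> X"
    then have "complex_of_real t \<in> of_real ` closure (D n)" using rho_Y[of "of_real t" n] by (auto simp only: X_def mem_Collect_eq)
    then show "t \<in> closure (D n)" by auto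
  qed
  have perfect: "t islimpt X" if t: "t \<in> X" for t
  proof (rule ccontr)
    assume "\<not> t islimpt X"
    then obtain e where e: "e > 0" "\<forall>s\<in>X. s \<noteq> t \<longrightarrow> e \<le> dist s t"
      unfolding islimpt_approachable by (meson not_le)
    have "t \<in> closure (D 0)" using t XD by blast
    then have tI: "t \<in> I - S" using D[of 0] k by (auto simp: admissible_def D_def)
    have "of_real t \<in> rho (range Y)"
    proof (rule isolated_point_projection[OF Y(1) tI e(1)])
      show "of_real s \<in> rho (range Y)" if "s \<in> ball t e" "s \<noteq> t" for s
        using that e(2) by (force simp: X_def dist_commute)
      show "x = 0" if x: "(x, of_real t *\<^sub>C x) \<in> A" "Y x = x" for x
      proof -
        obtain n where n: "t \<notin> D n" using empty by blast
        have "E (D n) x = 0" using spectral_valueD(4)[OF E_value[OF D] x(1)] n by simp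
        then show ?thesis using Y(3)[of n x] x(2) by simp
      qed
    qed
    then show False using t by (simp add: X_def)
  qed
  have "closure X = {}"
  proof (rule countable_perfect_empty)
    \<comment> \<open>A point of \<open>closure X\<close> lies in the closure of every
      \<open>D n\<close>, but leaves the sets themselves at some stage, so there it is a frontier
      point.\<close>
    have "closure X \<subseteq> (\<Union>n. frontier (D n))"
    proof
      fix t assume t: "t \<in> closure X"
      obtain n where n: "t \<notin> D n" using empty by blast
      have "closure X \<subseteq> closure (D n)" by (rule closure_minimal[OF XD closed_closure])
      then have "t \<in> frontier (D n)"
        using t n closure_or_interior[of t "D n"] interior_subset[of "D n"] by blast
      then show "t \<in> (\<Union>n. frontier (D n))" by blast
    qed
    moreover have "countable (\<Union>n. frontier (D n))"
      by (rule countable_UN) (use D in \<open>auto simp: admissible_def countable_finite\<close>)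
    ultimately show "countable (closure X)" by (rule countable_subset)
    show "t islimpt closure X" if "t \<in> closure X" for t
      using that perfect islimpt_subset[OF _ closure_subset[of X]] by (auto simp: closure_def)
  qed simp
  then have X: "of_real t \<in> rho (range Y)" for t using closure_subset[of X] by (auto simp: X_def)
  have rho: "l \<in> rho (range Y)" for l
  proof (cases "Im l = 0")
    case True
    then show ?thesis using X real_cases by metis
  next
    case False
    then show ?thesis by (intro rho_Y[of _ 0]) auto
  qed
  obtain K where K: "\<forall>x\<in>range (E (D 0)). \<exists>u. (x, u) \<in> A \<and> norm u \<le> K * norm x"
    using spectral_value_bounded[OF E_value[OF D[of 0]]] by (elim exE conjE)
  have "Y x = 0"
    by (rule Liouville_projection[OF Y(1) rho bspec[OF K]]) (use range_Y[of 0] in blast)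
  then have "(\<lambda>n. E (D n) x) \<longlonglongrightarrow> 0" using Y(2)[of x] by simp
  then show ?thesis unfolding D_def by (rule LIMSEQ_offset)
qed

text \<open>The remainder after n terms is the projection of the set \<open>C n\<close> not yet
  exhausted, and these sets decrease to the empty set.\<close>

lemma E_sums:
  assumes D: "\<And>i. admissible (D i)" "disjoint_family D" "admissible (\<Union>i. D i)"
  shows "(\<lambda>i. E (D i) x) sums E (\<Union>i. D i) x"
proof -
  define C where "C n = (\<Union>i. D i) - (\<Union>i<n. D i)" for n
  have C_Suc: "C (Suc n) = C n - D n" for n by (auto simp: C_def lessThan_Suc)
  have C: "admissible (C n)" for n
  proof (induction n)
    case 0
    then show ?case using D(3) by (simp add: C_def)
  next
    case (Suc n)
    then show ?case unfolding C_Suc by (intro admissible_Diff D(1))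
  qed
  have "D i \<inter> D n = {}" if "i < n" for i n
    using D(2) that by (auto simp only: disjoint_family_on_def UNIV_I less_irrefl)
  then have DC: "D n \<subseteq> C n" for n unfolding C_def by blast
  have split: "E (C n) x = E (D n) x + E (C (Suc n)) x" for n
  proof -
    have "C n = D n \<union> C (Suc n)" "D n \<inter> C (Suc n) = {}" using DC[of n] by (auto simp: C_Suc)
    then show ?thesis using E_Un_disjoint[OF D(1) C, of n "Suc n" x] by simp
  qed
  have partial: "(\<Sum>i<n. E (D i) x) = E (\<Union>i. D i) x - E (C n) x" for n
  proof (induction n)
    case 0
    then show ?case by (simp add: C_def)
  next
    case (Suc n)
    then show ?case using split[of n] by simp
  qed
  have "(\<lambda>n. E (C n) x) \<longlonglongrightarrow> 0"
    by (rule E_decreasing[OF C]) (auto simp: C_Suc, auto simp: C_def)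
  from tendsto_diff[OF tendsto_const this] show ?thesis unfolding sums_def partial by simp
qed

text \<open>If \<open>l\<close> is a spectral point off the closure, then it is real, lies in
  \<open>D\<close>, and the spectrum near it is contained in \<open>D\<close>. At a frontier point
  this makes it isolated for the complementary part, while its eigenvectors belong to the range of
  \<open>E D\<close>.\<close>

lemma E_spectrum_complement:
  assumes D: "admissible D" and l: "l \<notin> closure (- rho UNIV - of_real ` D)"
  shows "l \<in> rho (range (\<lambda>x. x - E D x))"
proof (cases "l \<in> rho UNIV")
  case True
  then show ?thesis
    using spectral_projectionD[OF spectral_projection_complement[OF E_projection[OF D]]] by (intro rho_range_UNIV)
next
  case False
  have "open (- closure (- rho UNIV - of_real ` D))" by (intro open_Compl closed_closure)
  then obtain e where e: "e > 0" "ball l e \<subseteq> - closure (- rho UNIV - of_real ` D)"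
    using l openE[of "- closure (- rho UNIV - of_real ` D)" l] by blast
  have e_ball: "k \<in> rho UNIV \<or> k \<in> of_real ` D" if "k \<in> ball l e" for k
    using e(2) that closure_subset[of "- rho UNIV - of_real ` D"] by blast
  then obtain t where t: "l = of_real t" "t \<in> D" using False e(1) e_ball[of l] by auto
  have D_rho: "of_real s \<in> rho UNIV \<or> s \<in> D" if "s \<in> ball t e" for s
    using e_ball[of "of_real s"] that t(1) by auto
  have fr: "finite (frontier D)" "frontier D \<subseteq> I - S" using D admissible_frontier by (auto simp: admissible_def)
  have compl: "spectral_projection (\<lambda>x. x - E D x)" by (rule spectral_projection_complement[OF E_projection[OF D]])
  show ?thesis
  proof (cases "t \<in> interior D")
    case True
    then show ?thesis unfolding t(1) by (rule spectral_valueD(3)[OF E_value[OF D]])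
  next
    case False
    then have tf: "t \<in> frontier D" using t(2) closure_subset[of D] by (auto simp: frontier_def)
    obtain d where d: "d > 0" "\<And>s. s \<in> frontier D \<Longrightarrow> s \<noteq> t \<Longrightarrow> d \<le> dist t s"
      using finite_set_avoid[OF fr(1), of t] by blast
    show ?thesis
      unfolding t(1)
    proof (rule isolated_point_projection[OF compl _ , of t "min d e"])
      show "t \<in> I - S" using tf fr(2) by blast
      show "min d e > 0" using d(1) e(1) by simp
      show "x = 0" if "(x, of_real t *\<^sub>C x) \<in> A" "x - E D x = x" for x
        using spectral_valueD(4)[OF E_value[OF D] that(1)] t(2) that(2) by simp
      show "of_real s \<in> rho (range (\<lambda>x. x - E D x))" if s: "s \<in> ball t (min d e)" "s \<noteq> t" for s
      proof (cases "s \<in> D")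
        case True
        have "s \<notin> frontier D" using d(2)[of s] s by auto
        then have "s \<in> interior D" using True closure_subset[of D] by (auto simp: frontier_def)
        then show ?thesis by (rule spectral_valueD(3)[OF E_value[OF D]])
      next
        case False
        then have "of_real s \<in> rho UNIV" using D_rho[of s] s(1) by auto
        then show ?thesis using spectral_projectionD[OF compl] by (intro rho_range_UNIV)
      qed
    qed
  qed
qed

lemma E_G_selfadjoint:
  assumes D: "admissible D" shows "G_selfadjoint G (op_graph (E D))"
proof -
  note e = spectral_projectionD[OF E_projection[OF D]]
  have graph: "op_graph (E D) O op_graph G = {(x, G (E D x)) | x. True}" by (auto simp: op_graph_def)
  have sym: "cinner (G (E D x)) y = cinner x (G (E D y))" for x y
    using e(5)[of x y] by (simp add: G_inner_def G_cinner)
  have "(y, z) \<in> adjoint_op (op_graph (E D) O op_graph G) \<longleftrightarrow> z = G (E D y)" for y z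
  proof
    assume "(y, z) \<in> adjoint_op (op_graph (E D) O op_graph G)"
    then have "cinner (G (E D x)) y = cinner x z" for x by (auto simp: adjoint_op_def graph)
    then have "cinner x (G (E D y) - z) = 0" for x by (simp add: sym cinner_diff_right)
    then have "cinner (G (E D y) - z) (G (E D y) - z) = 0" .
    then show "z = G (E D y)" by (simp add: cinner_self)
  qed (auto simp: adjoint_op_def graph sym)
  then have "selfadjoint (op_graph (E D) O op_graph G)"
    unfolding selfadjoint_def graph by (auto simp: set_eq_iff)
  moreover have "linear_operator (op_graph (E D))"
    by (auto simp: linear_operator_def op_graph_def single_valued_def bounded_clinearD[OF e(2)])
  ultimately show ?thesis by (simp add: G_selfadjoint_def)
qed

end

section \<open>Finite unions of intervals as admissible sets\<close>

lemma finite_frontier_interval: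
  fixes J :: "real set"
  assumes J: "is_interval J" "bounded J"
  shows "finite (frontier J)"
proof (cases "J = {}")
  case False
  have bdd: "bdd_below J" "bdd_above J" using J(2) bounded_imp_bdd_below bounded_imp_bdd_above by auto
  have "x \<in> {Inf J, Sup J}" if x: "x \<in> frontier J" for x
  proof (rule ccontr)
    assume neq: "x \<notin> {Inf J, Sup J}"
    have "closure J \<subseteq> {Inf J..Sup J}"
      using cInf_lower[OF _ bdd(1)] cSup_upper[OF _ bdd(2)] by (intro closure_minimal) auto
    then have "Inf J < x" "x < Sup J" using x neq by (auto simp: frontier_def less_le)
    then have "\<exists>p\<in>J. p < x" "\<exists>q\<in>J. x < q"
      using cInf_less_iff[OF False bdd(1)] less_cSup_iff[OF False bdd(2)] by simp_all
    then obtain p q where pq: "p \<in> J" "p < x" "q \<in> J" "x < q" by (elim bexE)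
    have "{p<..<q} \<subseteq> J"
      using mem_is_interval_1_I[OF J(1) pq(1,3)] by auto
    then have "x \<in> interior J" using pq by (intro interiorI[of "{p<..<q}"]) auto
    then show False using x by (simp add: frontier_def)
  qed
  then show ?thesis by (intro finite_subset[of "frontier J" "{Inf J, Sup J}"]) auto
qed simp

lemma open_real_interval: "open (real_interval a b)"
proof -
  have "real_interval a b = ereal -` {a<..<b}" by (auto simp: real_interval_def)
  moreover have "continuous_on UNIV ereal" by (intro continuous_on_ereal continuous_on_id)
  ultimately show ?thesis by (simp add: open_vimage)
qed

lemma interval_unions_off_regular:
  assumes "D \<in> interval_unions_off S a b"
  shows "bounded D" "closure D \<subseteq> real_interval a b" "finite (frontier D)" "frontier D \<inter> S = {}"
proof -
  obtain F where F: "finite F" "D = \<Union>F"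
    "\<forall>J\<in>F. is_interval J \<and> bounded J \<and> closure J \<subseteq> real_interval a b" and "frontier D \<inter> S = {}"
    using assms by (auto simp: interval_unions_off_def interval_unions_def)
  have cl: "closure D \<subseteq> (\<Union>J\<in>F. closure J)"
    unfolding F(2) by (intro closure_minimal closed_UN F(1) ballI closed_closure) (use closure_subset in blast)
  show "bounded D" using F by (auto simp: bounded_Union)
  show "closure D \<subseteq> real_interval a b" using cl F(3) by blast
  have "frontier D \<subseteq> (\<Union>J\<in>F. frontier J)"
  proof
    fix t assume t: "t \<in> frontier D"
    then obtain J where J: "J \<in> F" "t \<in> closure J" using cl by (auto simp: frontier_def)
    moreover have "interior J \<subseteq> interior D" using J(1) F(2) by (intro interior_mono) auto
    ultimately show "t \<in> (\<Union>J\<in>F. frontier J)" using t by (auto simp: frontier_def)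
  qed
  then show "finite (frontier D)"
    by (rule finite_subset) (use F finite_frontier_interval in auto)
  show "frontier D \<inter> S = {}" by fact
qed

theorem theorem5p3:
  fixes G :: "'a::chilbert_space \<Rightarrow> 'a"
    and A :: "'a operator"
    and a b :: ereal
    and S :: "real set"
  assumes G_bounded: "bounded_clinear G"
    and G_selfadj: "selfadjoint (op_graph G)"
    and A_linear: "linear_operator A"
    and A_closed: "closed A"
    and A_dense: "densely_defined A"
    and A_symm: "G_symmetric G A"
    and ab: "a < b"
    and type_pi_plus:
      "complex_of_real ` real_interval a b \<inter> sigma_ap A \<subseteq> sigma_pi_plus G A"
    and nbhd: "\<exists>U. open U \<and> complex_of_real ` real_interval a b \<subseteq> U \<and> U - \<real> \<subseteq> resolvent_set A"
    and S_def: "S = {t \<in> real_interval a b.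
      complex_of_real t \<in> sigma_pi_plus G A - sigma_plus G A}"
  shows "\<exists>E. local_spectral_function A a b S E \<and>
    (\<forall>D\<in>interval_unions_off S a b.
      G_selfadjoint G (op_graph (E D)) \<and> almost_pontryagin G (range (E D)))"
proof -
  interpret G_symmetric_operator A G by unfold_locales (fact assms)+
  have rho_UNIV: "rho UNIV = resolvent_set A"
    by (simp add: rho_def restrict_op_def)
  obtain U where U: "open U" "complex_of_real ` real_interval a b \<subseteq> U" "U - \<real> \<subseteq> resolvent_set A"
    using nbhd by blast
  have nonreal_near: "\<exists>e>0. \<forall>l\<in>ball (of_real t) e. Im l \<noteq> 0 \<longrightarrow> l \<in> rho UNIV" if "t \<in> real_interval a b" for t
  proof -
    obtain e where e: "e > 0" "ball (complex_of_real t) e \<subseteq> U" using openE[OF U(1), of "of_real t"] U(2) \<open>t \<in> _\<close> by blast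
    have "l \<in> rho UNIV" if "l \<in> ball (of_real t) e" "Im l \<noteq> 0" for l
    proof -
      have "l \<in> U - \<real>" using that e(2) by (auto simp: complex_is_Real_iff)
      then show ?thesis unfolding rho_UNIV using U(3) by blast
    qed
    then show ?thesis using e(1) by blast
  qed
  \<comment> \<open>Outside the approximate point spectrum there are no approximate eigensequences,
    so positive type holds vacuously there; this makes every point of the interval outside
    \<open>S\<close> usable.\<close>
  have positive: "positive_type_on G A (of_real t) UNIV" if "t \<in> real_interval a b" "t \<notin> S" for t
  proof (cases "complex_of_real t \<in> sigma_ap A")
    case True
    then have "complex_of_real t \<in> sigma_plus G A" using that type_pi_plus by (auto simp: S_def)
    then show ?thesis by (simp add: sigma_plus_def)
  next
    case False
    then show ?thesis by (auto simp: positive_type_on_def sigma_ap_def)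
  qed
  have robust_A: "robust A (of_real t)" if "t \<in> real_interval a b" "t \<notin> S" for t
    by (rule positive_type_UNIV_robust[OF positive[OF that]])
  have robust_I: "\<exists>M. robust M (of_real t)" if "t \<in> real_interval a b" for t
  proof (cases "t \<in> S")
    case True
    then obtain M where "csubspace M" "finite_codim UNIV M" "positive_type_on G A (of_real t) M"
      by (auto simp: S_def sigma_pi_plus_def)
    then show ?thesis using positive_type_robust by blast
  qed (use robust_A that in blast)
  \<comment> \<open>An accumulation point inside the interval still satisfies \<open>robust\<close>
    for some subspace, which contradicts nonpositive eigenvectors at infinitely many points
    converging to it.\<close>
  have S_discrete: "\<not> t islimpt S" if t: "t \<in> real_interval a b" for t
  proof
    assume "t islimpt S"
    then obtain \<tau> where \<tau>: "\<forall>n. \<tau> n \<in> S - {t}" "inj \<tau>" "\<tau> \<longlonglongrightarrow> t"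
      unfolding limpt_sequential_inj by (elim exE conjE)
    have "\<exists>x. x \<noteq> 0 \<and> (x, of_real (\<tau> n) *\<^sub>C x) \<in> A \<and> gq x \<le> 0" for n
      using spec[OF \<tau>(1), of n] by (intro exceptional_eigenvector) (auto simp: S_def)
    then obtain x where x: "\<And>n. x n \<noteq> 0" "\<And>n. (x n, of_real (\<tau> n) *\<^sub>C x n) \<in> A" "\<And>n. gq (x n) \<le> 0" by metis
    obtain M where M: "robust M (of_real t)" using robust_I[OF t] by blast
    obtain e where e: "e > 0" "\<And>l. l \<in> ball (of_real t) e \<Longrightarrow> Im l \<noteq> 0 \<Longrightarrow> l \<in> rho UNIV"
      using nonreal_near[OF t] by blast
    show False by (rule exceptional_points_isolated[OF M \<tau>(2) _ \<tau>(3) x e]) (use \<tau>(1) in auto)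
  qed
  interpret local_positive A G "real_interval a b" S
    by unfold_locales (fact open_real_interval nonreal_near robust_I robust_A S_discrete)+
  have adm: "admissible D" if "D \<in> interval_unions_off S a b" for D
    using interval_unions_off_regular[OF that] by (simp add: admissible_def)
  have "local_spectral_function A a b S E"
    unfolding local_spectral_function_def
  proof (intro conjI ballI allI impI)
    show "discrete_in S a b" using S_discrete by (auto simp: discrete_in_def S_def)
    show "E {} = (\<lambda>x. 0)" by (rule E_empty)
    fix D assume D: "D \<in> interval_unions_off S a b"
    note e = spectral_projectionD[OF E_projection[OF adm[OF D]]]
    show "bounded_projection (E D)" by (rule e(1))
    show "E (D \<inter> D') = E D \<circ> E D'" if "D' \<in> interval_unions_off S a b" for D'
      by (intro E_Int adm D that)
    show "commutes_with B (op_graph (E D))" if "bounded_clinear B" "commutes_with B A" for B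
      using e(6)[OF that] by (auto simp: commutes_with_def op_graph_def)
    show "spectrum_in (range (E D)) (restrict_op A (range (E D))) \<subseteq> complex_of_real ` closure D"
      using spectral_valueD(2)[OF E_value[OF adm[OF D]]] by (auto simp: spectrum_in_def rho_def)
    show "spectrum_in (range (\<lambda>x. x - E D x)) (restrict_op A (range (\<lambda>x. x - E D x)))
        \<subseteq> closure (spectrum A - complex_of_real ` D)"
      using E_spectrum_complement[OF adm[OF D]] unfolding rho_UNIV by (auto simp: spectrum_in_def rho_def)
  next
    fix D :: "nat \<Rightarrow> real set" and x
    assume "\<forall>i. D i \<in> interval_unions_off S a b" "disjoint_family D" "(\<Union>i. D i) \<in> interval_unions_off S a b"
    then show "(\<lambda>i. E (D i) x) sums E (\<Union>i. D i) x" by (intro E_sums adm) auto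
  qed
  then show ?thesis using E_G_selfadjoint[OF adm] E_almost_pontryagin[OF adm] by blast
qed

end
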